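(* Let $\{z_j\}_{j\ge1}\subset\mathbb{C}_+$ be distinct nodes and $\{w_j\}_{j\ge 1}\subset\mathbb{C}^{m\times m}$, and suppose that all truncated matrix Nevanlinna--Pick problems $w(z_j)=w_j$, $1\le j\le n$, $w\in\mathcal{R}_m$ ($n\ge1$) are completely indeterminate, i.e. $\mathbf{P}_n>O$ for every $n\ge1$. Fix $z_0\in\mathbb{C}_+\setminus\mathcal{Z}$ and let $(\widetilde{\mathcal P}_j)_{j\ge1}$ be the sequence of modified $2m\times2m$ matrices built from $z_0$ and the data as in the context. Then the full matrix Nevanlinna--Pick problem ($w\in\mathcal{R}_m$, $w(z_j)=w_j$ for all $j\in\mathbb{N}$) is completely indeterminate if and only if the matrix series $$\sum_{j=1}^{\infty}\frac{\operatorname{Im} z_j}{|z_0-z_j|^2}\,\widetilde{\mathcal P}_j\,\mathcal J$$ converges.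
   Context: Notation: $m\ge 1$ is fixed; $\mathbb{C}_+=\{\operatorname{Im}z>0\}$; $A^*$ is the conjugate transpose; for Hermitian matrices $A\ge B$ ($A>B$) means $A-B$ is positive semidefinite (positive definite). Convergence of matrices is entrywise. $\mathcal{J}=\begin{pmatrix}O&-iI_m\\ iI_m&O\end{pmatrix}\in\mathbb{C}^{2m\times2m}$. $\mathcal{R}_m$ is the set of holomorphic $w:\mathbb{C}_+\to\mathbb{C}^{m\times m}$ with $\frac{w(z)-w(z)^*}{2i}\ge O$ for all $z\in\mathbb{C}_+$. $\operatorname{Arg}z\in(-\pi,\pi]$ is the principal argument. Data: distinct nodes $z_j\in\mathbb{C}_+$, values $w_j\in\mathbb{C}^{m\times m}$ ($j\ge1$); $\mathcal{Z}=\{z_j\}_{j\ge1}$. Let $\mathcal{F}$ be the set of all $w\in\mathcal{R}_m$ with $w(z_j)=w_j$ for all $j\ge1$. Block matrices: $T_n=\operatorname{diag}(z_1^{-1}I_m,\dots,z_n^{-1}I_m)$, $v_n=\operatorname{col}(I_m,\dots,I_m)\in\mathbb{C}^{nm\times m}$, $u_n=\operatorname{col}(w_1,\dots,w_n)$, $R_{T_n}(z)=(I-zT_n)^{-1}$, and the Pick matrix $\mathbf{P}_n=T_n^{-1}\Big(\frac{w_j-w_k^*}{z_j-\bar z_k}\Big)_{j,k=1}^nT_n^{-*}$, where $T_n^{-*}=(T_n^{-1})^*$. The $n$-th truncated problem is called completely indeterminate when $\mathbf{P}_n>O$. For $j>1$ write $\mathbf{P}_j=\begin{pmatrix}\mathbf{P}_{j-1}&B_j\\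 B_j^*&C_j\end{pmatrix}$ with $C_j\in\mathbb{C}^{m\times m}$; $\widehat K_1=\mathbf{P}_1$, $\widehat K_j=C_j-B_j^*\mathbf{P}_{j-1}^{-1}B_j$ for $j>1$ (these are positive definite). Rational matrix functions of the first and second kind: $P_1(z)=\widehat K_1^{-1/2}R_{T_1}(z)v_1$, $Q_1(z)=-\widehat K_1^{-1/2}R_{T_1}(z)u_1$, and for $j>1$: $P_j(z)=\widehat K_j^{-1/2}(-B_j^*\mathbf{P}_{j-1}^{-1},\,I)R_{T_j}(z)v_j$, $Q_j(z)=-\widehat K_j^{-1/2}(-B_j^*\mathbf{P}_{j-1}^{-1},\,I)R_{T_j}(z)u_j$. Put $$\mathcal{P}_j=\frac{|z_j|^2}{2\operatorname{Im}z_j}\begin{pmatrix}P_j^*(0)P_j(0)&-P_j^*(0)Q_j(0)\\-Q_j^*(0)P_j(0)&Q_j^*(0)Q_j(0)\end{pmatrix}\mathcal{J}.$$ Modified matrices: with $\zeta_j(z)=\frac{\bar z_j}{z_j}\frac{z-z_j}{z-\bar z_j}$ and $\phi_j=\operatorname{Arg}\zeta_j(z_0)$, define recursively $\widetilde{\mathcal P}_1=\mathcal P_1$, $\widetilde{\mathcal P}_j=\mathcal U_{j-1}\mathcal P_j\,\mathcal U_{j-1}^{-1}$ for $j>1$, where $\mathcal U_j=\exp(-i\phi_j\widetilde{\mathcal P}_j)\exp(-i\phi_{j-1}\widetilde{\mathcal P}_{j-1})\cdots\exp(-i\phi_1\widetilde{\mathcal P}_1)$. Complete indeterminacy of the full problem: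 when all $\mathbf{P}_n>O$, for $z_0\in\mathbb{C}_+\setminus\mathcal{Z}$ the set $\{w(z_0):w\in\mathcal{F}\}$ is a matrix ball $\{c(z_0)+r(z_0)V\rho(z_0):V\in\mathbb{C}^{m\times m},\,V^*V\le I_m\}$ with $c(z_0)\in\mathbb{C}^{m\times m}$ and semi-radii $r(z_0)\ge O$, $\rho(z_0)\ge O$ (limits of the centers and positive definite semi-radii of the analogous balls for the truncated problems). The full problem is called completely indeterminate if $\operatorname{rank}r(z_0)=\operatorname{rank}\rho(z_0)=m$; it is known that this does not depend on the choice of $z_0\in\mathbb{C}_+\setminus\mathcal{Z}$. *)

theory Defs
  imports
    "HOL-Analysis.Analysis"
    "Jordan_Normal_Form.Gauss_Jordan_Elimination"
    "Jordan_Normal_Form.Schur_Decomposition"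
    "Jordan_Normal_Form.DL_Rank"
begin

section \<open>Complex matrices\<close>

definition psd :: "complex mat \<Rightarrow> bool" where
  "psd A \<longleftrightarrow> square_mat A \<and> mat_adjoint A = A \<and>
     (\<forall>x \<in> carrier_vec (dim_row A). 0 \<le> Re ((A *\<^sub>v x) \<bullet>c x))"

definition pos_def :: "complex mat \<Rightarrow> bool" where
  "pos_def A \<longleftrightarrow> square_mat A \<and> mat_adjoint A = A \<and>
     (\<forall>x \<in> carrier_vec (dim_row A). x \<noteq> 0\<^sub>v (dim_row A) \<longrightarrow> 0 < Re ((A *\<^sub>v x) \<bullet>c x))"

text \<open>Meaningful for invertible matrices only.\<close>
definition mat_inv :: "complex mat \<Rightarrow> complex mat" where
  "mat_inv A = the (mat_inverse A)"

definition mat_sqrt :: "complex mat \<Rightarrow> complex mat" where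
  "mat_sqrt A = (THE B. B \<in> carrier_mat (dim_row A) (dim_row A) \<and> psd B \<and> B * B = A)"

definition mat_exp :: "complex mat \<Rightarrow> complex mat" where
  "mat_exp A = mat (dim_row A) (dim_row A) (\<lambda>(a, b). \<Sum>k. (A ^\<^sub>m k) $$ (a, b) / fact k)"

definition mat_tendsto :: "nat \<Rightarrow> (nat \<Rightarrow> complex mat) \<Rightarrow> complex mat \<Rightarrow> bool" where
  "mat_tendsto m X L \<longleftrightarrow> (\<forall>a<m. \<forall>b<m. (\<lambda>n. X n $$ (a, b)) \<longlonglongrightarrow> L $$ (a, b))"

definition mat_summable :: "nat \<Rightarrow> (nat \<Rightarrow> complex mat) \<Rightarrow> bool" where
  "mat_summable d X \<longleftrightarrow> (\<forall>a<d. \<forall>b<d. summable (\<lambda>j. X j $$ (a, b)))"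

text \<open>The matrix of \<open>n \<times> k\<close> blocks of size \<open>m \<times> m\<close>; as for the nodes, block indices
  start at 1.\<close>
definition block_mat :: "nat \<Rightarrow> nat \<Rightarrow> nat \<Rightarrow> (nat \<Rightarrow> nat \<Rightarrow> complex mat) \<Rightarrow> complex mat" where
  "block_mat m n k F =
     mat (n * m) (k * m) (\<lambda>(a, b). F (Suc (a div m)) (Suc (b div m)) $$ (a mod m, b mod m))"

definition J_mat :: "nat \<Rightarrow> complex mat" where
  "J_mat m = four_block_mat (0\<^sub>m m m) ((- \<i>) \<cdot>\<^sub>m 1\<^sub>m m) (\<i> \<cdot>\<^sub>m 1\<^sub>m m) (0\<^sub>m m m)"

section \<open>The interpolation problem\<close>

abbreviation upper_half_plane :: "complex set" where
  "upper_half_plane \<equiv> {z. 0 < Im z}"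

text \<open>The values of \<open>w\<close> off the upper half plane are unconstrained and irrelevant.\<close>
definition nevanlinna_class :: "nat \<Rightarrow> (complex \<Rightarrow> complex mat) set" where
  "nevanlinna_class m = {w.
     (\<forall>z \<in> upper_half_plane. w z \<in> carrier_mat m m) \<and>
     (\<forall>a<m. \<forall>b<m. (\<lambda>z. w z $$ (a, b)) holomorphic_on upper_half_plane) \<and>
     (\<forall>z \<in> upper_half_plane. psd ((1 / (2 * \<i>)) \<cdot>\<^sub>m (w z - mat_adjoint (w z))))}"

text \<open>Throughout, \<open>z\<close> and \<open>W\<close> are the sequences of nodes and values, indexed from 1; the
  entries \<open>z 0\<close> and \<open>W 0\<close> are never used. \<open>N = {1..}\<close> is the full problem and
  \<open>N = {1..n}\<close> the \<open>n\<close>-th truncated one.\<close>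
definition solutions ::
  "nat \<Rightarrow> (nat \<Rightarrow> complex) \<Rightarrow> (nat \<Rightarrow> complex mat) \<Rightarrow> nat set \<Rightarrow> (complex \<Rightarrow> complex mat) set" where
  "solutions m z W N = {w \<in> nevanlinna_class m. \<forall>j \<in> N. w (z j) = W j}"

definition T_mat :: "nat \<Rightarrow> (nat \<Rightarrow> complex) \<Rightarrow> nat \<Rightarrow> complex mat" where
  "T_mat m z n = block_mat m n n (\<lambda>j k. if j = k then inverse (z j) \<cdot>\<^sub>m 1\<^sub>m m else 0\<^sub>m m m)"

definition v_mat :: "nat \<Rightarrow> nat \<Rightarrow> complex mat" where
  "v_mat m n = block_mat m n 1 (\<lambda>j k. 1\<^sub>m m)"

definition u_mat :: "nat \<Rightarrow> (nat \<Rightarrow> complex mat) \<Rightarrow> nat \<Rightarrow> complex mat" where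
  "u_mat m W n = block_mat m n 1 (\<lambda>j k. W j)"

definition R_mat :: "nat \<Rightarrow> (nat \<Rightarrow> complex) \<Rightarrow> nat \<Rightarrow> complex \<Rightarrow> complex mat" where
  "R_mat m z n x = mat_inv (1\<^sub>m (n * m) - x \<cdot>\<^sub>m T_mat m z n)"

definition pick_mat ::
  "nat \<Rightarrow> (nat \<Rightarrow> complex) \<Rightarrow> (nat \<Rightarrow> complex mat) \<Rightarrow> nat \<Rightarrow> complex mat" where
  "pick_mat m z W n =
     mat_inv (T_mat m z n) *
     block_mat m n n (\<lambda>j k. (1 / (z j - cnj (z k))) \<cdot>\<^sub>m (W j - mat_adjoint (W k))) *
     mat_adjoint (mat_inv (T_mat m z n))"

section \<open>Complete indeterminacy of the full problem\<close>

definition matrix_ball :: "nat \<Rightarrow> complex mat \<Rightarrow> complex mat \<Rightarrow> complex mat \<Rightarrow> complex mat set" where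
  "matrix_ball m c r \<rho> =
     {c + r * V * \<rho> | V. V \<in> carrier_mat m m \<and> psd (1\<^sub>m m - mat_adjoint V * V)}"

text \<open>\<open>c\<close>, \<open>r\<close>, \<open>\<rho>\<close> are the center and the semi-radii of the limit ball at \<open>z0\<close>. The
  semi-radii of a ball are determined only up to \<open>(r, \<rho>) \<mapsto> (t r, t\<^sup>-\<^sup>1 \<rho>)\<close>, \<open>t > 0\<close>, so the
  convergence required is that for some choice of the semi-radii of the truncated balls.\<close>
definition limit_ball ::
  "nat \<Rightarrow> (nat \<Rightarrow> complex) \<Rightarrow> (nat \<Rightarrow> complex mat) \<Rightarrow> complex \<Rightarrow>
   complex mat \<Rightarrow> complex mat \<Rightarrow> complex mat \<Rightarrow> bool" where
  "limit_ball m z W z0 c r \<rho> \<longleftrightarrow>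
     c \<in> carrier_mat m m \<and> r \<in> carrier_mat m m \<and> \<rho> \<in> carrier_mat m m \<and> psd r \<and> psd \<rho> \<and>
     (\<lambda>w. w z0) ` solutions m z W {1..} = matrix_ball m c r \<rho> \<and>
     (\<exists>cs rs \<rho>s.
        (\<forall>n\<ge>1. cs n \<in> carrier_mat m m \<and> rs n \<in> carrier_mat m m \<and> \<rho>s n \<in> carrier_mat m m \<and>
           pos_def (rs n) \<and> pos_def (\<rho>s n) \<and>
           (\<lambda>w. w z0) ` solutions m z W {1..n} = matrix_ball m (cs n) (rs n) (\<rho>s n)) \<and>
        mat_tendsto m cs c \<and> mat_tendsto m rs r \<and> mat_tendsto m \<rho>s \<rho>)"

text \<open>By a known theorem, the following does not depend on \<open>z0\<close> in the upper half plane
  minus the nodes. The rank condition does not depend on the admissible choice of \<open>c\<close>, \<open>r\<close>,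
  \<open>\<rho>\<close>: two representations of one ball, one of them with invertible semi-radii, differ only
  by the scaling above.\<close>
definition completely_indeterminate ::
  "nat \<Rightarrow> (nat \<Rightarrow> complex) \<Rightarrow> (nat \<Rightarrow> complex mat) \<Rightarrow> complex \<Rightarrow> bool" where
  "completely_indeterminate m z W z0 \<longleftrightarrow>
     (\<exists>c r \<rho>. limit_ball m z W z0 c r \<rho> \<and> vec_space.rank m r = m \<and> vec_space.rank m \<rho> = m)"

section \<open>Rational matrix functions and the modified matrices\<close>

definition B_block ::
  "nat \<Rightarrow> (nat \<Rightarrow> complex) \<Rightarrow> (nat \<Rightarrow> complex mat) \<Rightarrow> nat \<Rightarrow> complex mat" where
  "B_block m z W j =
     (case split_block (pick_mat m z W j) ((j - 1) * m) ((j - 1) * m) of (A, B, B', C) \<Rightarrow> B)"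

definition C_block ::
  "nat \<Rightarrow> (nat \<Rightarrow> complex) \<Rightarrow> (nat \<Rightarrow> complex mat) \<Rightarrow> nat \<Rightarrow> complex mat" where
  "C_block m z W j =
     (case split_block (pick_mat m z W j) ((j - 1) * m) ((j - 1) * m) of (A, B, B', C) \<Rightarrow> C)"

definition K_hat ::
  "nat \<Rightarrow> (nat \<Rightarrow> complex) \<Rightarrow> (nat \<Rightarrow> complex mat) \<Rightarrow> nat \<Rightarrow> complex mat" where
  "K_hat m z W j =
     (if j = 1 then pick_mat m z W 1
      else C_block m z W j -
        mat_adjoint (B_block m z W j) * mat_inv (pick_mat m z W (j - 1)) * B_block m z W j)"

text \<open>The block row \<open>(- B\<^sub>j\<^sup>* P\<^sub>j\<^sub>-\<^sub>1\<^sup>-\<^sup>1, I)\<close>, and \<open>I\<close> for \<open>j = 1\<close>. The two lower blocks below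
  have no rows.\<close>
definition L_row ::
  "nat \<Rightarrow> (nat \<Rightarrow> complex) \<Rightarrow> (nat \<Rightarrow> complex mat) \<Rightarrow> nat \<Rightarrow> complex mat" where
  "L_row m z W j =
     (if j = 1 then 1\<^sub>m m
      else four_block_mat
        (- (mat_adjoint (B_block m z W j) * mat_inv (pick_mat m z W (j - 1)))) (1\<^sub>m m)
        (0\<^sub>m 0 ((j - 1) * m)) (0\<^sub>m 0 m))"

definition P_fun ::
  "nat \<Rightarrow> (nat \<Rightarrow> complex) \<Rightarrow> (nat \<Rightarrow> complex mat) \<Rightarrow> nat \<Rightarrow> complex \<Rightarrow> complex mat" where
  "P_fun m z W j x =
     mat_inv (mat_sqrt (K_hat m z W j)) * L_row m z W j * R_mat m z j x * v_mat m j"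

definition Q_fun ::
  "nat \<Rightarrow> (nat \<Rightarrow> complex) \<Rightarrow> (nat \<Rightarrow> complex mat) \<Rightarrow> nat \<Rightarrow> complex \<Rightarrow> complex mat" where
  "Q_fun m z W j x =
     - (mat_inv (mat_sqrt (K_hat m z W j)) * L_row m z W j * R_mat m z j x * u_mat m W j)"

definition P_cal ::
  "nat \<Rightarrow> (nat \<Rightarrow> complex) \<Rightarrow> (nat \<Rightarrow> complex mat) \<Rightarrow> nat \<Rightarrow> complex mat" where
  "P_cal m z W j =
     (let P = P_fun m z W j 0; Q = Q_fun m z W j 0 in
      complex_of_real ((cmod (z j))\<^sup>2 / (2 * Im (z j))) \<cdot>\<^sub>m
        (four_block_mat (mat_adjoint P * P) (- (mat_adjoint P * Q))
                        (- (mat_adjoint Q * P)) (mat_adjoint Q * Q) * J_mat m))"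

definition blaschke :: "complex \<Rightarrow> complex \<Rightarrow> complex" where
  "blaschke a x = (cnj a / a) * ((x - a) / (x - cnj a))"

definition phase :: "(nat \<Rightarrow> complex) \<Rightarrow> complex \<Rightarrow> nat \<Rightarrow> real" where
  "phase z z0 j = Arg (blaschke (z j) z0)"

text \<open>\<open>U_mat\<close> and \<open>P_tilde\<close> are mutually recursive. \<open>P_tilde\<close> is inlined in the
  recursion for \<open>U_mat\<close> (see \<open>U_mat_Suc\<close>), and the convention that \<open>U_mat\<close> is the identity
  at index 0 turns the separate clause for the first modified matrix into an instance of the
  general one (see \<open>P_tilde_1\<close>).\<close>
primrec U_mat ::
  "nat \<Rightarrow> (nat \<Rightarrow> complex) \<Rightarrow> (nat \<Rightarrow> complex mat) \<Rightarrow> complex \<Rightarrow> nat \<Rightarrow> complex mat" where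
  "U_mat m z W z0 0 = 1\<^sub>m (2 * m)"
| "U_mat m z W z0 (Suc j) =
     mat_exp ((- \<i> * complex_of_real (phase z z0 (Suc j))) \<cdot>\<^sub>m
       (U_mat m z W z0 j * P_cal m z W (Suc j) * mat_inv (U_mat m z W z0 j))) *
     U_mat m z W z0 j"

definition P_tilde ::
  "nat \<Rightarrow> (nat \<Rightarrow> complex) \<Rightarrow> (nat \<Rightarrow> complex mat) \<Rightarrow> complex \<Rightarrow> nat \<Rightarrow> complex mat" where
  "P_tilde m z W z0 j =
     U_mat m z W z0 (j - 1) * P_cal m z W j * mat_inv (U_mat m z W z0 (j - 1))"

lemma U_mat_Suc:
  "U_mat m z W z0 (Suc j) =
     mat_exp ((- \<i> * complex_of_real (phase z z0 (Suc j))) \<cdot>\<^sub>m P_tilde m z W z0 (Suc j)) *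
     U_mat m z W z0 j"
  by (simp add: P_tilde_def)

lemma mat_inv_one: "mat_inv (1\<^sub>m n) = 1\<^sub>m n"
proof -
  have "1\<^sub>m n \<in> Units (ring_mat TYPE(complex) n b)" for b :: unit
    by (auto simp: Units_def ring_mat_def)
  then obtain B where B: "mat_inverse (1\<^sub>m n :: complex mat) = Some B"
    using mat_inverse(1)[of "1\<^sub>m n :: complex mat" n "()"]
    by (cases "mat_inverse (1\<^sub>m n :: complex mat)") auto
  then have "1\<^sub>m n * B = 1\<^sub>m n" "B \<in> carrier_mat n n"
    using mat_inverse(2)[of "1\<^sub>m n :: complex mat" n] by auto
  then show ?thesis
    using B by (simp add: mat_inv_def)
qed

lemma P_fun_dims:
  "dim_col (P_fun m z W j x) = m"
  "dim_col (Q_fun m z W j x) = m"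
  by (simp_all add: P_fun_def Q_fun_def v_mat_def u_mat_def block_mat_def)

lemma P_cal_carrier: "P_cal m z W j \<in> carrier_mat (2 * m) (2 * m)"
proof -
  have "dim_col (P_fun m z W j 0) = m" "dim_col (Q_fun m z W j 0) = m"
    using P_fun_dims by auto
  then show ?thesis
    by (auto simp: P_cal_def Let_def J_mat_def mat_adjoint_def)
qed

lemma P_tilde_1: "P_tilde m z W z0 1 = P_cal m z W 1"
  using P_cal_carrier[of m z W 1] by (simp add: P_tilde_def mat_inv_one)

end

theory Submission
  imports Defs "HOL-Complex_Analysis.Great_Picard"
begin

text \<open>
The proof compares two monotone quantities with the terms of the series. The elementary matrices
\<open>E\<^sub>k\<close> of the data satisfy \<open>E\<^sub>k\<^sup>2 = -E\<^sub>k\<close> and \<open>E\<^sub>k J \<ge> 0\<close>, so the product \<open>B\<^sub>n\<close> of the factors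
\<open>1 + (1 - \<zeta>\<^sub>k) E\<^sub>k\<close> at the point \<open>x = z\<^sub>0\<close> behaves like a Blaschke product:
\<open>X\<^sub>n = - B\<^sub>n J B\<^sub>n\<^sup>*\<close> decreases with \<open>n\<close> and its inverse increases (\<open>X_dec\<close>, \<open>Xi_inc\<close>).

These matrices describe the values of the solutions at \<open>x\<close>. By a closed formula for \<open>B\<^sub>n\<close>
(\<open>Potapov_closed\<close>), the Schur complement that decides whether a further condition \<open>w(x) = w\<^sub>0\<close> can be
met is \<open>y X\<^sub>n y\<^sup>*\<close> with the row \<open>y = (w\<^sub>0, -I)\<close>, up to a positive factor (\<open>Schur_eq_ball\<close>). Positivity of
the Pick matrix is necessary for solvability by Cauchy's integral formula (\<open>nevanlinna_pick\<close>),
definiteness is sufficient by an explicit rational solution (\<open>pick_solution\<close>), and compactness of the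
Nevanlinna class (\<open>nevanlinna_limit\<close>) gives the boundary. So the values for the truncated problem fill
the ball \<open>y X\<^sub>n y\<^sup>* \<ge> 0\<close> (\<open>values_eq_ball\<close>), and those for the full problem the intersection of these balls.
Center and semi-radii are read off from \<open>X\<^sub>n\<close> and its inverse, and the limit ball has definite
semi-radii exactly if \<open>X\<^sub>n\<close> and the inverse stay bounded (\<open>limit_of_balls\<close>, \<open>bounded_of_balls\<close>).

It remains to see that boundedness is equivalent to convergence of the series. The increments of
\<open>B\<^sub>n\<close> carry the complex numbers \<open>1 - \<zeta>\<^sub>k\<close>, which need not be small. Multiplication by the
\<open>J\<close>-unitary product of the exponentials replaces \<open>B\<^sub>n\<close> by matrices \<open>H\<^sub>n\<close> with the same \<open>J\<close>-form and with
\<open>H\<^sub>n\<^sub>+\<^sub>1 = H\<^sub>n (1 + (1 - \<bar>\<zeta>\<bar>) F)\<close>, where \<open>F\<close> is the modified elementary matrix (\<open>H_Suc\<close>, \<open>X_H\<close>). Since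
\<open>F J \<ge> 0\<close>, the series converges if and only if the norms of its terms are summable
(\<open>summable_entries_iff\<close>), and its coefficients are constant multiples of \<open>1 / \<bar>\<zeta>\<bar>\<^sup>2 - 1\<close>. If it converges,
the recursions bound \<open>H\<^sub>n\<close> and its inverse, hence \<open>X\<^sub>n\<close> and its inverse (\<open>bounded_X_Xi\<close>). Conversely, if
these are bounded, the differences \<open>X\<^sub>n - X\<^sub>n\<^sub>+\<^sub>1\<close> have a convergent sum of traces; this bounds \<open>H\<^sub>n\<close> and
its inverse, and the terms of the series are obtained from the differences by conjugation with the
inverse of \<open>H\<^sub>n\<close> (\<open>summable_coef_N\<close>).
\<close>

(*%FILE A1*)
section \<open>Matrices with finite rows and columns\<close>

definition rc_finite :: "(nat \<Rightarrow> nat \<Rightarrow> complex) \<Rightarrow> bool" where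
  "rc_finite f \<longleftrightarrow> (\<forall>i. finite {j. f i j \<noteq> 0}) \<and> (\<forall>j. finite {i. f i j \<noteq> 0})"

lemma rc_finite_combine:
  assumes "rc_finite f" "rc_finite g" "\<And>i j. h i j \<noteq> 0 \<Longrightarrow> f i j \<noteq> 0 \<or> g i j \<noteq> 0"
  shows "rc_finite h"
proof -
  have "finite {j. h i j \<noteq> 0}" for i
    by (rule finite_subset[of _ "{j. f i j \<noteq> 0} \<union> {j. g i j \<noteq> 0}"])
      (use assms in \<open>auto simp: rc_finite_def\<close>)
  moreover have "finite {i. h i j \<noteq> 0}" for j
    by (rule finite_subset[of _ "{i. f i j \<noteq> 0} \<union> {i. g i j \<noteq> 0}"])
      (use assms in \<open>auto simp: rc_finite_def\<close>)
  ultimately show ?thesis by (simp add: rc_finite_def)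
qed

lemma rc_finite_mult:
  assumes f: "rc_finite f" and g: "rc_finite g"
  shows "rc_finite (\<lambda>i j. \<Sum>k | f i k \<noteq> 0. f i k * g k j)"
proof -
  have ex: "\<exists>k. f i k \<noteq> 0 \<and> g k j \<noteq> 0" if "(\<Sum>k | f i k \<noteq> 0. f i k * g k j) \<noteq> 0" for i j
    using sum.not_neutral_contains_not_neutral[OF that] by auto
  have "finite {j. (\<Sum>k | f i k \<noteq> 0. f i k * g k j) \<noteq> 0}" for i
  proof (rule finite_subset)
    show "{j. (\<Sum>k | f i k \<noteq> 0. f i k * g k j) \<noteq> 0} \<subseteq> (\<Union>k\<in>{k. f i k \<noteq> 0}. {j. g k j \<noteq> 0})"
      using ex by fast
  qed (use f g in \<open>auto simp: rc_finite_def\<close>)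
  moreover have "finite {i. (\<Sum>k | f i k \<noteq> 0. f i k * g k j) \<noteq> 0}" for j
  proof (rule finite_subset)
    show "{i. (\<Sum>k | f i k \<noteq> 0. f i k * g k j) \<noteq> 0} \<subseteq> (\<Union>k\<in>{k. g k j \<noteq> 0}. {i. f i k \<noteq> 0})"
      using ex by fast
  qed (use f g in \<open>auto simp: rc_finite_def\<close>)
  ultimately show ?thesis by (simp add: rc_finite_def)
qed

text \<open>Matrices of all sizes are elements of one ring: a finite matrix is placed in the
  upper left corner and padded with zeros. Because rows and columns are finite, products are
  finite sums and the associative law holds, and the algebra of block matrices of growing
  size becomes computation in a single ordered ring. Sizes reappear only as support
  conditions.\<close>
typedef fmat = "{f. rc_finite f}"
  morphisms ent Fmat
  by (rule exI[of _ "\<lambda>_ _. 0"]) (simp add: rc_finite_def)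

setup_lifting type_definition_fmat

lemma finite_row: "finite {j. ent A i j \<noteq> 0}"
  using ent[of A] by (simp add: rc_finite_def)

lemma finite_col: "finite {i. ent A i j \<noteq> 0}"
  using ent[of A] by (simp add: rc_finite_def)

lemma fmat_eqI: "(\<And>i j. ent A i j = ent B i j) \<Longrightarrow> A = B"
  by (metis ent_inject ext)

instantiation fmat :: "{zero, one, plus, minus, uminus, times}"
begin

lift_definition zero_fmat :: fmat is "\<lambda>_ _. 0" by (simp add: rc_finite_def)

lift_definition one_fmat :: fmat is "\<lambda>i j. if i = j then 1 else 0" by (simp add: rc_finite_def)

lift_definition plus_fmat :: "fmat \<Rightarrow> fmat \<Rightarrow> fmat" is "\<lambda>f g i j. f i j + g i j"
  by (erule (1) rc_finite_combine) auto

lift_definition minus_fmat :: "fmat \<Rightarrow> fmat \<Rightarrow> fmat" is "\<lambda>f g i j. f i j - g i j"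
  by (erule (1) rc_finite_combine) auto

lift_definition uminus_fmat :: "fmat \<Rightarrow> fmat" is "\<lambda>f i j. - f i j" by (simp add: rc_finite_def)

lift_definition times_fmat :: "fmat \<Rightarrow> fmat \<Rightarrow> fmat"
  is "\<lambda>f g i j. \<Sum>k | f i k \<noteq> 0. f i k * g k j"
  by (rule rc_finite_mult)

instance ..
end

lift_definition adj :: "fmat \<Rightarrow> fmat" is "\<lambda>f i j. cnj (f j i)" by (simp add: rc_finite_def)

lift_definition cscale :: "complex \<Rightarrow> fmat \<Rightarrow> fmat" (infixr "*c" 75)
  is "\<lambda>c f i j. c * f i j"
  subgoal for c f by (rule rc_finite_combine[of f f]) auto
  done

lemma ent_mult_alt:
  assumes "finite S" "\<And>k. ent A i k \<noteq> 0 \<Longrightarrow> ent B k j \<noteq> 0 \<Longrightarrow> k \<in> S"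
  shows "ent (A * B) i j = (\<Sum>k\<in>S. ent A i k * ent B k j)"
proof -
  have "ent (A * B) i j = (\<Sum>k | ent A i k \<noteq> 0. ent A i k * ent B k j)"
    by transfer simp
  also have "\<dots> = (\<Sum>k\<in>S \<union> {k. ent A i k \<noteq> 0}. ent A i k * ent B k j)"
    by (rule sum.mono_neutral_left) (use assms finite_row in auto)
  also have "\<dots> = (\<Sum>k\<in>S. ent A i k * ent B k j)"
    by (rule sum.mono_neutral_right) (use assms finite_row in auto)
  finally show ?thesis .
qed

lemma ent_mult_row: "ent (A * B) i j = (\<Sum>k | ent A i k \<noteq> 0. ent A i k * ent B k j)"
  by transfer simp

lemma ent_mult_col: "ent (A * B) i j = (\<Sum>k | ent B k j \<noteq> 0. ent A i k * ent B k j)"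
  by (rule ent_mult_alt) (auto simp: finite_col)

lemma ent_simps [simp]:
  "ent 0 i j = 0" "ent (A + B) i j = ent A i j + ent B i j"
  "ent (A - B) i j = ent A i j - ent B i j" "ent (- A) i j = - ent A i j"
  "ent (adj A) i j = cnj (ent A j i)" "ent (c *c A) i j = c * ent A i j"
  by (transfer; simp)+

lemma ent_one: "ent 1 i j = (if i = j then 1 else 0)"
  by transfer simp

instance fmat :: ring_1
proof
  fix A B C :: fmat
  show "A * B * C = A * (B * C)"
  proof (rule fmat_eqI)
    fix i j
    let ?R = "{k. ent A i k \<noteq> 0}" and ?S = "{k. ent C k j \<noteq> 0}"
    have 1: "ent (A * B * C) i j = (\<Sum>l\<in>?S. \<Sum>k\<in>?R. ent A i k * ent B k l * ent C l j)"
      by (simp only: ent_mult_col[of "A * B" C] ent_mult_row[of A B i] sum_distrib_right)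
    have 2: "ent (A * (B * C)) i j = (\<Sum>k\<in>?R. \<Sum>l\<in>?S. ent A i k * ent B k l * ent C l j)"
      by (simp only: ent_mult_row[of A "B * C"] ent_mult_col[of B C _ j] sum_distrib_left mult.assoc)
    show "ent (A * B * C) i j = ent (A * (B * C)) i j"
      unfolding 1 2 by (rule sum.swap)
  qed
  show "1 * A = A"
    by (rule fmat_eqI, subst ent_mult_alt[where S = "{_}"]) (auto simp: ent_one split: if_splits)
  show "A * 1 = A"
    by (rule fmat_eqI, subst ent_mult_alt[where S = "{_}"]) (auto simp: ent_one split: if_splits)
  show "(A + B) * C = A * C + B * C"
  proof (rule fmat_eqI)
    fix i j
    show "ent ((A + B) * C) i j = ent (A * C + B * C) i j"
      by (simp add: ent_mult_col[of _ C _ j] distrib_right sum.distrib)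
  qed
  show "A * (B + C) = A * B + A * C"
  proof (rule fmat_eqI)
    fix i j
    show "ent (A * (B + C)) i j = ent (A * B + A * C) i j"
      by (simp add: ent_mult_row[of A _ i] distrib_left sum.distrib)
  qed
  show "(0::fmat) \<noteq> 1"
    by (metis ent_one ent_simps(1) zero_neq_one)
qed (auto intro!: fmat_eqI)

lemma adj_mult [simp]: "adj (A * B) = adj B * adj A"
proof (rule fmat_eqI)
  fix i j
  show "ent (adj (A * B)) i j = ent (adj B * adj A) i j"
    by (simp add: ent_mult_row[of A B j] ent_mult_col[of _ "adj A" _ j] mult.commute)
qed

lemma adj_simps [simp]:
  "adj (adj A) = A" "adj 0 = 0" "adj 1 = 1" "adj (A + B) = adj A + adj B"
  "adj (A - B) = adj A - adj B" "adj (- A) = - adj A" "adj (c *c A) = cnj c *c adj A"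
  by (auto intro!: fmat_eqI simp: ent_one)

lemma adj_sum [simp]: "adj (sum f S) = (\<Sum>x\<in>S. adj (f x))"
  by (induction S rule: infinite_finite_induct) auto

lemma ent_sum [simp]: "ent (sum f S) i j = (\<Sum>x\<in>S. ent (f x) i j)"
  by (induction S rule: infinite_finite_induct) auto

lemma cscale_mult [simp]: "(c *c A) * B = c *c (A * B)" "A * (c *c B) = c *c (A * B)"
proof -
  show "(c *c A) * B = c *c (A * B)"
  proof (rule fmat_eqI)
    fix i j
    show "ent ((c *c A) * B) i j = ent (c *c (A * B)) i j"
      by (simp add: ent_mult_col[of _ B _ j] sum_distrib_left mult.assoc)
  qed
  show "A * (c *c B) = c *c (A * B)"
  proof (rule fmat_eqI)
    fix i j
    show "ent (A * (c *c B)) i j = ent (c *c (A * B)) i j"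
      by (simp add: ent_mult_row[of A _ i] sum_distrib_left algebra_simps)
  qed
qed

lemma cscale_simps [simp]:
  "c *c d *c A = (c * d) *c A" "1 *c A = A" "0 *c A = 0" "c *c 0 = 0"
  "(- c) *c A = - (c *c A)" "c *c (- A) = - (c *c A)"
  by (auto intro!: fmat_eqI)

lemma cscale_distrib:
  "c *c (A + B) = c *c A + c *c B" "c *c (A - B) = c *c A - c *c B"
  "(c + d) *c A = c *c A + d *c A" "(c - d) *c A = c *c A - d *c A"
  by (auto intro!: fmat_eqI simp: algebra_simps)

lemma cscale_sum: "c *c sum f S = (\<Sum>x\<in>S. c *c f x)"
  by (induction S rule: infinite_finite_induct) (auto simp: cscale_distrib)

(*%FILE A2*)
section \<open>Corners and block rows\<close>

text \<open>The unit matrix of size \<open>d\<close>, used as a projection: factors of it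
  truncate rows or columns.\<close>
lift_definition dg :: "nat \<Rightarrow> fmat" is "\<lambda>d i j. if i = j \<and> i < d then 1 else 0"
  subgoal for d
    by (rule rc_finite_combine[of "\<lambda>i j. if i = j then 1 else 0" "\<lambda>i j. if i = j then 1 else 0"])
      (simp_all add: rc_finite_def split: if_splits)
  done

text \<open>The block row \<open>(0, \<dots>, 0, I, 0, \<dots>)\<close> that cuts out the
  \<open>k\<close>-th block of \<open>m\<close> rows; its adjoint puts a matrix into that
  block.\<close>
lift_definition blk :: "nat \<Rightarrow> nat \<Rightarrow> fmat" is "\<lambda>m k i j. if i < m \<and> j = k * m + i then 1 else 0"
  subgoal for m k
  proof -
    have "finite {j. (if i < m \<and> j = k * m + i then 1 else 0) \<noteq> (0::complex)}" for i
      by (rule finite_subset[of _ "{k * m + i}"]) auto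
    moreover have "finite {i. (if i < m \<and> j = k * m + i then 1 else 0) \<noteq> (0::complex)}" for j
      by (rule finite_subset[of _ "{..<m}"]) auto
    ultimately show ?thesis unfolding rc_finite_def by blast
  qed
  done

lemma ent_dg: "ent (dg d) i j = (if i = j \<and> i < d then 1 else 0)"
  by transfer simp

lemma ent_blk: "ent (blk m k) i j = (if i < m \<and> j = k * m + i then 1 else 0)"
  by transfer simp

lemma ent_dg_mult: "ent (dg d * A) i j = (if i < d then ent A i j else 0)"
proof -
  have "ent (dg d * A) i j = (\<Sum>k\<in>{i}. ent (dg d) i k * ent A k j)"
    by (rule ent_mult_alt) (simp_all add: ent_dg split: if_splits)
  then show ?thesis by (simp add: ent_dg)
qed

lemma ent_mult_dg: "ent (A * dg d) i j = (if j < d then ent A i j else 0)"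
proof -
  have "ent (A * dg d) i j = (\<Sum>k\<in>{j}. ent A i k * ent (dg d) k j)"
    by (rule ent_mult_alt) (simp_all add: ent_dg split: if_splits)
  then show ?thesis by (simp add: ent_dg)
qed

lemma adj_dg [simp]: "adj (dg d) = dg d"
  by (rule fmat_eqI) (simp add: ent_dg)

lemma dg_dg [simp]: "dg d * dg d = dg d"
  by (rule fmat_eqI) (simp add: ent_dg_mult ent_dg)

text \<open>Support in the first \<open>d\<close> rows and \<open>e\<close> columns, written
  as equations so that it can be used for rewriting.\<close>
definition cor :: "nat \<Rightarrow> nat \<Rightarrow> fmat \<Rightarrow> bool" where
  "cor d e A \<longleftrightarrow> dg d * A = A \<and> A * dg e = A"

lemma cor_iff: "cor d e A \<longleftrightarrow> (\<forall>i j. d \<le> i \<or> e \<le> j \<longrightarrow> ent A i j = 0)"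
proof
  assume "cor d e A"
  then have A: "ent (dg d * A) i j = ent A i j" "ent (A * dg e) i j = ent A i j" for i j
    unfolding cor_def by simp_all
  show "\<forall>i j. d \<le> i \<or> e \<le> j \<longrightarrow> ent A i j = 0"
  proof (intro allI impI)
    fix i j assume "d \<le> i \<or> e \<le> j"
    then show "ent A i j = 0"
      using A(1)[of i j] A(2)[of i j] by (auto simp: ent_dg_mult ent_mult_dg)
  qed
next
  assume "\<forall>i j. d \<le> i \<or> e \<le> j \<longrightarrow> ent A i j = 0"
  then show "cor d e A"
    unfolding cor_def by (intro conjI fmat_eqI) (auto simp: ent_dg_mult ent_mult_dg not_less)
qed

lemma corD:
  assumes "cor d e A"
  shows "dg d * A = A" "A * dg e = A" "dg d * (A * B) = A * B" "A * (dg e * B) = A * B"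
proof -
  show A: "dg d * A = A" "A * dg e = A"
    using assms unfolding cor_def by blast+
  have "dg d * (A * B) = (dg d * A) * B" "A * (dg e * B) = (A * dg e) * B"
    by (simp_all only: mult.assoc)
  then show "dg d * (A * B) = A * B" "A * (dg e * B) = A * B"
    unfolding A by blast+
qed

lemma cor_mult: "cor d e A \<Longrightarrow> cor e f B \<Longrightarrow> cor d f (A * B)"
  unfolding cor_def[of d f] by (simp only: corD mult.assoc simp_thms)

lemma corI: "(\<And>i j. d \<le> i \<or> e \<le> j \<Longrightarrow> ent A i j = 0) \<Longrightarrow> cor d e A"
  unfolding cor_iff by blast

lemma cor_ent: "cor d e A \<Longrightarrow> d \<le> i \<or> e \<le> j \<Longrightarrow> ent A i j = 0"
  unfolding cor_iff by blast

lemma cor_intros: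
  "cor d e 0" "cor d e A \<Longrightarrow> cor d e B \<Longrightarrow> cor d e (A + B)"
  "cor d e A \<Longrightarrow> cor d e B \<Longrightarrow> cor d e (A - B)" "cor d e A \<Longrightarrow> cor d e (- A)"
  "cor d e A \<Longrightarrow> cor d e (c *c A)" "cor d e A \<Longrightarrow> cor e d (adj A)" "cor d d (dg d)"
proof -
  show "cor d e 0" by (rule corI) simp
  show "cor d d (dg d)" by (rule corI) (auto simp: ent_dg)
  assume A: "cor d e A"
  note a = cor_ent[OF A]
  show "cor d e (- A)" "cor d e (c *c A)" "cor e d (adj A)"
    by (rule corI, use a in force)+
  assume B: "cor d e B"
  note b = cor_ent[OF B]
  show "cor d e (A + B)" "cor d e (A - B)"
    by (rule corI, use a b in force)+
qed

lemma cor_sum: "(\<And>x. x \<in> S \<Longrightarrow> cor d e (f x)) \<Longrightarrow> cor d e (sum f S)"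
  by (rule corI) (auto intro!: sum.neutral dest: cor_ent)

(*%FILE A3*)
lemma ent_mult_cor:
  assumes "cor d e A \<or> cor e f B"
  shows "ent (A * B) i j = (\<Sum>k<e. ent A i k * ent B k j)"
  by (rule ent_mult_alt) (use assms in \<open>auto simp: cor_iff not_le[symmetric]\<close>)

lemma ent_blk_mult: "ent (blk m k * A) a j = (if a < m then ent A (k * m + a) j else 0)"
proof -
  have "ent (blk m k * A) a j = (\<Sum>l\<in>{k * m + a}. ent (blk m k) a l * ent A l j)"
    by (rule ent_mult_alt) (simp_all add: ent_blk split: if_splits)
  then show ?thesis by (simp add: ent_blk)
qed

lemma ent_adj_blk_mult:
  "ent (adj (blk m k) * A) i j = (if k * m \<le> i \<and> i < k * m + m then ent A (i - k * m) j else 0)"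
proof -
  have "ent (adj (blk m k) * A) i j = (\<Sum>l\<in>{i - k * m}. ent (adj (blk m k)) i l * ent A l j)"
    by (rule ent_mult_alt) (simp_all add: ent_blk split: if_splits)
  moreover have "i - k * m < m \<and> i = k * m + (i - k * m) \<longleftrightarrow> k * m \<le> i \<and> i < k * m + m"
    by linarith
  ultimately show ?thesis by (simp add: ent_blk)
qed

lemma ent_mult_adj_blk:
  assumes "b < m"
  shows "ent (Y * adj (blk m k)) i b = ent Y i (k * m + b)"
proof -
  have "cnj (ent (Y * adj (blk m k)) i b) = ent (blk m k * adj Y) b i"
    by (simp only: ent_simps(5)[symmetric] adj_mult adj_simps)
  also have "\<dots> = cnj (ent Y i (k * m + b))" using assms by (simp add: ent_blk_mult)
  finally show ?thesis by simp
qed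

lemma ent_block:
  assumes "a < m" "b < m"
  shows "ent (blk m j * (Y * adj (blk m k))) a b = ent Y (j * m + a) (k * m + b)"
  using assms by (simp add: ent_blk_mult ent_mult_adj_blk)

lemma blk_adj_blk: "blk m j * adj (blk m k) = (if j = k then dg m else 0)"
proof (rule fmat_eqI)
  fix a b
  have "j = k \<and> a = b" if "a < m" "b < m" "j * m + a = k * m + b"
  proof -
    have "(j * m + a) div m = j" using that(1) by simp
    moreover have "(k * m + b) div m = k" using that(2) by simp
    ultimately have "j = k" using that(3) by simp
    then show ?thesis using that(3) by simp
  qed
  then show "ent (blk m j * adj (blk m k)) a b = ent (if j = k then dg m else 0) a b"
    by (auto simp: ent_blk_mult ent_blk ent_dg)
qed

lemma sum_adj_blk_blk: "(\<Sum>k<n. adj (blk m k) * blk m k) = dg (n * m)"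
proof (induction n)
  case 0 show ?case by (rule fmat_eqI) (simp add: ent_dg)
next
  case (Suc n)
  have "ent (adj (blk m n) * blk m n) i j = (if i = j \<and> n * m \<le> i \<and> i < n * m + m then 1 else 0)" for i j
    unfolding ent_adj_blk_mult by (auto simp: ent_blk)
  then show ?case unfolding sum.lessThan_Suc Suc
    by (intro fmat_eqI) (simp add: ent_dg)
qed

lemma cor_blk: "k < n \<Longrightarrow> cor m (n * m) (blk m k)"
  unfolding cor_iff
proof (intro allI impI)
  fix i j assume k: "k < n" and ij: "m \<le> i \<or> n * m \<le> j"
  have "k * m + i < n * m" if "i < m"
  proof -
    have "k * m + i < Suc k * m" using that by simp
    also have "\<dots> \<le> n * m" using k by (intro mult_le_mono1) simp
    finally show ?thesis .
  qed
  then show "ent (blk m k) i j = 0" using ij by (auto simp: ent_blk)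
qed

(*%FILE A4*)
section \<open>The positive semidefinite order\<close>

text \<open>The quadratic form of \<open>A\<close> at the first column of \<open>x\<close>.
  Vectors are themselves elements of the ring.\<close>
definition qf :: "fmat \<Rightarrow> fmat \<Rightarrow> real" where "qf A x = Re (ent (adj x * A * x) 0 0)"

lemma qf_simps [simp]: "qf (A + B) x = qf A x + qf B x" "qf (A - B) x = qf A x - qf B x"
  "qf (- A) x = - qf A x" "qf 0 x = 0" "qf (complex_of_real r *c A) x = r * qf A x"
  by (simp_all add: qf_def algebra_simps)

lemma qf_cong: "qf (C * A * adj C) x = qf A (adj C * x)"
  by (simp add: qf_def mult.assoc)

lift_definition munit :: "nat \<Rightarrow> fmat" is "\<lambda>k i j. if i = k \<and> j = 0 then 1 else 0"
  subgoal for k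
  proof -
    have "finite {j. (if i = k \<and> j = 0 then 1 else 0) \<noteq> (0::complex)}" for i
      by (rule finite_subset[of _ "{0}"]) auto
    moreover have "finite {i. (if i = k \<and> j = 0 then 1 else 0) \<noteq> (0::complex)}" for j :: nat
      by (rule finite_subset[of _ "{k}"]) auto
    ultimately show ?thesis unfolding rc_finite_def by blast
  qed
  done

lemma ent_munit: "ent (munit k) i j = (if i = k \<and> j = 0 then 1 else 0)"
  by transfer simp

lemma ent_qf_munit: "ent (adj (munit i) * A * munit j) 0 0 = ent A i j"
proof -
  have "ent (adj (munit i) * (A * munit j)) 0 0
      = (\<Sum>k\<in>{i}. ent (adj (munit i)) 0 k * ent (A * munit j) k 0)"
    by (rule ent_mult_alt) (simp_all add: ent_munit split: if_splits)
  also have "\<dots> = ent (A * munit j) i 0"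
    by (simp add: ent_munit)
  also have "\<dots> = (\<Sum>k\<in>{j}. ent A i k * ent (munit j) k 0)"
    by (rule ent_mult_alt) (simp_all add: ent_munit split: if_splits)
  also have "\<dots> = ent A i j"
    by (simp add: ent_munit)
  finally show ?thesis by (simp add: mult.assoc)
qed

lemma qf_munit: "qf A (munit i) = Re (ent A i i)"
  by (simp add: qf_def ent_qf_munit)

lemma qf_munit2:
  assumes "adj A = A"
  shows "qf A (munit i + c *c munit j) = Re (ent A i i) + (cmod c)\<^sup>2 * Re (ent A j j) + 2 * Re (c * ent A i j)"
proof -
  have ji: "ent A j i = cnj (ent A i j)" by (metis assms ent_simps(5))
  have "adj (munit i + c *c munit j) * A * (munit i + c *c munit j)
    = adj (munit i) * A * munit i + c *c (adj (munit i) * A * munit j)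
      + cnj c *c (adj (munit j) * A * munit i) + (cnj c * c) *c (adj (munit j) * A * munit j)"
    by (simp add: algebra_simps cscale_distrib)
  then have "qf A (munit i + c *c munit j)
    = Re (ent A i i + c * ent A i j + cnj c * ent A j i + (cnj c * c) * ent A j j)"
    by (simp only: qf_def ent_simps ent_qf_munit)
  also have "\<dots> = Re (ent A i i) + Re (cnj c * c) * Re (ent A j j) - Im (cnj c * c) * Im (ent A j j)
      + 2 * Re (c * ent A i j)"
    by (simp add: ji)
  also have "cnj c * c = complex_of_real ((cmod c)\<^sup>2)"
    by (metis complex_norm_square mult.commute)
  finally show ?thesis by simp
qed

instantiation fmat :: "{real_algebra_1, ordered_ab_group_add}"
begin

definition "scaleR r A = complex_of_real r *c A"
definition less_eq_fmat :: "fmat \<Rightarrow> fmat \<Rightarrow> bool" where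
  "less_eq_fmat A B \<longleftrightarrow> adj (B - A) = B - A \<and> (\<forall>x. 0 \<le> qf (B - A) x)"
definition less_fmat :: "fmat \<Rightarrow> fmat \<Rightarrow> bool" where
  "less_fmat A B \<longleftrightarrow> A \<le> B \<and> \<not> B \<le> A"

instance
proof
  fix A B C :: fmat
  show "A \<le> A" by (simp add: less_eq_fmat_def)
  show "A < B \<longleftrightarrow> A \<le> B \<and> \<not> B \<le> A" by (simp add: less_fmat_def)
  show "A \<le> C" if "A \<le> B" "B \<le> C"
  proof -
    have "adj (C - A) = adj (C - B) + adj (B - A)" by simp
    also have "\<dots> = (C - B) + (B - A)" using that unfolding less_eq_fmat_def by metis
    finally have "adj (C - A) = C - A" by simp
    moreover have "0 \<le> qf (C - A) x" for x
    proof -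
      have "0 \<le> qf (C - B) x" "0 \<le> qf (B - A) x" using that unfolding less_eq_fmat_def by blast+
      then show ?thesis by simp
    qed
    ultimately show ?thesis unfolding less_eq_fmat_def by blast
  qed
  show "A = B" if "A \<le> B" "B \<le> A"
  proof -
    let ?D = "B - A"
    have h: "adj ?D = ?D" using that unfolding less_eq_fmat_def by blast
    have q: "qf ?D x = 0" for x
    proof -
      have "0 \<le> qf (B - A) x" "0 \<le> qf (A - B) x" using that unfolding less_eq_fmat_def by blast+
      then show ?thesis by simp
    qed
    have d: "Re (ent ?D i i) = 0" for i using q[of "munit i"] unfolding qf_munit .
    have "Re (c * ent ?D i j) = 0" for c i j
      using q[of "munit i + c *c munit j"] unfolding qf_munit2[OF h] d by simp
    from this[of 1] this[of "\<i>"] have "ent ?D i j = 0" for i j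
      by (simp add: complex_eq_iff)
    then show ?thesis by (intro fmat_eqI) simp
  qed
  show "C + A \<le> C + B" if "A \<le> B" using that by (simp add: less_eq_fmat_def)
qed (auto simp: scaleR_fmat_def cscale_distrib)

end

lemma psd_iff: "0 \<le> A \<longleftrightarrow> adj A = A \<and> (\<forall>x. 0 \<le> qf A x)"
  by (simp add: less_eq_fmat_def)

lemma scaleR_cscale: "r *\<^sub>R A = complex_of_real r *c A"
  by (simp add: scaleR_fmat_def)

lemma ent_scaleR [simp]: "ent (r *\<^sub>R A) i j = complex_of_real r * ent A i j"
  by (simp add: scaleR_fmat_def)

lemma adj_scaleR [simp]: "adj (r *\<^sub>R A) = r *\<^sub>R adj A"
  by (simp add: scaleR_fmat_def)

lemma qf_scaleR [simp]: "qf (r *\<^sub>R A) x = r * qf A x"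
  by (simp add: scaleR_fmat_def)

lemma cor_scaleR: "cor d e A \<Longrightarrow> cor d e (r *\<^sub>R A)"
  by (simp add: scaleR_fmat_def cor_intros)

lemmas cor_rules = cor_intros cor_scaleR cor_mult

instance fmat :: ordered_real_vector
proof
  fix A B :: fmat and r s :: real
  show "r *\<^sub>R A \<le> r *\<^sub>R B" if "A \<le> B" "0 \<le> r"
  proof -
    have "r *\<^sub>R B - r *\<^sub>R A = r *\<^sub>R (B - A)" by (simp add: scaleR_diff_right)
    moreover have "adj (B - A) = B - A" "\<And>x. 0 \<le> qf (B - A) x"
      using that(1) unfolding less_eq_fmat_def by blast+
    ultimately show ?thesis
      using that(2) unfolding less_eq_fmat_def by (simp only: adj_scaleR qf_scaleR mult_nonneg_nonneg) simp
  qed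
  show "r *\<^sub>R A \<le> s *\<^sub>R A" if "r \<le> s" "0 \<le> A"
  proof -
    have "s *\<^sub>R A - r *\<^sub>R A = (s - r) *\<^sub>R A" by (simp add: scaleR_left_diff_distrib)
    moreover have "adj A = A" "\<And>x. 0 \<le> qf A x"
      using that(2) unfolding psd_iff by blast+
    ultimately show ?thesis
      using that(1) unfolding less_eq_fmat_def by (simp only: adj_scaleR qf_scaleR mult_nonneg_nonneg) simp
  qed
qed

lemma psd_adj: "0 \<le> A \<Longrightarrow> adj A = A"
  by (simp add: psd_iff)

lemma psd_cong: "0 \<le> A \<Longrightarrow> 0 \<le> C * A * adj C"
  by (simp add: psd_iff qf_cong) (simp add: mult.assoc)

lemma le_cong: "A \<le> B \<Longrightarrow> C * A * adj C \<le> C * B * adj C"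
  using psd_cong[of "B - A" C] by (simp add: algebra_simps)

lemma psd_one: "0 \<le> (1::fmat)"
proof -
  have "0 \<le> qf 1 x" for x
  proof -
    have "ent (adj x * x) 0 0 = (\<Sum>k | ent x k 0 \<noteq> 0. cnj (ent x k 0) * ent x k 0)"
      by (simp add: ent_mult_col[of "adj x" x])
    also have "Re \<dots> \<ge> 0"
      unfolding Re_sum by (rule sum_nonneg) simp
    finally show ?thesis by (simp add: qf_def)
  qed
  then show ?thesis by (simp add: psd_iff)
qed

lemma psd_square: "0 \<le> C * adj C" "0 \<le> adj C * C"
  using psd_cong[OF psd_one, of C] psd_cong[OF psd_one, of "adj C"] by simp_all

lemma psd_herm_square: "adj C = C \<Longrightarrow> 0 \<le> C * C"
  using psd_square[of C] by simp

lemma psd_dg: "0 \<le> dg d"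
  using psd_herm_square[of "dg d"] by simp

text \<open>The form is nonnegative on the span of two unit columns.\<close>
lemma psd_entry_bound:
  assumes "0 \<le> A"
  shows "cmod (ent A i j) \<le> (Re (ent A i i) + Re (ent A j j)) / 2" "0 \<le> Re (ent A i i)"
    "Im (ent A i i) = 0"
proof -
  have h: "adj A = A" and q: "\<And>x. 0 \<le> qf A x" using assms by (auto simp: psd_iff)
  show "0 \<le> Re (ent A i i)" using q[of "munit i"] by (simp add: qf_munit)
  have "cnj (ent A i i) = ent A i i" by (metis h ent_simps(5))
  then show "Im (ent A i i) = 0" by (simp add: complex_eq_iff)
  define a where "a = ent A i j"
  define c where "c = (if a = 0 then 1 else - cnj a / cmod a)"
  have c: "cmod c = 1" by (auto simp: c_def norm_divide)
  have "c * a = - complex_of_real (cmod a)"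
    by (auto simp: c_def field_simps complex_norm_square[symmetric] power2_eq_square)
  then have "Re (c * ent A i j) = - cmod a" by (simp add: a_def)
  then show "cmod (ent A i j) \<le> (Re (ent A i i) + Re (ent A j j)) / 2"
    using q[of "munit i + c *c munit j"] c by (simp add: qf_munit2[OF h] a_def)
qed

(*%FILE A5*)
section \<open>Embedding of finite matrices\<close>

lift_definition emb :: "complex mat \<Rightarrow> fmat"
  is "\<lambda>A i j. if i < dim_row A \<and> j < dim_col A then A $$ (i, j) else 0"
  subgoal for A
  proof -
    have "finite {j. (if i < dim_row A \<and> j < dim_col A then A $$ (i, j) else 0) \<noteq> 0}" for i
      by (rule finite_subset[of _ "{..<dim_col A}"]) auto
    moreover have "finite {i. (if i < dim_row A \<and> j < dim_col A then A $$ (i, j) else 0) \<noteq> 0}" for j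
      by (rule finite_subset[of _ "{..<dim_row A}"]) auto
    ultimately show ?thesis unfolding rc_finite_def by blast
  qed
  done

lemma ent_emb: "ent (emb A) i j = (if i < dim_row A \<and> j < dim_col A then A $$ (i, j) else 0)"
  by (simp add: emb.rep_eq)

lemma cor_emb: "A \<in> carrier_mat d e \<Longrightarrow> cor d e (emb A)"
  by (rule corI) (auto simp: ent_emb)

lemma emb_inj: "A \<in> carrier_mat d e \<Longrightarrow> B \<in> carrier_mat d e \<Longrightarrow> emb A = emb B \<Longrightarrow> A = B"
proof (rule eq_matI)
  fix i j assume AB: "A \<in> carrier_mat d e" "B \<in> carrier_mat d e" "emb A = emb B"
    and "i < dim_row B" "j < dim_col B"
  moreover from AB have "ent (emb A) i j = ent (emb B) i j" by simp
  note this[unfolded ent_emb]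
  ultimately show "A $$ (i, j) = B $$ (i, j)"
    using AB(1,2) by (simp split: if_splits)
qed auto

definition unemb :: "nat \<Rightarrow> nat \<Rightarrow> fmat \<Rightarrow> complex mat" where
  "unemb d e A = mat d e (\<lambda>(i, j). ent A i j)"

lemma unemb_carrier: "unemb d e A \<in> carrier_mat d e"
  by (simp add: unemb_def)

lemma emb_unemb: "cor d e A \<Longrightarrow> emb (unemb d e A) = A"
  by (rule fmat_eqI) (auto simp: ent_emb unemb_def cor_ent)

lemma unemb_emb: "A \<in> carrier_mat d e \<Longrightarrow> unemb d e (emb A) = A"
  by (rule eq_matI) (auto simp: ent_emb unemb_def)

lemma emb_mult:
  assumes "A \<in> carrier_mat d e" "B \<in> carrier_mat e f"
  shows "emb (A * B) = emb A * emb B"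
proof (rule fmat_eqI)
  fix i j
  have "ent (emb A * emb B) i j = (\<Sum>k<e. ent (emb A) i k * ent (emb B) k j)"
    by (rule ent_mult_cor) (use cor_emb[OF assms(1)] in blast)
  also have "\<dots> = ent (emb (A * B)) i j"
  proof (cases "i < d \<and> j < f")
    case True
    then show ?thesis
      using assms by (auto simp: ent_emb scalar_prod_def lessThan_atLeast0 intro!: sum.cong)
  next
    case False
    then show ?thesis
      using assms by (auto simp: ent_emb intro!: sum.neutral)
  qed
  finally show "ent (emb (A * B)) i j = ent (emb A * emb B) i j" by simp
qed

lemma emb_add: "A \<in> carrier_mat d e \<Longrightarrow> B \<in> carrier_mat d e \<Longrightarrow> emb (A + B) = emb A + emb B"
  by (rule fmat_eqI) (auto simp: ent_emb)

lemma emb_diff: "A \<in> carrier_mat d e \<Longrightarrow> B \<in> carrier_mat d e \<Longrightarrow> emb (A - B) = emb A - emb B"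
  by (rule fmat_eqI) (auto simp: ent_emb)

lemma emb_uminus: "emb (- A) = - emb A"
  by (rule fmat_eqI) (auto simp: ent_emb)

lemma emb_smult: "emb (c \<cdot>\<^sub>m A) = c *c emb A"
  by (rule fmat_eqI) (auto simp: ent_emb)

lemma emb_one: "emb (1\<^sub>m d) = dg d"
  by (rule fmat_eqI) (auto simp: ent_emb ent_dg)

lemma emb_zero: "emb (0\<^sub>m d e) = 0"
  by (rule fmat_eqI) (auto simp: ent_emb)

lemma mat_adjoint_index:
  assumes "i < dim_col A" "j < dim_row A"
  shows "mat_adjoint A $$ (i, j) = cnj (A $$ (j, i))"
  using assms by (simp add: mat_adjoint_def mat_of_rows_def)

lemma mat_adjoint_dims: "dim_row (mat_adjoint A) = dim_col A" "dim_col (mat_adjoint A) = dim_row A"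
  by (simp_all add: mat_adjoint_def)

lemma mat_adjoint_carrier: "A \<in> carrier_mat d e \<Longrightarrow> mat_adjoint A \<in> carrier_mat e d"
  by (auto simp: mat_adjoint_dims)

lemma emb_adj: "emb (mat_adjoint A) = adj (emb A)"
  by (rule fmat_eqI) (auto simp: ent_emb mat_adjoint_dims mat_adjoint_index)

definition colf :: "complex vec \<Rightarrow> fmat" where
  "colf x = emb (mat (dim_vec x) 1 (\<lambda>(i, j). x $ i))"

lemma qf_colf:
  assumes "A \<in> carrier_mat d d" "x \<in> carrier_vec d"
  shows "qf (emb A) (colf x) = Re ((A *\<^sub>v x) \<bullet>c x)"
proof -
  let ?X = "mat (dim_vec x) 1 (\<lambda>(i, j). x $ i)"
  have X: "?X \<in> carrier_mat d 1" using assms by auto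
  have "adj (colf x) * emb A * colf x = emb (mat_adjoint ?X * A * ?X)"
    unfolding colf_def emb_adj[symmetric]
    using X assms mat_adjoint_carrier[OF X]
    by (simp add: emb_mult[of _ 1 d _ d] emb_mult[of _ 1 d _ 1])
  moreover have "ent (emb (mat_adjoint ?X * A * ?X)) 0 0 = (A *\<^sub>v x) \<bullet>c x"
  proof -
    have "mat_adjoint ?X * A * ?X = mat_adjoint ?X * (A * ?X)"
      using X assms mat_adjoint_carrier[OF X] by (simp add: assoc_mult_mat[of _ 1 d _ d _ 1])
    moreover have "(mat_adjoint ?X * (A * ?X)) $$ (0, 0) = (A *\<^sub>v x) \<bullet>c x"
      using assms X
      by (auto simp: scalar_prod_def mat_adjoint_dims mat_adjoint_index mult.commute intro!: sum.cong)
    ultimately show ?thesis using X assms by (simp add: ent_emb mat_adjoint_dims)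
  qed
  ultimately show ?thesis by (simp add: qf_def)
qed

lemma qf_cor:
  assumes "cor d d A"
  shows "qf A x = qf A (colf (vec d (\<lambda>i. ent x i 0)))"
proof -
  let ?y = "colf (vec d (\<lambda>i. ent x i 0))"
  have y: "?y = dg d * (x * dg 1)"
    by (rule fmat_eqI) (simp add: ent_dg_mult ent_mult_dg colf_def ent_emb)
  have "adj ?y * A * ?y = dg 1 * ((adj x * A * x) * dg 1)"
    by (simp add: y mult.assoc corD[OF assms])
  then show ?thesis by (simp add: qf_def ent_dg_mult ent_mult_dg)
qed

lemma psd_emb:
  assumes "A \<in> carrier_mat d d"
  shows "psd A \<longleftrightarrow> 0 \<le> emb A"
proof
  assume "psd A"
  then have h: "mat_adjoint A = A" and q: "\<And>x. x \<in> carrier_vec d \<Longrightarrow> 0 \<le> Re ((A *\<^sub>v x) \<bullet>c x)"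
    using assms by (auto simp: psd_def)
  have "0 \<le> qf (emb A) x" for x
  proof -
    have "qf (emb A) x = Re ((A *\<^sub>v vec d (\<lambda>i. ent x i 0)) \<bullet>c vec d (\<lambda>i. ent x i 0))"
      using qf_cor[OF cor_emb[OF assms], of x] qf_colf[OF assms, of "vec d (\<lambda>i. ent x i 0)"] by simp
    then show ?thesis using q[of "vec d (\<lambda>i. ent x i 0)"] by simp
  qed
  then show "0 \<le> emb A" by (simp add: psd_iff h flip: emb_adj)
next
  assume "0 \<le> emb A"
  then have "emb (mat_adjoint A) = emb A" and q: "\<And>x. 0 \<le> qf (emb A) x"
    by (auto simp: psd_iff emb_adj)
  then have "mat_adjoint A = A"
    using emb_inj[OF mat_adjoint_carrier[OF assms] assms] by simp
  moreover have "0 \<le> Re ((A *\<^sub>v x) \<bullet>c x)" if "x \<in> carrier_vec (dim_row A)" for x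
    using qf_colf[OF assms, of x] q[of "colf x"] that assms by simp
  moreover have "square_mat A" using assms by simp
  ultimately show "psd A" unfolding psd_def by blast
qed

text \<open>Definiteness with an explicit lower bound, the shape that survives
  limits.\<close>
definition pd :: "nat \<Rightarrow> fmat \<Rightarrow> bool" where
  "pd d A \<longleftrightarrow> cor d d A \<and> (\<exists>\<delta>>0. \<delta> *\<^sub>R dg d \<le> A)"

lemma pd_psd: "pd d A \<Longrightarrow> 0 \<le> A"
  unfolding pd_def by (meson order_trans psd_dg scaleR_nonneg_nonneg less_imp_le)

lemma pd_mono: "pd d A \<Longrightarrow> A \<le> B \<Longrightarrow> cor d d B \<Longrightarrow> pd d B"
  unfolding pd_def by (meson order_trans)

lemma pd_scaleR: "pd d A \<Longrightarrow> 0 < r \<Longrightarrow> pd d (r *\<^sub>R A)"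
  unfolding pd_def
proof safe
  fix \<delta> :: real assume r: "0 < r" and "0 < \<delta>" "\<delta> *\<^sub>R dg d \<le> A"
  then have "(r * \<delta>) *\<^sub>R dg d \<le> r *\<^sub>R A" "0 < r * \<delta>"
    using scaleR_left_mono[of "\<delta> *\<^sub>R dg d" A r] by simp_all
  then show "\<exists>\<delta>>0. \<delta> *\<^sub>R dg d \<le> r *\<^sub>R A" by blast
qed (auto intro: cor_scaleR)

lemma qf_pos_of_ge:
  assumes "0 < \<delta>" "\<delta> *\<^sub>R dg d \<le> A" "x \<in> carrier_vec d" "x \<noteq> 0\<^sub>v d"
  shows "0 < qf A (colf x)"
proof -
  have "\<delta> * qf (dg d) (colf x) \<le> qf A (colf x)"
    using assms(2) unfolding less_eq_fmat_def by (auto dest!: spec[of _ "colf x"])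
  moreover have "qf (dg d) (colf x) = Re (x \<bullet>c x)"
    using qf_colf[of "1\<^sub>m d" d x] assms(3) by (simp add: emb_one)
  moreover have "0 < Re (x \<bullet>c x)"
    using conjugate_square_greater_0_vec[OF assms(3)] assms(3,4)
    by (auto simp: less_complex_def)
  moreover have "0 < \<delta> * qf (dg d) (colf x)"
    using calculation(2,3) assms(1) by (simp add: mult_pos_pos)
  ultimately show ?thesis by linarith
qed

lemma pd_imp_pos_def:
  assumes "A \<in> carrier_mat d d" "pd d (emb A)"
  shows "pos_def A"
proof -
  have "psd A" using pd_psd[OF assms(2)] psd_emb[OF assms(1)] by simp
  moreover obtain \<delta> where \<delta>: "0 < \<delta>" "\<delta> *\<^sub>R dg d \<le> emb A" using assms(2) by (auto simp: pd_def)
  ultimately show ?thesis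
    using qf_pos_of_ge[OF \<delta>] qf_colf[OF assms(1)] assms(1) by (auto simp: pos_def_def psd_def)
qed

lemma mat_inv_props:
  assumes A: "A \<in> carrier_mat d d" and inj: "\<And>x. x \<in> carrier_vec d \<Longrightarrow> A *\<^sub>v x = 0\<^sub>v d \<Longrightarrow> x = 0\<^sub>v d"
  shows "mat_inv A \<in> carrier_mat d d" "mat_inv A * A = 1\<^sub>m d" "A * mat_inv A = 1\<^sub>m d"
proof -
  have "det A \<noteq> 0" using det_0_iff_vec_prod_zero_field[OF A] inj by auto
  then have "A \<in> Units (ring_mat TYPE(complex) d ())" by (rule det_non_zero_imp_unit[OF A])
  then obtain B where B: "mat_inverse A = Some B"
    using mat_inverse(1)[OF A, of "()"] by (cases "mat_inverse A") auto
  then show "mat_inv A \<in> carrier_mat d d" "mat_inv A * A = 1\<^sub>m d" "A * mat_inv A = 1\<^sub>m d"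
    using mat_inverse(2)[OF A B] by (auto simp: mat_inv_def)
qed

lemma emb_mat_inv:
  assumes A: "A \<in> carrier_mat d d" and B: "cor d d B" "B * emb A = dg d \<or> emb A * B = dg d"
  shows "mat_inv A \<in> carrier_mat d d \<and> emb (mat_inv A) = B"
proof -
  let ?B = "unemb d d B"
  have B': "?B \<in> carrier_mat d d" "emb ?B = B"
    using B(1) by (auto simp: unemb_carrier emb_unemb)
  have BA: "?B * A = 1\<^sub>m d"
    using B(2)
  proof
    assume "B * emb A = dg d"
    then have "emb (?B * A) = emb (1\<^sub>m d)"
      using B' A by (simp add: emb_mult[of _ d d _ d] emb_one)
    then show ?thesis by (rule emb_inj[rotated 2]) (use A B' in auto)
  next
    assume "emb A * B = dg d"
    then have "emb (A * ?B) = emb (1\<^sub>m d)"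
      using B' A by (simp add: emb_mult[of _ d d _ d] emb_one)
    then have "A * ?B = 1\<^sub>m d" by (rule emb_inj[rotated 2]) (use A B' in auto)
    then show ?thesis by (rule mat_mult_left_right_inverse[OF A B'(1)])
  qed
  have "x = 0\<^sub>v d" if "x \<in> carrier_vec d" "A *\<^sub>v x = 0\<^sub>v d" for x
  proof -
    have "x = (?B * A) *\<^sub>v x" using that BA by simp
    also have "\<dots> = ?B *\<^sub>v (A *\<^sub>v x)" using that A B' by (simp add: assoc_mult_mat_vec[of _ d d])
    finally show ?thesis using that B' by (auto intro!: eq_vecI)
  qed
  note inv = mat_inv_props[OF A this]
  have "?B = ?B * (A * mat_inv A)" using inv B' by simp
  also have "\<dots> = ?B * A * mat_inv A"
    by (rule assoc_mult_mat[symmetric, OF B'(1) A inv(1)])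
  also have "\<dots> = mat_inv A" using BA inv by simp
  finally show ?thesis using inv B' by simp
qed

(*%FILE A6*)
section \<open>Inverses, norm and trace\<close>

lemma scaleR_nonneg_cancel: "0 < C \<Longrightarrow> 0 \<le> C *\<^sub>R (A::fmat) \<Longrightarrow> 0 \<le> A"
  using scaleR_nonneg_nonneg[of "1 / C" "C *\<^sub>R A"] by simp

lemma scaleR_le_cancel: "0 < C \<Longrightarrow> C *\<^sub>R (A::fmat) \<le> C *\<^sub>R B \<Longrightarrow> A \<le> B"
  using scaleR_nonneg_cancel[of C "B - A"] by (simp add: scaleR_diff_right)

lemma adj_inverse:
  assumes A: "adj A = A" "A * B = dg d" and B: "cor d d B"
  shows "adj B = B"
proof -
  have "adj B * A = dg d" using arg_cong[OF A(2), of adj] A(1) by simp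
  then have "adj B * (A * B) = dg d * B" by (simp flip: mult.assoc)
  then show ?thesis using corD(1)[OF B] corD(2)[OF cor_intros(6)[OF B]] A(2) by simp
qed

text \<open>For \<open>B = C - A\<close> one has \<open>A B A + B A B = C (C A -
  A\<^sup>2)\<close>. This identity stands in for functional calculus in all the operator
  inequalities that follow.\<close>
lemma psd_sub_square:
  assumes A: "0 \<le> A" "A \<le> C *\<^sub>R dg d" "cor d d A" and C: "0 < C"
  shows "0 \<le> C *\<^sub>R A - A * A"
proof -
  let ?B = "C *\<^sub>R dg d - A"
  have h: "adj A = A" "adj ?B = ?B" using psd_adj[OF A(1)] by auto
  have "0 \<le> A * ?B * A + ?B * A * ?B"
    using psd_cong[of ?B A] psd_cong[of A ?B] A h by (simp add: add_nonneg_nonneg)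
  also have "A * ?B * A + ?B * A * ?B = C *\<^sub>R (C *\<^sub>R A - A * A)"
    using corD[OF A(3)] corD(1)[OF cor_mult[OF A(3) A(3)]]
    by (simp add: algebra_simps scaleR_diff_right)
  finally show ?thesis by (rule scaleR_nonneg_cancel[OF C])
qed

lemma le_of_square_le:
  assumes h: "adj A = A" and c: "cor d d A" and le: "A * A \<le> C *\<^sub>R A" and C: "0 < C"
  shows "A \<le> C *\<^sub>R dg d" "0 \<le> A"
proof -
  let ?B = "C *\<^sub>R dg d - A"
  have "0 \<le> ?B * ?B" using h by (intro psd_herm_square) simp
  also have "?B * ?B = C *\<^sub>R (C *\<^sub>R dg d) - C *\<^sub>R A - C *\<^sub>R A + A * A"
    using corD[OF c] by (simp add: algebra_simps)
  also have "\<dots> \<le> C *\<^sub>R (C *\<^sub>R dg d) - C *\<^sub>R A - C *\<^sub>R A + C *\<^sub>R A"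
    using le by simp
  also have "\<dots> = C *\<^sub>R ?B" by (simp add: algebra_simps)
  finally have "0 \<le> ?B" by (rule scaleR_nonneg_cancel[OF C])
  then show "A \<le> C *\<^sub>R dg d" by simp
  have "0 \<le> A * A" using h by (rule psd_herm_square)
  then have "0 \<le> C *\<^sub>R A" using le by (rule order_trans)
  then show "0 \<le> A" by (rule scaleR_nonneg_cancel[OF C])
qed

text \<open>The matrix \<open>A = V V\<^sup>*\<close> satisfies \<open>A\<^sup>2 \<le>
  A\<close>.\<close>
lemma isometry_adj:
  assumes c: "cor d d V" and "adj V * V \<le> dg d"
  shows "V * adj V \<le> dg d"
proof -
  let ?A = "V * adj V"
  have "V * (adj V * V) * adj V \<le> V * dg d * adj V" using assms(2) by (rule le_cong)
  then have "?A * ?A \<le> 1 *\<^sub>R ?A" using corD[OF c] by (simp add: mult.assoc)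
  then show ?thesis using le_of_square_le(1)[of ?A d 1] c by (simp add: cor_rules)
qed

text \<open>The sum of the moduli of the entries: it is submultiplicative, and on positive
  matrices it is comparable with the trace, which is linear.\<close>
definition nrm :: "nat \<Rightarrow> fmat \<Rightarrow> real" where
  "nrm d A = (\<Sum>i<d. \<Sum>j<d. cmod (ent A i j))"

lemma nrm_nonneg: "0 \<le> nrm d A"
  by (simp add: nrm_def sum_nonneg)

lemma nrm_entry: "i < d \<Longrightarrow> j < d \<Longrightarrow> cmod (ent A i j) \<le> nrm d A"
proof -
  assume "i < d" "j < d"
  then have "cmod (ent A i j) \<le> (\<Sum>j<d. cmod (ent A i j))"
    by (intro member_le_sum) auto
  also have "\<dots> \<le> nrm d A"
    unfolding nrm_def using \<open>i < d\<close>
    by (intro member_le_sum[of i "{..<d}" "\<lambda>i. \<Sum>j<d. cmod (ent A i j)"]) (auto intro: sum_nonneg)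
  finally show ?thesis .
qed

lemma nrm_add: "nrm d (A + B) \<le> nrm d A + nrm d B"
  unfolding nrm_def sum.distrib[symmetric] by (intro sum_mono) (simp add: norm_triangle_ineq)

lemma nrm_diff: "nrm d (A - B) \<le> nrm d A + nrm d B"
  unfolding nrm_def sum.distrib[symmetric] by (intro sum_mono) (simp add: norm_triangle_ineq4)

lemma nrm_cscale: "nrm d (c *c A) = cmod c * nrm d A"
  by (simp add: nrm_def norm_mult sum_distrib_left)

lemma nrm_scaleR: "nrm d (r *\<^sub>R A) = \<bar>r\<bar> * nrm d A"
  by (simp add: scaleR_cscale nrm_cscale)

lemma nrm_adj: "nrm d (adj A) = nrm d A"
  unfolding nrm_def by (simp add: sum.swap[of "\<lambda>i j. cmod (ent A j i)" "{..<d}" "{..<d}"])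

lemma nrm_zero [simp]: "nrm d 0 = 0"
  by (simp add: nrm_def)

lemma nrm_mult:
  assumes "cor d d A \<or> cor d d B"
  shows "nrm d (A * B) \<le> nrm d A * nrm d B"
proof -
  have "nrm d (A * B) \<le> (\<Sum>i<d. \<Sum>j<d. \<Sum>k<d. cmod (ent A i k) * cmod (ent B k j))"
    unfolding nrm_def
  proof (intro sum_mono)
    fix i j
    have "ent (A * B) i j = (\<Sum>k<d. ent A i k * ent B k j)"
      using assms by (rule ent_mult_cor)
    then show "cmod (ent (A * B) i j) \<le> (\<Sum>k<d. cmod (ent A i k) * cmod (ent B k j))"
      by (simp add: norm_mult[symmetric] norm_sum)
  qed
  also have "\<dots> = (\<Sum>i<d. \<Sum>k<d. cmod (ent A i k) * (\<Sum>j<d. cmod (ent B k j)))"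
  proof (rule sum.cong[OF refl])
    fix i
    show "(\<Sum>j<d. \<Sum>k<d. cmod (ent A i k) * cmod (ent B k j))
        = (\<Sum>k<d. cmod (ent A i k) * (\<Sum>j<d. cmod (ent B k j)))"
      unfolding sum_distrib_left by (rule sum.swap)
  qed
  also have "\<dots> \<le> (\<Sum>i<d. \<Sum>k<d. cmod (ent A i k) * nrm d B)"
  proof (intro sum_mono mult_left_mono)
    fix k assume "k \<in> {..<d}"
    then show "(\<Sum>j<d. cmod (ent B k j)) \<le> nrm d B"
      unfolding nrm_def
      by (intro member_le_sum[of k "{..<d}" "\<lambda>i. \<Sum>j<d. cmod (ent B i j)"]) (auto intro: sum_nonneg)
  qed simp
  also have "\<dots> = nrm d A * nrm d B"
    by (simp add: nrm_def sum_distrib_right)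
  finally show ?thesis .
qed

lemma nrm_eq_0: "cor d d A \<Longrightarrow> nrm d A = 0 \<Longrightarrow> A = 0"
proof (rule fmat_eqI)
  fix i j assume A: "cor d d A" "nrm d A = 0"
  show "ent A i j = ent 0 i j"
    using nrm_entry[of i d j A] A cor_ent[OF A(1), of i j] by (cases "i < d \<and> j < d") auto
qed

definition trc :: "nat \<Rightarrow> fmat \<Rightarrow> real" where
  "trc d A = (\<Sum>i<d. Re (ent A i i))"

lemma trc_simps: "trc d (A + B) = trc d A + trc d B" "trc d (A - B) = trc d A - trc d B"
  "trc d (r *\<^sub>R A) = r * trc d A"
  by (simp_all add: trc_def sum.distrib sum_subtractf sum_distrib_left)

lemma trc_mono: "A \<le> B \<Longrightarrow> trc d A \<le> trc d B"
  unfolding trc_def using psd_entry_bound(2)[of "B - A"] by (intro sum_mono) simp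

lemma trc_nonneg: "0 \<le> A \<Longrightarrow> 0 \<le> trc d A"
  using trc_mono[of 0 A d] by (simp add: trc_def)

lemma trc_le_nrm: "trc d A \<le> nrm d A"
  unfolding trc_def nrm_def
proof (rule sum_mono)
  fix i assume "i \<in> {..<d}"
  then have "cmod (ent A i i) \<le> (\<Sum>j<d. cmod (ent A i j))"
    by (intro member_le_sum) auto
  then show "Re (ent A i i) \<le> (\<Sum>j<d. cmod (ent A i j))"
    using complex_Re_le_cmod order_trans by blast
qed

lemma trc_comm:
  assumes "cor d d A" "cor d d B"
  shows "trc d (A * B) = trc d (B * A)"
proof -
  have "trc d (A * B) = (\<Sum>i<d. \<Sum>k<d. Re (ent A i k * ent B k i))"
    unfolding trc_def using assms by (simp add: ent_mult_cor[of d d A d B])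
  also have "\<dots> = (\<Sum>k<d. \<Sum>i<d. Re (ent A i k * ent B k i))" by (rule sum.swap)
  also have "\<dots> = trc d (B * A)"
    unfolding trc_def using assms by (simp add: ent_mult_cor[of d d B d A] mult.commute)
  finally show ?thesis .
qed

lemma nrm_le_trc:
  assumes "0 \<le> A" shows "nrm d A \<le> real d * trc d A"
proof -
  have "nrm d A \<le> (\<Sum>i<d. \<Sum>j<d. (Re (ent A i i) + Re (ent A j j)) / 2)"
    unfolding nrm_def by (intro sum_mono psd_entry_bound(1)[OF assms])
  also have "\<dots> = real d * trc d A"
    by (simp add: trc_def sum.distrib add_divide_distrib sum_divide_distrib[symmetric] sum_distrib_left[symmetric])
  finally show ?thesis .
qed

lemma herm_le_nrm:
  assumes "adj A = A" "cor d d A"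
  shows "A \<le> nrm d A *\<^sub>R dg d"
proof -
  have "qf A x \<le> nrm d A * qf (dg d) x" for x
  proof -
    let ?x = "\<lambda>i. cmod (ent x i 0)"
    have n: "qf (dg d) x = (\<Sum>k<d. (?x k)\<^sup>2)"
    proof -
      have "ent (adj x * (dg d * x)) 0 0 = (\<Sum>k<d. ent (adj x) 0 k * ent (dg d * x) k 0)"
        by (rule ent_mult_alt) (auto simp: ent_dg_mult split: if_splits)
      also have "\<dots> = (\<Sum>k<d. complex_of_real ((?x k)\<^sup>2))"
        by (intro sum.cong refl) (simp add: ent_dg_mult complex_norm_square mult.commute del: of_real_power)
      finally show ?thesis by (simp add: qf_def mult.assoc)
    qed
    have "ent (adj x * (A * x)) 0 0 = (\<Sum>k<d. ent (adj x) 0 k * ent (A * x) k 0)"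
    proof (rule ent_mult_alt)
      fix k assume "ent (A * x) k 0 \<noteq> 0"
      then have "ent (dg d * (A * x)) k 0 \<noteq> 0" by (simp add: corD(3)[OF assms(2)])
      then show "k \<in> {..<d}" by (simp add: ent_dg_mult split: if_splits)
    qed simp
    also have "\<dots> = (\<Sum>k<d. \<Sum>l<d. cnj (ent x k 0) * (ent A k l * ent x l 0))"
      using ent_mult_cor[of d d A 0 x] assms(2) by (simp add: sum_distrib_left)
    finally have e: "qf A x = (\<Sum>k<d. \<Sum>l<d. Re (cnj (ent x k 0) * (ent A k l * ent x l 0)))"
      by (simp add: qf_def mult.assoc)
    have "Re (cnj (ent x k 0) * (ent A k l * ent x l 0)) \<le> cmod (ent A k l) * qf (dg d) x"
      if "k < d" "l < d" for k l
    proof -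
      have "Re (cnj (ent x k 0) * (ent A k l * ent x l 0)) \<le> cmod (ent A k l) * (?x k * ?x l)"
        using complex_Re_le_cmod[of "cnj (ent x k 0) * (ent A k l * ent x l 0)"]
        by (simp add: norm_mult mult.left_commute)
      also have "?x k * ?x l \<le> qf (dg d) x"
      proof -
        have "(?x k)\<^sup>2 \<le> qf (dg d) x" "(?x l)\<^sup>2 \<le> qf (dg d) x"
          unfolding n using that by (auto intro!: member_le_sum[where f = "\<lambda>k. (cmod (ent x k 0))\<^sup>2"])
        moreover have "?x k * ?x l \<le> ((?x k)\<^sup>2 + (?x l)\<^sup>2) / 2"
          using sum_squares_bound[of "?x k" "?x l"] by simp
        ultimately show ?thesis by simp
      qed
      finally show ?thesis by (simp add: mult_left_mono)
    qed
    then have "qf A x \<le> (\<Sum>k<d. \<Sum>l<d. cmod (ent A k l) * qf (dg d) x)"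
      unfolding e by (intro sum_mono) auto
    then show ?thesis by (simp add: nrm_def sum_distrib_right)
  qed
  then show ?thesis
    using assms(1) by (simp add: less_eq_fmat_def)
qed

text \<open>Conjugating \<open>C A - A\<^sup>2 \<ge> 0\<close> with the inverse
  \<open>B\<close> gives \<open>C B \<ge> 1\<close>.\<close>
lemma psd_inverse_pd:
  assumes A: "0 \<le> A" "cor d d A" and B: "cor d d B" "A * B = dg d" "B * A = dg d"
  shows "pd d B"
proof -
  note hB = adj_inverse[OF psd_adj[OF A(1)] B(2,1)]
  \<comment> \<open>the summand 1 makes the scaling constant positive also for the zero matrix\<close>
  define C where "C = nrm d A + 1"
  have C: "0 < C" "A \<le> C *\<^sub>R dg d"
  proof -
    show "0 < C" using nrm_nonneg[of d A] by (simp add: C_def)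
    have "A \<le> nrm d A *\<^sub>R dg d" using herm_le_nrm psd_adj A by blast
    also have "\<dots> \<le> C *\<^sub>R dg d" by (rule scaleR_right_mono) (auto simp: C_def psd_dg)
    finally show "A \<le> C *\<^sub>R dg d" .
  qed
  have "0 \<le> B * (C *\<^sub>R A - A * A) * adj B"
    by (rule psd_cong[OF psd_sub_square[OF A(1) C(2) A(2) C(1)]])
  also have "B * (C *\<^sub>R A - A * A) * adj B = C *\<^sub>R B - dg d"
  proof -
    have "B * (A * B) = B" "B * (A * (A * B)) = dg d"
      using B corD[OF B(1)] corD[OF A(2)] by simp_all
    then show ?thesis by (simp add: hB algebra_simps)
  qed
  finally have "C *\<^sub>R ((1 / C) *\<^sub>R dg d) \<le> C *\<^sub>R B" using C by simp
  then have "(1 / C) *\<^sub>R dg d \<le> B" by (rule scaleR_le_cancel[OF C(1)])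
  then show ?thesis unfolding pd_def using B(1) C by (intro conjI exI[of _ "1 / C"]) auto
qed

lemma pd_inverse_le:
  assumes B: "0 < \<delta>" "\<delta> *\<^sub>R dg d \<le> A" "cor d d A" "cor d d B" "A * B = dg d" "B * A = dg d"
  shows "adj B = B" "B \<le> (1 / \<delta>) *\<^sub>R dg d" "0 \<le> B"
proof -
  have A: "adj A = A"
    using B(2) unfolding less_eq_fmat_def by (simp add: algebra_simps)
  show h: "adj B = B" by (rule adj_inverse[OF A B(5,4)])
  have "B * (\<delta> *\<^sub>R dg d) * adj B \<le> B * A * adj B" using B(2) by (rule le_cong)
  then have "\<delta> *\<^sub>R (B * B) \<le> B" using corD[OF B(4)] B h by simp
  then have "\<delta> *\<^sub>R (B * B) \<le> \<delta> *\<^sub>R ((1 / \<delta>) *\<^sub>R B)" using B(1) by simp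
  then have "B * B \<le> (1 / \<delta>) *\<^sub>R B" by (rule scaleR_le_cancel[OF B(1)])
  then show "B \<le> (1 / \<delta>) *\<^sub>R dg d" "0 \<le> B"
    using le_of_square_le[OF h B(4), of "1 / \<delta>"] B(1) by auto
qed

lemma pd_inverse:
  assumes "pd d A"
  obtains B where "cor d d B" "A * B = dg d" "B * A = dg d" "pd d B"
proof -
  let ?A = "unemb d d A"
  have cA: "cor d d A" using assms by (simp add: pd_def)
  have A: "?A \<in> carrier_mat d d" "emb ?A = A" using cA by (auto simp: unemb_carrier emb_unemb)
  have "x = 0\<^sub>v d" if "x \<in> carrier_vec d" "?A *\<^sub>v x = 0\<^sub>v d" for x
  proof (rule ccontr)
    assume "x \<noteq> 0\<^sub>v d"
    moreover obtain \<delta> where "0 < \<delta>" "\<delta> *\<^sub>R dg d \<le> A" using assms by (auto simp: pd_def)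
    ultimately have "0 < qf A (colf x)" using qf_pos_of_ge that by blast
    moreover have "qf A (colf x) = 0" using qf_colf[OF A(1), of x] A that by simp
    ultimately show False by simp
  qed
  note inv = mat_inv_props[OF A(1) this]
  let ?B = "emb (mat_inv ?A)"
  have B: "cor d d ?B" "A * ?B = dg d" "?B * A = dg d"
    using inv cor_emb[OF inv(1)] emb_mult[OF A(1) inv(1)] emb_mult[OF inv(1) A(1)] A
    by (simp_all add: emb_one)
  then show ?thesis using that psd_inverse_pd[OF pd_psd[OF assms] cA B] by blast
qed

text \<open>Passing to the inverse twice yields the uniform lower bound without compactness
  of the unit sphere.\<close>
lemma pos_def_imp_pd:
  assumes A: "A \<in> carrier_mat d d" "pos_def A"
  shows "pd d (emb A)"
proof -
  have "x = 0\<^sub>v d" if "x \<in> carrier_vec d" "A *\<^sub>v x = 0\<^sub>v d" for x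
    using A that by (force simp: pos_def_def)
  note inv = mat_inv_props[OF A(1) this]
  have "psd A" using A(2) unfolding psd_def pos_def_def
  proof (safe, goal_cases)
    case (1 x) then show ?case by (cases "x = 0\<^sub>v (dim_row A)") (use A(1) in force)+
  qed
  then have "0 \<le> emb A" using psd_emb A by blast
  let ?B = "emb (mat_inv A)"
  have B: "cor d d ?B" "emb A * ?B = dg d" "?B * emb A = dg d"
    using inv cor_emb[OF inv(1)] emb_mult[OF A(1) inv(1)] emb_mult[OF inv(1) A(1)] A
    by (simp_all add: emb_one)
  then have "pd d ?B" by (rule psd_inverse_pd[OF \<open>0 \<le> emb A\<close> cor_emb[OF A(1)]])
  then show ?thesis
    using psd_inverse_pd[OF pd_psd B(1) cor_emb[OF A(1)] B(3,2)] by blast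
qed

(*%FILE A7a*)
section \<open>Entrywise convergence\<close>

definition tends :: "(nat \<Rightarrow> fmat) \<Rightarrow> fmat \<Rightarrow> bool" where
  "tends X L \<longleftrightarrow> (\<forall>i j. (\<lambda>n. ent (X n) i j) \<longlonglongrightarrow> ent L i j)"

lemma tendsD: "tends X L \<Longrightarrow> (\<lambda>n. ent (X n) i j) \<longlonglongrightarrow> ent L i j"
  by (simp add: tends_def)

lemma tends_const: "tends (\<lambda>n. A) A"
  by (simp add: tends_def)

lemma tends_add: "tends X L \<Longrightarrow> tends Y M \<Longrightarrow> tends (\<lambda>n. X n + Y n) (L + M)"
  by (auto simp: tends_def intro!: tendsto_intros)

lemma tends_diff: "tends X L \<Longrightarrow> tends Y M \<Longrightarrow> tends (\<lambda>n. X n - Y n) (L - M)"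
  by (auto simp: tends_def intro!: tendsto_intros)

lemma tends_uminus: "tends X L \<Longrightarrow> tends (\<lambda>n. - X n) (- L)"
  by (auto simp: tends_def intro!: tendsto_intros)

lemma tends_adj: "tends X L \<Longrightarrow> tends (\<lambda>n. adj (X n)) (adj L)"
  by (auto simp: tends_def intro!: tendsto_intros)

lemma tends_cscale: "tends X L \<Longrightarrow> tends (\<lambda>n. c *c X n) (c *c L)"
  by (auto simp: tends_def intro!: tendsto_intros)

lemma tends_scaleR: "tends X L \<Longrightarrow> tends (\<lambda>n. r *\<^sub>R X n) (r *\<^sub>R L)"
  by (simp add: scaleR_cscale tends_cscale)

lemma tends_scaleR': "r \<longlonglongrightarrow> s \<Longrightarrow> tends (\<lambda>n. r n *\<^sub>R A) (s *\<^sub>R A)"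
  by (auto simp: tends_def intro!: tendsto_intros)

lemma tends_unique: "tends X L \<Longrightarrow> tends X M \<Longrightarrow> L = M"
proof (rule fmat_eqI)
  fix i j assume "tends X L" "tends X M"
  then show "ent L i j = ent M i j" by (metis LIMSEQ_unique tendsD)
qed

(*%FILE A7b*)
lemma tends_offset: "tends X L \<Longrightarrow> tends (\<lambda>n. X (n + N)) L"
proof -
  assume X: "tends X L"
  have "(\<lambda>n. ent (X (n + N)) i j) \<longlonglongrightarrow> ent L i j" for i j
    by (rule LIMSEQ_ignore_initial_segment[OF tendsD[OF X]])
  then show ?thesis by (simp only: tends_def) blast
qed

lemma tends_cor: "tends X L \<Longrightarrow> (\<And>n. cor d e (X n)) \<Longrightarrow> cor d e L"
proof (rule corI)
  fix i j assume X: "tends X L" "\<And>n. cor d e (X n)" and ij: "d \<le> i \<or> e \<le> j"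
  then have "(\<lambda>n. 0) \<longlonglongrightarrow> ent L i j"
    using tendsD[OF X(1), of i j] cor_ent[OF X(2) ij] by simp
  then show "ent L i j = 0" by (simp add: LIMSEQ_const_iff)
qed

(*%FILE A7c*)
lemma tends_mult:
  assumes "tends X L" "tends Y M" "\<And>n. cor d e (X n)"
  shows "tends (\<lambda>n. X n * Y n) (L * M)"
  unfolding tends_def
proof (intro allI)
  fix i j
  have "ent (X n * Y n) i j = (\<Sum>k<e. ent (X n) i k * ent (Y n) k j)" for n
    by (rule ent_mult_cor) (use assms(3) in blast)
  moreover have "ent (L * M) i j = (\<Sum>k<e. ent L i k * ent M k j)"
    by (rule ent_mult_cor) (use tends_cor[OF assms(1,3)] in blast)
  moreover have "(\<lambda>n. \<Sum>k<e. ent (X n) i k * ent (Y n) k j) \<longlonglongrightarrow> (\<Sum>k<e. ent L i k * ent M k j)"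
    using assms(1,2) by (intro tendsto_intros) (auto simp: tends_def)
  ultimately show "(\<lambda>n. ent (X n * Y n) i j) \<longlonglongrightarrow> ent (L * M) i j" by simp
qed

lemma tends_qf:
  assumes X: "tends X L" and c: "\<And>n. cor d d (X n)"
  shows "(\<lambda>n. qf (X n) x) \<longlonglongrightarrow> qf L x"
proof -
  have e: "ent (adj x * A * x) 0 0 = (\<Sum>k<d. \<Sum>l<d. cnj (ent x k 0) * (ent A k l * ent x l 0))"
    if A: "cor d d A" for A
  proof -
    have "ent (adj x * (A * x)) 0 0 = (\<Sum>k<d. ent (adj x) 0 k * ent (A * x) k 0)"
    proof (rule ent_mult_alt)
      fix k assume "ent (A * x) k 0 \<noteq> 0"
      then have "ent (dg d * (A * x)) k 0 \<noteq> 0" by (simp add: corD(3)[OF A])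
      then show "k \<in> {..<d}" by (simp add: ent_dg_mult split: if_splits)
    qed simp
    also have "\<dots> = (\<Sum>k<d. \<Sum>l<d. cnj (ent x k 0) * (ent A k l * ent x l 0))"
      using ent_mult_cor[of d d A 0 x] A by (simp add: sum_distrib_left)
    finally show ?thesis by (simp add: mult.assoc)
  qed
  have "(\<lambda>n. \<Sum>k<d. \<Sum>l<d. cnj (ent x k 0) * (ent (X n) k l * ent x l 0))
      \<longlonglongrightarrow> (\<Sum>k<d. \<Sum>l<d. cnj (ent x k 0) * (ent L k l * ent x l 0))"
    using X by (intro tendsto_intros) (auto simp: tends_def)
  then show ?thesis
    unfolding qf_def e[OF c] e[OF tends_cor[OF X c]] by (rule tendsto_Re)
qed

lemma tends_psd:
  assumes X: "tends X L" and c: "\<And>n. cor d d (X n)" and "\<And>n. n \<ge> N \<Longrightarrow> 0 \<le> X n"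
  shows "0 \<le> L"
  unfolding psd_iff
proof (intro conjI allI)
  have t: "tends (\<lambda>n. X (n + N)) L" by (rule tends_offset[OF X])
  have "adj (X (n + N)) = X (n + N)" for n using assms(3)[of "n + N"] psd_adj by simp
  then have "tends (\<lambda>n. X (n + N)) (adj L)" using tends_adj[OF t] by simp
  then show "adj L = L" using t by (rule tends_unique)
  fix x
  have "qf (X n) x \<ge> 0" if "n \<ge> N" for n using assms(3)[OF that] by (simp add: psd_iff)
  then show "0 \<le> qf L x"
    by (intro LIMSEQ_le_const[OF tends_qf[OF X c, of x]]) blast
qed

lemma tends_ge:
  assumes X: "tends X L" and c: "\<And>n. cor d d (X n)" "cor d d A" and "\<And>n. n \<ge> N \<Longrightarrow> A \<le> X n"
  shows "A \<le> L"
  using tends_psd[OF tends_diff[OF X tends_const[of A]], of d N] assms(4) c by (simp add: cor_intros)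

lemma tends_le:
  assumes X: "tends X L" and c: "\<And>n. cor d d (X n)" "cor d d A" and "\<And>n. n \<ge> N \<Longrightarrow> X n \<le> A"
  shows "L \<le> A"
  using tends_psd[OF tends_diff[OF tends_const[of A] X], of d N] assms(4) c by (simp add: cor_intros)

lemma nrm_null_comparison:
  assumes "\<And>n. nrm d (X n) \<le> g n" "g \<longlonglongrightarrow> c" "c = 0"
  shows "(\<lambda>n. nrm d (X n)) \<longlonglongrightarrow> 0"
proof (rule Lim_null_comparison)
  show "\<forall>\<^sub>F n in sequentially. norm (nrm d (X n)) \<le> g n"
    using assms(1) by (intro always_eventually allI) (simp add: nrm_nonneg)
  show "g \<longlonglongrightarrow> 0" using assms(2,3) by simp
qed

(*%FILE A7e*)
lemma tends_iff_nrm: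
  assumes c: "\<And>n. cor d d (X n)" "cor d d L"
  shows "tends X L \<longleftrightarrow> (\<lambda>n. nrm d (X n - L)) \<longlonglongrightarrow> 0"
proof
  assume "tends X L"
  then have "(\<lambda>n. ent (X n) i j - ent L i j) \<longlonglongrightarrow> 0" for i j
    by (intro LIM_zero) (simp add: tends_def)
  then have "(\<lambda>n. \<Sum>i<d. \<Sum>j<d. cmod (ent (X n - L) i j)) \<longlonglongrightarrow> (\<Sum>i<d. \<Sum>j<d. 0)"
    by (intro tendsto_sum) (simp add: tendsto_norm_zero)
  then show "(\<lambda>n. nrm d (X n - L)) \<longlonglongrightarrow> 0" by (simp add: nrm_def)
next
  assume r: "(\<lambda>n. nrm d (X n - L)) \<longlonglongrightarrow> 0"
  show "tends X L"
    unfolding tends_def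
  proof (intro allI)
    fix i j
    show "(\<lambda>n. ent (X n) i j) \<longlonglongrightarrow> ent L i j"
    proof (cases "i < d \<and> j < d")
      case True
      have "(\<lambda>n. ent (X n - L) i j) \<longlonglongrightarrow> 0"
      proof (rule Lim_null_comparison[OF _ r])
        show "\<forall>\<^sub>F n in sequentially. cmod (ent (X n - L) i j) \<le> nrm d (X n - L)"
          using nrm_entry True by (intro always_eventually) blast
      qed
      then show ?thesis by (simp add: LIM_zero_iff)
    next
      case False
      then have "i \<ge> d \<or> j \<ge> d" by auto
      then show ?thesis using cor_ent[OF c(1)] cor_ent[OF c(2)] by simp
    qed
  qed
qed

(*%FILE A7f*)
text \<open>An increment is a positive matrix, hence bounded by its trace, and the traces
  are monotone and bounded. So every entry is a Cauchy sequence.\<close>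
lemma incseq_tends:
  assumes mono: "\<And>n. X n \<le> X (Suc n)" and c: "\<And>n. cor d d (X n)" and bd: "\<And>n. nrm d (X n) \<le> C"
  obtains L where "tends X L" "cor d d L" "\<And>n. X n \<le> L"
proof -
  have le: "X n \<le> X k" if "n \<le> k" for n k using lift_Suc_mono_le[of X, OF mono that] .
  define t where "t n = trc d (X n)" for n
  have "incseq t" unfolding t_def by (intro incseq_SucI trc_mono mono)
  moreover have "t n \<le> C" for n
    unfolding t_def by (rule order_trans[OF trc_le_nrm bd])
  ultimately obtain T where "t \<longlonglongrightarrow> T"
    using incseq_convergent[of t C] by metis
  then have Ct: "Cauchy t" by (simp add: LIMSEQ_imp_Cauchy)
  have ent_le: "cmod (ent (X k) i j - ent (X n) i j) \<le> real d * (t k - t n)" if "n \<le> k" "i < d" "j < d" for n k i j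
  proof -
    have "cmod (ent (X k - X n) i j) \<le> nrm d (X k - X n)" by (rule nrm_entry[OF that(2,3)])
    also have "\<dots> \<le> real d * trc d (X k - X n)" using le[OF that(1)] by (intro nrm_le_trc) simp
    finally show ?thesis by (simp add: t_def trc_simps)
  qed
  have "convergent (\<lambda>n. ent (X n) i j)" if ij: "i < d" "j < d" for i j
  proof -
    have "Cauchy (\<lambda>n. ent (X n) i j)"
    proof (rule CauchyI)
      fix e :: real assume e: "e > 0"
      then have e': "e / (real d + 1) > 0" by simp
      obtain M where M: "\<forall>k\<ge>M. \<forall>n\<ge>M. norm (t k - t n) < e / (real d + 1)"
        using CauchyD[OF Ct e'] by blast
      have small: "cmod (ent (X k) i j - ent (X n) i j) < e" if kn: "k \<ge> M" "n \<ge> M" "n \<le> k" for k n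
      proof -
        have "cmod (ent (X k) i j - ent (X n) i j) \<le> real d * (t k - t n)"
          by (rule ent_le[OF kn(3) ij])
        also have "\<dots> \<le> real d * norm (t k - t n)" by (intro mult_left_mono) auto
        also have "\<dots> \<le> (real d + 1) * norm (t k - t n)" by (intro mult_right_mono) auto
        also have "\<dots> < (real d + 1) * (e / (real d + 1))"
          using M kn by (intro mult_strict_left_mono) auto
        finally show ?thesis by simp
      qed
      have "norm (ent (X k) i j - ent (X n) i j) < e" if kn: "k \<ge> M" "n \<ge> M" for k n
        using small[of k n] small[of n k] kn by (cases "n \<le> k") (auto simp: norm_minus_commute)
      then show "\<exists>M. \<forall>m\<ge>M. \<forall>n\<ge>M. norm (ent (X m) i j - ent (X n) i j) < e" by blast
    qed
    then show ?thesis by (simp add: Cauchy_convergent_iff)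
  qed
  then have lim: "(\<lambda>n. ent (X n) i j) \<longlonglongrightarrow> lim (\<lambda>n. ent (X n) i j)" if "i < d" "j < d" for i j
    using that by (simp add: convergent_LIMSEQ_iff[symmetric])
  define L where "L = emb (mat d d (\<lambda>(i, j). lim (\<lambda>n. ent (X n) i j)))"
  have cL: "cor d d L" unfolding L_def by (rule cor_emb) simp
  have tL: "tends X L" unfolding tends_def
  proof (intro allI)
    fix i j
    show "(\<lambda>n. ent (X n) i j) \<longlonglongrightarrow> ent L i j"
    proof (cases "i < d \<and> j < d")
      case True then show ?thesis using lim[of i j] by (simp add: L_def ent_emb)
    next
      case False
      then have "i \<ge> d \<or> j \<ge> d" by auto
      then show ?thesis using cor_ent[OF c] cor_ent[OF cL] by simp
    qed
  qed
  moreover have "X n \<le> L" for n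
    by (rule tends_ge[OF tL c c, of n]) (rule le)
  ultimately show ?thesis using that cL by blast
qed

(*%FILE A7g*)
lemma decseq_tends:
  assumes mono: "\<And>n. X (Suc n) \<le> X n" and c: "\<And>n. cor d d (X n)" and bd: "\<And>n. nrm d (X n) \<le> C"
  obtains L where "tends X L" "cor d d L" "\<And>n. L \<le> X n"
proof -
  obtain L where L: "tends (\<lambda>n. - X n) L" "cor d d L" "\<And>n. - X n \<le> L"
    by (rule incseq_tends[of "\<lambda>n. - X n" d C])
      (use mono c bd in \<open>auto simp: cor_intros nrm_def\<close>)
  have "tends X (- L)" using tends_uminus[OF L(1)] by simp
  moreover have "- L \<le> X n" for n using L(3)[of n] by (simp add: minus_le_iff)
  ultimately show ?thesis using that L(2) cor_intros by blast
qed

(*%FILE A7h*)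
text \<open>Since \<open>Y\<^sub>n X\<^sub>n = 1 = L M\<close>, one has \<open>Y\<^sub>n - M
  = Y\<^sub>n (L - X\<^sub>n) M\<close>.\<close>
lemma tends_inverse:
  assumes X: "tends X L" and c: "\<And>n. cor d d (X n)" "\<And>n. cor d d (Y n)" "cor d d M"
    and inv: "\<And>n. Y n * X n = dg d" "L * M = dg d" and bd: "\<And>n. nrm d (Y n) \<le> C"
  shows "tends Y M"
proof -
  have cL: "cor d d L" using tends_cor[OF X c(1)] .
  have e: "Y n - M = Y n * (L - X n) * M" for n
  proof -
    have "Y n * (L - X n) * M = Y n * (L * M) - (Y n * X n) * M" by (simp add: algebra_simps)
    then show ?thesis by (simp add: inv corD(1)[OF c(3)] corD(2)[OF c(2)])
  qed
  have "nrm d (Y n - M) \<le> C * (nrm d (X n - L) * nrm d M)" for n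
  proof -
    have "nrm d (Y n - M) \<le> nrm d (Y n * (L - X n)) * nrm d M"
      unfolding e using c(3) by (intro nrm_mult) blast
    also have "\<dots> \<le> (nrm d (Y n) * nrm d (L - X n)) * nrm d M"
      using c(2) by (intro mult_right_mono nrm_mult nrm_nonneg) blast
    also have "\<dots> \<le> (C * nrm d (L - X n)) * nrm d M"
      using bd by (intro mult_right_mono nrm_nonneg)
    also have "nrm d (L - X n) = nrm d (X n - L)"
      by (simp add: nrm_def norm_minus_commute)
    finally show ?thesis by (simp add: mult.assoc)
  qed
  moreover have "(\<lambda>n. C * (nrm d (X n - L) * nrm d M)) \<longlonglongrightarrow> C * (0 * nrm d M)"
    using tends_iff_nrm[of d X L, OF c(1) cL] X by (intro tendsto_mult tendsto_const) blast
  ultimately have "(\<lambda>n. nrm d (Y n - M)) \<longlonglongrightarrow> 0"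
    by (rule nrm_null_comparison) simp
  then show ?thesis using tends_iff_nrm[of d Y M, OF c(2,3)] by blast
qed

(*%FILE A8_0*)

(*%FILE A8_1*)
section \<open>Square roots\<close>

text \<open>Polynomials in \<open>N\<close> with nonnegative coefficients. They commute, and
  they are positive for positive \<open>N\<close>; the iteration for the square root stays
  in this set.\<close>
inductive_set cone :: "fmat \<Rightarrow> fmat set" for N where
  pow: "N ^ k \<in> cone N"
| zero: "0 \<in> cone N"
| add: "X \<in> cone N \<Longrightarrow> Y \<in> cone N \<Longrightarrow> X + Y \<in> cone N"
| scale: "X \<in> cone N \<Longrightarrow> 0 \<le> r \<Longrightarrow> r *\<^sub>R X \<in> cone N"

lemma cone_pow_mult: "X \<in> cone N \<Longrightarrow> X * N ^ k \<in> cone N \<and> X * N ^ k = N ^ k * X"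
proof (induction rule: cone.induct)
  case (pow j)
  have "N ^ j * N ^ k = N ^ (j + k)" "N ^ k * N ^ j = N ^ (j + k)"
    by (simp_all add: power_add[symmetric] add.commute)
  then show ?case using cone.pow by metis
qed (auto intro: cone.intros simp: distrib_left distrib_right)

(*%FILE A8_2*)
lemma cone_mult: "Y \<in> cone N \<Longrightarrow> X \<in> cone N \<Longrightarrow> X * Y \<in> cone N \<and> X * Y = Y * X"
proof (induction rule: cone.induct)
  case (pow k) then show ?case by (rule cone_pow_mult)
qed (auto intro: cone.intros simp: distrib_left distrib_right)

lemma psd_pow:
  fixes N :: fmat
  assumes "0 \<le> N" shows "0 \<le> N ^ k"
proof -
  have h: "adj (N ^ j) = N ^ j" for j
    by (induction j) (simp_all add: psd_adj[OF assms] power_commutes)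
  show ?thesis
  proof (cases "even k")
    case True
    then obtain j where "k = j + j" by (metis evenE mult_2)
    then show ?thesis using psd_herm_square[OF h[of j]] by (simp add: power_add)
  next
    case False
    then obtain j where "k = Suc (j + j)" by (metis oddE mult_2 Suc_eq_plus1)
    then show ?thesis using psd_cong[OF assms, of "N ^ j"] h[of j]
      by (simp add: power_add power_commutes mult.assoc)
  qed
qed

lemma cone_psd: "X \<in> cone N \<Longrightarrow> 0 \<le> N \<Longrightarrow> 0 \<le> X"
proof (induction rule: cone.induct)
  case (pow k) then show ?case by (intro psd_pow)
next
  case zero show ?case by simp
next
  case (add X Y) then show ?case by (intro add_nonneg_nonneg) blast+
next
  case (scale X r) then show ?case by (intro scaleR_nonneg_nonneg) blast+
qed

(*%FILE A8_3*)
text \<open>After scaling, \<open>A = C (1 - N)\<close> with \<open>0 \<le> N \<le>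
  1\<close>. The iteration \<open>Y\<^sub>k\<^sub>+\<^sub>1 = (N + Y\<^sub>k\<^sup>2) /
  2\<close> for \<open>1 - (1 - N)\<^sup>1\<^sup>/\<^sup>2\<close> increases, because its
  increments lie in the cone of \<open>N\<close>, and it is bounded by 1.\<close>
lemma psd_sqrt_exists:
  assumes A: "0 \<le> A" "cor d d A"
  obtains B where "0 \<le> B" "cor d d B" "B * B = A"
proof -
  define C where "C = nrm d A + 1"
  have C: "0 < C" using nrm_nonneg[of d A] by (simp add: C_def)
  have AC: "A \<le> C *\<^sub>R dg d"
  proof -
    have "A \<le> nrm d A *\<^sub>R dg d" using herm_le_nrm psd_adj A by blast
    also have "\<dots> \<le> C *\<^sub>R dg d" by (rule scaleR_right_mono) (auto simp: C_def psd_dg)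
    finally show ?thesis .
  qed
  define N where "N = dg d - (1 / C) *\<^sub>R A"
  have cN: "cor d d N" unfolding N_def using A by (intro cor_rules) auto
  have "C *\<^sub>R ((1 / C) *\<^sub>R A) \<le> C *\<^sub>R dg d" using AC C by simp
  then have "0 \<le> N" unfolding N_def using scaleR_le_cancel[OF C] by simp
  have "N \<le> dg d" unfolding N_def using A C by (simp add: scaleR_nonneg_nonneg)
  define Y where "Y = rec_nat (0::fmat) (\<lambda>_ y. (1/2) *\<^sub>R (N + y * y))"
  have Y0: "Y 0 = 0" and YS: "Y (Suc k) = (1/2) *\<^sub>R (N + Y k * Y k)" for k
    by (simp_all add: Y_def)
  have cY: "cor d d (Y k)" for k
  proof (induction k)
    case 0 show ?case unfolding Y0 by (rule cor_intros)
  next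
    case (Suc k)
    show ?case unfolding YS by (intro cor_scaleR cor_intros(2) cN cor_mult[OF Suc Suc])
  qed
  have N1: "N \<in> cone N" using cone.pow[of N 1] by simp
  have Yc: "Y k \<in> cone N" for k
  proof (induction k)
    case 0 show ?case unfolding Y0 by (rule cone.zero)
  next
    case (Suc k)
    have "Y k * Y k \<in> cone N" using cone_mult[OF Suc Suc] by blast
    then show ?case unfolding YS by (intro cone.scale cone.add N1) simp_all
  qed
  have Dc: "Y (Suc k) - Y k \<in> cone N" for k
  proof (induction k)
    case 0
    have "Y (Suc 0) - Y 0 = (1/2) *\<^sub>R N" by (simp only: YS Y0) simp
    then show ?case using cone.scale[OF N1, of "1/2"] by simp
  next
    case (Suc k)
    have "Y (Suc k) * Y k = Y k * Y (Suc k)" using cone_mult[OF Yc Yc] by blast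
    then have "(Y (Suc k) - Y k) * (Y (Suc k) + Y k) = Y (Suc k) * Y (Suc k) - Y k * Y k"
      by (simp add: algebra_simps)
    moreover have "Y (Suc (Suc k)) - Y (Suc k)
        = (1/2) *\<^sub>R (N + Y (Suc k) * Y (Suc k)) - (1/2) *\<^sub>R (N + Y k * Y k)"
      by (rule arg_cong2[where f = minus, OF YS YS])
    then have "Y (Suc (Suc k)) - Y (Suc k) = (1/2) *\<^sub>R (Y (Suc k) * Y (Suc k) - Y k * Y k)"
      by (simp only: scaleR_diff_right[symmetric] add_diff_cancel_left)
    ultimately have "Y (Suc (Suc k)) - Y (Suc k) = (1/2) *\<^sub>R ((Y (Suc k) - Y k) * (Y (Suc k) + Y k))"
      by simp
    moreover have "\<dots> \<in> cone N"
      using cone_mult[OF cone.add[OF Yc[of "Suc k"] Yc[of k]] Suc] by (intro cone.scale) auto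
    ultimately show ?case by simp
  qed
  have Ypos: "0 \<le> Y k" for k by (rule cone_psd[OF Yc \<open>0 \<le> N\<close>])
  have Yle: "Y k \<le> dg d" for k
  proof (induction k)
    case 0 then show ?case by (simp add: Y0 psd_dg)
  next
    case (Suc k)
    have "Y k * Y k \<le> Y k" using psd_sub_square[of "Y k" 1 d] Ypos Suc cY by simp
    then have "N + Y k * Y k \<le> dg d + dg d" using Suc \<open>N \<le> dg d\<close> by (intro add_mono) auto
    then have "(1/2) *\<^sub>R (N + Y k * Y k) \<le> (1/2) *\<^sub>R (dg d + dg d)" by (intro scaleR_left_mono) auto
    also have "(1/2) *\<^sub>R (dg d + dg d) = dg d" by (simp only: scaleR_half_double)
    finally show ?case by (simp only: YS)
  qed
  have bd: "nrm d (Y k) \<le> real d * trc d (dg d)" for k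
    by (rule order_trans[OF nrm_le_trc[OF Ypos] mult_left_mono[OF trc_mono[OF Yle]]]) simp
  have inc: "Y k \<le> Y (Suc k)" for k using cone_psd[OF Dc[of k] \<open>0 \<le> N\<close>] by simp
  obtain L where L: "tends Y L" "cor d d L" "\<And>k. Y k \<le> L"
    using incseq_tends[of Y d, OF inc cY bd] by blast
  have "tends (\<lambda>k. Y (Suc k)) L" using tends_offset[OF L(1), of 1] by simp
  moreover have "tends (\<lambda>k. Y (Suc k)) ((1/2) *\<^sub>R (N + L * L))"
    unfolding YS by (intro tends_scaleR tends_add tends_const tends_mult[OF L(1) L(1) cY])
  ultimately have "L = (1/2) *\<^sub>R (N + L * L)" by (rule tends_unique)
  then have "2 *\<^sub>R L = 2 *\<^sub>R ((1/2) *\<^sub>R (N + L * L))" by simp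
  then have eq: "L + L = N + L * L" by (simp add: scaleR_2)
  have "L \<le> dg d" by (rule tends_le[OF L(1) cY cor_intros(7), of 0]) (rule Yle)
  define B where "B = sqrt C *\<^sub>R (dg d - L)"
  have "B * B = (sqrt C * sqrt C) *\<^sub>R ((dg d - L) * (dg d - L))" by (simp add: B_def)
  also have "(dg d - L) * (dg d - L) = dg d - (L + L) + L * L"
    using corD[OF L(2)] by (simp add: algebra_simps)
  also have "\<dots> = (1 / C) *\<^sub>R A" unfolding eq by (simp add: N_def)
  finally have "B * B = A" using C by simp
  moreover have "0 \<le> B" unfolding B_def using \<open>L \<le> dg d\<close> C by (intro scaleR_nonneg_nonneg) auto
  moreover have "cor d d B" unfolding B_def by (intro cor_rules L)
  ultimately show ?thesis using that by blast
qed

text \<open>The Cauchy-Schwarz inequality between the entry sum and the Hilbert-Schmidt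
  norm.\<close>
lemma trc_square:
  assumes "cor d d D"
  shows "(nrm d D)\<^sup>2 \<le> (real d)\<^sup>2 * trc d (D * adj D)"
proof -
  let ?S = "{..<d} \<times> {..<d}"
  have "trc d (D * adj D) = (\<Sum>i<d. \<Sum>k<d. (cmod (ent D i k))\<^sup>2)"
  proof -
    have "Re (ent D i k * cnj (ent D i k)) = (cmod (ent D i k))\<^sup>2" for i k
      by (simp add: cmod_power2) (simp add: power2_eq_square)
    then show ?thesis
      unfolding trc_def using assms ent_mult_cor[of d d D d "adj D"] by simp
  qed
  also have "\<dots> = (\<Sum>p\<in>?S. (cmod (ent D (fst p) (snd p)))\<^sup>2)"
    by (simp add: sum.cartesian_product case_prod_beta)
  finally have 1: "trc d (D * adj D) = (\<Sum>p\<in>?S. (cmod (ent D (fst p) (snd p)))\<^sup>2)" .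
  have 2: "nrm d D = (\<Sum>p\<in>?S. cmod (ent D (fst p) (snd p)) * 1)"
    by (simp add: nrm_def sum.cartesian_product case_prod_beta)
  have "(nrm d D)\<^sup>2 \<le> (\<Sum>p\<in>?S. (cmod (ent D (fst p) (snd p)))\<^sup>2) * (\<Sum>p\<in>?S. 1\<^sup>2)"
    unfolding 2 by (rule Cauchy_Schwarz_ineq_sum)
  then show ?thesis unfolding 1 by (simp add: power2_eq_square mult.commute)
qed

text \<open>With \<open>D = r - s\<close> one has \<open>r\<^sup>2 - s\<^sup>2 = r D + D
  s\<close>, and the trace of \<open>D (r D + D s)\<close> is at least \<open>2
  \<delta>\<close> times the trace of \<open>D\<^sup>2\<close>.\<close>
lemma sqrt_lipschitz:
  assumes r: "\<delta> *\<^sub>R dg d \<le> r" "cor d d r" and s: "\<delta> *\<^sub>R dg d \<le> s" "cor d d s" and \<delta>: "0 < \<delta>"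
  shows "nrm d (r - s) \<le> (real d)\<^sup>2 / (2 * \<delta>) * nrm d (r * r - s * s)"
proof -
  define D where "D = r - s"
  define E where "E = r * r - s * s"
  have "0 \<le> \<delta> *\<^sub>R dg d" using \<delta> psd_dg by (intro scaleR_nonneg_nonneg) auto
  then have "0 \<le> r" "0 \<le> s" using r(1) s(1) by (auto intro: order_trans)
  then have h: "adj D = D" by (simp add: D_def psd_adj)
  have cD: "cor d d D" and cE: "cor d d E" unfolding D_def E_def using r s by (auto intro!: cor_rules)
  have ge: "\<delta> * trc d (D * D) \<le> trc d (D * x * D)" if "\<delta> *\<^sub>R dg d \<le> x" for x
  proof -
    have "D * (\<delta> *\<^sub>R dg d) * adj D \<le> D * x * adj D" using that by (rule le_cong)
    then have "\<delta> *\<^sub>R (D * D) \<le> D * x * D" using h corD[OF cD] by simp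
    from trc_mono[OF this, of d] show ?thesis by (simp add: trc_simps)
  qed
  have "E = r * D + D * s" by (simp add: D_def E_def algebra_simps)
  then have "trc d (D * E) = trc d (D * r * D) + trc d (D * (D * s))"
    by (simp add: distrib_left trc_simps mult.assoc)
  also have "trc d (D * (D * s)) = trc d (D * s * D)"
    using trc_comm[of d D "D * s"] cD s by (simp add: cor_rules)
  finally have "2 * \<delta> * trc d (D * D) \<le> trc d (D * E)" using ge[OF r(1)] ge[OF s(1)] by simp
  also have "\<dots> \<le> nrm d (D * E)" by (rule trc_le_nrm)
  also have "\<dots> \<le> nrm d D * nrm d E" using cD by (intro nrm_mult) blast
  finally have 1: "2 * \<delta> * trc d (D * D) \<le> nrm d D * nrm d E" .
  have "2 * \<delta> * (nrm d D)\<^sup>2 \<le> 2 * \<delta> * ((real d)\<^sup>2 * trc d (D * D))"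
    using trc_square[OF cD, unfolded h] \<delta> by (intro mult_left_mono) auto
  also have "\<dots> = (real d)\<^sup>2 * (2 * \<delta> * trc d (D * D))" by simp
  also have "\<dots> \<le> (real d)\<^sup>2 * (nrm d D * nrm d E)" using 1 by (intro mult_left_mono) auto
  finally have 2: "nrm d D * (2 * \<delta> * nrm d D) \<le> nrm d D * ((real d)\<^sup>2 * nrm d E)"
    by (simp add: power2_eq_square mult_ac)
  have "2 * \<delta> * nrm d D \<le> (real d)\<^sup>2 * nrm d E"
  proof (cases "nrm d D = 0")
    case False
    then have "0 < nrm d D" using nrm_nonneg[of d D] by simp
    then show ?thesis using 2 by simp
  qed (simp add: nrm_nonneg)
  then show ?thesis
    unfolding D_def[symmetric] E_def[symmetric] using \<delta> by (simp add: pos_le_divide_eq mult.commute)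
qed

(*%FILE A8_4*)
text \<open>From \<open>(1 - r)\<^sup>2 \<ge> 0\<close> one gets \<open>r \<le> (1 + C) /
  2\<close>, hence \<open>r\<^sup>2 \<le> (1 + C) / 2 r\<close>.\<close>
lemma sqrt_lower_bound:
  assumes r: "0 \<le> r" "cor d d r" and R: "\<delta> *\<^sub>R dg d \<le> r * r" "r * r \<le> C *\<^sub>R dg d" and "0 < \<delta>" "0 \<le> C"
  shows "(2 * \<delta> / (1 + C)) *\<^sub>R dg d \<le> r"
proof -
  define c where "c = (1 + C) / 2"
  have c: "0 < c" using assms by (simp add: c_def)
  have h: "adj r = r" using r psd_adj by blast
  have "0 \<le> (dg d - r) * (dg d - r)" using h by (intro psd_herm_square) simp
  also have "(dg d - r) * (dg d - r) = dg d + r * r - (r + r)"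
    using corD[OF r(2)] by (simp add: algebra_simps)
  also have "\<dots> \<le> dg d + C *\<^sub>R dg d - (r + r)" using R(2) by simp
  finally have "r + r \<le> dg d + C *\<^sub>R dg d" by simp
  moreover have "c *\<^sub>R dg d + c *\<^sub>R dg d = dg d + C *\<^sub>R dg d"
  proof -
    have "c + c = 1 + C" by (simp add: c_def field_simps)
    then have "(c + c) *\<^sub>R dg d = (1 + C) *\<^sub>R dg d" by (rule arg_cong)
    then show ?thesis by (simp only: scaleR_add_left scaleR_one)
  qed
  ultimately have "2 *\<^sub>R r \<le> 2 *\<^sub>R (c *\<^sub>R dg d)"
    by (simp only: scaleR_2)
  then have "r \<le> c *\<^sub>R dg d" using scaleR_le_cancel[of 2] by simp
  then have "r * r \<le> c *\<^sub>R r" using psd_sub_square[OF r(1) _ r(2) c] by simp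
  then have "c *\<^sub>R ((\<delta> / c) *\<^sub>R dg d) \<le> c *\<^sub>R r" using R(1) c by simp
  then have "(\<delta> / c) *\<^sub>R dg d \<le> r" using scaleR_le_cancel[OF c] by blast
  then show ?thesis by (simp add: c_def mult.commute)
qed

lemma pd_sqrt:
  assumes r: "0 \<le> r" "cor d d r" and R: "pd d (r * r)"
  shows "pd d r"
proof -
  obtain \<delta> where \<delta>: "0 < \<delta>" "\<delta> *\<^sub>R dg d \<le> r * r" using R by (auto simp: pd_def)
  have "r * r \<le> nrm d (r * r) *\<^sub>R dg d"
    using herm_le_nrm psd_adj[OF pd_psd[OF R]] R by (auto simp: pd_def)
  then have "(2 * \<delta> / (1 + nrm d (r * r))) *\<^sub>R dg d \<le> r"
    using sqrt_lower_bound[OF r \<delta>(2)] \<delta>(1) nrm_nonneg by blast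
  moreover have "0 < 2 * \<delta> / (1 + nrm d (r * r))"
    using \<delta>(1) nrm_nonneg[of d "r * r"] by (auto intro!: divide_pos_pos add_pos_nonneg)
  ultimately show ?thesis using r(2) unfolding pd_def by blast
qed

lemma pd_sqrt_exists:
  assumes "pd d A"
  obtains r where "pd d r" "r * r = A"
proof -
  have "cor d d A" using assms by (simp add: pd_def)
  then obtain r where "0 \<le> r" "cor d d r" "r * r = A"
    by (rule psd_sqrt_exists[OF pd_psd[OF assms]])
  then show ?thesis using pd_sqrt[of r d] assms by (intro that[of r]) simp_all
qed

(*%FILE A8_5*)
lemma pd_common:
  assumes "pd d r" "pd d s"
  obtains \<delta> where "0 < \<delta>" "\<delta> *\<^sub>R dg d \<le> r" "\<delta> *\<^sub>R dg d \<le> s"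
proof -
  obtain a b where a: "0 < a" "a *\<^sub>R dg d \<le> r" and b: "0 < b" "b *\<^sub>R dg d \<le> s"
    using assms by (auto simp: pd_def)
  have "min a b *\<^sub>R dg d \<le> r" "min a b *\<^sub>R dg d \<le> s"
    using order_trans[OF scaleR_right_mono[OF _ psd_dg] a(2), of "min a b"]
      order_trans[OF scaleR_right_mono[OF _ psd_dg] b(2), of "min a b"] by auto
  then show ?thesis using that[of "min a b"] a b by simp
qed

lemma pd_sqrt_unique:
  assumes "pd d r" "pd d s" "r * r = s * s"
  shows "r = s"
proof -
  obtain \<delta> where \<delta>: "0 < \<delta>" "\<delta> *\<^sub>R dg d \<le> r" "\<delta> *\<^sub>R dg d \<le> s" using pd_common assms by blast
  have c: "cor d d r" "cor d d s" using assms by (auto simp: pd_def)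
  have "nrm d (r - s) \<le> 0" using sqrt_lipschitz[OF \<delta>(2) c(1) \<delta>(3) c(2) \<delta>(1)] assms(3) by simp
  then have "nrm d (r - s) = 0" using nrm_nonneg[of d "r - s"] by simp
  then show ?thesis using nrm_eq_0[of d "r - s"] c by (simp add: cor_rules)
qed

lemma tends_sqrt:
  assumes R: "tends (\<lambda>n. r n * r n) (l * l)"
    and r: "\<And>n. 0 \<le> r n" "\<And>n. cor d d (r n)" and l: "0 \<le> l" "cor d d l"
    and lo: "0 < \<delta>" "\<And>n. \<delta> *\<^sub>R dg d \<le> r n * r n" and up: "\<And>n. r n * r n \<le> C *\<^sub>R dg d" "0 \<le> C"
  shows "tends r l"
proof -
  define e where "e = 2 * \<delta> / (1 + C)"
  have e: "0 < e" using lo up by (simp add: e_def)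
  have crr: "cor d d (r n * r n)" for n using r by (intro cor_rules)
  have cd: "cor d d (x *\<^sub>R dg d)" for x by (intro cor_rules)
  have rn: "e *\<^sub>R dg d \<le> r n" for n unfolding e_def using r lo up by (intro sqrt_lower_bound)
  have "\<delta> *\<^sub>R dg d \<le> l * l" "l * l \<le> C *\<^sub>R dg d"
    by (rule tends_ge[OF R crr cd, where N = 0], rule lo(2))
      (rule tends_le[OF R crr cd, where N = 0], rule up(1))
  then have ln: "e *\<^sub>R dg d \<le> l" unfolding e_def using l lo(1) up(2) by (intro sqrt_lower_bound)
  have "(\<lambda>n. nrm d (r n * r n - l * l)) \<longlonglongrightarrow> 0"
    using tends_iff_nrm[of d "\<lambda>n. r n * r n" "l * l"] R crr l by (simp add: cor_rules)
  from tendsto_mult_left[OF this, of "(real d)\<^sup>2 / (2 * e)"]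
  have "(\<lambda>n. (real d)\<^sup>2 / (2 * e) * nrm d (r n * r n - l * l)) \<longlonglongrightarrow> 0" by simp
  then have "(\<lambda>n. nrm d (r n - l)) \<longlonglongrightarrow> 0"
    by (rule nrm_null_comparison[OF sqrt_lipschitz[OF rn r(2) ln l(2) e] _ refl])
  then show ?thesis using tends_iff_nrm[of d r l] r(2) l(2) by blast
qed

(*%FILE A8_6*)
text \<open>The root is characterised as the only positive one, so a competing positive root
  has to be compared with \<open>r\<close>; since \<open>A\<close> is definite, the
  competitor is definite too.\<close>
lemma emb_mat_sqrt:
  assumes A: "A \<in> carrier_mat d d" and r: "pd d r" "r * r = emb A"
  shows "mat_sqrt A \<in> carrier_mat d d" "emb (mat_sqrt A) = r"
proof -
  have cr: "cor d d r" using r by (simp add: pd_def)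
  let ?R = "unemb d d r"
  have R: "?R \<in> carrier_mat d d" "emb ?R = r" using cr by (auto simp: unemb_carrier emb_unemb)
  have "mat_sqrt A = ?R"
    unfolding mat_sqrt_def
  proof (rule the_equality)
    have "emb (?R * ?R) = emb A" using R r(2) by (simp add: emb_mult[of _ d d _ d])
    then have "?R * ?R = A" by (rule emb_inj[rotated 2]) (use A R in auto)
    then show "?R \<in> carrier_mat (dim_row A) (dim_row A) \<and> psd ?R \<and> ?R * ?R = A"
      using R A pd_psd[OF r(1)] psd_emb[OF R(1)] by auto
  next
    fix B assume B: "B \<in> carrier_mat (dim_row A) (dim_row A) \<and> psd B \<and> B * B = A"
    then have B': "B \<in> carrier_mat d d" "0 \<le> emb B" "emb B * emb B = emb A"
      using A psd_emb[of B d] emb_mult[of B d d B d] by auto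
    have "pd d (emb A)" 
    proof -
      obtain s where s: "cor d d s" "r * s = dg d" "s * r = dg d" "pd d s" using pd_inverse[OF r(1)] by blast
      have "cor d d (s * s)" "emb A * (s * s) = dg d" "(s * s) * emb A = dg d"
        using s cr corD[OF cr] corD[OF s(1)] unfolding r(2)[symmetric]
        by (simp_all add: cor_rules mult.assoc) (simp_all flip: mult.assoc)
      moreover have "0 \<le> s * s" using psd_herm_square psd_adj[OF pd_psd[OF s(4)]] by blast
      ultimately show ?thesis using psd_inverse_pd[of "s * s" d "emb A"] cor_emb[OF A] by blast
    qed
    then have "pd d (emb B)" using pd_sqrt[OF B'(2) cor_emb[OF B'(1)]] B'(3) by simp
    then have "emb B = r" using pd_sqrt_unique[of d "emb B" r] r B'(3) by simp
    then show "B = ?R" using unemb_emb[OF B'(1)] by simp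
  qed
  then show "mat_sqrt A \<in> carrier_mat d d" "emb (mat_sqrt A) = r" using R by auto
qed

(*%FILE A9*)
section \<open>Pick matrices and the Lyapunov identity\<close>

lemma blk_adj_blk_mult: "blk m j * (adj (blk m k) * A) = (if j = k then dg m * A else 0)"
  by (simp add: mult.assoc[symmetric] blk_adj_blk)

lemma dg_blk [simp]: "dg m * blk m k = blk m k" "dg m * (blk m k * A) = blk m k * A"
  "adj (blk m k) * dg m = adj (blk m k)" "adj (blk m k) * (dg m * A) = adj (blk m k) * A"
  using corD[OF cor_blk[of k "Suc k" m]] corD[OF cor_intros(6)[OF cor_blk[of k "Suc k" m]]] by auto

definition Jm :: "nat \<Rightarrow> fmat" where
  "Jm m = \<i> *c (adj (blk m 1) * blk m 0) - \<i> *c (adj (blk m 0) * blk m 1)"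

lemma blk_Jm: "blk m 0 * Jm m = - (\<i> *c blk m 1)" "blk m 1 * Jm m = \<i> *c blk m 0"
  by (simp_all add: Jm_def right_diff_distrib blk_adj_blk_mult)

lemma adj_Jm: "adj (Jm m) = Jm m"
  by (simp add: Jm_def)

lemma sum_blk2: "adj (blk m 0) * blk m 0 + adj (blk m 1) * blk m 1 = dg (2 * m)"
proof -
  have "{..<2::nat} = {0, 1}" by auto
  then show ?thesis using sum_adj_blk_blk[of m 2] by simp
qed

lemma Jm_Jm: "Jm m * Jm m = dg (2 * m)"
proof -
  have "Jm m * Jm m = \<i> *c (adj (blk m 1) * (blk m 0 * Jm m)) - \<i> *c (adj (blk m 0) * (blk m 1 * Jm m))"
    by (simp add: Jm_def left_diff_distrib mult.assoc)
  also have "\<dots> = dg (2 * m)" unfolding blk_Jm sum_blk2[symmetric] by simp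
  finally show ?thesis .
qed

lemma cor_blk2: "cor m (2 * m) (blk m 0)" "cor m (2 * m) (blk m 1)"
  using cor_blk[of 0 2 m] cor_blk[of 1 2 m] by simp_all

lemma cor_Jm: "cor (2 * m) (2 * m) (Jm m)"
  unfolding Jm_def using cor_blk2 by (intro cor_intros cor_mult) auto

text \<open>Nodes and values are numbered from 0 here.\<close>
locale pick_data =
  fixes m :: nat and z :: "nat \<Rightarrow> complex" and w :: "nat \<Rightarrow> fmat"
  assumes Im_z: "0 < Im (z k)" and cor_w: "cor m m (w k)"
begin

lemma w_simps [simp]: "dg m * w k = w k" "w k * dg m = w k" "dg m * (w k * A) = w k * A"
  "w k * (dg m * A) = w k * A" "dg m * adj (w k) = adj (w k)" "adj (w k) * dg m = adj (w k)"
  "dg m * (adj (w k) * A) = adj (w k) * A" "adj (w k) * (dg m * A) = adj (w k) * A"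
  using corD[OF cor_w[of k]] corD[OF cor_intros(6)[OF cor_w[of k]]] by auto

lemma z_nz: "z k \<noteq> 0" "z j - cnj (z k) \<noteq> 0" "cnj (z j) - z k \<noteq> 0"
  using Im_z[of k] Im_z[of j] by (auto simp: complex_eq_iff)

text \<open>A block of the Pick matrix together with the outer factors
  \<open>T\<^sup>-\<^sup>1\<close> and \<open>T\<^sup>-\<^sup>*\<close>.\<close>
definition pick_block :: "nat \<Rightarrow> nat \<Rightarrow> fmat" where
  "pick_block j k = (z j * cnj (z k) / (z j - cnj (z k))) *c (w j - adj (w k))"

lemma adj_pick_block: "adj (pick_block j k) = pick_block k j"
proof -
  have "cnj (z j * cnj (z k) / (z j - cnj (z k))) = - (z k * cnj (z j) / (z k - cnj (z j)))"
    using z_nz(2)[of k j] z_nz(3)[of j k] by (simp add: divide_simps) (simp add: algebra_simps)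
  then show ?thesis by (simp add: pick_block_def cscale_distrib)
qed

lemma cor_pick_block: "cor m m (pick_block j k)"
  unfolding pick_block_def by (intro cor_intros cor_w)

lemma pick_block_simps [simp]: "dg m * pick_block j k = pick_block j k" "pick_block j k * dg m = pick_block j k"
  "dg m * (pick_block j k * A) = pick_block j k * A" "pick_block j k * (dg m * A) = pick_block j k * A"
  using corD[OF cor_pick_block] by auto

text \<open>The row \<open>(I, w\<^sub>k)\<close> of \<open>(v, u)\<close>.\<close>
definition node_row :: "nat \<Rightarrow> fmat" where "node_row k = blk m 0 + w k * blk m 1"

lemma adj_node_row: "adj (node_row k) = adj (blk m 0) + adj (blk m 1) * adj (w k)"
  by (simp add: node_row_def)

lemma node_row_J_node_row: "node_row j * (Jm m * adj (node_row k)) = \<i> *c (w j - adj (w k))"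
proof -
  have "node_row j * Jm m = - (\<i> *c blk m 1) + \<i> *c (w j * blk m 0)"
    by (simp only: node_row_def distrib_right mult.assoc blk_Jm cscale_mult)
  then have "node_row j * Jm m * adj (node_row k) = \<i> *c (w j - adj (w k))"
    by (simp add: adj_node_row distrib_left distrib_right left_diff_distrib mult.assoc blk_adj_blk blk_adj_blk_mult
        cscale_distrib)
  then show ?thesis by (simp add: mult.assoc)
qed

lemma cor_node_row: "cor m (2 * m) (node_row k)"
  unfolding node_row_def using cor_blk2 cor_w by (intro cor_intros cor_mult) auto

lemma node_row_simps [simp]: "dg m * node_row k = node_row k" "dg m * (node_row k * A) = node_row k * A" "adj (node_row k) * dg m = adj (node_row k)"
  "adj (node_row k) * (dg m * A) = adj (node_row k) * A"
  "node_row k * dg (2 * m) = node_row k" "dg (2 * m) * adj (node_row k) = adj (node_row k)"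
  "node_row k * (dg (2 * m) * A) = node_row k * A" "dg (2 * m) * (adj (node_row k) * A) = adj (node_row k) * A"
  using corD[OF cor_node_row[of k]] corD[OF cor_intros(6)[OF cor_node_row[of k]]] by auto

definition Pick :: "nat \<Rightarrow> fmat" where
  "Pick n = (\<Sum>j<n. \<Sum>k<n. adj (blk m j) * (pick_block j k * blk m k))"
text \<open>In terms of the data, \<open>V\<close> is \<open>(v, u)\<close>,
  \<open>Ts\<close> is \<open>T\<^sup>*\<close>, \<open>last_col\<close> is the off-diagonal
  block in the next Pick matrix, and \<open>S n x\<close> is \<open>(v, u)\<^sup>* (1 - x
  T\<^sup>*)\<^sup>-\<^sup>1\<close>.\<close>
definition V :: "nat \<Rightarrow> fmat" where "V n = (\<Sum>k<n. adj (blk m k) * node_row k)"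
definition Ts :: "nat \<Rightarrow> fmat" where "Ts n = (\<Sum>k<n. (1 / cnj (z k)) *c (adj (blk m k) * blk m k))"
definition last_col :: "nat \<Rightarrow> fmat" where "last_col n = (\<Sum>j<n. adj (blk m j) * pick_block j n)"
definition S :: "nat \<Rightarrow> complex \<Rightarrow> fmat" where
  "S n x = (\<Sum>k<n. (1 / (1 - x / cnj (z k))) *c (adj (node_row k) * blk m k))"

lemma adj_Ts: "adj (Ts n) = (\<Sum>k<n. (1 / z k) *c (adj (blk m k) * blk m k))"
  by (simp add: Ts_def)

lemma adj_last_col: "adj (last_col n) = (\<Sum>k<n. pick_block n k * blk m k)"
  by (simp add: last_col_def adj_pick_block)

lemma adj_V: "adj (V n) = (\<Sum>k<n. adj (node_row k) * blk m k)"
  by (simp add: V_def)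

lemma adj_Pick: "adj (Pick n) = Pick n"
  unfolding Pick_def by (simp add: adj_pick_block mult.assoc) (rule sum.swap)

lemma cor_nm: "cor (n * m) (n * m) (Pick n)" "cor (n * m) (n * m) (Ts n)" "cor (n * m) m (last_col n)"
  "cor (n * m) (2 * m) (V n)" "cor (2 * m) (n * m) (S n x)"
proof -
  note b = cor_blk[of _ n m]
  show "cor (n * m) (n * m) (Pick n)" unfolding Pick_def
    by (intro cor_sum cor_mult[OF cor_intros(6)[OF b]] cor_mult[OF cor_pick_block b]) auto
  show "cor (n * m) (n * m) (Ts n)" unfolding Ts_def
    by (intro cor_sum cor_intros(5) cor_mult[OF cor_intros(6)[OF b] b]) auto
  show "cor (n * m) m (last_col n)" unfolding last_col_def
    by (intro cor_sum cor_mult[OF cor_intros(6)[OF b] cor_pick_block]) auto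
  show "cor (n * m) (2 * m) (V n)" unfolding V_def
    by (intro cor_sum cor_mult[OF cor_intros(6)[OF b] cor_node_row]) auto
  show "cor (2 * m) (n * m) (S n x)" unfolding S_def
    by (intro cor_sum cor_intros(5) cor_mult[OF cor_intros(6)[OF cor_node_row] b]) auto
qed

lemma blk_orth: "blk m n * dg (n * m) = 0" "dg (n * m) * adj (blk m n) = 0"
proof -
  show *: "blk m n * dg (n * m) = 0"
    unfolding sum_adj_blk_blk[symmetric] by (simp add: sum_distrib_left blk_adj_blk_mult)
  show "dg (n * m) * adj (blk m n) = 0" using arg_cong[OF *, of adj] by simp
qed

lemma blk_orth': "cor (n * m) d A \<Longrightarrow> blk m n * A = 0" "cor d (n * m) A \<Longrightarrow> A * adj (blk m n) = 0"
proof -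
  assume A: "cor (n * m) d A"
  have "blk m n * A = (blk m n * dg (n * m)) * A" by (simp only: mult.assoc corD[OF A])
  then show "blk m n * A = 0" by (simp add: blk_orth)
next
  assume A: "cor d (n * m) A"
  have "A * adj (blk m n) = A * (dg (n * m) * adj (blk m n))" by (simp only: corD[OF A])
  then show "A * adj (blk m n) = 0" by (simp add: blk_orth)
qed

lemma Pick_Suc: "Pick (Suc n) = Pick n + last_col n * blk m n + adj (blk m n) * adj (last_col n)
    + adj (blk m n) * (pick_block n n * blk m n)"
  by (simp add: Pick_def sum.distrib last_col_def adj_pick_block sum_distrib_left sum_distrib_right mult.assoc)

lemma V_Suc: "V (Suc n) = V n + adj (blk m n) * node_row n"
  by (simp add: V_def)

lemma S_Suc: "S (Suc n) x = S n x + (1 / (1 - x / cnj (z n))) *c (adj (node_row n) * blk m n)"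
  by (simp add: S_def)

lemma pick_block_Lyapunov: "(1 / cnj (z k)) *c pick_block j k - (1 / z j) *c pick_block j k = - (\<i> *c (node_row j * (Jm m * adj (node_row k))))"
proof -
  have "(1 / cnj (z k) - 1 / z j) * (z j * cnj (z k) / (z j - cnj (z k))) = 1"
    using z_nz by (simp add: field_simps)
  then have "(1 / cnj (z k)) *c pick_block j k - (1 / z j) *c pick_block j k = 1 *c (w j - adj (w k))"
    unfolding pick_block_def cscale_simps(1) cscale_distrib(4)[symmetric] left_diff_distrib by (rule arg_cong)
  then show ?thesis unfolding node_row_J_node_row by simp
qed

lemma last_col_Lyapunov: "(1 / cnj (z n)) *c last_col n - adj (Ts n) * last_col n = - (\<i> *c (V n * (Jm m * adj (node_row n))))"
proof -
  have "adj (Ts n) * last_col n = (\<Sum>j<n. (1 / z j) *c (adj (blk m j) * pick_block j n))"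
    unfolding adj_Ts last_col_def
    by (simp add: sum_distrib_right sum_distrib_left mult.assoc blk_adj_blk_mult if_distrib cong: if_cong)
  then have "(1 / cnj (z n)) *c last_col n - adj (Ts n) * last_col n
      = (\<Sum>j<n. adj (blk m j) * ((1 / cnj (z n)) *c pick_block j n - (1 / z j) *c pick_block j n))"
    by (simp add: last_col_def cscale_sum sum_subtractf[symmetric] right_diff_distrib)
  also have "\<dots> = - (\<i> *c (V n * (Jm m * adj (node_row n))))"
    unfolding pick_block_Lyapunov by (simp add: V_def sum_distrib_right cscale_sum sum_negf mult.assoc)
  finally show ?thesis .
qed

text \<open>The Lyapunov identity, checked block by block. It is the source of every
  property of the data with respect to \<open>J\<close>.\<close>
lemma Pick_Lyapunov: "Pick n * Ts n - adj (Ts n) * Pick n = - (\<i> *c (V n * (Jm m * adj (V n))))"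
proof -
  have "blk m k * Ts n = (1 / cnj (z k)) *c blk m k" if "k < n" for k
    unfolding Ts_def using that
    by (simp add: sum_distrib_left blk_adj_blk_mult if_distrib cong: if_cong)
  then have 1: "Pick n * Ts n = (\<Sum>j<n. \<Sum>k<n. (1 / cnj (z k)) *c (adj (blk m j) * (pick_block j k * blk m k)))"
    unfolding Pick_def by (simp add: sum_distrib_right mult.assoc)
  have "adj (Ts n) * Pick n = (\<Sum>j<n. \<Sum>k<n. \<Sum>i<n. (1 / z i) *c (adj (blk m i) * (blk m i * (adj (blk m j) * (pick_block j k * blk m k)))))"
    unfolding Pick_def adj_Ts
    by (simp add: sum_distrib_right sum_distrib_left mult.assoc)
  also have "\<dots> = (\<Sum>j<n. \<Sum>k<n. (1 / z j) *c (adj (blk m j) * (pick_block j k * blk m k)))"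
    by (simp add: blk_adj_blk_mult if_distrib cong: if_cong)
  finally have "Pick n * Ts n - adj (Ts n) * Pick n
      = (\<Sum>j<n. \<Sum>k<n. adj (blk m j) * (((1 / cnj (z k)) *c pick_block j k - (1 / z j) *c pick_block j k) * blk m k))"
    unfolding 1 by (simp add: sum_subtractf[symmetric] right_diff_distrib left_diff_distrib)
  also have "\<dots> = - (\<i> *c (V n * (Jm m * adj (V n))))"
    unfolding pick_block_Lyapunov V_def adj_V
    by (simp add: sum_distrib_right sum_distrib_left cscale_sum sum_negf mult.assoc) (subst sum.swap, rule refl)
  finally show ?thesis .
qed

lemma S_Ts: "Im x > 0 \<Longrightarrow> S n x - x *c (S n x * Ts n) = adj (V n)"
proof -
  assume x: "Im x > 0"
  have "S n x * Ts n = (\<Sum>k<n. (1 / cnj (z k) * (1 / (1 - x / cnj (z k)))) *c (adj (node_row k) * blk m k))"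
    unfolding S_def Ts_def
    by (simp add: sum_distrib_right sum_distrib_left mult.assoc blk_adj_blk_mult if_distrib cong: if_cong)
  then have "S n x - x *c (S n x * Ts n) = (\<Sum>k<n. (1 / (1 - x / cnj (z k)) - x * (1 / cnj (z k) * (1 / (1 - x / cnj (z k))))) *c (adj (node_row k) * blk m k))"
    by (simp add: S_def cscale_sum cscale_distrib sum_subtractf)
  also have "\<dots> = (\<Sum>k<n. 1 *c (adj (node_row k) * blk m k))"
  proof (rule sum.cong[OF refl])
    fix k
    have "x \<noteq> cnj (z k)" using x Im_z[of k] by (auto simp: complex_eq_iff)
    then have "1 - x / cnj (z k) \<noteq> 0" using z_nz(1)[of k] by simp
    moreover have "1 / (1 - x / cnj (z k)) - x * (1 / cnj (z k) * (1 / (1 - x / cnj (z k))))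
        = (1 - x / cnj (z k)) / (1 - x / cnj (z k))"
      by (simp only: diff_divide_distrib) simp
    ultimately have "1 / (1 - x / cnj (z k)) - x * (1 / cnj (z k) * (1 / (1 - x / cnj (z k)))) = 1"
      by (metis divide_self)
    then show "(1 / (1 - x / cnj (z k)) - x * (1 / cnj (z k) * (1 / (1 - x / cnj (z k))))) *c (adj (node_row k) * blk m k)
      = 1 *c (adj (node_row k) * blk m k)" by (simp only:)
  qed
  also have "\<dots> = adj (V n)" by (simp add: adj_V)
  finally show ?thesis .
qed

end

(*%FILE B1*)
section \<open>Schur complements\<close>

definition cinv :: "nat \<Rightarrow> fmat \<Rightarrow> fmat" where
  "cinv d A = (SOME B. cor d d B \<and> A * B = dg d \<and> B * A = dg d)"

lemma cinv:
  assumes "pd d A"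
  shows "cor d d (cinv d A)" "A * cinv d A = dg d" "cinv d A * A = dg d" "pd d (cinv d A)"
    "adj (cinv d A) = cinv d A"
proof -
  have cA: "cor d d A" using assms by (simp add: pd_def)
  have "\<exists>B. cor d d B \<and> A * B = dg d \<and> B * A = dg d"
    using pd_inverse[OF assms] by metis
  then have B: "cor d d (cinv d A) \<and> A * cinv d A = dg d \<and> cinv d A * A = dg d"
    unfolding cinv_def by (rule someI_ex)
  then show "cor d d (cinv d A)" "A * cinv d A = dg d" "cinv d A * A = dg d" by blast+
  then show "pd d (cinv d A)" using psd_inverse_pd[OF pd_psd[OF assms] cA] by blast
  then show "adj (cinv d A) = cinv d A" using psd_adj pd_psd by blast
qed

context pick_data
begin

text \<open>The inverse of the Pick matrix, built by bordering; only matrices of size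
  \<open>m\<close> are inverted.\<close>
primrec Pick_inv :: "nat \<Rightarrow> fmat" where
  "Pick_inv 0 = 0"
| "Pick_inv (Suc n) = Pick_inv n + adj (blk m n - adj (last_col n) * Pick_inv n)
     * (cinv m (pick_block n n - adj (last_col n) * (Pick_inv n * last_col n)) * (blk m n - adj (last_col n) * Pick_inv n))"

declare Pick_inv.simps(2) [simp del]

text \<open>The row \<open>(-B\<^sup>* P\<^sup>-\<^sup>1, I)\<close>, the Schur complement
  in the bordered Pick matrix, and the inverse of the latter.\<close>
definition Schur_row :: "nat \<Rightarrow> fmat" where "Schur_row n = blk m n - adj (last_col n) * Pick_inv n"
definition Schur :: "nat \<Rightarrow> fmat" where "Schur n = pick_block n n - adj (last_col n) * (Pick_inv n * last_col n)"
definition Schur_inv :: "nat \<Rightarrow> fmat" where "Schur_inv n = cinv m (Schur n)"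

lemma Pick_inv_Suc: "Pick_inv (Suc n) = Pick_inv n + adj (Schur_row n) * (Schur_inv n * Schur_row n)"
  by (simp add: Schur_row_def Schur_def Schur_inv_def Pick_inv.simps(2))

definition nondegenerate :: "nat \<Rightarrow> bool" where "nondegenerate n \<longleftrightarrow> (\<forall>k<n. pd m (Schur k))"

lemma nondegenerate_Suc: "nondegenerate (Suc n) \<longleftrightarrow> nondegenerate n \<and> pd m (Schur n)"
  by (auto simp: nondegenerate_def less_Suc_eq)

lemma Pick_0: "Pick 0 = 0"
  by (simp add: Pick_def)

text \<open>Block elimination in the bordered Pick matrix.\<close>
lemma schur_step:
  assumes P: "cor (n * m) (n * m) (Pick_inv n)" "adj (Pick_inv n) = Pick_inv n" "Pick_inv n * Pick n = dg (n * m)"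
  shows "Pick_inv n * Pick (Suc n) = dg (n * m) + Pick_inv n * last_col n * blk m n"
    "Schur_row n * Pick (Suc n) = Schur n * blk m n"
    "adj (Schur_row n) = adj (blk m n) - Pick_inv n * last_col n"
    "blk m n * adj (Schur_row n) = dg m"
    "Schur_row n * adj (blk m n) = dg m"
    "cor m (Suc n * m) (Schur_row n)"
    "Schur_row n * (Pick (Suc n) * adj (Schur_row n)) = Schur n"
    "cor m m (Schur n)" "adj (Schur n) = Schur n"
proof -
  have z1: "Pick_inv n * adj (blk m n) = 0" "Pick_inv n * (adj (blk m n) * A) = 0" for A
    using blk_orth'(2)[OF P(1)] by (simp_all flip: mult.assoc)
  show 1: "Pick_inv n * Pick (Suc n) = dg (n * m) + Pick_inv n * last_col n * blk m n"
    by (simp add: Pick_Suc distrib_left P z1 mult.assoc)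
  have z2: "blk m n * Pick n = 0" "blk m n * last_col n = 0" "blk m n * (last_col n * A) = 0" "blk m n * Pick_inv n = 0"
    "blk m n * (Pick_inv n * A) = 0" for A
    using blk_orth'(1)[OF cor_nm(1)] blk_orth'(1)[OF cor_nm(3)] blk_orth'(1)[OF P(1)]
    by (simp_all flip: mult.assoc)
  have cb: "cor m (n * m) (adj (last_col n))" by (intro cor_intros cor_nm)
  show 2: "Schur_row n * Pick (Suc n) = Schur n * blk m n"
  proof -
    have a: "blk m n * Pick (Suc n) = adj (last_col n) + pick_block n n * blk m n"
      by (simp add: Pick_Suc distrib_left z2 blk_adj_blk_mult mult.assoc corD[OF cb])
    have "Schur_row n * Pick (Suc n) = blk m n * Pick (Suc n) - adj (last_col n) * (Pick_inv n * Pick (Suc n))"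
      by (simp only: Schur_row_def left_diff_distrib mult.assoc)
    also have "\<dots> = Schur n * blk m n"
      unfolding a 1 by (simp add: distrib_left left_diff_distrib Schur_def mult.assoc corD[OF cb])
    finally show ?thesis .
  qed
  show 3: "adj (Schur_row n) = adj (blk m n) - Pick_inv n * last_col n"
    by (simp add: Schur_row_def P)
  show 4: "blk m n * adj (Schur_row n) = dg m"
    unfolding 3 by (simp add: right_diff_distrib z2 blk_adj_blk)
  show "Schur_row n * adj (blk m n) = dg m"
    using arg_cong[OF 4, of adj] by simp
  have "cor (n * m) (Suc n * m) (Pick_inv n)" "cor m (Suc n * m) (blk m n)"
    using P(1) cor_blk[of n "Suc n" m] by (auto simp: cor_iff)
  then show "cor m (Suc n * m) (Schur_row n)"
    unfolding Schur_row_def by (intro cor_intros cor_mult[OF cb])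
  show "cor m m (Schur n)" unfolding Schur_def
    by (intro cor_intros cor_pick_block cor_mult[OF cb] cor_mult[OF P(1)] cor_nm)
  then show "Schur_row n * (Pick (Suc n) * adj (Schur_row n)) = Schur n"
    using 2 4 by (simp add: mult.assoc[symmetric]) (simp add: mult.assoc corD)
  show "adj (Schur n) = Schur n"
    by (simp add: Schur_def adj_pick_block P mult.assoc)
qed

lemma Pick_inv:
  assumes "nondegenerate n"
  shows "cor (n * m) (n * m) (Pick_inv n) \<and> 0 \<le> Pick_inv n \<and> Pick_inv n * Pick n = dg (n * m)"
  using assms
proof (induction n)
  case 0 show ?case by (auto simp: cor_iff Pick_0 intro!: fmat_eqI simp: ent_dg)
next
  case (Suc n)
  then have IH: "cor (n * m) (n * m) (Pick_inv n)" "0 \<le> Pick_inv n" "Pick_inv n * Pick n = dg (n * m)"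
    and K: "pd m (Schur n)" by (auto simp: nondegenerate_Suc)
  note st = schur_step[OF IH(1) psd_adj[OF IH(2)] IH(3)]
  note ci = cinv[OF K, folded Schur_inv_def]
  have cor: "cor (Suc n * m) (Suc n * m) (Pick_inv n)" using IH(1) by (auto simp: cor_iff)
  have 1: "cor (Suc n * m) (Suc n * m) (Pick_inv (Suc n))"
    unfolding Pick_inv_Suc by (intro cor_intros(2) cor cor_mult[OF cor_intros(6)[OF st(6)] cor_mult[OF ci(1) st(6)]])
  have 2: "0 \<le> Pick_inv (Suc n)"
    unfolding Pick_inv_Suc using psd_cong[OF pd_psd[OF ci(4)], of "adj (Schur_row n)"] IH(2)
    by (simp add: mult.assoc)
  have "Pick_inv (Suc n) * Pick (Suc n) = Pick_inv n * Pick (Suc n) + adj (Schur_row n) * (Schur_inv n * (Schur_row n * Pick (Suc n)))"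
    by (simp only: Pick_inv_Suc distrib_right mult.assoc)
  also have "\<dots> = dg (n * m) + adj (blk m n) * blk m n"
    unfolding st(1) st(2) mult.assoc[of "Schur_inv n", symmetric] ci(3)
    by (simp add: st(3) left_diff_distrib mult.assoc)
  also have "\<dots> = dg (Suc n * m)" using sum_adj_blk_blk[of m n] sum_adj_blk_blk[of m "Suc n"] by simp
  finally show ?case using 1 2 by blast
qed

lemma Pick_inv_props:
  assumes "nondegenerate n"
  shows "cor (n * m) (n * m) (Pick_inv n)" "0 \<le> Pick_inv n" "Pick_inv n * Pick n = dg (n * m)" "adj (Pick_inv n) = Pick_inv n"
    "Pick n * Pick_inv n = dg (n * m)"
proof -
  show 1: "cor (n * m) (n * m) (Pick_inv n)" "0 \<le> Pick_inv n" "Pick_inv n * Pick n = dg (n * m)" using Pick_inv[OF assms] by auto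
  show 2: "adj (Pick_inv n) = Pick_inv n" using psd_adj[OF 1(2)] .
  show "Pick n * Pick_inv n = dg (n * m)" using arg_cong[OF 1(3), of adj] 2 by (simp add: adj_Pick)
qed

lemmas schur_steps = schur_step[OF Pick_inv_props(1,4,3)]

lemma Pick_pd: "nondegenerate n \<Longrightarrow> pd (n * m) (Pick n)"
  using psd_inverse_pd[of "Pick_inv n" "n * m" "Pick n"] Pick_inv_props[of n] cor_nm(1) by blast

lemma Schur_psd: "nondegenerate n \<Longrightarrow> 0 \<le> Pick (Suc n) \<Longrightarrow> 0 \<le> Schur n"
  using psd_cong[of "Pick (Suc n)" "Schur_row n"] schur_steps(7)[of n] by (simp add: mult.assoc)

text \<open>The Schur complement is the bordered Pick matrix conjugated by a row
  \<open>L\<close> with \<open>L L\<^sup>* \<ge> 1\<close>, so it inherits the lower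
  bound.\<close>
lemma Schur_pd:
  assumes "nondegenerate n" and pd: "pd (Suc n * m) (Pick (Suc n))"
  shows "pd m (Schur n)"
proof -
  note st = schur_steps[OF assms(1) assms(1) assms(1)]
  obtain \<delta> where \<delta>: "0 < \<delta>" "\<delta> *\<^sub>R dg (Suc n * m) \<le> Pick (Suc n)" using pd by (auto simp: pd_def)
  have cb: "cor m (n * m) (adj (last_col n))" by (intro cor_intros cor_nm)
  note P = Pick_inv_props[OF assms(1)]
  have "\<delta> *\<^sub>R (Schur_row n * adj (Schur_row n)) \<le> Schur n"
    using le_cong[OF \<delta>(2), of "Schur_row n"] st(7) corD[OF st(6)] by (simp add: mult.assoc)
  moreover have "dg m \<le> Schur_row n * adj (Schur_row n)"
  proof -
    let ?B = "adj (last_col n) * Pick_inv n"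
    have "?B * adj (blk m n) = 0" using blk_orth'(2)[OF cor_mult[OF cb P(1)]] .
    moreover have "blk m n * adj ?B = 0" using arg_cong[OF calculation, of adj] by simp
    ultimately have "Schur_row n * adj (Schur_row n) = dg m + ?B * adj ?B"
      unfolding Schur_row_def by (simp add: algebra_simps blk_adj_blk)
    then show ?thesis using psd_square(1)[of ?B] by simp
  qed
  then have "\<delta> *\<^sub>R dg m \<le> \<delta> *\<^sub>R (Schur_row n * adj (Schur_row n))" using \<delta>(1) by (intro scaleR_left_mono) auto
  ultimately show ?thesis using \<delta>(1) st(8) unfolding pd_def by (meson order_trans)
qed

lemma nondegenerate_if_Pick_pd: "(\<forall>k<n. pd (Suc k * m) (Pick (Suc k))) \<Longrightarrow> nondegenerate n"
  by (induction n) (auto simp: nondegenerate_Suc Schur_pd less_Suc_eq, simp add: nondegenerate_def)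

text \<open>The row \<open>(-B\<^sup>* P\<^sup>-\<^sup>1, I) (v, u)\<close>, that is
  \<open>K\<^sup>1\<^sup>/\<^sup>2\<close> times the pair formed by the rational functions
  of first kind and minus those of second kind at 0.\<close>
definition g :: "nat \<Rightarrow> fmat" where "g n = Schur_row n * V (Suc n)"
definition node_weight :: "nat \<Rightarrow> real" where "node_weight n = (cmod (z n))\<^sup>2 / (2 * Im (z n))"

lemma node_weight_pos: "0 < node_weight n"
  using Im_z[of n] z_nz(1)[of n] by (simp add: node_weight_def)

lemma node_weight_eq: "1 / cnj (z n) - 1 / z n = \<i> / node_weight n"
proof -
  have "1 / cnj (z n) - 1 / z n = (z n - cnj (z n)) / (z n * cnj (z n))"
    using z_nz(1)[of n] by (simp add: field_simps)
  also have "z n * cnj (z n) = (complex_of_real (cmod (z n)))\<^sup>2"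
    by (metis complex_norm_square of_real_power)
  also have "z n - cnj (z n) = 2 * \<i> * Im (z n)"
    using complex_diff_cnj[of "z n"] by (simp add: mult.commute mult.left_commute)
  also have "2 * \<i> * Im (z n) / (complex_of_real (cmod (z n)))\<^sup>2 = \<i> / node_weight n"
    using Im_z[of n] z_nz(1)[of n] by (simp add: node_weight_def)
  finally show ?thesis .
qed

lemma cor_g: "nondegenerate n \<Longrightarrow> cor m (2 * m) (g n)"
  unfolding g_def by (rule cor_mult[OF schur_steps(6) cor_nm(4)])

lemma blk_Ts: "blk m n * Ts (Suc n) = (1 / cnj (z n)) *c blk m n" "adj (Ts (Suc n)) * adj (blk m n) = (1 / z n) *c adj (blk m n)"
proof -
  show *: "blk m n * Ts (Suc n) = (1 / cnj (z n)) *c blk m n"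
    by (simp add: Ts_def sum_distrib_left blk_adj_blk_mult distrib_left)
  show "adj (Ts (Suc n)) * adj (blk m n) = (1 / z n) *c adj (blk m n)"
    using arg_cong[OF *, of adj] by simp
qed

text \<open>The Lyapunov identity conjugated by the elimination row, which reduces the
  bordered Pick matrix to its Schur complement in the last block.\<close>
lemma g_J_g:
  assumes "nondegenerate n"
  shows "g n * (Jm m * adj (g n)) = - ((1 / complex_of_real (node_weight n)) *c Schur n)"
proof -
  note st = schur_steps[OF assms assms assms]
  have "- (\<i> *c (g n * (Jm m * adj (g n)))) = Schur_row n * (- (\<i> *c (V (Suc n) * (Jm m * adj (V (Suc n)))))) * adj (Schur_row n)"
    by (simp add: g_def mult.assoc)
  also have "\<dots> = (Schur_row n * Pick (Suc n)) * (Ts (Suc n) * adj (Schur_row n)) - (Schur_row n * adj (Ts (Suc n))) * (Pick (Suc n) * adj (Schur_row n))"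
    unfolding Pick_Lyapunov[symmetric] by (simp add: left_diff_distrib right_diff_distrib mult.assoc)
  also have "Pick (Suc n) * adj (Schur_row n) = adj (blk m n) * Schur n"
    using arg_cong[OF st(2), of adj] by (simp add: adj_Pick st(9))
  also have "(Schur_row n * Pick (Suc n)) * (Ts (Suc n) * adj (Schur_row n)) = (1 / cnj (z n)) *c Schur n"
    unfolding st(2) mult.assoc mult.assoc[of "blk m n", symmetric] blk_Ts cscale_mult st(4)
    using corD[OF st(8)] by simp
  also have "(Schur_row n * adj (Ts (Suc n))) * (adj (blk m n) * Schur n) = (1 / z n) *c Schur n"
    unfolding mult.assoc mult.assoc[of "adj (Ts (Suc n))", symmetric] blk_Ts cscale_mult
    using st(5) corD[OF st(8)] by (simp flip: mult.assoc)
  also have "(1 / cnj (z n)) *c Schur n - (1 / z n) *c Schur n = (\<i> / node_weight n) *c Schur n"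
    by (simp only: node_weight_eq cscale_distrib(4)[symmetric])
  finally have "\<i> *c (- (\<i> *c (g n * (Jm m * adj (g n))))) = \<i> *c ((\<i> / node_weight n) *c Schur n)" by (rule arg_cong)
  then show ?thesis by (simp add: minus_equation_iff[of _ "g n * _"])
qed

end

(*%FILE B2*)
section \<open>Blaschke-Potapov products\<close>

context pick_data
begin

text \<open>The matrix of the elementary factor with number \<open>n\<close>; \<open>N0
  n\<close> is the positive matrix obtained from it by multiplication with
  \<open>J\<close>.\<close>
definition elem :: "nat \<Rightarrow> fmat" where
  "elem n = complex_of_real (node_weight n) *c (adj (g n) * (Schur_inv n * (g n * Jm m)))"
definition zeta :: "nat \<Rightarrow> complex \<Rightarrow> complex" where "zeta n x = blaschke (z n) x"
definition N0 :: "nat \<Rightarrow> fmat" where "N0 n = complex_of_real (node_weight n) *c (adj (g n) * (Schur_inv n * g n))"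

lemma zeta_eq:
  assumes "0 < Im x"
  shows "(1 - zeta n x) * complex_of_real (node_weight n) = - (\<i> * x * (1 / (1 - x / cnj (z n))))"
proof -
  have x: "x - cnj (z n) \<noteq> 0" using assms Im_z[of n] by (auto simp: complex_eq_iff)
  have c: "complex_of_real (node_weight n) * (z n - cnj (z n)) = \<i> * (z n * cnj (z n))"
  proof -
    have "(z n - cnj (z n)) / (z n * cnj (z n)) = \<i> / node_weight n"
      using node_weight_eq[of n] z_nz(1)[of n] by (simp add: field_simps)
    then show ?thesis using node_weight_pos[of n] z_nz(1)[of n] by (simp add: field_simps)
  qed
  have "1 - zeta n x = x * (z n - cnj (z n)) / (z n * (x - cnj (z n)))"
    unfolding zeta_def blaschke_def using x z_nz(1)[of n] by (simp add: field_simps)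
  then have "(1 - zeta n x) * complex_of_real (node_weight n)
      = x * (complex_of_real (node_weight n) * (z n - cnj (z n))) / (z n * (x - cnj (z n)))" by simp
  also have "\<dots> = x * \<i> * cnj (z n) / (x - cnj (z n))"
    unfolding c using z_nz(1)[of n] by simp
  also have "\<dots> = - (\<i> * x * (1 / (1 - x / cnj (z n))))"
  proof -
    define d where "d = x - cnj (z n)"
    have "1 - x / cnj (z n) = - (d / cnj (z n))" using z_nz(1)[of n] by (simp add: d_def field_simps)
    moreover have "d \<noteq> 0" using x by (simp add: d_def)
    ultimately show ?thesis unfolding d_def[symmetric] using z_nz(1)[of n] by (simp add: mult_ac)
  qed
  finally show ?thesis .
qed

definition factor :: "nat \<Rightarrow> complex \<Rightarrow> fmat" where "factor n x = 1 + (1 - zeta n x) *c elem n"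

text \<open>The Blaschke-Potapov product of the first \<open>n\<close> elementary
  factors.\<close>
primrec Potapov :: "nat \<Rightarrow> complex \<Rightarrow> fmat" where
  "Potapov 0 x = 1"
| "Potapov (Suc n) x = Potapov n x * factor n x"

text \<open>Induction on \<open>n\<close>: in the next factor the product is applied to the
  columns of \<open>g\<^sup>*\<close>, and the induction hypothesis with the Lyapunov
  identity evaluates it there in closed form.\<close>
lemma Potapov_closed:
  assumes "nondegenerate n" "0 < Im x"
  shows "Potapov n x = 1 - (\<i> * x) *c (S n x * (Pick_inv n * (V n * Jm m)))"
  using assms(1)
proof (induction n)
  case 0 show ?case by simp
next
  case (Suc n)
  then have kp: "nondegenerate n" and K: "pd m (Schur n)" by (auto simp: nondegenerate_Suc)
  note IH = Suc.IH[OF kp]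
  note st = schur_steps[OF kp kp kp] and P = Pick_inv_props[OF kp]
  define s where "s = 1 / (1 - x / cnj (z n))"
  define l where "l = Pick_inv n * last_col n"
  have s: "s \<noteq> 0" "(1 / s) = 1 - x / cnj (z n)"
  proof -
    have "x \<noteq> cnj (z n)" using assms(2) Im_z[of n] by (auto simp: complex_eq_iff)
    then show "s \<noteq> 0" "(1 / s) = 1 - x / cnj (z n)" using z_nz(1)[of n] by (simp_all add: s_def)
  qed
  have aL: "adj (Schur_row n) = adj (blk m n) - l" by (simp add: st(3) l_def)
  have cl: "cor (n * m) m l" unfolding l_def by (rule cor_mult[OF P(1) cor_nm(3)])
  have Pl: "Pick n * l = last_col n"
    using corD[OF cor_nm(3)[of n]] P(5) by (simp add: l_def flip: mult.assoc)
  have z1: "S n x * adj (blk m n) = 0" "adj (V n) * adj (blk m n) = 0" "blk m n * l = 0"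
    using blk_orth'(2)[OF cor_nm(5)] blk_orth'(2)[OF cor_intros(6)[OF cor_nm(4)]] blk_orth'(1)[OF cl] by auto
  have SL: "S (Suc n) x * adj (Schur_row n) = s *c adj (node_row n) - S n x * l"
    unfolding S_Suc aL s_def[symmetric]
    by (simp add: algebra_simps z1 blk_adj_blk mult.assoc)
  have gl: "adj (g n) = adj (node_row n) - adj (V n) * l"
    unfolding g_def adj_mult V_Suc aL
    by (simp add: algebra_simps z1 blk_adj_blk mult.assoc)
  have Vl: "adj (V n) * l = S n x * l - x *c (S n x * (Ts n * l))"
    unfolding S_Ts[OF assms(2), symmetric] by (simp add: left_diff_distrib mult.assoc)
  have SP: "S n x * (Pick_inv n * (Pick n * A)) = S n x * A" for A
  proof -
    have "S n x * (Pick_inv n * (Pick n * A)) = S n x * ((Pick_inv n * Pick n) * A)" by (simp only: mult.assoc)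
    then show ?thesis by (simp add: P corD[OF cor_nm(5)])
  qed
  \<comment> \<open>the product of the first factors, evaluated on the columns that the next factor uses\<close>
  have key: "Potapov n x * adj (g n) = adj (node_row n) - (1 / s) *c (S n x * l)"
  proof -
    have J: "- (\<i> *c (V n * (Jm m * adj (g n)))) = (1 / cnj (z n)) *c last_col n - Pick n * (Ts n * l)"
    proof -
      have "- (\<i> *c (V n * (Jm m * adj (g n))))
        = - (\<i> *c (V n * (Jm m * adj (node_row n)))) - (- (\<i> *c (V n * (Jm m * adj (V n))))) * l"
        by (simp add: gl right_diff_distrib cscale_distrib mult.assoc)
      also have "\<dots> = (1 / cnj (z n)) *c last_col n - Pick n * (Ts n * l)"
        unfolding last_col_Lyapunov[symmetric] Pick_Lyapunov[symmetric] by (simp add: left_diff_distrib mult.assoc Pl)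
      finally show ?thesis .
    qed
    have "Potapov n x * adj (g n) = adj (g n) + x *c (S n x * (Pick_inv n * (- (\<i> *c (V n * (Jm m * adj (g n)))))))"
      unfolding IH by (simp add: left_diff_distrib mult.assoc mult.commute)
    also have "\<dots> = adj (g n) + x *c ((1 / cnj (z n)) *c (S n x * l) - S n x * (Ts n * l))"
      unfolding J by (simp add: right_diff_distrib SP) (simp add: l_def mult.assoc)
    also have "\<dots> = adj (node_row n) - (1 / s) *c (S n x * l)"
      unfolding gl Vl s(2) by (simp add: cscale_distrib algebra_simps)
    finally show ?thesis .
  qed
  have SL': "S (Suc n) x * adj (Schur_row n) = s *c (Potapov n x * adj (g n))"
    unfolding SL key using s(1) by (simp add: cscale_distrib)
  have z2: "S (Suc n) x * (Pick_inv n * A) = S n x * (Pick_inv n * A)" for A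
  proof -
    have "blk m n * Pick_inv n = 0" by (rule blk_orth'(1)[OF P(1)])
    then show ?thesis by (simp add: S_Suc distrib_right mult.assoc) (simp flip: mult.assoc)
  qed
  have z3: "Pick_inv n * (V (Suc n) * A) = Pick_inv n * (V n * A)" for A
  proof -
    have "Pick_inv n * adj (blk m n) = 0" by (rule blk_orth'(2)[OF P(1)])
    then show ?thesis by (simp add: V_Suc distrib_left distrib_right mult.assoc) (simp flip: mult.assoc)
  qed
  have "S (Suc n) x * (Pick_inv (Suc n) * (V (Suc n) * Jm m))
     = S n x * (Pick_inv n * (V n * Jm m)) + (S (Suc n) x * adj (Schur_row n)) * (Schur_inv n * ((Schur_row n * V (Suc n)) * Jm m))"
    unfolding Pick_inv_Suc by (simp add: distrib_left distrib_right mult.assoc z2 z3)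
  also have "\<dots> = S n x * (Pick_inv n * (V n * Jm m)) + s *c (Potapov n x * (adj (g n) * (Schur_inv n * (g n * Jm m))))"
    unfolding SL' g_def[symmetric] by (simp add: mult.assoc)
  finally have e: "S (Suc n) x * (Pick_inv (Suc n) * (V (Suc n) * Jm m))
    = S n x * (Pick_inv n * (V n * Jm m)) + s *c (Potapov n x * (adj (g n) * (Schur_inv n * (g n * Jm m))))" .
  have "1 - (\<i> * x) *c (S (Suc n) x * (Pick_inv (Suc n) * (V (Suc n) * Jm m)))
    = (1 - (\<i> * x) *c (S n x * (Pick_inv n * (V n * Jm m))))
      + (- (\<i> * x * s)) *c (Potapov n x * (adj (g n) * (Schur_inv n * (g n * Jm m))))"
    unfolding e by (simp add: cscale_distrib)
  also have "\<dots> = Potapov n x + (- (\<i> * x * s)) *c (Potapov n x * (adj (g n) * (Schur_inv n * (g n * Jm m))))"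
    by (simp only: IH[symmetric])
  also have "\<dots> = Potapov (Suc n) x"
    unfolding s_def zeta_eq[OF assms(2), symmetric]
    by (simp add: factor_def elem_def distrib_left mult.assoc)
  finally show ?case by simp
qed

definition X :: "nat \<Rightarrow> complex \<Rightarrow> fmat" where "X n x = - (Potapov n x * (Jm m * adj (Potapov n x)))"

text \<open>Insert the closed form of the product; the mixed term contains \<open>V J
  V\<^sup>*\<close>, which the Lyapunov identity replaces by Pick matrices that cancel
  against their inverses.\<close>
lemma X_closed:
  assumes kp: "nondegenerate n" and x: "0 < Im x"
  shows "X n x = - Jm m - (2 * Im x) *\<^sub>R (S n x * (Pick_inv n * adj (S n x)))"
proof -
  note P = Pick_inv_props[OF kp]
  let ?S = "S n x" and ?P = "Pick_inv n" and ?V = "V n" and ?J = "Jm m"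
  let ?e = "dg (2 * m)"
  have J_J_mult: "?J * (?J * A) = ?e * A" for A by (simp add: Jm_Jm flip: mult.assoc)
  have Ve: "?V * ?e = ?V" "?e * adj ?V = adj ?V" "?V * (?e * A) = ?V * A" for A
    using corD[OF cor_nm(4)[of n]] corD[OF cor_intros(6)[OF cor_nm(4)[of n]]] by auto
  have Ve': "?V * dg (m * 2) = ?V" using Ve(1) by (simp add: mult.commute)
  have SV: "adj ?V = ?S - x *c (?S * Ts n)" using S_Ts[OF x] by simp
  have SV': "?V = adj ?S - cnj x *c (adj (Ts n) * adj ?S)" using arg_cong[OF SV, of adj] by simp
  have B: "Potapov n x = 1 - (\<i> * x) *c (?S * (?P * (?V * ?J)))" by (rule Potapov_closed[OF kp x])
  have aB: "adj (Potapov n x) = 1 + (\<i> * cnj x) *c (?J * (adj ?V * (?P * adj ?S)))"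
    unfolding B by (simp add: adj_Jm P(4) mult.assoc)
  have 1: "?J * adj (Potapov n x) = ?J + (\<i> * cnj x) *c (adj ?V * (?P * adj ?S))"
    unfolding aB by (simp add: distrib_left J_J_mult Ve mult.assoc[symmetric]) (simp add: mult.assoc J_J_mult Ve)
  have PP: "?P * (Pick n * (Ts n * (?P * A))) = dg (n * m) * (Ts n * (?P * A))" for A
    using P(3) by (simp flip: mult.assoc)
  have PP': "?P * (adj (Ts n) * (Pick n * (?P * adj ?S))) = ?P * (adj (Ts n) * adj ?S)"
  proof -
    have "Pick n * (?P * adj ?S) = adj ?S"
      using P(5) corD[OF cor_intros(6)[OF cor_nm(5)[of n x]]] by (simp flip: mult.assoc)
    then show ?thesis by simp
  qed
  have VJV: "?V * (?J * (adj ?V * A)) = \<i> *c (Pick n * (Ts n * A)) - \<i> *c (adj (Ts n) * (Pick n * A))" for A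
  proof -
    have "\<i> *c (Pick n * Ts n - adj (Ts n) * Pick n) = ?V * (?J * adj ?V)"
      unfolding Pick_Lyapunov by simp
    then have "(?V * (?J * adj ?V)) * A = (\<i> *c (Pick n * Ts n - adj (Ts n) * Pick n)) * A" by simp
    then show ?thesis by (simp add: mult.assoc left_diff_distrib cscale_distrib)
  qed
  have "Potapov n x * (?J * adj (Potapov n x)) = Potapov n x * (?J + (\<i> * cnj x) *c (adj ?V * (?P * adj ?S)))"
    by (simp only: 1)
  also have "\<dots> = ?J + (\<i> * cnj x) *c (adj ?V * (?P * adj ?S))
      - (\<i> * x) *c (?S * (?P * ?V)) + (x * cnj x) *c (?S * (?P * (?V * (?J * (adj ?V * (?P * adj ?S))))))"
    unfolding B by (simp add: left_diff_distrib distrib_left cscale_distrib mult.assoc Jm_Jm Ve Ve' algebra_simps)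
  also have "?S * (?P * (?V * (?J * (adj ?V * (?P * adj ?S)))))
      = \<i> *c (?S * (Ts n * (?P * adj ?S))) - \<i> *c (?S * (?P * (adj (Ts n) * adj ?S)))"
    unfolding VJV by (simp add: right_diff_distrib PP PP' corD[OF cor_nm(5)])
  also have "adj ?V * (?P * adj ?S) = ?S * (?P * adj ?S) - x *c (?S * (Ts n * (?P * adj ?S)))"
    unfolding SV by (simp add: left_diff_distrib mult.assoc)
  also have "?S * (?P * ?V) = ?S * (?P * adj ?S) - cnj x *c (?S * (?P * (adj (Ts n) * adj ?S)))"
    unfolding SV' by (simp add: right_diff_distrib)
  finally have "Potapov n x * (?J * adj (Potapov n x)) = ?J + (\<i> * cnj x - \<i> * x) *c (?S * (?P * adj ?S))"
    by (simp add: cscale_distrib algebra_simps)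
  also have "\<i> * cnj x - \<i> * x = complex_of_real (2 * Im x)"
    by (simp add: complex_eq_iff)
  finally show ?thesis by (simp add: X_def scaleR_cscale)
qed

text \<open>The row \<open>(w\<^sub>0, -I)\<close>, on which the \<open>J\<close>-form is a
  multiple of the imaginary part of \<open>w\<^sub>0\<close>.\<close>
definition value_row :: "fmat \<Rightarrow> fmat" where "value_row w0 = w0 * blk m 0 - blk m 1"

lemma value_row_adj_node_row:
  assumes "cor m m w0" shows "value_row w0 * adj (node_row k) = w0 - adj (w k)"
  using corD[OF assms]
  by (simp add: value_row_def adj_node_row left_diff_distrib distrib_left mult.assoc blk_adj_blk blk_adj_blk_mult)

lemma value_row_J_value_row:
  assumes "cor m m w0"
  shows "value_row w0 * (Jm m * adj (value_row w0)) = \<i> *c (w0 - adj w0)"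
proof -
  have "value_row w0 * Jm m = - (\<i> *c (w0 * blk m 1)) - \<i> *c blk m 0"
    by (simp only: value_row_def left_diff_distrib mult.assoc blk_Jm cscale_mult mult_minus_right)
  moreover have "adj (value_row w0) = adj (blk m 0) * adj w0 - adj (blk m 1)"
    by (simp add: value_row_def)
  ultimately have "(value_row w0 * Jm m) * adj (value_row w0) = \<i> *c (w0 - adj w0)"
    using corD[OF assms] corD[OF cor_intros(6)[OF assms]]
    by (simp add: left_diff_distrib right_diff_distrib mult.assoc blk_adj_blk blk_adj_blk_mult cscale_distrib)
  then show ?thesis by (simp add: mult.assoc)
qed

text \<open>At \<open>x = z\<^sub>n\<close> the row \<open>(w\<^sub>n, -I)\<close> turns
  \<open>S n x\<close> into a multiple of the last column of the bordered Pick matrix, and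
  the closed form of \<open>X\<close> into a Schur complement. So whether one more
  interpolation condition can be met is decided by a quadratic inequality for the
  value.\<close>
lemma Schur_eq_ball:
  assumes kp: "nondegenerate n"
  shows "value_row (w n) * (X n (z n) * adj (value_row (w n))) = (2 * Im (z n) / (cmod (z n))\<^sup>2) *\<^sub>R Schur n"
proof -
  let ?x = "z n" and ?y = "value_row (w n)"
  have cz: "1 - ?x / cnj (z k) \<noteq> 0" for k
  proof -
    have "?x \<noteq> cnj (z k)" using Im_z[of k] Im_z[of n] by (auto simp: complex_eq_iff)
    then show ?thesis using z_nz(1)[of k] by simp
  qed
  have "(- ?x) * (1 / (1 - ?x / cnj (z k))) = ?x * cnj (z k) / (?x - cnj (z k))" for k
  proof -
    define d where "d = ?x - cnj (z k)"
    have "1 - ?x / cnj (z k) = - (d / cnj (z k))" using z_nz(1)[of k] by (simp add: d_def field_simps)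
    moreover have "d \<noteq> 0" using z_nz(2)[of n k] by (simp add: d_def)
    ultimately show ?thesis unfolding d_def[symmetric] using z_nz(1)[of k] by simp
  qed
  then have "adj (last_col n) = (- ?x) *c (?y * S n ?x)"
    unfolding adj_last_col S_def pick_block_def
    by (simp only: sum_distrib_left cscale_sum cscale_mult cscale_simps(1) mult.assoc[symmetric] value_row_adj_node_row[OF cor_w])
  then have ab: "?y * S n ?x = (- 1 / ?x) *c adj (last_col n)" using z_nz(1)[of n] by simp
  from arg_cong[OF this, of adj] have ab': "adj (S n ?x) * adj ?y = (- 1 / cnj ?x) *c last_col n" by simp
  have "?y * (X n ?x * adj ?y) = - (?y * (Jm m * adj ?y)) - (2 * Im ?x) *\<^sub>R ((?y * S n ?x) * (Pick_inv n * (adj (S n ?x) * adj ?y)))"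
    unfolding X_closed[OF kp Im_z] by (simp add: left_diff_distrib right_diff_distrib mult.assoc)
  also have "\<dots> = - (\<i> *c (w n - adj (w n))) - (2 * Im ?x / (?x * cnj ?x)) *c (adj (last_col n) * (Pick_inv n * last_col n))"
    unfolding ab ab' value_row_J_value_row[OF cor_w] by (simp add: scaleR_cscale mult.commute)
  also have "- (\<i> *c (w n - adj (w n))) = (2 * Im ?x / (?x * cnj ?x)) *c pick_block n n"
  proof -
    have "complex_of_real (2 * Im ?x) = - \<i> * (?x - cnj ?x)" by (simp add: complex_eq_iff)
    then have "complex_of_real (2 * Im ?x) / (?x * cnj ?x) * (?x * cnj ?x / (?x - cnj ?x)) = - \<i>"
      using z_nz(1)[of n] z_nz(2)[of n n] by simp
    then show ?thesis by (simp add: pick_block_def)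
  qed
  also have "?x * cnj ?x = complex_of_real ((cmod ?x)\<^sup>2)" by (simp only: complex_norm_square)
  finally show ?thesis
    by (simp add: Schur_def scaleR_cscale cscale_distrib)
qed

end

(*%FILE B3*)
section \<open>Removal of the phases\<close>

text \<open>As \<open>-P\<close> is idempotent, \<open>a \<mapsto> 1 + (1 - a) P\<close> is
  multiplicative.\<close>
lemma proj_calculus:
  assumes "(P::fmat) * P = - P"
  shows "(1 + (1 - a) *c P) * (1 + (1 - c) *c P) = 1 + (1 - a * c) *c P"
    "P * (1 + (1 - c) *c P) = c *c P" "(1 + (1 - c) *c P) * P = c *c P"
  using assms by (simp_all add: distrib_left distrib_right cscale_distrib algebra_simps)

text \<open>Definiteness of all Pick matrices, required here through the Schur
  complements.\<close>
locale pick_point = pick_data +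
  fixes x :: complex
  assumes m_pos: "0 < m" and Im_x: "0 < Im x" and x_z: "x \<noteq> z k" and kp: "pd m (Schur k)"
begin

lemma nondegenerate_all: "nondegenerate n" by (simp add: nondegenerate_def kp)

abbreviation "J \<equiv> Jm m"
abbreviation "e \<equiv> dg (2 * m)"

lemmas Schur_inv = cinv[OF kp, folded Schur_inv_def]
lemmas cor_g_all = cor_g[OF nondegenerate_all]
lemmas g_J_g_all = g_J_g[OF nondegenerate_all]

lemma g_J_g_mult: "g n * (J * (adj (g n) * A)) = - ((1 / complex_of_real (node_weight n)) *c (Schur n * A))"
proof -
  have "g n * (J * (adj (g n) * A)) = (g n * (J * adj (g n))) * A" by (simp only: mult.assoc)
  then show ?thesis unfolding g_J_g_all by simp
qed

lemma Schur_inverse_mult: "Schur n * (Schur_inv n * A) = dg m * A" "Schur_inv n * (Schur n * A) = dg m * A"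
  using Schur_inv(2,3)[of n] by (simp_all flip: mult.assoc)

lemma node_weight_ne: "complex_of_real (node_weight n) \<noteq> 0" using node_weight_pos[of n] by simp

lemma elem_elem: "elem n * elem n = - elem n"
  unfolding elem_def using node_weight_ne[of n] corD[OF cor_g_all[of n]]
  by (simp add: mult.assoc g_J_g_mult Schur_inverse_mult)

lemma N0_J: "N0 n * J = elem n"
  by (simp add: N0_def elem_def mult.assoc)

lemma cor_N0: "cor (2 * m) (2 * m) (N0 n)"
  unfolding N0_def by (intro cor_intros(5) cor_mult[OF cor_intros(6)[OF cor_g_all] cor_mult[OF Schur_inv(1) cor_g_all]])

lemma cor_elem: "cor (2 * m) (2 * m) (elem n)"
  unfolding N0_J[symmetric] by (rule cor_mult[OF cor_N0 cor_Jm])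

lemma N0_psd: "0 \<le> N0 n"
  unfolding N0_def scaleR_cscale[symmetric]
  using node_weight_pos[of n] psd_cong[OF pd_psd[OF Schur_inv(4)], of "adj (g n)"]
  by (intro scaleR_nonneg_nonneg) (simp_all add: mult.assoc)

lemma J_J_mult: "J * (J * A) = e * A"
  by (simp add: Jm_Jm flip: mult.assoc)

lemma elem_J: "elem n * J = N0 n" "J * adj (elem n) = N0 n" "adj (elem n) = J * N0 n"
proof -
  show "elem n * J = N0 n" unfolding N0_J[symmetric] using corD[OF cor_N0] by (simp add: mult.assoc Jm_Jm)
  show a: "adj (elem n) = J * N0 n" unfolding N0_J[symmetric] by (simp add: adj_Jm psd_adj[OF N0_psd])
  show "J * adj (elem n) = N0 n" unfolding a J_J_mult using corD[OF cor_N0] by simp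
qed

definition M0 :: "nat \<Rightarrow> fmat" where "M0 n = J * (N0 n * J)"

lemma M0_psd: "0 \<le> M0 n"
  unfolding M0_def using psd_cong[OF N0_psd, of J] by (simp add: adj_Jm mult.assoc)

text \<open>So the factor is expansive with respect to \<open>J\<close> for
  \<open>\<bar>a\<bar> \<le> 1\<close> and unitary for \<open>\<bar>a\<bar> =
  1\<close>.\<close>
lemma factor_J: "(1 + (1 - a) *c elem n) * (J * adj (1 + (1 - a) *c elem n)) = J + (1 - (cmod a)\<^sup>2) *\<^sub>R N0 n"
proof -
  have "J * adj (1 + (1 - a) *c elem n) = J + (1 - cnj a) *c N0 n"
    by (simp add: distrib_left elem_J(2))
  then have "(1 + (1 - a) *c elem n) * (J * adj (1 + (1 - a) *c elem n))
      = J + (1 - cnj a) *c N0 n + (1 - a) *c N0 n - ((1 - a) * (1 - cnj a)) *c N0 n"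
  proof -
    have "elem n * N0 n = - N0 n"
      using elem_elem[of n] unfolding elem_J(1)[symmetric] by (simp flip: mult.assoc)
    then show ?thesis using \<open>J * adj _ = _\<close>
      by (simp add: distrib_left distrib_right elem_J(1,2) cscale_distrib algebra_simps)
  qed
  also have "\<dots> = J + (1 - a * cnj a) *c N0 n"
    by (simp add: cscale_distrib algebra_simps)
  also have "1 - a * cnj a = complex_of_real (1 - (cmod a)\<^sup>2)"
    by (simp add: complex_norm_square[symmetric] del: of_real_power)
  finally show ?thesis by (simp only: scaleR_cscale)
qed

lemma factor_J': "adj (1 + (1 - a) *c elem n) * (J * (1 + (1 - a) *c elem n)) = J + (1 - (cmod a)\<^sup>2) *\<^sub>R M0 n"
proof -
  have JP: "J * elem n = M0 n" "adj (elem n) * J = M0 n"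
    by (simp_all add: M0_def N0_J elem_J mult.assoc)
  have AM: "adj (elem n) * M0 n = - M0 n"
  proof -
    have "adj (elem n) * (J * elem n) = (adj (elem n) * J) * elem n" by (simp only: mult.assoc)
    also have "\<dots> = (J * elem n) * elem n" by (simp only: JP)
    also have "\<dots> = J * (elem n * elem n)" by (simp only: mult.assoc)
    finally show ?thesis by (simp add: JP elem_elem)
  qed
  have "J * (1 + (1 - a) *c elem n) = J + (1 - a) *c M0 n"
    by (simp add: distrib_left JP)
  then have "adj (1 + (1 - a) *c elem n) * (J * (1 + (1 - a) *c elem n))
      = J + (1 - a) *c M0 n + (1 - cnj a) *c M0 n - ((1 - a) * (1 - cnj a)) *c M0 n"
    by (simp add: distrib_left distrib_right JP AM cscale_distrib algebra_simps)
  also have "\<dots> = J + (1 - a * cnj a) *c M0 n"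
    by (simp add: cscale_distrib algebra_simps)
  also have "1 - a * cnj a = complex_of_real (1 - (cmod a)\<^sup>2)"
    by (simp add: complex_norm_square[symmetric] del: of_real_power)
  finally show ?thesis by (simp only: scaleR_cscale)
qed

text \<open>The Blaschke factor at the point \<open>x\<close> and its phase.\<close>
definition ze :: "nat \<Rightarrow> complex" where "ze n = zeta n x"
definition ph :: "nat \<Rightarrow> complex" where "ph n = exp (\<i> * Arg (ze n))"

lemma x_cz: "x - cnj (z n) \<noteq> 0" "x - z n \<noteq> 0"
  using Im_x Im_z[of n] x_z[of n] by (auto simp: complex_eq_iff)

lemma ze_nz: "ze n \<noteq> 0"
  using x_cz[of n] z_nz(1)[of n] by (simp add: ze_def zeta_def blaschke_def)

lemma cmod_ze: "cmod (ze n) = cmod (x - z n) / cmod (x - cnj (z n))"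
  using z_nz(1)[of n] by (simp add: ze_def zeta_def blaschke_def norm_mult norm_divide)

lemma one_minus_ze: "1 - (cmod (ze n))\<^sup>2 = 4 * Im x * Im (z n) / (cmod (x - cnj (z n)))\<^sup>2"
proof -
  have "(cmod (x - cnj (z n)))\<^sup>2 - (cmod (x - z n))\<^sup>2 = 4 * Im x * Im (z n)"
    by (simp add: cmod_power2) (simp add: power2_eq_square algebra_simps)
  moreover have "1 - (cmod (ze n))\<^sup>2 = ((cmod (x - cnj (z n)))\<^sup>2 - (cmod (x - z n))\<^sup>2) / (cmod (x - cnj (z n)))\<^sup>2"
    unfolding cmod_ze using x_cz[of n] by (simp add: power_divide diff_divide_distrib)
  ultimately show ?thesis by (simp only:)
qed

lemma ze_lt_1: "cmod (ze n) < 1"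
proof -
  have "0 < 1 - (cmod (ze n))\<^sup>2"
    unfolding one_minus_ze using Im_x Im_z[of n] x_cz[of n] by simp
  then show ?thesis by (simp add: power_less_one_iff abs_square_less_1[symmetric])
qed

lemma coef_eq: "Im (z n) / (cmod (x - z n))\<^sup>2 = (1 / (cmod (ze n))\<^sup>2 - 1) / (4 * Im x)"
proof -
  have "(1 / (cmod (ze n))\<^sup>2 - 1) = (1 - (cmod (ze n))\<^sup>2) / (cmod (ze n))\<^sup>2"
    using ze_nz[of n] by (simp add: field_simps)
  also have "\<dots> = (4 * Im x * Im (z n) / (cmod (x - cnj (z n)))\<^sup>2)
      / ((cmod (x - z n))\<^sup>2 / (cmod (x - cnj (z n)))\<^sup>2)"
    by (simp only: one_minus_ze) (simp add: cmod_ze power_divide)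
  also have "\<dots> = 4 * Im x * Im (z n) / (cmod (x - z n))\<^sup>2"
    using x_cz[of n] by simp
  finally show ?thesis using Im_x by simp
qed

lemma ph_props: "ze n = cmod (ze n) * ph n" "cmod (ph n) = 1" "ph n * cnj (ph n) = 1" "ph n \<noteq> 0"
proof -
  show "ze n = cmod (ze n) * ph n" unfolding ph_def using Arg_eq[OF ze_nz[of n]] by simp
  show 1: "cmod (ph n) = 1" by (simp add: ph_def)
  then show "ph n * cnj (ph n) = 1" using complex_norm_square[of "ph n"] by simp
  show "ph n \<noteq> 0" using 1 by auto
qed

abbreviation "fac a n \<equiv> 1 + (1 - a) *c elem n"

text \<open>The matrices that remove the phases. With \<open>\<phi>\<close> the argument of
  the Blaschke factor, \<open>fac (ph n) n\<close> is the exponential of \<open>-\<i>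
  \<phi>\<close> times the elementary matrix, and \<open>U n\<close> is the product of these
  exponentials in the original order. Conjugating each of them by its predecessors reverses
  the order, which gives the product of exponentials of the modified matrices.\<close>
primrec U :: "nat \<Rightarrow> fmat" where "U 0 = 1" | "U (Suc n) = U n * fac (ph n) n"
primrec Ui :: "nat \<Rightarrow> fmat" where "Ui 0 = 1" | "Ui (Suc n) = fac (cnj (ph n)) n * Ui n"
primrec Potapov_inv :: "nat \<Rightarrow> fmat" where "Potapov_inv 0 = 1" | "Potapov_inv (Suc n) = fac (1 / ze n) n * Potapov_inv n"
text \<open>The Blaschke-Potapov product at \<open>x\<close> with its phases removed, its
  inverse, the modified matrix times \<open>J\<close>, and the inverse of \<open>X n
  x\<close>.\<close>
definition H :: "nat \<Rightarrow> fmat" where "H n = Potapov n x * Ui n"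
definition Hi :: "nat \<Rightarrow> fmat" where "Hi n = U n * Potapov_inv n"
definition N :: "nat \<Rightarrow> fmat" where "N n = U n * (N0 n * adj (U n))"
definition Xi :: "nat \<Rightarrow> fmat" where "Xi n = - (adj (Potapov_inv n) * (J * Potapov_inv n))"

lemma factor_eq_fac: "factor n x = fac (ze n) n"
  by (simp add: factor_def ze_def)

lemmas fac_calculus = proj_calculus[OF elem_elem]

lemma U_Ui: "U n * Ui n = 1" "Ui n * U n = 1"
proof (induction n)
  case (Suc n)
  { case 1
    have "U (Suc n) * Ui (Suc n) = U n * ((fac (ph n) n * fac (cnj (ph n)) n) * Ui n)"
      by (simp only: U.simps Ui.simps mult.assoc)
    then show ?case unfolding fac_calculus ph_props(3) by (simp add: Suc) }
  { case 2
    have "Ui (Suc n) * U (Suc n) = fac (cnj (ph n)) n * ((Ui n * U n) * fac (ph n) n)"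
      by (simp only: U.simps Ui.simps mult.assoc)
    then have "Ui (Suc n) * U (Suc n) = fac (cnj (ph n)) n * fac (ph n) n" by (simp only: Suc mult_1)
    then show ?case unfolding fac_calculus using ph_props(3)[of n] by (simp add: mult.commute) }
qed simp_all

lemma Potapov_inverse: "Potapov n x * Potapov_inv n = 1" "Potapov_inv n * Potapov n x = 1"
proof (induction n)
  case (Suc n)
  { case 1
    have "Potapov (Suc n) x * Potapov_inv (Suc n) = Potapov n x * ((fac (ze n) n * fac (1 / ze n) n) * Potapov_inv n)"
      by (simp only: Potapov.simps Potapov_inv.simps mult.assoc factor_eq_fac)
    then show ?case unfolding fac_calculus using ze_nz[of n] by (simp add: Suc) }
  { case 2
    have "Potapov_inv (Suc n) * Potapov (Suc n) x = fac (1 / ze n) n * ((Potapov_inv n * Potapov n x) * fac (ze n) n)"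
      by (simp only: Potapov.simps Potapov_inv.simps mult.assoc factor_eq_fac)
    then have "Potapov_inv (Suc n) * Potapov (Suc n) x = fac (1 / ze n) n * fac (ze n) n" by (simp only: Suc mult_1)
    then show ?case unfolding fac_calculus using ze_nz[of n] by simp }
qed simp_all

lemma inverse_cancel: "U n * (Ui n * A) = A" "Ui n * (U n * A) = A" "Potapov n x * (Potapov_inv n * A) = A" "Potapov_inv n * (Potapov n x * A) = A"
  by (simp_all add: U_Ui Potapov_inverse flip: mult.assoc)

lemma H_Hi: "H n * Hi n = 1" "Hi n * H n = 1"
  unfolding H_def Hi_def by (simp_all add: mult.assoc inverse_cancel U_Ui Potapov_inverse)

lemma adj_U_J: "adj (U n) * J = J * Ui n"
proof (induction n)
  case (Suc n)
  have "adj (fac (ph n) n) * J = J * fac (cnj (ph n)) n"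
    by (simp add: distrib_left distrib_right elem_J N0_J mult.assoc)
  have "adj (U (Suc n)) * J = adj (fac (ph n) n) * (adj (U n) * J)" by (simp only: U.simps adj_mult mult.assoc)
  also have "\<dots> = (adj (fac (ph n) n) * J) * Ui n" unfolding Suc by (simp only: mult.assoc)
  also have "\<dots> = J * Ui (Suc n)" unfolding \<open>adj (fac (ph n) n) * J = _\<close> by (simp only: Ui.simps mult.assoc)
  finally show ?case .
qed simp

lemma N_J: "N n * J = U n * (elem n * Ui n)"
  unfolding N_def N0_J[symmetric] by (simp add: mult.assoc adj_U_J)

lemma N_psd: "0 \<le> N n"
  unfolding N_def using psd_cong[OF N0_psd, of "U n"] by (simp add: mult.assoc)

lemma corner_commute_fac: "e * fac a n = fac a n * e" "e * (fac a n * A) = fac a n * (e * A)"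
proof -
  show *: "e * fac a n = fac a n * e"
    using corD[OF cor_elem[of n]] by (simp add: distrib_left distrib_right)
  show "e * (fac a n * A) = fac a n * (e * A)" using * by (simp only: mult.assoc[symmetric])
qed

lemma corner_commute: "e * U n = U n * e" "e * Ui n = Ui n * e" "e * Potapov n x = Potapov n x * e" "e * Potapov_inv n = Potapov_inv n * e"
proof (induction n)
  case (Suc n)
  { case 1 show ?case unfolding U.simps by (metis Suc(1) corner_commute_fac(1) mult.assoc) }
  { case 2 show ?case unfolding Ui.simps by (metis Suc(2) corner_commute_fac(1) mult.assoc) }
  { case 3 show ?case unfolding Potapov.simps factor_eq_fac by (metis Suc(3) corner_commute_fac(1) mult.assoc) }
  { case 4 show ?case unfolding Potapov_inv.simps by (metis Suc(4) corner_commute_fac(1) mult.assoc) }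
qed simp_all

lemma corner_commute_adj: "e * adj (U n) = adj (U n) * e" "e * adj (Potapov n x) = adj (Potapov n x) * e" "e * adj (Potapov_inv n) = adj (Potapov_inv n) * e"
  using arg_cong[OF corner_commute(1)[of n], of adj] arg_cong[OF corner_commute(3)[of n], of adj] arg_cong[OF corner_commute(4)[of n], of adj]
  by simp_all

lemma corner_commute_H: "e * H n = H n * e" "e * Hi n = Hi n * e"
proof -
  show "e * H n = H n * e" unfolding H_def by (metis corner_commute(2,3) mult.assoc)
  show "e * Hi n = Hi n * e" unfolding Hi_def by (metis corner_commute(1,4) mult.assoc)
qed

lemma cor_commuting:
  assumes "cor (2 * m) (2 * m) Y" "e * A = A * e"
  shows "cor (2 * m) (2 * m) (A * Y)" "cor (2 * m) (2 * m) (Y * A)"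
proof -
  have "e * (A * Y) = A * (e * Y)" by (metis assms(2) mult.assoc)
  moreover have "(Y * A) * e = (Y * e) * A" by (metis assms(2) mult.assoc)
  ultimately show "cor (2 * m) (2 * m) (A * Y)" "cor (2 * m) (2 * m) (Y * A)"
    unfolding cor_def using corD[OF assms(1)] by (simp_all add: mult.assoc)
qed

lemma cor_N: "cor (2 * m) (2 * m) (N n)"
  unfolding N_def by (intro cor_commuting cor_N0 corner_commute corner_commute_adj)

lemma cor_X: "cor (2 * m) (2 * m) (X n x)"
  unfolding X_def by (intro cor_intros(4) cor_commuting cor_Jm corner_commute corner_commute_adj)

lemma cor_Xi: "cor (2 * m) (2 * m) (Xi n)"
  unfolding Xi_def by (intro cor_intros(4) cor_commuting cor_Jm corner_commute corner_commute_adj)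

lemma cor_He: "cor (2 * m) (2 * m) (H n * e)" "cor (2 * m) (2 * m) (Hi n * e)"
  by (intro cor_commuting cor_intros corner_commute_H)+

lemma adj_X: "adj (X n x) = X n x" "adj (Xi n) = Xi n"
  by (simp_all add: X_def Xi_def adj_Jm mult.assoc)

lemma X_Suc: "X (Suc n) x = X n x - (1 - (cmod (ze n))\<^sup>2) *\<^sub>R (Potapov n x * (N0 n * adj (Potapov n x)))"
proof -
  have "X (Suc n) x = - (Potapov n x * ((fac (ze n) n * (J * adj (fac (ze n) n))) * adj (Potapov n x)))"
    by (simp only: X_def Potapov.simps factor_eq_fac adj_mult mult.assoc)
  then show ?thesis unfolding factor_J X_def by (simp add: distrib_left distrib_right mult.assoc)
qed

lemma Xi_Suc: "Xi (Suc n) = Xi n + (1 / (cmod (ze n))\<^sup>2 - 1) *\<^sub>R (adj (Potapov_inv n) * (M0 n * Potapov_inv n))"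
proof -
  have "Xi (Suc n) = - (adj (Potapov_inv n) * ((adj (fac (1 / ze n) n) * (J * fac (1 / ze n) n)) * Potapov_inv n))"
    by (simp only: Xi_def Potapov_inv.simps adj_mult mult.assoc)
  then show ?thesis unfolding factor_J' Xi_def[of n]
    by (simp add: distrib_left distrib_right left_diff_distrib right_diff_distrib mult.assoc norm_divide
        power_divide scaleR_left_diff_distrib)
qed

text \<open>Both monotonicity statements come from the \<open>J\<close>-form of one
  elementary factor.\<close>
lemma X_dec: "X (Suc n) x \<le> X n x"
proof -
  have "0 \<le> (1 - (cmod (ze n))\<^sup>2) *\<^sub>R (Potapov n x * (N0 n * adj (Potapov n x)))"
    using ze_lt_1[of n] psd_cong[OF N0_psd, of "Potapov n x"]
    by (intro scaleR_nonneg_nonneg) (simp_all add: mult.assoc power_le_one_iff)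
  then show ?thesis unfolding X_Suc by simp
qed

lemma inv_ze_ge: "0 \<le> 1 / (cmod (ze n))\<^sup>2 - 1"
  using ze_lt_1[of n] ze_nz[of n] by (simp add: field_simps power_le_one_iff)

lemma Xi_inc: "Xi n \<le> Xi (Suc n)"
proof -
  have "0 \<le> (1 / (cmod (ze n))\<^sup>2 - 1) *\<^sub>R (adj (Potapov_inv n) * (M0 n * Potapov_inv n))"
    using inv_ze_ge psd_cong[OF M0_psd, of "adj (Potapov_inv n)"]
    by (intro scaleR_nonneg_nonneg) (simp_all add: mult.assoc)
  then show ?thesis unfolding Xi_Suc by simp
qed

lemma X_Xi: "X n x * Xi n = e" "Xi n * X n x = e"
proof -
  have "X n x * Xi n = Potapov n x * (J * ((adj (Potapov n x) * adj (Potapov_inv n)) * (J * Potapov_inv n)))"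
    by (simp add: X_def Xi_def mult.assoc)
  also have "adj (Potapov n x) * adj (Potapov_inv n) = 1" using arg_cong[OF Potapov_inverse(2), of adj] by simp
  finally have "X n x * Xi n = Potapov n x * (e * Potapov_inv n)" by (simp add: J_J_mult)
  then show *: "X n x * Xi n = e" by (simp add: corner_commute inverse_cancel)
  show "Xi n * X n x = e" using arg_cong[OF *, of adj] adj_X by simp
qed

lemma N_J_nz: "N n * J \<noteq> 0"
proof
  assume "N n * J = 0"
  then have "Ui n * (N n * J) * U n = 0" by simp
  then have "elem n = 0" unfolding N_J by (simp add: mult.assoc inverse_cancel U_Ui)
  then have "g n * (J * elem n) = 0" by simp
  then have "g n * J = 0" unfolding elem_def
    using node_weight_ne[of n] corD[OF cor_g_all[of n]] by (simp add: g_J_g_mult Schur_inverse_mult)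
  then have "g n * (J * adj (g n)) = 0" by (simp flip: mult.assoc)
  then have "complex_of_real (node_weight n) *c ((1 / complex_of_real (node_weight n)) *c Schur n) = 0" unfolding g_J_g_all by simp
  then have "Schur n = 0" using node_weight_ne[of n] by simp
  then have "dg m = 0" using Schur_inv(2)[of n] by simp
  then have "ent (dg m) 0 0 = ent 0 0 0" by simp
  then show False using m_pos by (simp add: ent_dg)
qed

text \<open>The negative of \<open>N n * J\<close> is a nonzero idempotent, so its norm is
  at least 1. This keeps the terms of the series away from 0 relative to their
  coefficients.\<close>
lemma nrm_N_J: "1 \<le> nrm (2 * m) (N n * J)"
proof -
  let ?E = "N n * J"
  have cE: "cor (2 * m) (2 * m) ?E" by (rule cor_mult[OF cor_N cor_Jm])
  have "?E * ?E = U n * ((elem n * elem n) * Ui n)" unfolding N_J by (simp add: mult.assoc inverse_cancel)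
  then have "?E * ?E = - ?E" unfolding elem_elem N_J by simp
  then have "nrm (2 * m) ?E = nrm (2 * m) (?E * ?E)" by (simp add: nrm_def)
  also have "\<dots> \<le> nrm (2 * m) ?E * nrm (2 * m) ?E" using cE by (intro nrm_mult) blast
  finally have 1: "nrm (2 * m) ?E \<le> nrm (2 * m) ?E * nrm (2 * m) ?E" .
  have "0 < nrm (2 * m) ?E" using nrm_eq_0[OF cE] N_J_nz nrm_nonneg[of "2 * m" ?E] by force
  then show ?thesis using 1 by simp
qed

text \<open>This is why the phases are removed: the increments of \<open>H\<close> have the
  real coefficients \<open>1 - \<bar>\<zeta>\<bar>\<close>, of the size of those in the
  series, whereas the ones of the original product have the complex coefficients \<open>1 -
  \<zeta>\<close>, which need not be small.\<close>
lemma H_Suc: "H (Suc n) = H n + (1 - cmod (ze n)) *\<^sub>R (H n * (N n * J))"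
proof -
  have ac: "ze n * cnj (ph n) = complex_of_real (cmod (ze n))"
    using ph_props(3)[of n] by (subst ph_props(1)) (simp add: mult.assoc)
  have "H (Suc n) = Potapov n x * ((fac (ze n) n * fac (cnj (ph n)) n) * Ui n)"
    by (simp only: H_def Potapov.simps Ui.simps factor_eq_fac mult.assoc)
  then have "H (Suc n) = H n + (1 - complex_of_real (cmod (ze n))) *c (Potapov n x * (elem n * Ui n))"
    unfolding fac_calculus ac by (simp add: distrib_left distrib_right H_def mult.assoc)
  moreover have "H n * (N n * J) = Potapov n x * (elem n * Ui n)"
    unfolding N_J H_def by (simp add: mult.assoc inverse_cancel)
  ultimately show ?thesis by (simp add: scaleR_cscale)
qed

lemma Hi_Suc: "Hi (Suc n) = Hi n + (1 - 1 / cmod (ze n)) *\<^sub>R ((N n * J) * Hi n)"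
proof -
  have ac: "ph n * (1 / ze n) = complex_of_real (1 / cmod (ze n))"
    using ph_props(4)[of n] ze_nz[of n] by (subst ph_props(1)) simp
  have "Hi (Suc n) = U n * ((fac (ph n) n * fac (1 / ze n) n) * Potapov_inv n)"
    by (simp only: Hi_def U.simps Potapov_inv.simps mult.assoc)
  then have "Hi (Suc n) = Hi n + (1 - complex_of_real (1 / cmod (ze n))) *c (U n * (elem n * Potapov_inv n))"
    unfolding fac_calculus ac by (simp add: distrib_left distrib_right Hi_def mult.assoc)
  moreover have "(N n * J) * Hi n = U n * (elem n * Potapov_inv n)"
    unfolding N_J Hi_def by (simp add: mult.assoc inverse_cancel)
  ultimately show ?thesis by (simp add: scaleR_cscale)
qed

text \<open>The removed factor is \<open>J\<close>-unitary, so the forms do not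
  change.\<close>
lemma X_H: "X n x = - (H n * (J * adj (H n)))" "Xi n = - (adj (Hi n) * (J * Hi n))"
proof -
  have "adj (U n) * (J * U n) = (adj (U n) * J) * U n" by (simp only: mult.assoc)
  also have "\<dots> = J" unfolding adj_U_J by (simp add: mult.assoc U_Ui)
  finally have UJU: "adj (U n) * (J * U n) = J" .
  have UJU': "adj (U n) * (J * (U n * A)) = J * A" for A
    using arg_cong[OF UJU, of "\<lambda>B. B * A"] by (simp add: mult.assoc)
  show "Xi n = - (adj (Hi n) * (J * Hi n))" unfolding Xi_def Hi_def by (simp add: mult.assoc UJU')
  have "Ui n * (J * adj (Ui n)) = J"
  proof -
    have 1: "J * adj (Ui n) = U n * J"
    proof -
      have "adj (J * Ui n) = adj (adj (U n) * J)" by (simp only: adj_U_J)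
      then have "adj (Ui n) * J = J * U n" by (simp add: adj_Jm)
      then have "J * (adj (Ui n) * J) * J = J * (J * U n) * J" by simp
      then have "J * (adj (Ui n) * e) = e * (U n * J)" by (simp add: mult.assoc Jm_Jm J_J_mult)
      moreover have "adj (Ui n) * e = e * adj (Ui n)" using arg_cong[OF corner_commute(2)[of n], of adj] by simp
      ultimately have "(J * e) * adj (Ui n) = (e * U n) * J" by (simp only: mult.assoc)
      then show ?thesis using corD[OF cor_Jm] by (simp add: corner_commute mult.assoc)
    qed
    show ?thesis unfolding 1 by (rule inverse_cancel)
  qed
  then have "Ui n * (J * (adj (Ui n) * A)) = J * A" for A by (metis mult.assoc)
  then show "X n x = - (H n * (J * adj (H n)))" unfolding X_def H_def by (simp add: mult.assoc)
qed

lemma H_Suc': "H (Suc n) = H n - ((1 - cmod (ze n)) *\<^sub>R (Potapov n x * (N0 n * adj (Potapov n x)))) * (Xi n * H n)"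
proof -
  have "Hi n * Potapov n x = U n" by (simp add: Hi_def mult.assoc Potapov_inverse)
  from arg_cong[OF this, of adj] have "adj (Potapov n x) * adj (Hi n) = adj (U n)" by (simp only: adj_mult)
  then have a: "adj (Potapov n x) * (adj (Hi n) * A) = adj (U n) * A" for A by (metis mult.assoc)
  have "(Potapov n x * (N0 n * adj (Potapov n x))) * (Xi n * H n) = - (Potapov n x * (N0 n * (adj (U n) * J)))"
    unfolding X_H(2) by (simp add: mult.assoc a H_Hi)
  also have "\<dots> = - (H n * (N n * J))"
    unfolding adj_U_J N_J H_def by (simp add: mult.assoc inverse_cancel N0_J[symmetric])
  finally show ?thesis unfolding H_Suc by simp
qed

lemma Del_eq_H_N: "Potapov n x * (N0 n * adj (Potapov n x)) = H n * (N n * adj (H n))"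
proof -
  have "H n * U n = Potapov n x" by (simp add: H_def mult.assoc U_Ui)
  from arg_cong[OF this, of adj] have "adj (U n) * adj (H n) = adj (Potapov n x)" by (simp only: adj_mult)
  then show ?thesis unfolding N_def by (simp add: mult.assoc) (simp add: H_def mult.assoc inverse_cancel)
qed

end

(*%FILE B4*)
section \<open>Bounded products and the series\<close>

text \<open>Since \<open>1 + a \<le> exp a\<close>.\<close>
lemma growth_bound:
  fixes h a :: "nat \<Rightarrow> real"
  assumes "\<And>n. h (Suc n) \<le> h n * (1 + a n)" "\<And>n. 0 \<le> h n" "\<And>n. 0 \<le> a n" "summable a"
  shows "h n \<le> h 0 * exp (suminf a)"
proof -
  have "h n \<le> h 0 * exp (sum a {..<n})" for n
  proof (induction n)
    case (Suc n)
    have "h (Suc n) \<le> h n * (1 + a n)" by (rule assms)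
    also have "\<dots> \<le> (h 0 * exp (sum a {..<n})) * exp (a n)"
      using Suc assms exp_ge_add_one_self[of "a n"] by (intro mult_mono) auto
    finally show ?case by (simp add: exp_add mult.assoc)
  qed simp
  also have "h 0 * exp (sum a {..<n}) \<le> h 0 * exp (suminf a)"
    using assms sum_le_suminf[of a "{..<n}"] by (intro mult_left_mono) auto
  finally show ?thesis .
qed

context pick_point
begin

abbreviation "nr \<equiv> nrm (2 * m)"

text \<open>The decrease of \<open>X\<close> at the \<open>n\<close>-th step, up to a
  positive factor.\<close>
definition Del :: "nat \<Rightarrow> fmat" where "Del n = Potapov n x * (N0 n * adj (Potapov n x))"

lemma Del_psd: "0 \<le> Del n"
  unfolding Del_def using psd_cong[OF N0_psd, of "Potapov n x"] by (simp add: mult.assoc)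

lemma cor_Del: "cor (2 * m) (2 * m) (Del n)"
  unfolding Del_def by (intro cor_commuting cor_N0 corner_commute corner_commute_adj)

lemma cmod_ze_bounds: "0 < cmod (ze n)" "cmod (ze n) < 1" "(cmod (ze n))\<^sup>2 < 1" "(cmod (ze n))\<^sup>2 \<le> cmod (ze n)"
proof -
  show 1: "0 < cmod (ze n)" "cmod (ze n) < 1" using ze_nz ze_lt_1 by auto
  then show "(cmod (ze n))\<^sup>2 < 1" by (simp add: abs_square_less_1)
  show "(cmod (ze n))\<^sup>2 \<le> cmod (ze n)" using 1 by (simp add: power2_eq_square mult_left_le)
qed

definition coef :: "nat \<Rightarrow> real" where "coef n = Im (z n) / (cmod (x - z n))\<^sup>2"

lemma coef_nonneg: "0 \<le> coef n"
  using Im_z[of n] by (simp add: coef_def)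

lemma coef_alt: "coef n = (1 / (cmod (ze n))\<^sup>2 - 1) / (4 * Im x)"
  unfolding coef_def by (rule coef_eq)

lemma N_eq_Hi_Del: "N n = (Hi n * e) * (Del n * adj (Hi n * e))"
proof -
  have "Hi n * (Del n * adj (Hi n)) = ((Hi n * H n) * N n) * adj (Hi n * H n)"
    unfolding Del_def Del_eq_H_N by (simp only: adj_mult mult.assoc)
  then have "N n = Hi n * (Del n * adj (Hi n))" by (simp add: H_Hi)
  then show ?thesis using corD[OF cor_Del] by (simp add: mult.assoc)
qed

text \<open>The decreases of \<open>X\<close> have summable traces, as these telescope. The
  increments of \<open>H\<close> are these decreases multiplied by the bounded inverse of
  \<open>X\<close> and by \<open>H\<close>, so \<open>H\<close> and then its inverse stay
  bounded. Undoing the conjugation by \<open>H\<close> gives the convergence of the series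
  with coefficients \<open>1 - \<bar>\<zeta>\<bar>\<^sup>2\<close>. Its terms tend to 0
  while the norms of the modified matrices do not, so \<open>\<bar>\<zeta>\<bar>\<close>
  tends to 1 and these coefficients are comparable with the given ones.\<close>
lemma summable_coef_N:
  assumes C: "\<And>n. nr (X n x) \<le> C" "\<And>n. nr (Xi n) \<le> C"
  shows "summable (\<lambda>n. coef n * nr (N n))"
proof -
  let ?d = "real (2 * m)"
  have C0: "0 \<le> C" using C(1)[of 0] nrm_nonneg order_trans by blast
  define q where "q n = 1 - (cmod (ze n))\<^sup>2" for n
  have q0: "0 < q n" for n using cmod_ze_bounds by (simp add: q_def)
  define t where "t n = trc (2 * m) (q n *\<^sub>R Del n)" for n
  have tS: "t n = trc (2 * m) (X n x) - trc (2 * m) (X (Suc n) x)" for n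
    unfolding t_def X_Suc Del_def q_def by (simp add: trc_simps)
  have t0: "0 \<le> t n" for n unfolding t_def using q0[of n] Del_psd by (intro trc_nonneg scaleR_nonneg_nonneg) auto
  have "summable t"
  proof (rule summableI_nonneg_bounded[OF t0])
    fix n
    have "sum t {..<n} = trc (2 * m) (X 0 x) - trc (2 * m) (X n x)"
      unfolding tS by (induction n) auto
    also have "\<dots> \<le> C + C"
    proof -
      have "- trc (2 * m) (X n x) = trc (2 * m) (- X n x)" by (simp add: trc_def sum_negf)
      also have "\<dots> \<le> nr (- X n x)" by (rule trc_le_nrm)
      also have "nr (- X n x) = nr (X n x)" by (simp add: nrm_def)
      finally show ?thesis using trc_le_nrm[of "2 * m" "X 0 x"] C(1)[of 0] C(1)[of n] by linarith
    qed
    finally show "sum t {..<n} \<le> C + C" .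
  qed
  have nD: "nr (q n *\<^sub>R Del n) \<le> ?d * t n" for n
    unfolding t_def using q0[of n] Del_psd by (intro nrm_le_trc scaleR_nonneg_nonneg) auto
  define a where "a n = ?d * t n * C" for n
  have "summable a" unfolding a_def using \<open>summable t\<close> by (intro summable_mult summable_mult2)
  have a0: "0 \<le> a n" for n using t0 C0 by (simp add: a_def)
  define h where "h n = nr (H n * e)" for n
  have "h (Suc n) \<le> h n * (1 + a n)" for n
  proof -
    have "H (Suc n) * e = H n * e - ((1 - cmod (ze n)) *\<^sub>R Del n) * (Xi n * (H n * e))"
      unfolding H_Suc' Del_def by (simp add: left_diff_distrib mult.assoc)
    then have "h (Suc n) \<le> h n + nr (((1 - cmod (ze n)) *\<^sub>R Del n) * (Xi n * (H n * e)))"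
      unfolding h_def using nrm_diff by metis
    also have "\<dots> \<le> h n + nr ((1 - cmod (ze n)) *\<^sub>R Del n) * (nr (Xi n) * h n)"
    proof -
      have "nr (((1 - cmod (ze n)) *\<^sub>R Del n) * (Xi n * (H n * e)))
        \<le> nr ((1 - cmod (ze n)) *\<^sub>R Del n) * nr (Xi n * (H n * e))"
        by (rule nrm_mult) (use cor_scaleR[OF cor_Del] in blast)
      also have "\<dots> \<le> nr ((1 - cmod (ze n)) *\<^sub>R Del n) * (nr (Xi n) * h n)"
        unfolding h_def by (intro mult_left_mono nrm_nonneg nrm_mult) (use cor_Xi in blast)
      finally show ?thesis by simp
    qed
    also have "\<dots> \<le> h n + (?d * t n) * (C * h n)"
    proof -
      have "nr ((1 - cmod (ze n)) *\<^sub>R Del n) \<le> nr (q n *\<^sub>R Del n)"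
        unfolding nrm_scaleR using cmod_ze_bounds[of n] by (intro mult_right_mono nrm_nonneg) (simp add: q_def)
      then have "nr ((1 - cmod (ze n)) *\<^sub>R Del n) \<le> ?d * t n" using nD order_trans by blast
      then show ?thesis
        using C(2)[of n] t0[of n] C0 nrm_nonneg[of "2 * m" "H n * e"] nrm_nonneg[of "2 * m" "Xi n"]
        by (intro add_left_mono mult_mono mult_nonneg_nonneg) (auto simp: h_def)
    qed
    finally show ?thesis by (simp add: a_def algebra_simps)
  qed
  then have hb: "h n \<le> h 0 * exp (suminf a)" for n
    by (rule growth_bound[OF _ _ a0 \<open>summable a\<close>]) (simp add: h_def nrm_nonneg)
  define K where "K = nr J * (h 0 * exp (suminf a)) * C"
  have Hib: "nr (Hi n * e) \<le> K" for n
  proof -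
    have ea: "adj (H n) * e = e * adj (H n)" using arg_cong[OF corner_commute_H(1), of adj] by simp
    have "Hi n * e = Hi n * (X n x * Xi n)" by (simp add: X_Xi)
    also have "\<dots> = - (J * (adj (H n) * Xi n))"
      unfolding X_H(1) by (simp add: H_Hi flip: mult.assoc)
    also have "adj (H n) * Xi n = adj (H n * e) * Xi n"
    proof -
      have "adj (H n * e) * Xi n = (e * adj (H n)) * Xi n" by simp
      also have "\<dots> = adj (H n) * (e * Xi n)" by (simp only: ea[symmetric] mult.assoc)
      also have "\<dots> = adj (H n) * Xi n" by (simp only: corD(1)[OF cor_Xi])
      finally show ?thesis by (rule sym)
    qed
    finally have "nr (Hi n * e) = nr (J * (adj (H n * e) * Xi n))" by (simp add: nrm_def)
    also have "\<dots> \<le> nr J * nr (adj (H n * e) * Xi n)" by (rule nrm_mult) (use cor_Jm in blast)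
    also have "\<dots> \<le> nr J * (nr (adj (H n * e)) * nr (Xi n))"
      by (intro mult_left_mono nrm_nonneg nrm_mult) (use cor_Xi in blast)
    also have "\<dots> = nr J * (h n * nr (Xi n))" unfolding nrm_adj h_def ..
    also have "\<dots> \<le> nr J * ((h 0 * exp (suminf a)) * C)"
      using hb[of n] C(2)[of n]
      by (intro mult_left_mono mult_mono nrm_nonneg) (auto simp: h_def nrm_nonneg)
    finally show ?thesis by (simp add: K_def mult.assoc)
  qed
  have K0: "0 \<le> K" using Hib[of 0] nrm_nonneg order_trans by blast
  have qN: "q n * nr (N n) \<le> K * (?d * t n) * K" for n
  proof -
    have "q n * nr (N n) = nr ((Hi n * e) * ((q n *\<^sub>R Del n) * adj (Hi n * e)))"
      by (subst N_eq_Hi_Del) (use q0[of n] in \<open>simp add: nrm_scaleR\<close>)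
    also have "\<dots> \<le> nr (Hi n * e) * (nr (q n *\<^sub>R Del n) * nr (adj (Hi n * e)))"
      by (intro order_trans[OF nrm_mult] mult_left_mono nrm_nonneg nrm_mult)
        (use cor_He cor_scaleR[OF cor_Del] in blast)+
    also have "\<dots> \<le> K * ((?d * t n) * K)"
      unfolding nrm_adj using Hib[of n] nD[of n] K0 t0[of n]
      by (intro mult_mono mult_nonneg_nonneg nrm_nonneg) auto
    finally show ?thesis by (simp add: mult.assoc)
  qed
  have sq: "summable (\<lambda>n. q n * nr (N n))"
  proof (rule summable_comparison_test')
    show "summable (\<lambda>n. K * (?d * t n) * K)" using \<open>summable t\<close> by (intro summable_mult summable_mult2)
    show "norm (q n * nr (N n)) \<le> K * (?d * t n) * K" if "n \<ge> 0" for n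
      using qN[of n] q0[of n] nrm_nonneg[of "2 * m" "N n"] by (simp add: abs_mult)
  qed
  define nu where "nu = nr J + 1"
  have nu: "0 < nu" using nrm_nonneg[of "2 * m" J] by (simp add: nu_def)
  \<comment> \<open>as the terms of the convergent series tend to 0, this forces the first coefficient to 0\<close>
  have N_lower: "1 \<le> nu * nr (N n)" for n
  proof -
    have "1 \<le> nr (N n * J)" by (rule nrm_N_J)
    also have "\<dots> \<le> nr (N n) * nr J" by (rule nrm_mult) (use cor_N in blast)
    also have "\<dots> \<le> nr (N n) * nu" by (intro mult_left_mono nrm_nonneg) (simp add: nu_def)
    finally show ?thesis by (simp add: mult.commute)
  qed
  have "(\<lambda>n. nu * (q n * nr (N n))) \<longlonglongrightarrow> nu * 0"
    by (intro tendsto_mult_left summable_LIMSEQ_zero sq)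
  then have "\<forall>\<^sub>F n in sequentially. nu * (q n * nr (N n)) < 1 / 2"
    by (intro order_tendstoD) auto
  then have ev: "\<forall>\<^sub>F n in sequentially. norm (coef n * nr (N n)) \<le> 1 / (2 * Im x) * (q n * nr (N n))"
  proof eventually_elim
    case (elim n)
    have "q n * 1 \<le> q n * (nu * nr (N n))" using q0[of n] N_lower by (intro mult_left_mono) auto
    then have "q n < 1 / 2" using elim by (simp add: mult_ac)
    then have z2: "1 / 2 \<le> (cmod (ze n))\<^sup>2" by (simp add: q_def)
    have "coef n = q n / (cmod (ze n))\<^sup>2 / (4 * Im x)"
      unfolding coef_alt q_def using cmod_ze_bounds(1)[of n] by (simp add: diff_divide_distrib)
    also have "\<dots> \<le> q n / (1 / 2) / (4 * Im x)"
      using z2 q0[of n] Im_x by (intro divide_right_mono divide_left_mono) auto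
    finally have "coef n \<le> 1 / (2 * Im x) * q n" by simp
    then have "coef n * nr (N n) \<le> (1 / (2 * Im x) * q n) * nr (N n)"
      by (intro mult_right_mono nrm_nonneg)
    then show ?case using coef_nonneg[of n] nrm_nonneg[of "2 * m" "N n"] by (simp add: abs_mult)
  qed
  show ?thesis
    by (rule summable_comparison_test_ev[OF ev]) (intro summable_mult sq)
qed

text \<open>Both \<open>1 - \<bar>\<zeta>\<bar>\<close> and \<open>1 / \<bar>\<zeta>\<bar> -
  1\<close> are at most \<open>1 / \<bar>\<zeta>\<bar>\<^sup>2 - 1\<close>, a multiple of
  the coefficient. Hence the recursions for \<open>H\<close> and its inverse have summable
  relative increments.\<close>
lemma bounded_X_Xi:
  assumes "summable (\<lambda>n. coef n * nr (N n))"
  obtains C where "\<And>n. nr (X n x) \<le> C" "\<And>n. nr (Xi n) \<le> C"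
proof -
  define k where "k n = 1 / (cmod (ze n))\<^sup>2 - 1" for n
  have kc: "k n = 4 * Im x * coef n" for n unfolding k_def coef_alt using Im_x by simp
  define a where "a n = 4 * Im x * (coef n * nr (N n)) * nr J" for n
  have sa: "summable a" unfolding a_def using assms by (intro summable_mult summable_mult2)
  have a_alt: "a n = k n * (nr (N n) * nr J)" for n by (simp add: a_def kc)
  have a0: "0 \<le> a n" for n unfolding a_def using Im_x coef_nonneg nrm_nonneg by simp
  have k1: "1 - cmod (ze n) \<le> k n" "1 / cmod (ze n) - 1 \<le> k n" for n
  proof -
    let ?r = "1 / cmod (ze n)"
    have r: "1 \<le> ?r" using cmod_ze_bounds[of n] by simp
    have k: "k n = ?r\<^sup>2 - 1" by (simp add: k_def power_divide)
    have "?r * 1 \<le> ?r * ?r" using r by (intro mult_left_mono) linarith+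
    then have "?r \<le> ?r\<^sup>2" by (simp only: power2_eq_square mult_1_right)
    then show 1: "?r - 1 \<le> k n" unfolding k by simp
    have "cmod (ze n) * ?r = 1" using cmod_ze_bounds[of n] by simp
    have "2 \<le> cmod (ze n) + ?r"
    proof -
      have "0 \<le> (cmod (ze n) - 1)\<^sup>2 / cmod (ze n)" using cmod_ze_bounds[of n] by simp
      also have "\<dots> = cmod (ze n) + ?r - 2" using cmod_ze_bounds[of n] by (simp add: power2_eq_square field_simps)
      finally show ?thesis by simp
    qed
    then show "1 - cmod (ze n) \<le> k n" using 1 by linarith
  qed
  have NJ: "nr (N n * J) \<le> nr (N n) * nr J" for n by (rule nrm_mult) (use cor_N in blast)
  have cNJ: "cor (2 * m) (2 * m) (N n * J)" for n by (rule cor_mult[OF cor_N cor_Jm])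
  define h where "h n = nr (H n * e)" for n
  have "h (Suc n) \<le> h n * (1 + a n)" for n
  proof -
    have NJe: "N n * (J * e) = e * (N n * J)" using corD[OF cNJ] by (simp add: mult.assoc)
    have "H (Suc n) * e = H n * e + (1 - cmod (ze n)) *\<^sub>R ((H n * e) * (N n * J))"
      unfolding H_Suc using corD[OF cNJ[of n]] NJe by (simp add: distrib_right mult.assoc)
    then have "h (Suc n) \<le> h n + nr ((1 - cmod (ze n)) *\<^sub>R ((H n * e) * (N n * J)))"
      unfolding h_def using nrm_add by metis
    also have "\<dots> \<le> h n + k n * (h n * (nr (N n) * nr J))"
    proof -
      have "nr ((H n * e) * (N n * J)) \<le> h n * nr (N n * J)"
        unfolding h_def by (rule nrm_mult) (use cNJ in blast)
      also have "\<dots> \<le> h n * (nr (N n) * nr J)"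
        using NJ by (intro mult_left_mono) (simp_all add: h_def nrm_nonneg)
      finally have "(1 - cmod (ze n)) * nr ((H n * e) * (N n * J)) \<le> k n * (h n * (nr (N n) * nr J))"
        using k1(1)[of n] cmod_ze_bounds[of n] by (intro mult_mono) (auto simp: nrm_nonneg)
      then show ?thesis unfolding nrm_scaleR using cmod_ze_bounds[of n] by simp
    qed
    finally show ?thesis unfolding a_alt by (simp add: algebra_simps)
  qed
  then have hb: "h n \<le> h 0 * exp (suminf a)" for n
    by (rule growth_bound[OF _ _ a0 sa]) (simp add: h_def nrm_nonneg)
  define hi where "hi n = nr (Hi n * e)" for n
  have "hi (Suc n) \<le> hi n * (1 + a n)" for n
  proof -
    have "Hi (Suc n) * e = Hi n * e + (1 - 1 / cmod (ze n)) *\<^sub>R ((N n * J) * (Hi n * e))"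
      unfolding Hi_Suc by (simp add: distrib_right mult.assoc)
    then have "hi (Suc n) \<le> hi n + nr ((1 - 1 / cmod (ze n)) *\<^sub>R ((N n * J) * (Hi n * e)))"
      unfolding hi_def using nrm_add by metis
    also have "\<dots> \<le> hi n + k n * ((nr (N n) * nr J) * hi n)"
    proof -
      have "nr ((N n * J) * (Hi n * e)) \<le> nr (N n * J) * hi n"
        unfolding hi_def by (rule nrm_mult) (use cNJ in blast)
      also have "\<dots> \<le> (nr (N n) * nr J) * hi n"
        using NJ by (intro mult_right_mono) (simp_all add: hi_def nrm_nonneg)
      finally have "(1 / cmod (ze n) - 1) * nr ((N n * J) * (Hi n * e)) \<le> k n * ((nr (N n) * nr J) * hi n)"
        using k1(2)[of n] cmod_ze_bounds[of n] inv_ze_ge[of n] by (intro mult_mono) (auto simp: nrm_nonneg k_def)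
      then show ?thesis unfolding nrm_scaleR using cmod_ze_bounds[of n] by (simp add: abs_if)
    qed
    finally show ?thesis unfolding a_alt by (simp add: algebra_simps)
  qed
  then have hib: "hi n \<le> hi 0 * exp (suminf a)" for n
    by (rule growth_bound[OF _ _ a0 sa]) (simp add: hi_def nrm_nonneg)
  have 1: "nr (X n x) \<le> h n * (nr J * h n)" for n
  proof -
    have "X n x = - ((H n * e) * (J * adj (H n * e)))"
      unfolding X_H using corD[OF cor_Jm[of m]] by (simp add: mult.assoc)
    then have "nr (X n x) = nr ((H n * e) * (J * adj (H n * e)))" by (simp add: nrm_def)
    also have "\<dots> \<le> nr (H n * e) * (nr J * nr (adj (H n * e)))"
      by (intro order_trans[OF nrm_mult] mult_left_mono nrm_nonneg nrm_mult) (use cor_He cor_Jm in blast)+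
    finally show ?thesis unfolding nrm_adj h_def .
  qed
  have 2: "nr (Xi n) \<le> hi n * (nr J * hi n)" for n
  proof -
    have ec: "e * (J * e) = J" using corD[OF cor_Jm[of m]] by simp
    have "Xi n = e * (Xi n * e)" using corD[OF cor_Xi] by simp
    then have "Xi n = - (adj (Hi n * e) * (J * (Hi n * e)))"
      by (subst (asm) X_H(2)) (simp add: mult.assoc)
    then have "nr (Xi n) = nr (adj (Hi n * e) * (J * (Hi n * e)))" by (simp add: nrm_def)
    also have "\<dots> \<le> nr (adj (Hi n * e)) * (nr J * nr (Hi n * e))"
      by (intro order_trans[OF nrm_mult] mult_left_mono nrm_nonneg nrm_mult)
        (use cor_intros(6)[OF cor_He(2)] cor_Jm in blast)+
    finally show ?thesis unfolding nrm_adj hi_def .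
  qed
  define C1 where "C1 = h 0 * exp (suminf a)"
  define C2 where "C2 = hi 0 * exp (suminf a)"
  have hh: "0 \<le> h n" "0 \<le> hi n" for n by (simp_all add: h_def hi_def nrm_nonneg)
  have "nr (X n x) \<le> max (C1 * (nr J * C1)) (C2 * (nr J * C2))" for n
  proof -
    have "h n * (nr J * h n) \<le> C1 * (nr J * C1)"
      using hb[of n] hh[of n] nrm_nonneg by (intro mult_mono mult_nonneg_nonneg) (auto simp: C1_def[symmetric] intro: order_trans)
    then show ?thesis using 1[of n] by linarith
  qed
  moreover have "nr (Xi n) \<le> max (C1 * (nr J * C1)) (C2 * (nr J * C2))" for n
  proof -
    have "hi n * (nr J * hi n) \<le> C2 * (nr J * C2)"
      using hib[of n] hh[of n] nrm_nonneg by (intro mult_mono mult_nonneg_nonneg) (auto simp: C2_def[symmetric] intro: order_trans)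
    then show ?thesis using 2[of n] by linarith
  qed
  ultimately show ?thesis using that by blast
qed

text \<open>The corner blocks of \<open>-X\<close> and of its inverse. Their inverses are
  the squares of the right and of the left semi-radius of the ball.\<close>
definition aX :: "nat \<Rightarrow> fmat" where "aX n = - (blk m 0 * (X n x * adj (blk m 0)))"
definition sX :: "nat \<Rightarrow> fmat" where "sX n = blk m 1 * (Xi n * adj (blk m 1))"

lemma g_0: "g 0 = node_row 0"
  by (simp add: g_def Schur_row_def last_col_def V_def blk_adj_blk_mult)

lemma N0_0: "blk m 0 * (N0 0 * adj (blk m 0)) = node_weight 0 *\<^sub>R Schur_inv 0"
proof -
  have "node_row 0 * adj (blk m 0) = dg m" "blk m 0 * adj (node_row 0) = dg m"
    by (simp_all add: node_row_def distrib_left distrib_right mult.assoc blk_adj_blk blk_adj_blk_mult)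
  then have "blk m 0 * (adj (node_row 0) * (Schur_inv 0 * (node_row 0 * adj (blk m 0)))) = Schur_inv 0"
    using corD[OF Schur_inv(1)] by (simp flip: mult.assoc)
  then show ?thesis unfolding N0_def g_0 by (simp add: mult.assoc scaleR_cscale)
qed

lemma aX_1: "aX 1 = ((1 - (cmod (ze 0))\<^sup>2) * node_weight 0) *\<^sub>R Schur_inv 0"
proof -
  have "blk m 0 * (J * adj (blk m 0)) = 0"
    by (simp add: blk_Jm blk_adj_blk flip: mult.assoc)
  then show ?thesis
    unfolding aX_def One_nat_def X_Suc by (simp add: X_def left_diff_distrib right_diff_distrib N0_0 mult.assoc)
qed

lemma sX_1: "sX 1 = ((1 / (cmod (ze 0))\<^sup>2 - 1) * node_weight 0) *\<^sub>R Schur_inv 0"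
proof -
  have b: "blk m 1 * (J * A) = \<i> *c (blk m 0 * A)" for A
    using blk_Jm(2)[of m] by (simp flip: mult.assoc)
  have b': "J * adj (blk m 1) = - (\<i> *c adj (blk m 0))"
    using arg_cong[OF blk_Jm(2)[of m], of adj] by (simp add: adj_Jm)
  have "blk m 1 * (J * adj (blk m 1)) = 0" by (simp only: b blk_adj_blk) simp
  moreover have "blk m 1 * (M0 0 * adj (blk m 1)) = node_weight 0 *\<^sub>R Schur_inv 0"
    unfolding M0_def using N0_0
    by (simp only: mult.assoc b b' cscale_mult mult_minus_right cscale_simps) (simp add: scaleR_cscale)
  ultimately show ?thesis
    unfolding sX_def One_nat_def Xi_Suc
    by (simp add: Xi_def distrib_left distrib_right left_diff_distrib right_diff_distrib mult.assoc)
qed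

lemma aX_inc: "1 \<le> n \<Longrightarrow> aX n \<le> aX (Suc n)" "1 \<le> n \<Longrightarrow> aX 1 \<le> aX n"
proof -
  have *: "aX n \<le> aX (Suc n)" for n
    using le_cong[OF X_dec, of "blk m 0" n] by (simp add: aX_def mult.assoc)
  then show "aX n \<le> aX (Suc n)" .
  show "1 \<le> n \<Longrightarrow> aX 1 \<le> aX n" using lift_Suc_mono_le[of aX, OF *] by blast
qed

lemma sX_inc: "1 \<le> n \<Longrightarrow> sX n \<le> sX (Suc n)" "1 \<le> n \<Longrightarrow> sX 1 \<le> sX n"
proof -
  have *: "sX n \<le> sX (Suc n)" for n
    using le_cong[OF Xi_inc, of "blk m 1" n] by (simp add: sX_def mult.assoc)
  then show "sX n \<le> sX (Suc n)" .
  show "1 \<le> n \<Longrightarrow> sX 1 \<le> sX n" using lift_Suc_mono_le[of sX, OF *] by blast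
qed

lemma cor_aX: "cor m m (aX n)" "cor m m (sX n)"
  unfolding aX_def sX_def
  by (intro cor_intros(4) cor_mult[OF cor_blk2(1) cor_mult[OF cor_X cor_intros(6)[OF cor_blk2(1)]]]
        cor_mult[OF cor_blk2(2) cor_mult[OF cor_Xi cor_intros(6)[OF cor_blk2(2)]]])+

lemma pd_aX_sX: "1 \<le> n \<Longrightarrow> pd m (aX n)" "1 \<le> n \<Longrightarrow> pd m (sX n)"
proof -
  have "pd m (aX 1)" unfolding aX_1 using cmod_ze_bounds[of 0] node_weight_pos[of 0] by (intro pd_scaleR Schur_inv) simp
  then show "1 \<le> n \<Longrightarrow> pd m (aX n)" using pd_mono aX_inc(2) cor_aX by blast
  have "0 < 1 / (cmod (ze 0))\<^sup>2 - 1" using cmod_ze_bounds[of 0] by simp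
  then have "pd m (sX 1)" unfolding sX_1 using node_weight_pos[of 0] by (intro pd_scaleR Schur_inv) simp
  then show "1 \<le> n \<Longrightarrow> pd m (sX n)" using pd_mono sX_inc(2) cor_aX by blast
qed

end

(*%FILE B5*)
section \<open>Matrix balls\<close>

definition ballX :: "nat \<Rightarrow> fmat \<Rightarrow> fmat set" where
  "ballX m X = {w. cor m m w \<and> 0 \<le> (w * blk m 0 - blk m 1) * (X * adj (w * blk m 0 - blk m 1))}"

text \<open>Here \<open>-a\<close> and \<open>R2\<close> are the negative and the positive
  pivot of \<open>X\<close>. The inverse enters because its lower corner block is the
  inverse of \<open>R2\<close>, which makes \<open>R2\<close> definite.\<close>
locale ball_data =
  fixes m :: nat and X Xi :: fmat
  assumes cor_X: "cor (2 * m) (2 * m) X" and cor_Xi: "cor (2 * m) (2 * m) Xi" and X_Xi: "X * Xi = dg (2 * m)"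
    and adj_X: "adj X = X"
    and pd_a: "pd m (- (blk m 0 * (X * adj (blk m 0))))" and pd_s: "pd m (blk m 1 * (Xi * adj (blk m 1)))"
begin

definition "a = - (blk m 0 * (X * adj (blk m 0)))"
definition "ai = cinv m a"
definition "X12 = blk m 0 * (X * adj (blk m 1))"
definition "X22 = blk m 1 * (X * adj (blk m 1))"
definition "c = - (adj X12 * ai)"
definition "R2 = X22 + adj X12 * (ai * X12)"
definition "sX = blk m 1 * (Xi * adj (blk m 1))"

lemmas ai = cinv[OF pd_a[folded a_def], folded ai_def]

lemma cor_a: "cor m m a" using pd_a unfolding a_def pd_def by blast
lemma adj_a: "adj a = a" unfolding a_def by (simp add: adj_X mult.assoc)
lemma adj_X22: "adj X22 = X22" unfolding X22_def by (simp add: adj_X mult.assoc)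

lemma cor_X12: "cor m m X12" "cor m m X22"
  unfolding X12_def X22_def
  by (intro cor_mult[OF cor_blk2(1) cor_mult[OF cor_X cor_intros(6)[OF cor_blk2(2)]]]
     cor_mult[OF cor_blk2(2) cor_mult[OF cor_X cor_intros(6)[OF cor_blk2(2)]]])+

lemma cor_c: "cor m m c" "cor m m R2"
  unfolding c_def R2_def by (intro cor_intros cor_mult[OF cor_intros(6)[OF cor_X12(1)]] ai cor_mult[OF ai(1)] cor_X12)+

lemma cor_sX: "cor m m sX"
  unfolding sX_def by (intro cor_mult[OF cor_blk2(2) cor_mult[OF cor_Xi cor_intros(6)[OF cor_blk2(2)]]])

lemma X21: "blk m 1 * (X * adj (blk m 0)) = adj X12"
  unfolding X12_def by (simp add: adj_X mult.assoc)

text \<open>Completing the square.\<close>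
lemma ball_form:
  assumes w: "cor m m w"
  shows "(w * blk m 0 - blk m 1) * (X * adj (w * blk m 0 - blk m 1)) = R2 - (w - c) * (a * adj (w - c))"
proof -
  have "(w * blk m 0 - blk m 1) * (X * adj (w * blk m 0 - blk m 1))
     = - (w * (a * adj w)) - w * X12 - adj X12 * adj w + X22"
    unfolding a_def X12_def X22_def by (simp add: algebra_simps adj_X)
  also have "\<dots> = R2 - (w - c) * (a * adj (w - c))"
  proof -
    have 1: "a * (ai * A) = dg m * A" "ai * (a * A) = dg m * A" for A using ai by (simp_all flip: mult.assoc)
    have "adj c = - (ai * X12)" by (simp add: c_def ai)
    then show ?thesis
      unfolding R2_def c_def
      by (simp add: algebra_simps 1 ai corD[OF w] corD[OF cor_intros(6)[OF w]] corD[OF cor_X12(1)]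
          corD[OF cor_intros(6)[OF cor_X12(1)]])
  qed
  finally show ?thesis .
qed

text \<open>The lower corner block of an inverse is the inverse of a Schur
  complement.\<close>
lemma R2_sX: "R2 * sX = dg m"
proof -
  define y where "y = c * blk m 0 - blk m 1"
  have y: "cor m (2 * m) y" unfolding y_def using cor_blk2 by (intro cor_intros cor_mult[OF cor_c(1)])
  have "y * (X * adj (blk m 0)) = 0"
  proof -
    have "y * (X * adj (blk m 0)) = - (c * a) - adj X12"
      unfolding y_def a_def using X21 by (simp add: left_diff_distrib mult.assoc)
    also have "c * a = - adj X12" unfolding c_def
      using ai corD[OF cor_intros(6)[OF cor_X12(1)]] by (simp add: mult.assoc)
    finally show ?thesis by simp
  qed
  moreover have "y * (X * adj (blk m 1)) = - R2"
    unfolding y_def R2_def c_def by (simp add: left_diff_distrib mult.assoc X12_def X22_def)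
  moreover have "y * X = y * X * (adj (blk m 0) * blk m 0 + adj (blk m 1) * blk m 1)"
    unfolding sum_blk2 using corD[OF cor_X] by (simp add: mult.assoc)
  ultimately have "y * X = - (R2 * blk m 1)"
    by (simp add: distrib_left flip: mult.assoc)
  then have "(y * X) * (Xi * adj (blk m 1)) = - (R2 * sX)"
    unfolding sX_def by (simp add: mult.assoc)
  moreover have "(y * X) * (Xi * adj (blk m 1)) = y * adj (blk m 1)"
    using corD(2)[OF y] X_Xi by (metis mult.assoc)
  moreover have "y * adj (blk m 1) = - dg m"
    unfolding y_def by (simp add: left_diff_distrib mult.assoc blk_adj_blk)
  ultimately show ?thesis by simp
qed

lemma adj_R2: "adj R2 = R2"
  by (simp add: R2_def adj_X22 ai mult.assoc)

lemma pd_R2: "pd m R2"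
proof -
  have p: "pd m sX" using pd_s unfolding sX_def .
  have "sX * R2 = dg m"
    using arg_cong[OF R2_sX, of adj] psd_adj[OF pd_psd[OF p]] adj_R2 by simp
  then show ?thesis using psd_inverse_pd[OF pd_psd[OF p] cor_sX cor_c(2)] R2_sX by blast
qed

lemma mem_ballX: "w \<in> ballX m X \<longleftrightarrow> cor m m w \<and> (w - c) * (a * adj (w - c)) \<le> R2"
  unfolding ballX_def using ball_form by auto

text \<open>With \<open>w - c = r V \<rho>\<close> the condition becomes \<open>V V\<^sup>*
  \<le> 1\<close>, which is equivalent to \<open>V\<^sup>* V \<le> 1\<close>.\<close>
lemma ballX_eq:
  assumes r: "pd m r" "r * r = R2" and \<rho>: "pd m \<rho>" "\<rho> * \<rho> = ai"
  shows "ballX m X = {c + r * V * \<rho> | V. cor m m V \<and> adj V * V \<le> dg m}"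
proof -
  have cr: "cor m m r" "cor m m \<rho>" using r \<rho> by (auto simp: pd_def)
  note ri = cinv[OF r(1)] and pi = cinv[OF \<rho>(1)]
  have hr: "adj r = r" "adj \<rho> = \<rho>" using psd_adj pd_psd r \<rho> by blast+
  let ?ri = "cinv m r" and ?pi = "cinv m \<rho>"
  have rr: "r * (?ri * A) = dg m * A" "?ri * (r * A) = dg m * A" "\<rho> * (?pi * A) = dg m * A" "?pi * (\<rho> * A) = dg m * A" for A
    using ri pi by (simp_all flip: mult.assoc)
  have a_eq: "a = ?pi * ?pi"
  proof -
    have "a = a * (\<rho> * (\<rho> * (?pi * ?pi)))" using corD[OF pi(1)] corD[OF cor_a] by (simp add: rr pi)
    also have "\<dots> = a * (ai * (?pi * ?pi))" unfolding \<rho>(2)[symmetric] by (simp add: mult.assoc)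
    also have "\<dots> = (a * ai) * (?pi * ?pi)" by (simp only: mult.assoc)
    also have "\<dots> = ?pi * ?pi" using ai corD[OF pi(1)] by simp
    finally show ?thesis .
  qed
  show ?thesis
  proof (intro equalityI subsetI)
    fix w assume "w \<in> ballX m X"
    then have w: "cor m m w" "(w - c) * (a * adj (w - c)) \<le> R2" by (auto simp: mem_ballX)
    have cwc: "cor m m (w - c)" by (intro cor_intros w cor_c)
    define V where "V = ?ri * ((w - c) * ?pi)"
    have cV: "cor m m V" unfolding V_def by (intro cor_mult[OF ri(1)] cor_mult[OF cwc] pi)
    have "V * adj V = ?ri * ((w - c) * (a * adj (w - c))) * adj ?ri"
      unfolding V_def a_eq by (simp add: mult.assoc pi ri)
    also have "\<dots> \<le> ?ri * R2 * adj ?ri" by (rule le_cong[OF w(2)])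
    also have "\<dots> = dg m" unfolding r(2)[symmetric] by (simp add: mult.assoc rr ri)
    finally have "adj V * V \<le> dg m"
      using isometry_adj[of m "adj V"] cV by (simp add: cor_intros)
    moreover have "w = c + r * V * \<rho>"
      unfolding V_def using corD[OF cwc] by (simp add: mult.assoc rr pi)
    ultimately show "w \<in> {c + r * V * \<rho> | V. cor m m V \<and> adj V * V \<le> dg m}" using cV by blast
  next
    fix w assume "w \<in> {c + r * V * \<rho> | V. cor m m V \<and> adj V * V \<le> dg m}"
    then obtain V where V: "cor m m V" "adj V * V \<le> dg m" and w: "w = c + r * V * \<rho>" by blast
    have cw: "cor m m w" unfolding w by (intro cor_intros cor_c cor_mult[OF cor_mult[OF cr(1) V(1)] cr(2)])
    have "(w - c) * (a * adj (w - c)) = r * (V * adj V) * adj r"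
      unfolding w a_eq using corD[OF cor_intros(6)[OF V(1)]] by (simp add: mult.assoc hr rr pi)
    also have "\<dots> \<le> r * dg m * adj r" by (rule le_cong[OF isometry_adj[OF V]])
    also have "\<dots> = R2" using corD[OF cr(1)] r(2) hr by simp
    finally show "w \<in> ballX m X" using cw by (simp add: mem_ballX)
  qed
qed

text \<open>Shrinking towards the center makes the inequality strict.\<close>
lemma ball_shrink:
  assumes w: "w \<in> ballX m X" and t: "0 \<le> t" "t < 1"
  defines "wt \<equiv> c + t *\<^sub>R (w - c)"
  shows "cor m m wt" "pd m ((wt * blk m 0 - blk m 1) * (X * adj (wt * blk m 0 - blk m 1)))"
proof -
  have cw: "cor m m w" and le: "(w - c) * (a * adj (w - c)) \<le> R2" using w by (auto simp: mem_ballX)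
  show cwt: "cor m m wt" unfolding wt_def by (intro cor_intros(2,3) cor_scaleR cw cor_c)
  have "(wt * blk m 0 - blk m 1) * (X * adj (wt * blk m 0 - blk m 1))
     = R2 - (t * t) *\<^sub>R ((w - c) * (a * adj (w - c)))"
    unfolding ball_form[OF cwt] by (simp add: wt_def)
  moreover have "(1 - t * t) *\<^sub>R R2 \<le> R2 - (t * t) *\<^sub>R ((w - c) * (a * adj (w - c)))"
    using scaleR_left_mono[OF le, of "t * t"] by (simp add: scaleR_left_diff_distrib)
  moreover have "pd m ((1 - t * t) *\<^sub>R R2)"
    using t abs_square_less_1[of t] by (intro pd_scaleR pd_R2) (simp add: power2_eq_square)
  moreover have "cor m m (R2 - (t * t) *\<^sub>R ((w - c) * (a * adj (w - c))))"
    by (intro cor_intros(3) cor_c cor_scaleR cor_mult[OF cor_intros(3)[OF cw cor_c(1)]] cor_mult[OF cor_a]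
        cor_intros(6) cw)
  ultimately show "pd m ((wt * blk m 0 - blk m 1) * (X * adj (wt * blk m 0 - blk m 1)))"
    using pd_mono by metis
qed

end

(*%FILE C1*)
section \<open>Necessity of the Pick condition\<close>

text \<open>On the circle of radius \<open>r\<close> the conjugate of \<open>u - s\<close>
  equals \<open>(r\<^sup>2 - cnj s u) / u\<close>, so the integrand is a Cauchy
  kernel.\<close>
lemma disc_kernel_integral:
  assumes F: "F holomorphic_on ball 0 1" and r: "0 < r" "r < 1" and t: "cmod t < r" "cmod s < r"
  defines "u \<equiv> \<lambda>y. complex_of_real r * exp (2 * of_real pi * \<i> * complex_of_real y)"
  shows "((\<lambda>y. F (u y) / ((u y - t) * cnj (u y - s))) has_integral F t / (complex_of_real r ^ 2 - t * cnj s)) {0..1}"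
proof -
  define G where "G v = F v / (complex_of_real r ^ 2 - cnj s * v)" for v
  have nz: "complex_of_real r ^ 2 - cnj s * v \<noteq> 0" if "cmod v \<le> r" for v
  proof
    assume "complex_of_real r ^ 2 - cnj s * v = 0"
    then have "cnj s * v = complex_of_real (r\<^sup>2)" by simp
    then have "cmod (cnj s * v) = r\<^sup>2" by (metis abs_power2 norm_of_real)
    moreover have "cmod (cnj s * v) \<le> cmod s * r" using that by (simp add: norm_mult mult_left_mono)
    moreover have "cmod s * r < r\<^sup>2" using t r by (simp add: power2_eq_square)
    ultimately show False by simp
  qed
  have sub: "cball 0 r \<subseteq> ball (0::complex) 1" using r by auto
  have "G holomorphic_on cball 0 r"
    unfolding G_def
    by (intro holomorphic_intros holomorphic_on_subset[OF F sub]) (use nz in auto)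
  then have "((\<lambda>v. G v / (v - t)) has_contour_integral (2 * of_real pi * \<i> * G t)) (circlepath 0 r)"
    using Cauchy_integral_circlepath_simple[of G 0 r t] t by simp
  then have 1: "((\<lambda>y. G (circlepath 0 r y) / (circlepath 0 r y - t)
      * vector_derivative (circlepath 0 r) (at y within {0..1})) has_integral (2 * of_real pi * \<i> * G t)) {0..1}"
    unfolding has_contour_integral_def .
  have "((\<lambda>y. (2 * of_real pi * \<i>) * (F (u y) / ((u y - t) * cnj (u y - s)))) has_integral (2 * of_real pi * \<i> * G t)) {0..1}"
  proof (rule has_integral_eq[OF _ 1])
    fix y :: real assume y: "y \<in> {0..1}"
    have c: "circlepath 0 r y = u y" by (simp add: circlepath u_def)
    have nu: "cmod (u y) = r" using r by (simp add: u_def norm_mult)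
    then have u0: "u y \<noteq> 0" using r by auto
    have rr: "complex_of_real r ^ 2 = u y * cnj (u y)" using nu complex_norm_square[of "u y"] by simp
    have d: "complex_of_real r ^ 2 - cnj s * u y = u y * cnj (u y - s)" unfolding rr by (simp add: algebra_simps)
    have "vector_derivative (circlepath 0 r) (at y within {0..1}) = 2 * pi * \<i> * u y"
      using y by (simp add: vector_derivative_circlepath01 u_def)
    then show "G (circlepath 0 r y) / (circlepath 0 r y - t) * vector_derivative (circlepath 0 r) (at y within {0..1})
      = (2 * of_real pi * \<i>) * (F (u y) / ((u y - t) * cnj (u y - s)))"
      unfolding c G_def d using u0 by (simp add: mult_ac)
  qed
  from has_integral_mult_right[OF this, of "1 / (2 * of_real pi * \<i>)"]
  show ?thesis by (simp add: G_def mult.commute)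
qed

text \<open>The Pick kernel is an integral of nonnegative forms over the circle.\<close>
lemma disc_pick_radius:
  fixes F :: "'i \<Rightarrow> 'i \<Rightarrow> complex \<Rightarrow> complex"
  assumes I: "finite I" and F: "\<And>p q. p \<in> I \<Longrightarrow> q \<in> I \<Longrightarrow> F p q holomorphic_on ball 0 1"
    and pos: "\<And>t c. cmod t < 1 \<Longrightarrow> 0 \<le> Re (\<Sum>p\<in>I. \<Sum>q\<in>I. cnj (c p) * F p q t * c q)"
    and r: "0 < r" "r < 1" and t: "\<And>p. p \<in> I \<Longrightarrow> cmod (t p) < r"
  shows "0 \<le> Re (\<Sum>p\<in>I. \<Sum>q\<in>I. cnj (\<xi> p) * ((F p q (t p) + cnj (F q p (t q))) / (complex_of_real r ^ 2 - t p * cnj (t q))) * \<xi> q)"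
proof -
  define u where "u y = complex_of_real r * exp (2 * of_real pi * \<i> * complex_of_real y)" for y
  have 1: "((\<lambda>y. F p q (u y) / ((u y - t p) * cnj (u y - t q))) has_integral F p q (t p) / (complex_of_real r ^ 2 - t p * cnj (t q))) {0..1}"
    if "p \<in> I" "q \<in> I" for p q
    using disc_kernel_integral[OF F[OF that] r t[OF that(1)] t[OF that(2)]] unfolding u_def .
  have 2: "((\<lambda>y. cnj (F q p (u y)) / ((u y - t p) * cnj (u y - t q))) has_integral cnj (F q p (t q)) / (complex_of_real r ^ 2 - t p * cnj (t q))) {0..1}"
    if "p \<in> I" "q \<in> I" for p q
    using 1[OF that(2,1)] unfolding has_integral_cnj[symmetric, of "\<lambda>y. F q p (u y) / ((u y - t q) * cnj (u y - t p))"]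
    by (simp add: o_def mult.commute)
  have 3: "((\<lambda>y. cnj (\<xi> p) * ((F p q (u y) + cnj (F q p (u y))) / ((u y - t p) * cnj (u y - t q))) * \<xi> q)
      has_integral cnj (\<xi> p) * ((F p q (t p) + cnj (F q p (t q))) / (complex_of_real r ^ 2 - t p * cnj (t q))) * \<xi> q) {0..1}"
    if "p \<in> I" "q \<in> I" for p q
    unfolding add_divide_distrib
    by (intro has_integral_mult_left has_integral_mult_right has_integral_add 1 2 that)
  have "((\<lambda>y. \<Sum>p\<in>I. \<Sum>q\<in>I. cnj (\<xi> p) * ((F p q (u y) + cnj (F q p (u y))) / ((u y - t p) * cnj (u y - t q))) * \<xi> q)
      has_integral (\<Sum>p\<in>I. \<Sum>q\<in>I. cnj (\<xi> p) * ((F p q (t p) + cnj (F q p (t q))) / (complex_of_real r ^ 2 - t p * cnj (t q))) * \<xi> q)) {0..1}"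
    by (intro has_integral_sum I 3)
  from has_integral_linear[OF this bounded_linear_Re]
  show ?thesis
  proof (rule has_integral_nonneg)
    fix y :: real assume "y \<in> {0..1}"
    define c where "c q = \<xi> q / cnj (u y - t q)" for q
    have "cmod (u y) < 1" using r by (simp add: u_def norm_mult)
    define R where "R = (\<Sum>p\<in>I. \<Sum>q\<in>I. cnj (c p) * F p q (u y) * c q)"
    have "(\<Sum>p\<in>I. \<Sum>q\<in>I. cnj (\<xi> p) * ((F p q (u y) + cnj (F q p (u y))) / ((u y - t p) * cnj (u y - t q))) * \<xi> q)
       = (\<Sum>p\<in>I. \<Sum>q\<in>I. cnj (c p) * F p q (u y) * c q) + (\<Sum>p\<in>I. \<Sum>q\<in>I. cnj (c p) * cnj (F q p (u y)) * c q)"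
      unfolding sum.distrib[symmetric]
      by (intro sum.cong refl) (simp add: c_def add_divide_distrib distrib_left distrib_right mult_ac)
    also have "(\<Sum>p\<in>I. \<Sum>q\<in>I. cnj (c p) * cnj (F q p (u y)) * c q) = cnj R"
      unfolding R_def by (subst sum.swap) (simp add: mult_ac)
    finally have eq: "(\<Sum>p\<in>I. \<Sum>q\<in>I. cnj (\<xi> p) * ((F p q (u y) + cnj (F q p (u y))) / ((u y - t p) * cnj (u y - t q))) * \<xi> q)
        = R + cnj R" unfolding R_def[symmetric] .
    show "0 \<le> (Re \<circ> (\<lambda>y. \<Sum>p\<in>I. \<Sum>q\<in>I. cnj (\<xi> p) * ((F p q (u y) + cnj (F q p (u y))) / ((u y - t p) * cnj (u y - t q))) * \<xi> q)) y"
      unfolding o_apply eq using pos[OF \<open>cmod (u y) < 1\<close>, of c, folded R_def] by simp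
  qed
qed

lemma disc_pick:
  fixes F :: "'i \<Rightarrow> 'i \<Rightarrow> complex \<Rightarrow> complex"
  assumes I: "finite I" and F: "\<And>p q. p \<in> I \<Longrightarrow> q \<in> I \<Longrightarrow> F p q holomorphic_on ball 0 1"
    and pos: "\<And>t c. cmod t < 1 \<Longrightarrow> 0 \<le> Re (\<Sum>p\<in>I. \<Sum>q\<in>I. cnj (c p) * F p q t * c q)"
    and t: "\<And>p. p \<in> I \<Longrightarrow> cmod (t p) < 1"
  shows "0 \<le> Re (\<Sum>p\<in>I. \<Sum>q\<in>I. cnj (\<xi> p) * ((F p q (t p) + cnj (F q p (t q))) / (1 - t p * cnj (t q))) * \<xi> q)"
proof (rule tendsto_lowerbound)
  have nz: "1 - t p * cnj (t q) \<noteq> 0" if "p \<in> I" "q \<in> I" for p q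
  proof
    assume "1 - t p * cnj (t q) = 0"
    then have "cmod (t p) * cmod (t q) = 1" by (metis complex_mod_cnj eq_iff_diff_eq_0 norm_mult norm_one)
    moreover have "cmod (t p) * cmod (t q) < 1 * 1" using t that by (intro mult_strict_mono) auto
    ultimately show False by simp
  qed
  have "((\<lambda>r. Re (\<Sum>p\<in>I. \<Sum>q\<in>I. cnj (\<xi> p) * ((F p q (t p) + cnj (F q p (t q))) / (complex_of_real r ^ 2 - t p * cnj (t q))) * \<xi> q))
     \<longlongrightarrow> Re (\<Sum>p\<in>I. \<Sum>q\<in>I. cnj (\<xi> p) * ((F p q (t p) + cnj (F q p (t q))) / (complex_of_real 1 ^ 2 - t p * cnj (t q))) * \<xi> q)) (at_left 1)"
    by (intro tendsto_Re tendsto_sum tendsto_mult tendsto_divide tendsto_diff tendsto_const tendsto_power tendsto_of_real tendsto_ident_at)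
       (use nz in simp)
  then show "((\<lambda>r. Re (\<Sum>p\<in>I. \<Sum>q\<in>I. cnj (\<xi> p) * ((F p q (t p) + cnj (F q p (t q))) / (complex_of_real r ^ 2 - t p * cnj (t q))) * \<xi> q))
     \<longlongrightarrow> Re (\<Sum>p\<in>I. \<Sum>q\<in>I. cnj (\<xi> p) * ((F p q (t p) + cnj (F q p (t q))) / (1 - t p * cnj (t q))) * \<xi> q)) (at_left 1)"
    by simp
  define M where "M = Max (insert 0 (cmod ` t ` I))"
  have M: "M < 1" "\<And>p. p \<in> I \<Longrightarrow> cmod (t p) \<le> M" "0 \<le> M" unfolding M_def using I t by auto
  have "\<forall>\<^sub>F r in at_left 1. M < r \<and> r < 1"
    unfolding eventually_at_left_field using M(1) by (intro exI[of _ M]) auto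
  then show "\<forall>\<^sub>F r in at_left 1. 0 \<le> Re (\<Sum>p\<in>I. \<Sum>q\<in>I. cnj (\<xi> p) * ((F p q (t p) + cnj (F q p (t q))) / (complex_of_real r ^ 2 - t p * cnj (t q))) * \<xi> q)"
  proof eventually_elim
    case (elim r)
    have "\<And>p. p \<in> I \<Longrightarrow> cmod (t p) < r" using M(2) elim by fastforce
    then show ?case using disc_pick_radius[OF I F pos, of r t \<xi>] elim M(3) by simp
  qed
qed simp

text \<open>The Cayley transform; the denominators of the kernels differ by factors that are
  absorbed into \<open>\<xi>\<close>.\<close>
lemma halfplane_pick:
  fixes f :: "'i \<Rightarrow> 'i \<Rightarrow> complex \<Rightarrow> complex"
  assumes I: "finite I" and f: "\<And>p q. p \<in> I \<Longrightarrow> q \<in> I \<Longrightarrow> f p q holomorphic_on upper_half_plane"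
    and pos: "\<And>t c. 0 < Im t \<Longrightarrow> 0 \<le> Im (\<Sum>p\<in>I. \<Sum>q\<in>I. cnj (c p) * f p q t * c q)"
    and x: "\<And>p. p \<in> I \<Longrightarrow> 0 < Im (x p)"
  shows "0 \<le> Re (\<Sum>p\<in>I. \<Sum>q\<in>I. cnj (\<xi> p) * ((f p q (x p) - cnj (f q p (x q))) / (x p - cnj (x q))) * \<xi> q)"
proof -
  \<comment> \<open>the Cayley transform from the disc to the half plane, and the preimages of the points\<close>
  define \<phi> where "\<phi> t = \<i> * (1 + t) / (1 - t)" for t
  define F where "F p q t = - \<i> * f p q (\<phi> t)" for p q t
  define t where "t p = (x p - \<i>) / (x p + \<i>)" for p
  have im: "0 < Im (\<phi> s)" if s: "cmod s < 1" for s
  proof -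
    have s1: "s \<noteq> 1" using s by auto
    have "\<phi> s = (\<i> * (1 + s) * cnj (1 - s)) / ((1 - s) * cnj (1 - s))"
      unfolding \<phi>_def using s1 by simp
    also have "(1 - s) * cnj (1 - s) = complex_of_real ((cmod (1 - s))\<^sup>2)" by (simp only: complex_norm_square)
    finally have "Im (\<phi> s) = Im (\<i> * (1 + s) * cnj (1 - s)) / (cmod (1 - s))\<^sup>2" by (simp only: Im_divide_of_real)
    also have "Im (\<i> * (1 + s) * cnj (1 - s)) = 1 - (cmod s)\<^sup>2"
      by (simp add: cmod_power2 algebra_simps) (simp add: power2_eq_square)
    finally have "Im (\<phi> s) = (1 - (cmod s)\<^sup>2) / (cmod (1 - s))\<^sup>2" .
    moreover have "0 < 1 - (cmod s)\<^sup>2" using s by (simp add: abs_square_less_1)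
    ultimately show ?thesis using s1 by simp
  qed
  have hol: "F p q holomorphic_on ball 0 1" if "p \<in> I" "q \<in> I" for p q
  proof -
    have "\<phi> holomorphic_on ball 0 1"
      unfolding \<phi>_def by (intro holomorphic_intros) auto
    then have "(f p q \<circ> \<phi>) holomorphic_on ball 0 1"
      by (rule holomorphic_on_compose_gen[OF _ f[OF that]]) (auto intro: im)
    then show ?thesis unfolding F_def o_def by (intro holomorphic_intros)
  qed
  have posF: "0 \<le> Re (\<Sum>p\<in>I. \<Sum>q\<in>I. cnj (c p) * F p q s * c q)" if "cmod s < 1" for s c
  proof -
    have "(\<Sum>p\<in>I. \<Sum>q\<in>I. cnj (c p) * F p q s * c q) = - \<i> * (\<Sum>p\<in>I. \<Sum>q\<in>I. cnj (c p) * f p q (\<phi> s) * c q)"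
      unfolding sum_distrib_left by (simp add: F_def mult_ac)
    then show ?thesis using pos[OF im[OF that], of c] by simp
  qed
  have xi: "x p + \<i> \<noteq> 0" if "p \<in> I" for p using x[OF that] by (auto simp: complex_eq_iff)
  have \<phi>t: "\<phi> (t p) = x p" if p: "p \<in> I" for p
  proof -
    have "1 + t p = 2 * x p / (x p + \<i>)" "1 - t p = 2 * \<i> / (x p + \<i>)"
      using xi[OF p] by (simp_all add: t_def field_simps)
    then show ?thesis unfolding \<phi>_def using xi[OF p] by simp
  qed
  have tt: "cmod (t p) < 1" if p: "p \<in> I" for p
  proof -
    have "(cmod (x p - \<i>))\<^sup>2 < (cmod (x p + \<i>))\<^sup>2"
      using x[OF p] by (simp add: cmod_power2) (simp add: power2_eq_square algebra_simps)
    then have "cmod (x p - \<i>) < cmod (x p + \<i>)" by (rule power_less_imp_less_base) simp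
    then show ?thesis using xi[OF p] by (simp add: t_def norm_divide)
  qed
  define c where "c p = \<xi> p / cnj (x p + \<i>)" for p
  have "0 \<le> Re (\<Sum>p\<in>I. \<Sum>q\<in>I. cnj (c p) * ((F p q (t p) + cnj (F q p (t q))) / (1 - t p * cnj (t q))) * c q)"
    by (rule disc_pick[OF I hol posF tt])
  also have "(\<Sum>p\<in>I. \<Sum>q\<in>I. cnj (c p) * ((F p q (t p) + cnj (F q p (t q))) / (1 - t p * cnj (t q))) * c q)
     = (\<Sum>p\<in>I. \<Sum>q\<in>I. (1 / 2) * (cnj (\<xi> p) * ((f p q (x p) - cnj (f q p (x q))) / (x p - cnj (x q))) * \<xi> q))"
  proof (intro sum.cong refl)
    fix p q assume p: "p \<in> I" and q: "q \<in> I"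
    define A where "A = x p + \<i>"
    define B where "B = cnj (x q + \<i>)"
    define D where "D = x p - cnj (x q)"
    define N where "N = f p q (x p) - cnj (f q p (x q))"
    have nz: "A \<noteq> 0" "B \<noteq> 0" "D \<noteq> 0"
      using xi[OF p] xi[OF q] x[OF p] x[OF q] by (auto simp: A_def B_def D_def complex_eq_iff)
    have n: "F p q (t p) + cnj (F q p (t q)) = - \<i> * N"
      by (simp add: F_def \<phi>t p q N_def algebra_simps)
    have "1 - t p * cnj (t q) = (A * B - (x p - \<i>) * (cnj (x q) + \<i>)) / (A * B)"
    proof -
      have "t p = (x p - \<i>) / A" "cnj (t q) = (cnj (x q) + \<i>) / B"
        by (simp_all add: t_def A_def B_def)
      then have "t p * cnj (t q) = ((x p - \<i>) * (cnj (x q) + \<i>)) / (A * B)" by simp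
      then show ?thesis unfolding diff_divide_distrib using nz by simp
    qed
    also have "A * B - (x p - \<i>) * (cnj (x q) + \<i>) = - 2 * \<i> * D"
      by (simp add: A_def B_def D_def algebra_simps)
    finally have d: "1 - t p * cnj (t q) = - 2 * \<i> * D / (A * B)" .
    have "cnj (c p) = cnj (\<xi> p) / A" "c q = \<xi> q / B" by (simp_all add: c_def A_def B_def)
    then show "cnj (c p) * ((F p q (t p) + cnj (F q p (t q))) / (1 - t p * cnj (t q))) * c q
      = (1 / 2) * (cnj (\<xi> p) * ((f p q (x p) - cnj (f q p (x q))) / (x p - cnj (x q))) * \<xi> q)"
      unfolding n d N_def[symmetric] D_def[symmetric] using nz by simp
  qed
  also have "\<dots> = (1 / 2) * (\<Sum>p\<in>I. \<Sum>q\<in>I. cnj (\<xi> p) * ((f p q (x p) - cnj (f q p (x q))) / (x p - cnj (x q))) * \<xi> q)"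
    by (simp only: sum_distrib_left)
  finally show ?thesis by simp
qed

lemma nevanlinna_form:
  assumes w: "w \<in> nevanlinna_class m" and t: "0 < Im t"
  shows "0 \<le> Im (\<Sum>a<m. \<Sum>b<m. cnj (d a) * w t $$ (a, b) * d b)"
proof -
  have c: "w t \<in> carrier_mat m m" and p: "psd ((1 / (2 * \<i>)) \<cdot>\<^sub>m (w t - mat_adjoint (w t)))"
    using w t by (auto simp: nevanlinna_class_def)
  let ?A = "(1 / (2 * \<i>)) \<cdot>\<^sub>m (w t - mat_adjoint (w t))"
  have cA: "?A \<in> carrier_mat m m" using c mat_adjoint_carrier[OF c] by auto
  define S where "S = (\<Sum>a<m. \<Sum>b<m. cnj (d a) * w t $$ (a, b) * d b)"
  have "0 \<le> Re ((?A *\<^sub>v vec m d) \<bullet>c vec m d)"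
    using p cA unfolding psd_def by (auto simp del: smult_carrier_mat)
  also have "(?A *\<^sub>v vec m d) \<bullet>c vec m d
      = (\<Sum>a<m. (\<Sum>b<m. (1 / (2 * \<i>)) * (w t $$ (a, b) - cnj (w t $$ (b, a))) * d b) * cnj (d a))"
    using c by (simp add: scalar_prod_def lessThan_atLeast0 mat_adjoint_dims mat_adjoint_index)
  also have "\<dots> = (1 / (2 * \<i>)) * ((\<Sum>a<m. \<Sum>b<m. cnj (d a) * w t $$ (a, b) * d b)
      - (\<Sum>a<m. \<Sum>b<m. cnj (d a) * cnj (w t $$ (b, a)) * d b))"
    unfolding sum_distrib_left sum_distrib_right sum_subtractf[symmetric]
    by (intro sum.cong refl) (simp add: algebra_simps)
  also have "(\<Sum>a<m. \<Sum>b<m. cnj (d a) * cnj (w t $$ (b, a)) * d b) = cnj S"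
    unfolding S_def by (subst sum.swap) (simp add: mult_ac)
  also have "(1 / (2 * \<i>)) * ((\<Sum>a<m. \<Sum>b<m. cnj (d a) * w t $$ (a, b) * d b) - cnj S) = complex_of_real (Im S)"
    unfolding S_def[symmetric] by (simp add: complex_eq_iff Re_divide Im_divide)
  finally show ?thesis by (simp add: S_def)
qed

lemma sum_swap4:
  fixes h :: "'a \<Rightarrow> 'b \<Rightarrow> 'c \<Rightarrow> 'd \<Rightarrow> complex"
  shows "(\<Sum>j\<in>A. \<Sum>a\<in>B. \<Sum>k\<in>C. \<Sum>b\<in>D. h j a k b) = (\<Sum>a\<in>B. \<Sum>b\<in>D. \<Sum>j\<in>A. \<Sum>k\<in>C. h j a k b)"
proof -
  have 1: "(\<Sum>k\<in>C. \<Sum>b\<in>D. h j a k b) = (\<Sum>b\<in>D. \<Sum>k\<in>C. h j a k b)" for j a by (rule sum.swap)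
  have 2: "(\<Sum>j\<in>A. \<Sum>b\<in>D. \<Sum>k\<in>C. h j a k b) = (\<Sum>b\<in>D. \<Sum>j\<in>A. \<Sum>k\<in>C. h j a k b)" for a by (rule sum.swap)
  have "(\<Sum>j\<in>A. \<Sum>a\<in>B. \<Sum>k\<in>C. \<Sum>b\<in>D. h j a k b) = (\<Sum>a\<in>B. \<Sum>j\<in>A. \<Sum>k\<in>C. \<Sum>b\<in>D. h j a k b)"
    by (rule sum.swap)
  then show ?thesis by (simp only: 1 2)
qed

text \<open>The scalar kernel inequality, with pairs of a node and a coordinate as
  indices.\<close>
lemma (in pick_data) nevanlinna_pick:
  assumes f: "f \<in> nevanlinna_class m" and w: "\<And>k. k < n \<Longrightarrow> w k = emb (f (z k))"
  shows "0 \<le> Pick n"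
  unfolding psd_iff
proof (intro conjI allI)
  show "adj (Pick n) = Pick n" by (rule adj_Pick)
  fix y
  define I where "I = {..<n} \<times> {..<m}"
  define eta where "eta p = ent (blk m (fst p) * y) (snd p) 0" for p
  define \<xi> where "\<xi> p = cnj (z (fst p)) * eta p" for p
  have fc: "f (z k) \<in> carrier_mat m m" for k using f Im_z[of k] by (auto simp: nevanlinna_class_def)
  have ew: "ent (w j) a b = f (z j) $$ (a, b)" if "j < n" "a < m" "b < m" for j a b
    using that fc[of j] by (simp add: w ent_emb)
  have "0 \<le> Re (\<Sum>p\<in>I. \<Sum>q\<in>I. cnj (\<xi> p) * ((f (z (fst p)) $$ (snd p, snd q) - cnj (f (z (fst q)) $$ (snd q, snd p)))
      / (z (fst p) - cnj (z (fst q)))) * \<xi> q)"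
  proof (rule halfplane_pick[where f = "\<lambda>p q t. f t $$ (snd p, snd q)" and x = "\<lambda>p. z (fst p)"])
    show "finite I" by (simp add: I_def)
    show "(\<lambda>t. f t $$ (snd p, snd q)) holomorphic_on upper_half_plane" if "p \<in> I" "q \<in> I" for p q
      using f that by (auto simp: nevanlinna_class_def I_def)
    show "0 < Im (z (fst p))" for p by (rule Im_z)
    fix t :: complex and c :: "nat \<times> nat \<Rightarrow> complex" assume t: "0 < Im t"
    define d where "d a = (\<Sum>j<n. c (j, a))" for a
    have "(\<Sum>p\<in>I. \<Sum>q\<in>I. cnj (c p) * f t $$ (snd p, snd q) * c q)
        = (\<Sum>j<n. \<Sum>a<m. \<Sum>k<n. \<Sum>b<m. cnj (c (j, a)) * f t $$ (a, b) * c (k, b))"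
      unfolding I_def sum.cartesian_product' by simp
    also have "\<dots> = (\<Sum>a<m. \<Sum>b<m. cnj (d a) * f t $$ (a, b) * d b)"
    proof -
      have e: "(\<Sum>j<n. \<Sum>k<n. cnj (c (j, a)) * f t $$ (a, b) * c (k, b)) = cnj (d a) * f t $$ (a, b) * d b" for a b
        unfolding d_def by (simp add: sum_distrib_left sum_distrib_right) (rule sum.swap)
      show ?thesis by (subst sum_swap4) (simp only: e)
    qed
    finally show "0 \<le> Im (\<Sum>p\<in>I. \<Sum>q\<in>I. cnj (c p) * f t $$ (snd p, snd q) * c q)"
      using nevanlinna_form[OF f t, of d] by simp
  qed
  also have "(\<Sum>p\<in>I. \<Sum>q\<in>I. cnj (\<xi> p) * ((f (z (fst p)) $$ (snd p, snd q) - cnj (f (z (fst q)) $$ (snd q, snd p)))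
      / (z (fst p) - cnj (z (fst q)))) * \<xi> q)
     = (\<Sum>p\<in>I. \<Sum>q\<in>I. cnj (eta p) * (ent (pick_block (fst p) (fst q)) (snd p) (snd q) * eta q))"
    unfolding \<xi>_def pick_block_def
    by (intro sum.cong refl) (auto simp: I_def ew mult_ac)
  also have "\<dots> = (\<Sum>j<n. \<Sum>a<m. \<Sum>k<n. \<Sum>b<m. cnj (eta (j, a)) * (ent (pick_block j k) a b * eta (k, b)))"
    unfolding I_def sum.cartesian_product' by simp
  also have "\<dots> = ent (adj y * Pick n * y) 0 0"
  proof -
    have "ent (adj y * Pick n * y) 0 0 = (\<Sum>j<n. \<Sum>k<n. ent (adj (blk m j * y) * (pick_block j k * (blk m k * y))) 0 0)"
      unfolding Pick_def by (simp add: sum_distrib_left sum_distrib_right mult.assoc)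
    also have "\<dots> = (\<Sum>j<n. \<Sum>k<n. \<Sum>a<m. \<Sum>b<m. cnj (eta (j, a)) * (ent (pick_block j k) a b * eta (k, b)))"
    proof (intro sum.cong refl)
      fix j k
      have "ent (adj (blk m j * y) * (pick_block j k * (blk m k * y))) 0 0
          = (\<Sum>a<m. ent (adj (blk m j * y)) 0 a * ent (pick_block j k * (blk m k * y)) a 0)"
      proof (rule ent_mult_alt)
        fix a assume "ent (pick_block j k * (blk m k * y)) a 0 \<noteq> 0"
        then have "ent (dg m * (pick_block j k * (blk m k * y))) a 0 \<noteq> 0" by simp
        then show "a \<in> {..<m}" unfolding ent_dg_mult by (simp split: if_splits)
      qed simp
      also have "\<dots> = (\<Sum>a<m. \<Sum>b<m. cnj (eta (j, a)) * (ent (pick_block j k) a b * eta (k, b)))"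
      proof (rule sum.cong[OF refl])
        fix a
        have "ent (adj (blk m j * y)) 0 a = cnj (eta (j, a))" by (simp only: ent_simps eta_def fst_conv snd_conv)
        moreover have "ent (pick_block j k * (blk m k * y)) a 0 = (\<Sum>b<m. ent (pick_block j k) a b * eta (k, b))"
          using ent_mult_cor[of m m "pick_block j k" 0 "blk m k * y"] cor_pick_block by (simp add: eta_def)
        ultimately show "ent (adj (blk m j * y)) 0 a * ent (pick_block j k * (blk m k * y)) a 0
          = (\<Sum>b<m. cnj (eta (j, a)) * (ent (pick_block j k) a b * eta (k, b)))"
          by (simp only: sum_distrib_left)
      qed
      finally show "ent (adj (blk m j * y) * (pick_block j k * (blk m k * y))) 0 0
          = (\<Sum>a<m. \<Sum>b<m. cnj (eta (j, a)) * (ent (pick_block j k) a b * eta (k, b)))" .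
    qed
    also have "\<dots> = (\<Sum>j<n. \<Sum>a<m. \<Sum>k<n. \<Sum>b<m. cnj (eta (j, a)) * (ent (pick_block j k) a b * eta (k, b)))"
    proof (rule sum.cong[OF refl])
      fix j
      show "(\<Sum>k<n. \<Sum>a<m. \<Sum>b<m. cnj (eta (j, a)) * (ent (pick_block j k) a b * eta (k, b)))
        = (\<Sum>a<m. \<Sum>k<n. \<Sum>b<m. cnj (eta (j, a)) * (ent (pick_block j k) a b * eta (k, b)))"
        by (rule sum.swap)
    qed
    finally show ?thesis by simp
  qed
  finally show "0 \<le> qf (Pick n) y" by (simp add: qf_def)
qed

(*%FILE C2*)
section \<open>Solutions of truncated problems\<close>

lemma det_holomorphic:
  assumes "\<And>t. t \<in> S \<Longrightarrow> A t \<in> carrier_mat d d" and "\<And>i j. i < d \<Longrightarrow> j < d \<Longrightarrow> (\<lambda>t. A t $$ (i, j)) holomorphic_on S"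
  shows "(\<lambda>t. det (A t)) holomorphic_on S"
proof -
  have "(\<lambda>t. \<Sum>p | p permutes {0..<d}. signof p * (\<Prod>i = 0..<d. A t $$ (i, p i))) holomorphic_on S"
  proof (intro holomorphic_intros)
    fix p i assume p: "p \<in> {p. p permutes {0..<d}}" and i: "i \<in> {0..<d}"
    then have "p i < d" using permutes_in_image[of p "{0..<d}" i] by auto
    then show "(\<lambda>t. A t $$ (i, p i)) holomorphic_on S" using i by (intro assms) auto
  qed
  then show ?thesis
  proof (rule holomorphic_transform)
    fix t assume "t \<in> S"
    from det_def'[OF assms(1)[OF this]]
    show "(\<Sum>p | p permutes {0..<d}. signof p * (\<Prod>i = 0..<d. A t $$ (i, p i))) = det (A t)" by (rule sym)
  qed
qed

lemma adjugate_holomorphic: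
  assumes A: "\<And>t. t \<in> S \<Longrightarrow> A t \<in> carrier_mat d d" and h: "\<And>i j. i < d \<Longrightarrow> j < d \<Longrightarrow> (\<lambda>t. A t $$ (i, j)) holomorphic_on S"
    and ij: "i < d" "j < d"
  shows "(\<lambda>t. adj_mat (A t) $$ (i, j)) holomorphic_on S"
proof -
  have "(\<lambda>t. det (mat_delete (A t) j i)) holomorphic_on S"
  proof (rule det_holomorphic)
    show "mat_delete (A t) j i \<in> carrier_mat (d - 1) (d - 1)" if "t \<in> S" for t
      using mat_delete_carrier[OF A[OF that]] .
    fix k l assume kl: "k < d - 1" "l < d - 1"
    have "(\<lambda>t. A t $$ (if k < j then k else Suc k, if l < i then l else Suc l)) holomorphic_on S"
      using kl by (intro h) auto
    then show "(\<lambda>t. mat_delete (A t) j i $$ (k, l)) holomorphic_on S"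
    proof (rule holomorphic_transform)
      fix t assume "t \<in> S"
      then have "dim_row (A t) = d" "dim_col (A t) = d" using A by auto
      then show "A t $$ (if k < j then k else Suc k, if l < i then l else Suc l) = mat_delete (A t) j i $$ (k, l)"
        using kl by (simp add: mat_delete_def)
    qed
  qed
  then have "(\<lambda>t. (-1) ^ (j + i) * det (mat_delete (A t) j i)) holomorphic_on S"
    by (intro holomorphic_intros)
  then show ?thesis
  proof (rule holomorphic_transform)
    fix t assume "t \<in> S"
    then have "dim_row (A t) = d" "dim_col (A t) = d" using A by auto
    then show "(-1) ^ (j + i) * det (mat_delete (A t) j i) = adj_mat (A t) $$ (i, j)"
      using ij by (simp add: adj_mat_def cofactor_def)
  qed
qed

text \<open>Cramer's rule.\<close>
lemma inverse_holomorphic: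
  assumes A: "\<And>t. t \<in> S \<Longrightarrow> A t \<in> carrier_mat d d" and h: "\<And>i j. i < d \<Longrightarrow> j < d \<Longrightarrow> (\<lambda>t. A t $$ (i, j)) holomorphic_on S"
    and B: "\<And>t. t \<in> S \<Longrightarrow> B t \<in> carrier_mat d d" "\<And>t. t \<in> S \<Longrightarrow> B t * A t = 1\<^sub>m d" and ij: "i < d" "j < d"
  shows "(\<lambda>t. B t $$ (i, j)) holomorphic_on S"
proof -
  have nz: "det (A t) \<noteq> 0" if "t \<in> S" for t
  proof
    assume "det (A t) = 0"
    then have "det (B t * A t) = 0" using det_mult[OF B(1)[OF that] A[OF that]] by simp
    then show False using B(2)[OF that] by simp
  qed
  have eq: "adj_mat (A t) $$ (i, j) / det (A t) = B t $$ (i, j)" if t: "t \<in> S" for t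
  proof -
    note adj = adj_mat[OF A[OF t]]
    have "adj_mat (A t) = B t * A t * adj_mat (A t)" using B(2)[OF t] adj by simp
    also have "\<dots> = B t * (A t * adj_mat (A t))" by (rule assoc_mult_mat[OF B(1)[OF t] A[OF t] adj(1)])
    also have "\<dots> = det (A t) \<cdot>\<^sub>m B t"
      unfolding adj(2) using B(1)[OF t] by (simp add: mult_smult_distrib[OF B(1)[OF t] one_carrier_mat])
    finally show ?thesis using nz[OF t] ij B(1)[OF t] by simp
  qed
  have "(\<lambda>t. adj_mat (A t) $$ (i, j) / det (A t)) holomorphic_on S"
    by (intro holomorphic_intros adjugate_holomorphic[OF A h] det_holomorphic[OF A h] nz ij)
  then show ?thesis by (rule holomorphic_transform) (use eq in auto)
qed

lemma blk_sum:
  assumes "i < n"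
  shows "blk m i * (\<Sum>j<n. adj (blk m j) * D j) = dg m * D i"
  using assms by (simp add: sum_distrib_left blk_adj_blk_mult if_distrib cong: if_cong)

context pick_data
begin

text \<open>A solution of the truncated problem is \<open>u\<^sub>z\<^sup>* (M - x
  P)\<^sup>-\<^sup>1 u\<^sub>z\<close>, where \<open>u\<^sub>z\<close> has the blocks
  \<open>z\<^sub>k w\<^sub>k\<close>, \<open>P\<close> is the Pick matrix and
  \<open>M\<close> is a Hermitian matrix chosen so that the \<open>k\<close>-th block row of
  \<open>M - z\<^sub>k P\<close> is \<open>z\<^sub>k u\<^sub>z\<^sup>*\<close>. The four
  definitions are \<open>u\<^sub>z\<close>, \<open>M\<close>, \<open>M - x P\<close> and its
  inverse.\<close>
definition lifted_values :: "nat \<Rightarrow> fmat" where "lifted_values n = (\<Sum>k<n. z k *c (adj (blk m k) * w k))"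
definition pencil_const :: "nat \<Rightarrow> fmat" where
  "pencil_const n = (\<Sum>j<n. \<Sum>k<n. z j *c (adj (blk m j) * (pick_block j k * blk m k)))
     + (\<Sum>j<n. \<Sum>k<n. (z j * cnj (z k)) *c (adj (blk m j) * (adj (w k) * blk m k)))"
definition pencil :: "nat \<Rightarrow> complex \<Rightarrow> fmat" where "pencil n x = pencil_const n - x *c Pick n"
definition pencil_inv :: "nat \<Rightarrow> complex \<Rightarrow> complex mat" where
  "pencil_inv n x = mat_inv (unemb (n * m) (n * m) (pencil n x))"

lemma cor_lifted_values: "cor (n * m) m (lifted_values n)"
  unfolding lifted_values_def by (intro cor_sum cor_intros(5) cor_mult[OF cor_intros(6)[OF cor_blk] cor_w]) auto

lemma cor_pencil_const: "cor (n * m) (n * m) (pencil_const n)"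
proof -
  have bb: "cor (n * m) (n * m) (adj (blk m j) * (Y * blk m k))" if "j < n" "k < n" "cor m m Y" for j k Y
    by (rule cor_mult[OF cor_intros(6)[OF cor_blk[OF that(1)]] cor_mult[OF that(3) cor_blk[OF that(2)]]])
  show ?thesis unfolding pencil_const_def
    by (intro cor_intros(2) cor_sum cor_intros(5) bb cor_pick_block cor_intros(6) cor_w) simp_all
qed

lemma adj_pencil_const: "adj (pencil_const n) = pencil_const n"
  proof -
    have 0: "z j *c pick_block j k + (z j * cnj (z k)) *c adj (w k) = cnj (z k) *c pick_block j k + (z j * cnj (z k)) *c w j" for j k
    proof -
      have "z j *c pick_block j k - cnj (z k) *c pick_block j k = ((z j - cnj (z k)) * (z j * cnj (z k) / (z j - cnj (z k)))) *c (w j - adj (w k))"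
        unfolding pick_block_def cscale_simps(1) cscale_distrib(4)[symmetric] left_diff_distrib by (rule refl)
      also have "\<dots> = (z j * cnj (z k)) *c (w j - adj (w k))" using z_nz(2)[of j k] by simp
      finally have e: "z j *c pick_block j k = cnj (z k) *c pick_block j k + (z j * cnj (z k)) *c (w j - adj (w k))"
        by (simp only: diff_eq_eq add.commute)
      show ?thesis unfolding e cscale_distrib(2) by simp
    qed
    have M': "pencil_const n = (\<Sum>j<n. \<Sum>k<n. adj (blk m j) * ((z j *c pick_block j k + (z j * cnj (z k)) *c adj (w k)) * blk m k))"
      unfolding pencil_const_def sum.distrib[symmetric] by (simp add: distrib_left distrib_right)
    have "adj (pencil_const n) = (\<Sum>k<n. \<Sum>j<n. adj (blk m j) * ((cnj (z k) *c pick_block j k + (z j * cnj (z k)) *c w j) * blk m k))"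
      unfolding M' by (simp add: adj_pick_block mult.assoc mult.commute[of "z _" "cnj _"])
    also have "\<dots> = pencil_const n" unfolding M' 0 by (rule sum.swap)
    finally show ?thesis .
  qed

lemma blk_pencil_const:
  assumes j: "j < n"
  shows "blk m j * pencil_const n = z j *c (blk m j * Pick n) + z j *c adj (lifted_values n)"
  proof -
    define D1 where "D1 i = (\<Sum>k<n. z i *c (pick_block i k * blk m k))" for i
    define D2 where "D2 i = (\<Sum>k<n. (z i * cnj (z k)) *c (adj (w k) * blk m k))" for i
    define D3 where "D3 i = (\<Sum>k<n. pick_block i k * blk m k)" for i
    have c: "dg m * D1 i = D1 i" "dg m * D2 i = D2 i" "dg m * D3 i = D3 i" for i
      by (simp_all add: D1_def D2_def D3_def sum_distrib_left)
    have "pencil_const n = (\<Sum>i<n. adj (blk m i) * D1 i) + (\<Sum>i<n. adj (blk m i) * D2 i)"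
      by (simp add: pencil_const_def D1_def D2_def sum_distrib_left)
    then have "blk m j * pencil_const n = D1 j + D2 j" by (simp only: distrib_left blk_sum[OF j] c)
    moreover have "Pick n = (\<Sum>i<n. adj (blk m i) * D3 i)"
      by (simp add: Pick_def D3_def sum_distrib_left)
    then have "blk m j * Pick n = D3 j" by (simp only: blk_sum[OF j] c)
    moreover have "D1 j = z j *c D3 j" by (simp add: D1_def D3_def cscale_sum)
    moreover have "z j *c adj (lifted_values n) = D2 j"
      unfolding lifted_values_def D2_def by (simp add: cscale_sum)
    ultimately show ?thesis by simp
  qed

lemma cor_pencil: "cor (n * m) (n * m) (pencil n x)"
  unfolding pencil_def by (intro cor_intros(3,5) cor_pencil_const cor_nm)

text \<open>On the kernel the imaginary part of the form of \<open>M - x P\<close> vanishes;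
  it is \<open>-Im x\<close> times the form of \<open>P\<close>.\<close>
lemma pencil_inj:
  assumes kp: "nondegenerate n" and x: "0 < Im x" and v: "v \<in> carrier_vec (n * m)"
    "unemb (n * m) (n * m) (pencil n x) *\<^sub>v v = 0\<^sub>v (n * m)"
  shows "v = 0\<^sub>v (n * m)"
  proof (rule ccontr)
    assume v0: "v \<noteq> 0\<^sub>v (n * m)"
    let ?V = "colf v"
    let ?A = "unemb (n * m) (n * m) (pencil n x)"
    have "pencil n x * ?V = emb ?A * emb (mat (dim_vec v) 1 (\<lambda>(i, j). v $ i))" by (simp add: unemb_carrier emb_unemb[OF cor_pencil] colf_def)
    also have "\<dots> = emb (?A * mat (dim_vec v) 1 (\<lambda>(i, j). v $ i))"
      using v(1) unemb_carrier emb_unemb[OF cor_pencil] by (subst emb_mult[of _ "n * m" "n * m" _ 1]) auto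
    also have "?A * mat (dim_vec v) 1 (\<lambda>(i, j). v $ i) = 0\<^sub>m (n * m) 1"
    proof (rule eq_matI)
      fix i j assume "i < dim_row (0\<^sub>m (n * m) 1 :: complex mat)" "j < dim_col (0\<^sub>m (n * m) 1 :: complex mat)"
      then have i: "i < (n * m)" "j = 0" by auto
      have "(?A *\<^sub>v v) $ i = 0" using v(2) i by simp
      then show "(?A * mat (dim_vec v) 1 (\<lambda>(i, j). v $ i)) $$ (i, j) = 0\<^sub>m (n * m) 1 $$ (i, j)"
        using i v(1) by (simp add: scalar_prod_def unemb_def)
    qed (use unemb_carrier in auto)
    finally have AV: "pencil n x * ?V = 0" by (simp add: emb_zero)
    define h where "h = ent (adj ?V * pencil_const n * ?V) 0 0"
    define p where "p = ent (adj ?V * Pick n * ?V) 0 0"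
    have "adj (adj ?V * pencil_const n * ?V) = adj ?V * pencil_const n * ?V" "adj (adj ?V * Pick n * ?V) = adj ?V * Pick n * ?V"
      by (simp_all add: adj_pencil_const adj_Pick mult.assoc)
    then have h: "cnj h = h" and p: "cnj p = p"
      unfolding h_def p_def by (metis ent_simps(5))+
    have "ent (adj ?V * (pencil n x * ?V)) 0 0 = h - x * p"
      unfolding pencil_def h_def p_def by (simp add: left_diff_distrib right_diff_distrib mult.assoc)
    then have "Im (h - x * p) = 0" unfolding AV by simp
    moreover have "Im h = 0" "Im p = 0" using h p by (simp_all add: complex_eq_iff)
    ultimately have "Im x * Re p = 0" by simp
    then have "Re p = 0" using x by simp
    moreover obtain \<delta> where "0 < \<delta>" "\<delta> *\<^sub>R dg (n * m) \<le> Pick n" using Pick_pd[OF kp] by (auto simp: pd_def)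
    then have "0 < qf (Pick n) ?V" using qf_pos_of_ge v v0 by blast
    ultimately show False by (simp add: qf_def p_def)
  qed

lemma pencil_inv:
  assumes "nondegenerate n" "0 < Im x"
  shows "pencil_inv n x \<in> carrier_mat (n * m) (n * m)" "pencil_inv n x * unemb (n * m) (n * m) (pencil n x) = 1\<^sub>m (n * m)"
    "unemb (n * m) (n * m) (pencil n x) * pencil_inv n x = 1\<^sub>m (n * m)"
  unfolding pencil_inv_def by (rule mat_inv_props[OF unemb_carrier pencil_inj[OF assms]]; assumption)+

lemma pencil_inv_holomorphic:
  assumes kp: "nondegenerate n" and ij: "i < n * m" "j < n * m"
  shows "(\<lambda>x. pencil_inv n x $$ (i, j)) holomorphic_on upper_half_plane"
proof (rule inverse_holomorphic[where A = "\<lambda>x. unemb (n * m) (n * m) (pencil n x)" and d = "n * m"])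
  show "(\<lambda>x. unemb (n * m) (n * m) (pencil n x) $$ (i, j)) holomorphic_on upper_half_plane"
    if "i < n * m" "j < n * m" for i j
  proof -
    have "(\<lambda>x. ent (pencil_const n) i j - x * ent (Pick n) i j) holomorphic_on upper_half_plane" by (intro holomorphic_intros)
    then show ?thesis using that by (simp add: unemb_def pencil_def)
  qed
  show "pencil_inv n x * unemb (n * m) (n * m) (pencil n x) = 1\<^sub>m (n * m)" "pencil_inv n x \<in> carrier_mat (n * m) (n * m)"
    if "x \<in> upper_half_plane" for x
    using pencil_inv[OF kp] that by simp_all
qed (use ij in \<open>simp_all add: unemb_carrier\<close>)

lemma emb_pencil_inv:
  assumes "nondegenerate n" "0 < Im x"
  shows "cor (n * m) (n * m) (emb (pencil_inv n x))" "emb (pencil_inv n x) * pencil n x = dg (n * m)" "pencil n x * emb (pencil_inv n x) = dg (n * m)"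
proof -
  note r = pencil_inv[OF assms]
  show "cor (n * m) (n * m) (emb (pencil_inv n x))" by (rule cor_emb[OF r(1)])
  show "emb (pencil_inv n x) * pencil n x = dg (n * m)"
    using emb_mult[OF r(1) unemb_carrier[of "n * m" "n * m" "pencil n x"]] unfolding r(2) emb_unemb[OF cor_pencil] emb_one by (rule sym)
  show "pencil n x * emb (pencil_inv n x) = dg (n * m)"
    using emb_mult[OF unemb_carrier[of "n * m" "n * m" "pencil n x"] r(1)] unfolding r(3) emb_unemb[OF cor_pencil] emb_one by (rule sym)
qed

text \<open>The class condition holds because \<open>M\<close> is Hermitian and
  \<open>P\<close> positive, the interpolation conditions by the choice of
  \<open>M\<close>.\<close>
lemma pick_solution:
  assumes kp: "nondegenerate n"
  shows "\<exists>f \<in> nevanlinna_class m. \<forall>k<n. emb (f (z k)) = w k"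
proof -
  define f where "f x = unemb m m (adj (lifted_values n) * (emb (pencil_inv n x) * lifted_values n))" for x
  have ef: "emb (f x) = adj (lifted_values n) * (emb (pencil_inv n x) * lifted_values n)" if "0 < Im x" for x
    unfolding f_def by (rule emb_unemb) (intro cor_mult[OF cor_intros(6)[OF cor_lifted_values]] cor_mult[OF emb_pencil_inv(1)[OF kp that] cor_lifted_values])
  have fc: "f x \<in> carrier_mat m m" for x by (simp add: f_def unemb_carrier)
  have "f \<in> nevanlinna_class m"
    unfolding nevanlinna_class_def
  proof (intro CollectI conjI ballI allI impI)
    fix a c assume ac: "a < m" "c < m"
    have "(\<lambda>x. \<Sum>i<(n * m). \<Sum>j<(n * m). cnj (ent (lifted_values n) i a) * (pencil_inv n x $$ (i, j) * ent (lifted_values n) j c)) holomorphic_on upper_half_plane"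
      by (intro holomorphic_intros pencil_inv_holomorphic[OF kp]) auto
    then show "(\<lambda>x. f x $$ (a, c)) holomorphic_on upper_half_plane"
    proof (rule holomorphic_transform)
      fix x assume "x \<in> upper_half_plane"
      then have x: "0 < Im x" by simp
      have "f x $$ (a, c) = ent (adj (lifted_values n) * (emb (pencil_inv n x) * lifted_values n)) a c" using ac by (simp add: f_def unemb_def)
      also have "\<dots> = (\<Sum>i<(n * m). ent (adj (lifted_values n)) a i * ent (emb (pencil_inv n x) * lifted_values n) i c)"
        by (rule ent_mult_cor) (use cor_intros(6)[OF cor_lifted_values] in blast)
      also have "\<dots> = (\<Sum>i<(n * m). \<Sum>j<(n * m). cnj (ent (lifted_values n) i a) * (ent (emb (pencil_inv n x)) i j * ent (lifted_values n) j c))"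
        using ent_mult_cor[of "n * m" "n * m" "emb (pencil_inv n x)" m "lifted_values n"] emb_pencil_inv(1)[OF kp x] by (simp add: sum_distrib_left)
      also have "\<dots> = (\<Sum>i<(n * m). \<Sum>j<(n * m). cnj (ent (lifted_values n) i a) * (pencil_inv n x $$ (i, j) * ent (lifted_values n) j c))"
        using pencil_inv(1)[OF kp x] by (intro sum.cong refl) (simp add: ent_emb)
      finally show "(\<Sum>i<(n * m). \<Sum>j<(n * m). cnj (ent (lifted_values n) i a) * (pencil_inv n x $$ (i, j) * ent (lifted_values n) j c)) = f x $$ (a, c)" by simp
    qed
  next
    fix x assume "x \<in> upper_half_plane"
    then have x: "0 < Im x" by simp
    let ?R = "emb (pencil_inv n x)"
    have "adj ?R * (adj (pencil n x) * ?R) = adj ?R * adj (pencil n x) * ?R" by (simp only: mult.assoc)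
    also have "adj ?R * adj (pencil n x) = dg (n * m)" using arg_cong[OF emb_pencil_inv(3)[OF kp x], of adj] by simp
    finally have 1: "adj ?R * (adj (pencil n x) * ?R) = ?R" using corD[OF emb_pencil_inv(1)[OF kp x]] by simp
    have 2: "adj ?R * (pencil n x * ?R) = adj ?R" using emb_pencil_inv(3)[OF kp x] corD[OF cor_intros(6)[OF emb_pencil_inv(1)[OF kp x]]] by simp
    have "?R - adj ?R = adj ?R * ((adj (pencil n x) - pencil n x) * ?R)"
      by (simp add: left_diff_distrib right_diff_distrib 1 2)
    also have "adj (pencil n x) - pencil n x = (x - cnj x) *c Pick n"
      by (simp add: pencil_def adj_pencil_const adj_Pick cscale_distrib)
    finally have RR: "?R - adj ?R = (x - cnj x) *c (adj ?R * (Pick n * ?R))" by simp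
    have "emb ((1 / (2 * \<i>)) \<cdot>\<^sub>m (f x - mat_adjoint (f x))) = (1 / (2 * \<i>)) *c (adj (lifted_values n) * ((?R - adj ?R) * lifted_values n))"
    proof -
      have "emb ((1 / (2 * \<i>)) \<cdot>\<^sub>m (f x - mat_adjoint (f x))) = (1 / (2 * \<i>)) *c (emb (f x) - adj (emb (f x)))"
        by (simp only: emb_smult emb_diff[OF fc[of x] mat_adjoint_carrier[OF fc[of x]]] emb_adj)
      also have "emb (f x) - adj (emb (f x)) = adj (lifted_values n) * ((?R - adj ?R) * lifted_values n)"
        unfolding ef[OF x] by (simp add: left_diff_distrib right_diff_distrib mult.assoc)
      finally show ?thesis .
    qed
    also have "\<dots> = (1 / (2 * \<i>) * (x - cnj x)) *c (adj (?R * lifted_values n) * Pick n * (?R * lifted_values n))"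
      unfolding RR by (simp add: mult.assoc)
    also have "1 / (2 * \<i>) * (x - cnj x) = complex_of_real (Im x)" by (simp add: complex_eq_iff)
    finally have "emb ((1 / (2 * \<i>)) \<cdot>\<^sub>m (f x - mat_adjoint (f x))) = Im x *\<^sub>R (adj (?R * lifted_values n) * Pick n * (?R * lifted_values n))"
      by (simp only: scaleR_cscale)
    also have "0 \<le> \<dots>"
      using x psd_cong[OF pd_psd[OF Pick_pd[OF kp]], of "adj (?R * lifted_values n)"] by (intro scaleR_nonneg_nonneg) simp_all
    finally show "psd ((1 / (2 * \<i>)) \<cdot>\<^sub>m (f x - mat_adjoint (f x)))"
      by (subst psd_emb[of _ m]) (use fc[of x] mat_adjoint_carrier[OF fc[of x]] in auto)
  qed (rule fc)
  moreover have "emb (f (z k)) = w k" if k: "k < n" for k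
  proof -
    have "blk m k * pencil n (z k) = z k *c adj (lifted_values n)"
      unfolding pencil_def by (simp add: right_diff_distrib blk_pencil_const[OF k])
    then have "z k *c (adj (lifted_values n) * emb (pencil_inv n (z k))) = blk m k * (pencil n (z k) * emb (pencil_inv n (z k)))" by (simp flip: mult.assoc)
    then have "z k *c (adj (lifted_values n) * emb (pencil_inv n (z k))) = blk m k" using emb_pencil_inv(3)[OF kp Im_z[of k]] corD[OF cor_blk[OF k]] by simp
    then have "(z k *c (adj (lifted_values n) * emb (pencil_inv n (z k)))) * lifted_values n = blk m k * lifted_values n" by (rule arg_cong)
    then have "z k *c (adj (lifted_values n) * (emb (pencil_inv n (z k)) * lifted_values n)) = blk m k * lifted_values n" by (simp only: cscale_mult mult.assoc)
    also have "blk m k * lifted_values n = z k *c w k"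
    proof -
      have "lifted_values n = (\<Sum>k<n. adj (blk m k) * (z k *c w k))" by (simp add: lifted_values_def)
      then have "blk m k * lifted_values n = dg m * (z k *c w k)" by (simp only: blk_sum[OF k])
      then show ?thesis by simp
    qed
    finally have "(1 / z k) *c (z k *c (adj (lifted_values n) * (emb (pencil_inv n (z k)) * lifted_values n))) = (1 / z k) *c (z k *c w k)" by simp
    then show ?thesis using z_nz(1)[of k] by (simp add: ef[OF Im_z])
  qed
  ultimately show ?thesis by blast
qed

end

(*%FILE C3*)
section \<open>Compactness of the Nevanlinna class\<close>

text \<open>The Pick matrix of two nodes, with the first block row scaled by
  \<open>s\<close>.\<close>
lemma (in pick_data) pick_block_bound:
  assumes P: "0 \<le> Pick 2" and s: "0 < s" and ab: "a < m" "c < m"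
  shows "cmod (ent (pick_block 0 1) a c) \<le> (s * Re (ent (pick_block 0 0) a a) + Re (ent (pick_block 1 1) c c) / s) / 2"
proof -
  define D where "D = complex_of_real s *c (adj (blk m 0) * blk m 0) + adj (blk m 1) * blk m 1"
  have b2: "blk m j * (Pick 2 * adj (blk m k)) = pick_block j k" if "j < 2" "k < 2" for j k
  proof -
    have "Pick 2 = (\<Sum>j<2. adj (blk m j) * (\<Sum>k<2. pick_block j k * blk m k))"
      by (simp add: Pick_def sum_distrib_left)
    then have "blk m j * Pick 2 = dg m * (\<Sum>k<2. pick_block j k * blk m k)" by (simp only: blk_sum[OF that(1)])
    then have "(blk m j * Pick 2) * adj (blk m k) = (\<Sum>l<2. pick_block j l * (blk m l * adj (blk m k)))"
      by (simp add: sum_distrib_left sum_distrib_right mult.assoc)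
    also have "\<dots> = pick_block j k" using that(2) by (simp add: blk_adj_blk if_distrib cong: if_cong)
    finally show ?thesis by (simp only: mult.assoc)
  qed
  have psd: "0 \<le> D * Pick 2 * adj D" using P by (rule psd_cong)
  have bD: "blk m 0 * D = complex_of_real s *c blk m 0" "blk m 1 * D = blk m 1"
    unfolding D_def by (simp_all add: distrib_left blk_adj_blk_mult)
  have bDa: "adj D * adj (blk m 0) = complex_of_real s *c adj (blk m 0)" "adj D * adj (blk m 1) = adj (blk m 1)"
    using arg_cong[OF bD(1), of adj] arg_cong[OF bD(2), of adj] by simp_all
  note e = ent_block
  let ?Y = "D * Pick 2 * adj D"
  have Y: "blk m 0 * (?Y * adj (blk m 1)) = complex_of_real s *c pick_block 0 1"
    "blk m 0 * (?Y * adj (blk m 0)) = (complex_of_real s * complex_of_real s) *c pick_block 0 0"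
    "blk m 1 * (?Y * adj (blk m 1)) = pick_block 1 1"
  proof -
    have "blk m j * (?Y * adj (blk m k)) = (blk m j * D) * (Pick 2 * (adj D * adj (blk m k)))" for j k
      by (simp only: mult.assoc)
    then show "blk m 0 * (?Y * adj (blk m 1)) = complex_of_real s *c pick_block 0 1"
      "blk m 0 * (?Y * adj (blk m 0)) = (complex_of_real s * complex_of_real s) *c pick_block 0 0"
      "blk m 1 * (?Y * adj (blk m 1)) = pick_block 1 1"
      using b2[of 0 1] b2[of 0 0] b2[of 1 1] by (simp_all only: bD bDa cscale_mult cscale_simps)
  qed
  have "cmod (ent ?Y (0 * m + a) (1 * m + c)) \<le> (Re (ent ?Y (0 * m + a) (0 * m + a)) + Re (ent ?Y (1 * m + c) (1 * m + c))) / 2"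
    by (rule psd_entry_bound(1)[OF psd])
  then have "cmod (ent (complex_of_real s *c pick_block 0 1) a c)
      \<le> (Re (ent ((complex_of_real s * complex_of_real s) *c pick_block 0 0) a a) + Re (ent (pick_block 1 1) c c)) / 2"
    unfolding e[OF ab(1) ab(2), symmetric] e[OF ab(1) ab(1), symmetric] e[OF ab(2) ab(2), symmetric] Y .
  then have "s * cmod (ent (pick_block 0 1) a c) \<le> (s * s * Re (ent (pick_block 0 0) a a) + Re (ent (pick_block 1 1) c c)) / 2"
    using s by (simp add: norm_mult)
  also have "\<dots> = s * ((s * Re (ent (pick_block 0 0) a a) + Re (ent (pick_block 1 1) c c) / s) / 2)"
    using s by (simp add: field_simps)
  finally show ?thesis using s by (simp only: mult_le_cancel_left_pos)
qed

text \<open>A bound of Harnack type from the Pick matrix of the nodes \<open>x\<close> and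
  \<open>z0\<close>. The scaling parameter is chosen so that the unknown value enters the
  right hand side with factor one half.\<close>
lemma nevanlinna_growth:
  assumes f: "f \<in> nevanlinna_class m" and x: "0 < Im x" and z0: "0 < Im z0" and m: "0 < m"
  shows "nrm m (emb (f x)) \<le> nrm m (emb (f z0)) * (2 + (real m)\<^sup>2 * (cmod (x - cnj z0))\<^sup>2 / (Im x * Im z0))"
proof -
  define z where "z k = (if k = 0 then x else z0)" for k :: nat
  define w where "w k = emb (f (z k))" for k
  have fc: "f t \<in> carrier_mat m m" if "0 < Im t" for t using f that by (auto simp: nevanlinna_class_def)
  interpret P: pick_data m z w
    by unfold_locales (use x z0 fc in \<open>auto simp: z_def w_def intro!: cor_emb\<close>)
  have "0 \<le> P.Pick 2" by (rule P.nevanlinna_pick[OF f]) (simp add: w_def)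
  note bd = P.pick_block_bound[OF this]
  let ?A = "emb (f x)" and ?B = "emb (f z0)"
  have w01: "w 0 = ?A" "w 1 = ?B" "z 0 = x" "z 1 = z0" by (simp_all add: w_def z_def)
  have xz: "x - cnj z0 \<noteq> 0" "x \<noteq> 0" "z0 \<noteq> 0" using x z0 by (auto simp: complex_eq_iff)
  define k where "k = cmod (x * cnj z0 / (x - cnj z0))"
  have k: "0 < k" unfolding k_def using xz by simp
  \<comment> \<open>then the contribution of the unknown value is half of the left hand side\<close>
  define s where "s = k * Im x / (real m * (cmod x)\<^sup>2)"
  have s: "0 < s" unfolding s_def using k x xz m by simp
  have diag: "Re (ent (P.pick_block j j) a a) = (cmod (z j))\<^sup>2 / Im (z j) * Im (ent (w j) a a)" for j a
  proof -
    have "z j - cnj (z j) = 2 * \<i> * Im (z j)" by (simp add: complex_eq_iff)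
    moreover have "ent (w j) a a - cnj (ent (w j) a a) = 2 * \<i> * Im (ent (w j) a a)" by (simp add: complex_eq_iff)
    moreover have "z j * cnj (z j) = complex_of_real ((cmod (z j))\<^sup>2)" by (simp only: complex_norm_square)
    ultimately have "ent (P.pick_block j j) a a = complex_of_real ((cmod (z j))\<^sup>2) / (2 * \<i> * Im (z j)) * (2 * \<i> * Im (ent (w j) a a))"
      by (simp add: P.pick_block_def)
    also have "\<dots> = complex_of_real ((cmod (z j))\<^sup>2 / Im (z j) * Im (ent (w j) a a))"
      using P.Im_z[of j] by simp
    finally show ?thesis by simp
  qed
  have tr: "(\<Sum>a<m. Im (ent Y a a)) \<le> nrm m Y" for Y
    unfolding nrm_def
  proof (rule sum_mono)
    fix a assume "a \<in> {..<m}"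
    then have "cmod (ent Y a a) \<le> (\<Sum>j<m. cmod (ent Y a j))" by (intro member_le_sum) auto
    then show "Im (ent Y a a) \<le> (\<Sum>j<m. cmod (ent Y a j))" using abs_Im_le_cmod[of "ent Y a a"] by linarith
  qed
  have "k * nrm m (?A - adj ?B) = nrm m (P.pick_block 0 1)"
    unfolding P.pick_block_def w01 nrm_cscale k_def ..
  also have "\<dots> \<le> (\<Sum>a<m. \<Sum>c<m. (s * Re (ent (P.pick_block 0 0) a a) + Re (ent (P.pick_block 1 1) c c) / s) / 2)"
    unfolding nrm_def by (intro sum_mono bd[OF s]) auto
  also have "\<dots> = real m / 2 * (s * ((cmod x)\<^sup>2 / Im x) * (\<Sum>a<m. Im (ent ?A a a)) + (cmod z0)\<^sup>2 / Im z0 / s * (\<Sum>a<m. Im (ent ?B a a)))"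
    unfolding diag w01
    by (simp add: sum.distrib add_divide_distrib sum_divide_distrib[symmetric] sum_distrib_left[symmetric]
        distrib_left mult.assoc)
  also have "\<dots> \<le> real m / 2 * (s * ((cmod x)\<^sup>2 / Im x) * nrm m ?A + (cmod z0)\<^sup>2 / Im z0 / s * nrm m ?B)"
    using s x z0 by (intro mult_left_mono add_mono tr) auto
  also have "\<dots> = k / 2 * nrm m ?A + real m / 2 * ((cmod z0)\<^sup>2 / Im z0 / s) * nrm m ?B"
    using x xz m by (simp add: s_def field_simps)
  finally have 1: "k * nrm m (?A - adj ?B) \<le> k / 2 * nrm m ?A + real m / 2 * ((cmod z0)\<^sup>2 / Im z0 / s) * nrm m ?B" .
  have "nrm m ?A \<le> nrm m (?A - adj ?B) + nrm m ?B"
    using nrm_add[of m "?A - adj ?B" "adj ?B"] by (simp add: nrm_adj)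
  then have "k * nrm m ?A \<le> k * (nrm m (?A - adj ?B) + nrm m ?B)" using k by (intro mult_left_mono) auto
  then have "k / 2 * nrm m ?A \<le> nrm m ?B * (k + real m / 2 * ((cmod z0)\<^sup>2 / Im z0 / s))"
  proof -
    define q where "q = real m / 2 * ((cmod z0)\<^sup>2 / Im z0 / s)"
    have "k * nrm m ?A = k / 2 * nrm m ?A + k / 2 * nrm m ?A" by simp
    moreover have "k * (nrm m (?A - adj ?B) + nrm m ?B) = k * nrm m (?A - adj ?B) + k * nrm m ?B" by (rule distrib_left)
    ultimately have "k / 2 * nrm m ?A \<le> k * nrm m ?B + q * nrm m ?B"
      using 1 \<open>k * nrm m ?A \<le> _\<close> unfolding q_def[symmetric] by linarith
    moreover have "nrm m ?B * (k + q) = k * nrm m ?B + q * nrm m ?B" by (simp add: algebra_simps)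
    ultimately show ?thesis unfolding q_def[symmetric] by simp
  qed
  then have "nrm m ?A \<le> nrm m ?B * (k + real m / 2 * ((cmod z0)\<^sup>2 / Im z0 / s)) / (k / 2)"
    using k by (simp only: pos_le_divide_eq[of "k / 2"] mult.commute half_gt_zero)
  also have "\<dots> = nrm m ?B * (2 + real m * (cmod z0)\<^sup>2 / (Im z0 * s * k))"
    using k s z0 by (simp add: field_simps)
  also have "real m * (cmod z0)\<^sup>2 / (Im z0 * s * k) = (real m)\<^sup>2 * (cmod (x - cnj z0))\<^sup>2 / (Im x * Im z0)"
  proof -
    have "k = cmod x * cmod z0 / cmod (x - cnj z0)" by (simp add: k_def norm_mult norm_divide)
    then have "k * k = (cmod x)\<^sup>2 * (cmod z0)\<^sup>2 / (cmod (x - cnj z0))\<^sup>2" by (simp add: power2_eq_square)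
    moreover have "Im z0 * s * k = Im z0 * (Im x / (real m * (cmod x)\<^sup>2)) * (k * k)" by (simp add: s_def)
    ultimately have "Im z0 * s * k = Im z0 * (Im x / (real m * (cmod x)\<^sup>2)) * ((cmod x)\<^sup>2 * (cmod z0)\<^sup>2 / (cmod (x - cnj z0))\<^sup>2)"
      by (simp only:)
    then have "Im z0 * s * k = Im z0 * Im x * (cmod z0)\<^sup>2 / (real m * (cmod (x - cnj z0))\<^sup>2)"
      using xz by simp
    then show ?thesis using xz x z0 m by (simp add: power2_eq_square mult.commute[of "Im x"])
  qed
  finally show ?thesis .
qed

text \<open>Montel's theorem, applied to one entry after the other.\<close>
lemma montel_finite_family:
  fixes F :: "nat \<Rightarrow> 'i \<Rightarrow> complex \<Rightarrow> complex"
  assumes I: "finite I" and S: "open S" and hol: "\<And>n i. i \<in> I \<Longrightarrow> F n i holomorphic_on S"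
    and bd: "\<And>K. compact K \<Longrightarrow> K \<subseteq> S \<Longrightarrow> \<exists>B. \<forall>n. \<forall>i\<in>I. \<forall>x\<in>K. cmod (F n i x) \<le> B"
  shows "\<exists>g (r :: nat \<Rightarrow> nat). strict_mono r \<and> (\<forall>i\<in>I. g i holomorphic_on S \<and> (\<forall>x\<in>S. (\<lambda>n. F (r n) i x) \<longlonglongrightarrow> g i x))"
  using I hol bd
proof (induction I rule: finite_induct)
  case empty
  have "strict_mono (id :: nat \<Rightarrow> nat)" by (simp add: strict_mono_def)
  then show ?case by blast
next
  case (insert i I)
  have "\<exists>g (r :: nat \<Rightarrow> nat). strict_mono r \<and> (\<forall>i\<in>I. g i holomorphic_on S \<and> (\<forall>x\<in>S. (\<lambda>n. F (r n) i x) \<longlonglongrightarrow> g i x))"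
  proof (rule insert.IH)
    show "\<exists>B. \<forall>n. \<forall>i\<in>I. \<forall>x\<in>K. cmod (F n i x) \<le> B" if "compact K" "K \<subseteq> S" for K
      using insert.prems(2)[OF that] by blast
  qed (use insert.prems(1) in blast)
  then obtain g r where r: "strict_mono (r :: nat \<Rightarrow> nat)"
    and g: "\<And>j. j \<in> I \<Longrightarrow> g j holomorphic_on S" "\<And>j x. j \<in> I \<Longrightarrow> x \<in> S \<Longrightarrow> (\<lambda>n. F (r n) j x) \<longlonglongrightarrow> g j x"
    by blast
  define H where "H = range (\<lambda>n. F (r n) i)"
  obtain h q where h: "h holomorphic_on S" and q: "strict_mono (q :: nat \<Rightarrow> nat)"
    and lim: "\<And>x. x \<in> S \<Longrightarrow> (\<lambda>n. F (r (q n)) i x) \<longlonglongrightarrow> h x"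
  proof (rule Montel[of S H "\<lambda>n. F (r n) i"])
    show "open S" by (rule S)
    show "k holomorphic_on S" if "k \<in> H" for k using that insert.prems(1) by (auto simp: H_def)
    show "\<exists>B. \<forall>h\<in>H. \<forall>z\<in>K. cmod (h z) \<le> B" if "compact K" "K \<subseteq> S" for K
      using insert.prems(2)[OF that] unfolding H_def by blast
    show "range (\<lambda>n. F (r n) i) \<subseteq> H" by (simp add: H_def)
  qed (use that in blast)
  define G where "G j = (if j = i then h else g j)" for j
  have "G j holomorphic_on S \<and> (\<forall>x\<in>S. (\<lambda>n. F ((r \<circ> q) n) j x) \<longlonglongrightarrow> G j x)" if j: "j \<in> insert i I" for j
  proof (cases "j = i")
    case True then show ?thesis using h lim by (simp add: G_def)
  next
    case False
    then have "j \<in> I" using j by simp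
    have "(\<lambda>n. F (r (q n)) j x) \<longlonglongrightarrow> g j x" if "x \<in> S" for x
      using LIMSEQ_subseq_LIMSEQ[OF g(2)[OF \<open>j \<in> I\<close> that] q] by (simp add: o_def)
    then show ?thesis using False g(1)[OF \<open>j \<in> I\<close>] by (simp add: G_def)
  qed
  moreover have "strict_mono (r \<circ> q)" using r q by (rule strict_mono_o)
  ultimately show ?case by blast
qed

text \<open>A bound at one point bounds the family on compact sets, and the class is closed
  under pointwise limits.\<close>
lemma nevanlinna_limit:
  assumes F: "\<And>n. F n \<in> nevanlinna_class m" and z0: "0 < Im z0" and m: "0 < m"
    and C: "\<And>n. nrm m (emb (F n z0)) \<le> C"
  obtains f r where "f \<in> nevanlinna_class m" "strict_mono (r :: nat \<Rightarrow> nat)"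
    "\<And>x. 0 < Im x \<Longrightarrow> tends (\<lambda>n. emb (F (r n) x)) (emb (f x))"
proof -
  define I where "I = {..<m} \<times> {..<m}"
  have Fc: "F n x \<in> carrier_mat m m" if "0 < Im x" for n x using F[of n] that by (auto simp: nevanlinna_class_def)
  have C0: "0 \<le> C" using C[of 0] nrm_nonneg order_trans by blast
  have "\<exists>g (r :: nat \<Rightarrow> nat). strict_mono r \<and> (\<forall>p\<in>I. g p holomorphic_on upper_half_plane
      \<and> (\<forall>x\<in>upper_half_plane. (\<lambda>n. F (r n) x $$ p) \<longlonglongrightarrow> g p x))"
  proof (rule montel_finite_family[of I upper_half_plane "\<lambda>n p x. F n x $$ p"])
    show "finite I" by (simp add: I_def)
    show "open upper_half_plane" by (rule open_halfspace_Im_gt)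
    show "(\<lambda>x. F n x $$ p) holomorphic_on upper_half_plane" if "p \<in> I" for n p
      using F[of n] that by (auto simp: nevanlinna_class_def I_def)
    fix K :: "complex set" assume K: "compact K" "K \<subseteq> upper_half_plane"
    define D where "D x = 2 + (real m)\<^sup>2 * (cmod (x - cnj z0))\<^sup>2 / (Im x * Im z0)" for x
    have "continuous_on K D"
      unfolding D_def using K z0 by (intro continuous_intros) auto
    then have "bounded (D ` K)" using compact_continuous_image K(1) compact_imp_bounded by blast
    then obtain B where B0: "\<forall>y\<in>D ` K. norm y \<le> B" unfolding bounded_iff by (elim exE)
    have B: "D x \<le> B" if "x \<in> K" for x
    proof -
      have "norm (D x) \<le> B" using B0 that by (simp only: ball_simps)
      then show ?thesis by simp
    qed
    have "cmod (F n x $$ p) \<le> C * B" if "p \<in> I" "x \<in> K" for n p x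
    proof -
      have x: "0 < Im x" using K that by auto
      have "F n x $$ p = ent (emb (F n x)) (fst p) (snd p)" using Fc[OF x, of n] that by (auto simp: ent_emb I_def)
      then have "cmod (F n x $$ p) \<le> nrm m (emb (F n x))" using nrm_entry that by (auto simp: I_def)
      also have "\<dots> \<le> nrm m (emb (F n z0)) * D x" unfolding D_def by (rule nevanlinna_growth[OF F x z0 m])
      also have "\<dots> \<le> C * B"
      proof (intro mult_mono C C0 B that)
        show "0 \<le> D x" unfolding D_def using x z0 by simp
      qed
      finally show ?thesis .
    qed
    then show "\<exists>B. \<forall>n. \<forall>p\<in>I. \<forall>x\<in>K. cmod (F n x $$ p) \<le> B" by blast
  qed
  then obtain g r where r: "strict_mono (r :: nat \<Rightarrow> nat)"
    and g: "\<And>p. p \<in> I \<Longrightarrow> g p holomorphic_on upper_half_plane"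
      "\<And>p x. p \<in> I \<Longrightarrow> 0 < Im x \<Longrightarrow> (\<lambda>n. F (r n) x $$ p) \<longlonglongrightarrow> g p x"
    by blast
  define f where "f x = mat m m (\<lambda>p. g p x)" for x
  have fc: "f x \<in> carrier_mat m m" for x by (simp add: f_def)
  have T: "tends (\<lambda>n. emb (F (r n) x)) (emb (f x))" if x: "0 < Im x" for x
    unfolding tends_def
  proof (intro allI)
    fix i j
    show "(\<lambda>n. ent (emb (F (r n) x)) i j) \<longlonglongrightarrow> ent (emb (f x)) i j"
    proof (cases "i < m \<and> j < m")
      case True
      then have "(i, j) \<in> I" by (simp add: I_def)
      then show ?thesis using g(2)[of "(i, j)" x] x True carrier_matD[OF Fc[OF x]] by (simp add: ent_emb f_def)
    next
      case False
      then show ?thesis using carrier_matD[OF Fc[OF x]] by (auto simp: ent_emb f_def)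
    qed
  qed
  have "f \<in> nevanlinna_class m"
    unfolding nevanlinna_class_def
  proof (intro CollectI conjI ballI allI impI)
    show "f x \<in> carrier_mat m m" for x by (rule fc)
    fix a b assume "a < m" "b < m"
    then show "(\<lambda>x. f x $$ (a, b)) holomorphic_on upper_half_plane"
      using g(1)[of "(a, b)"] by (simp add: f_def I_def)
  next
    fix x assume "x \<in> upper_half_plane"
    then have x: "0 < Im x" by simp
    have e: "emb ((1 / (2 * \<i>)) \<cdot>\<^sub>m (M - mat_adjoint M)) = (1 / (2 * \<i>)) *c (emb M - adj (emb M))"
      if "M \<in> carrier_mat m m" for M
      by (simp only: emb_smult emb_diff[OF that mat_adjoint_carrier[OF that]] emb_adj)
    have c: "(1 / (2 * \<i>)) \<cdot>\<^sub>m (M - mat_adjoint M) \<in> carrier_mat m m" if "M \<in> carrier_mat m m" for M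
      by (intro smult_carrier_mat minus_carrier_mat mat_adjoint_carrier that)
    have "0 \<le> (1 / (2 * \<i>)) *c (emb (f x) - adj (emb (f x)))"
    proof (rule tends_psd)
      show "tends (\<lambda>n. (1 / (2 * \<i>)) *c (emb (F (r n) x) - adj (emb (F (r n) x)))) ((1 / (2 * \<i>)) *c (emb (f x) - adj (emb (f x))))"
        by (intro tends_cscale tends_diff tends_adj T x)
      show "cor m m ((1 / (2 * \<i>)) *c (emb (F (r n) x) - adj (emb (F (r n) x))))" for n
        by (intro cor_intros(3,5,6) cor_emb Fc x)
      fix n :: nat assume "n \<ge> 0"
      have "psd ((1 / (2 * \<i>)) \<cdot>\<^sub>m (F (r n) x - mat_adjoint (F (r n) x)))"
        using F[of "r n"] x by (simp add: nevanlinna_class_def)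
      then show "0 \<le> (1 / (2 * \<i>)) *c (emb (F (r n) x) - adj (emb (F (r n) x)))"
        unfolding psd_emb[OF c[OF Fc[OF x]]] e[OF Fc[OF x]] .
    qed
    then show "psd ((1 / (2 * \<i>)) \<cdot>\<^sub>m (f x - mat_adjoint (f x)))"
      unfolding psd_emb[OF c[OF fc]] e[OF fc] .
  qed
  then show ?thesis using that r T by blast
qed

(*%FILE D1*)
section \<open>Values of solutions at a point\<close>

text \<open>Everything with index \<open>n\<close> depends on the first \<open>n\<close>
  nodes and values alone, so a further node can be attached without changing it.\<close>
lemma pick_data_cong:
  assumes "pick_data m z w" "pick_data m z' w'" and eq: "\<And>k. k < n \<Longrightarrow> z' k = z k" "\<And>k. k < n \<Longrightarrow> w' k = w k"
  shows "pick_data.nondegenerate m z' w' n \<longleftrightarrow> pick_data.nondegenerate m z w n"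
    and "pick_data.X m z' w' n x = pick_data.X m z w n x"
proof -
  interpret P: pick_data m z w by fact
  interpret Q: pick_data m z' w' by fact
  have pick_block: "Q.pick_block j k = P.pick_block j k" if "j < n" "k < n" for j k
    using that by (simp add: P.pick_block_def Q.pick_block_def eq)
  have last_col: "Q.last_col j = P.last_col j" if "j < n" for j
    unfolding P.last_col_def Q.last_col_def by (rule sum.cong) (use that pick_block in auto)
  have Pick_inv: "j \<le> n \<Longrightarrow> Q.Pick_inv j = P.Pick_inv j" for j
    by (induction j) (auto simp: P.Pick_inv.simps Q.Pick_inv.simps pick_block last_col)
  have Schur: "Q.Schur j = P.Schur j" if "j < n" for j
    using that by (simp add: P.Schur_def Q.Schur_def pick_block last_col Pick_inv)
  show "Q.nondegenerate n \<longleftrightarrow> P.nondegenerate n" by (auto simp: P.nondegenerate_def Q.nondegenerate_def Schur)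
  have node_row: "Q.node_row j = P.node_row j" if "j < n" for j using that by (simp add: P.node_row_def Q.node_row_def eq)
  have V: "Q.V j = P.V j" if "j \<le> n" for j
    unfolding P.V_def Q.V_def by (rule sum.cong) (use that node_row in auto)
  have g: "Q.g j = P.g j" if "j < n" for j
    using that by (simp add: P.g_def Q.g_def P.Schur_row_def Q.Schur_row_def V last_col Pick_inv)
  have b: "Q.factor j x = P.factor j x" if "j < n" for j
    using that by (simp add: P.factor_def Q.factor_def P.zeta_def Q.zeta_def P.elem_def Q.elem_def P.node_weight_def Q.node_weight_def P.Schur_inv_def Q.Schur_inv_def g Schur eq)
  have "j \<le> n \<Longrightarrow> Q.Potapov j x = P.Potapov j x" for j by (induction j) (auto simp: b)
  then show "Q.X n x = P.X n x" by (simp add: P.X_def Q.X_def)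
qed

context pick_data
begin

definition interpolants :: "nat \<Rightarrow> (complex \<Rightarrow> complex mat) set" where
  "interpolants n = {f \<in> nevanlinna_class m. \<forall>k<n. emb (f (z k)) = w k}"

lemma value_extension:
  assumes "cor m m w0" and x: "0 < Im x"
  shows "pick_data m (z(n := x)) (w(n := w0))"
  by unfold_locales (use assms Im_z cor_w in auto)

text \<open>Attach \<open>x\<close> as a further node: its Schur complement is nonnegative
  by necessity of the Pick condition.\<close>
lemma values_in_ball:
  assumes kp: "nondegenerate n" and x: "0 < Im x" and f: "f \<in> interpolants n"
  shows "emb (f x) \<in> ballX m (X n x)"
proof -
  have fn: "f \<in> nevanlinna_class m" "\<And>k. k < n \<Longrightarrow> emb (f (z k)) = w k" using f by (auto simp: interpolants_def)
  let ?w0 = "emb (f x)"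
  have w0: "cor m m ?w0" using fn(1) x by (auto simp: nevanlinna_class_def intro: cor_emb)
  interpret Q: pick_data m "z(n := x)" "w(n := ?w0)" by (rule value_extension[OF w0 x])
  have kq: "Q.nondegenerate n" using kp pick_data_cong(1)[OF pick_data_axioms Q.pick_data_axioms, of n] by simp
  have X: "Q.X n x = X n x" by (rule pick_data_cong(2)[OF pick_data_axioms Q.pick_data_axioms]) auto
  have "0 \<le> Q.Pick (Suc n)" by (rule Q.nevanlinna_pick[OF fn(1)]) (use fn(2) in auto)
  then have "0 \<le> Q.Schur n" by (rule Q.Schur_psd[OF kq])
  moreover have "0 \<le> 2 * Im x / (cmod x)\<^sup>2" using x by simp
  ultimately have "0 \<le> (2 * Im x / (cmod x)\<^sup>2) *\<^sub>R Q.Schur n" by (intro scaleR_nonneg_nonneg)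
  then have "0 \<le> Q.value_row ?w0 * (X n x * adj (Q.value_row ?w0))" using Q.Schur_eq_ball[OF kq] X by simp
  then show ?thesis using w0 by (simp add: ballX_def Q.value_row_def)
qed

text \<open>Attach \<open>x\<close> as a further node: its Schur complement is definite, so
  the extended problem has a solution.\<close>
lemma value_of_interior:
  assumes kp: "nondegenerate n" and x: "0 < Im x" and w0: "cor m m w0"
    and pd: "pd m ((w0 * blk m 0 - blk m 1) * (X n x * adj (w0 * blk m 0 - blk m 1)))"
  shows "\<exists>f \<in> interpolants n. emb (f x) = w0"
proof -
  interpret Q: pick_data m "z(n := x)" "w(n := w0)" by (rule value_extension[OF w0 x])
  have kq: "Q.nondegenerate n" using kp pick_data_cong(1)[OF pick_data_axioms Q.pick_data_axioms, of n] by simp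
  have X: "Q.X n x = X n x" by (rule pick_data_cong(2)[OF pick_data_axioms Q.pick_data_axioms]) auto
  define s where "s = 2 * Im x / (cmod x)\<^sup>2"
  have "x \<noteq> 0" using x by auto
  then have s: "0 < s" using x by (simp add: s_def)
  have "pd m (s *\<^sub>R Q.Schur n)" using Q.Schur_eq_ball[OF kq] X pd by (simp add: Q.value_row_def s_def)
  then have "pd m ((1 / s) *\<^sub>R (s *\<^sub>R Q.Schur n))" by (rule pd_scaleR) (use s in simp)
  then have "pd m (Q.Schur n)" using s by simp
  then have "Q.nondegenerate (Suc n)" using kq by (simp add: Q.nondegenerate_Suc)
  from Q.pick_solution[OF this] obtain f where f: "f \<in> nevanlinna_class m"
    and v: "\<forall>k<Suc n. emb (f ((z(n := x)) k)) = (w(n := w0)) k" by blast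
  have "emb (f (z k)) = w k" if "k < n" for k using v[rule_format, of k] that by simp
  moreover have "emb (f x) = w0" using v[rule_format, of n] by simp
  ultimately show ?thesis using f by (auto simp: interpolants_def)
qed

text \<open>Interpolation conditions that hold eventually along a sequence hold in the
  limit. The index set \<open>N\<close> covers truncated and full problems.\<close>
lemma values_limit:
  assumes m: "0 < m" and x: "0 < Im x" and F: "\<And>k. F k \<in> nevanlinna_class m"
    and N: "\<And>k j. j \<in> N \<Longrightarrow> j \<le> k \<Longrightarrow> emb (F k (z j)) = w j" and T: "tends (\<lambda>k. emb (F k x)) w0"
    and C: "\<And>k. nrm m (emb (F k x)) \<le> C"
  shows "\<exists>f \<in> nevanlinna_class m. (\<forall>j\<in>N. emb (f (z j)) = w j) \<and> emb (f x) = w0"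
proof -
  obtain f r where f: "f \<in> nevanlinna_class m" and r: "strict_mono (r :: nat \<Rightarrow> nat)"
    and lim: "\<And>x. 0 < Im x \<Longrightarrow> tends (\<lambda>n. emb (F (r n) x)) (emb (f x))"
    using nevanlinna_limit[of F, OF F x m C] by metis
  have "emb (f (z j)) = w j" if j: "j \<in> N" for j
  proof (rule tends_unique)
    show "tends (\<lambda>k. emb (F (r (k + j)) (z j))) (emb (f (z j)))"
      by (rule tends_offset[OF lim[OF Im_z]])
    have "j \<le> r (k + j)" for k using seq_suble[OF r, of "k + j"] by linarith
    then have "emb (F (r (k + j)) (z j)) = w j" for k using N[OF j] by blast
    then show "tends (\<lambda>k. emb (F (r (k + j)) (z j))) (w j)" by (simp only: tends_const)
  qed
  moreover have "emb (f x) = w0"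
  proof (rule tends_unique)
    show "tends (\<lambda>n. emb (F (r n) x)) (emb (f x))" by (rule lim[OF x])
    show "tends (\<lambda>n. emb (F (r n) x)) w0"
      unfolding tends_def
    proof (intro allI)
      fix a c
      show "(\<lambda>n. ent (emb (F (r n) x)) a c) \<longlonglongrightarrow> ent w0 a c"
        using LIMSEQ_subseq_LIMSEQ[OF tendsD[OF T, of a c] r] by (simp add: o_def)
    qed
  qed
  ultimately show ?thesis using f by blast
qed

text \<open>Boundary points of the ball are limits of interior ones along a segment from the
  center.\<close>
lemma values_eq_ball:
  assumes m: "0 < m" and kp: "nondegenerate n" and x: "0 < Im x" and B: "ball_data m (X n x) Y"
  shows "(\<lambda>f. emb (f x)) ` interpolants n = ballX m (X n x)"
proof (intro equalityI subsetI)
  show "u \<in> ballX m (X n x)" if "u \<in> (\<lambda>f. emb (f x)) ` interpolants n" for u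
    using that values_in_ball[OF kp x] by blast
next
  interpret B: ball_data m "X n x" Y by (rule B)
  fix u assume u: "u \<in> ballX m (X n x)"
  \<comment> \<open>points of the segment from the center to the given point\<close>
  define t where "t k = 1 - 1 / real (Suc k)" for k
  have t: "0 \<le> t k" "t k < 1" for k by (simp_all add: t_def field_simps)
  define v where "v k = B.c + t k *\<^sub>R (u - B.c)" for k
  have "\<exists>f \<in> interpolants n. emb (f x) = v k" for k
    by (rule value_of_interior[OF kp x]) (use B.ball_shrink[OF u t, of k] in \<open>simp_all only: v_def\<close>)
  then obtain F where F: "\<And>k. F k \<in> interpolants n" "\<And>k. emb (F k x) = v k" by metis
  have "t \<longlonglongrightarrow> 1 - 0" unfolding t_def by (intro tendsto_diff tendsto_const LIMSEQ_inverse_real_of_nat[unfolded inverse_eq_divide])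
  then have "t \<longlonglongrightarrow> 1" by simp
  have T: "tends v (B.c + 1 *\<^sub>R (u - B.c))"
    unfolding v_def by (intro tends_add tends_const tends_scaleR' \<open>t \<longlonglongrightarrow> 1\<close>)
  have "nrm m (v k) \<le> nrm m B.c + nrm m (u - B.c)" for k
  proof -
    have "nrm m (v k) \<le> nrm m B.c + t k * nrm m (u - B.c)"
      unfolding v_def using nrm_add[of m B.c "t k *\<^sub>R (u - B.c)"] t[of k] by (simp add: nrm_scaleR)
    also have "t k * nrm m (u - B.c) \<le> 1 * nrm m (u - B.c)"
      using t[of k] by (intro mult_right_mono nrm_nonneg) simp
    finally show ?thesis by simp
  qed
  then have "\<exists>f \<in> nevanlinna_class m. (\<forall>j\<in>{..<n}. emb (f (z j)) = w j) \<and> emb (f x) = u"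
    using F T by (intro values_limit[OF m x, of F]) (auto simp: interpolants_def)
  then show "u \<in> (\<lambda>f. emb (f x)) ` interpolants n" by (auto simp: interpolants_def)
qed

end

context pick_point
begin

lemma ball_data_X: "1 \<le> n \<Longrightarrow> ball_data m (X n x) (Xi n)"
  by unfold_locales (use pd_aX_sX[of n] in \<open>simp_all only: cor_X cor_Xi X_Xi adj_X aX_def sX_def\<close>)

lemma interpolant_values: "1 \<le> n \<Longrightarrow> (\<lambda>f. emb (f x)) ` interpolants n = ballX m (X n x)"
  by (rule values_eq_ball[OF m_pos nondegenerate_all Im_x ball_data_X])

text \<open>A value attained in every truncated problem is attained in the full one, by
  compactness.\<close>
lemma full_interpolant_values:
  "(\<lambda>f. emb (f x)) ` {f \<in> nevanlinna_class m. \<forall>k. emb (f (z k)) = w k} = (\<Inter>n\<in>{1..}. ballX m (X n x))"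
proof (intro equalityI subsetI)
  fix u assume "u \<in> (\<lambda>f. emb (f x)) ` {f \<in> nevanlinna_class m. \<forall>k. emb (f (z k)) = w k}"
  then obtain f where f: "f \<in> nevanlinna_class m" "\<And>k. emb (f (z k)) = w k" and u: "u = emb (f x)" by blast
  have "f \<in> interpolants n" for n using f by (simp add: interpolants_def)
  then show "u \<in> (\<Inter>n\<in>{1..}. ballX m (X n x))"
    using values_in_ball[OF nondegenerate_all Im_x] u by blast
next
  fix u assume u: "u \<in> (\<Inter>n\<in>{1..}. ballX m (X n x))"
  have "\<exists>f \<in> interpolants (Suc k). emb (f x) = u" for k
  proof -
    have "u \<in> ballX m (X (Suc k) x)" using u by auto
    then have "u \<in> (\<lambda>f. emb (f x)) ` interpolants (Suc k)" by (simp only: interpolant_values[of "Suc k"])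
    then show ?thesis by blast
  qed
  then obtain F where F: "\<And>k. F k \<in> interpolants (Suc k)" "\<And>k. emb (F k x) = u" by metis
  have "\<exists>f \<in> nevanlinna_class m. (\<forall>j\<in>UNIV. emb (f (z j)) = w j) \<and> emb (f x) = u"
  proof (rule values_limit[OF m_pos Im_x, of F])
    show "F k \<in> nevanlinna_class m" for k using F(1)[of k] by (simp add: interpolants_def)
    show "emb (F k (z j)) = w j" if "j \<le> k" for k j using F(1)[of k] that by (simp add: interpolants_def)
    show "tends (\<lambda>k. emb (F k x)) u" by (simp only: F(2) tends_const)
    show "nrm m (emb (F k x)) \<le> nrm m u" for k by (simp only: F(2) order_refl)
  qed
  then show "u \<in> (\<lambda>f. emb (f x)) ` {f \<in> nevanlinna_class m. \<forall>k. emb (f (z k)) = w k}" by blast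
qed

end

(*%FILE D2*)
section \<open>Convergence of the balls\<close>

lemma nrm_le_of_le_dg:
  assumes "0 \<le> A" "A \<le> C *\<^sub>R dg e" "e \<le> d" shows "nrm d A \<le> real d * (C * real e)"
proof -
  have "(\<Sum>i<d. Re (ent (dg e) i i)) = (\<Sum>i<e. (1::real))"
    by (rule sum.mono_neutral_cong_right) (use assms(3) in \<open>auto simp: ent_dg\<close>)
  then have "trc d (dg e) = real e" by (simp add: trc_def)
  then have "trc d A \<le> C * real e" using trc_mono[OF assms(2), of d] by (simp add: trc_simps)
  then show ?thesis using nrm_le_trc[OF assms(1), of d] mult_left_mono[of "trc d A" "C * real e" "real d"] by simp
qed

text \<open>Conjugate \<open>C A - A\<^sup>2 \<ge> 0\<close> with the inverse.\<close>
lemma inverse_ge: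
  assumes A: "0 \<le> A" "A \<le> C *\<^sub>R dg d" "cor d d A" and C: "0 < C"
    and B: "cor d d B" "adj B = B" "A * B = dg d" "B * A = dg d"
  shows "(1 / C) *\<^sub>R dg d \<le> B"
proof -
  have "0 \<le> B * (C *\<^sub>R A - A * A) * adj B" by (rule psd_cong[OF psd_sub_square[OF A C]])
  also have "B * (C *\<^sub>R A - A * A) * adj B = C *\<^sub>R ((B * A) * B) - (B * A) * (A * B)"
    using B(2) by (simp add: left_diff_distrib right_diff_distrib mult.assoc)
  also have "\<dots> = C *\<^sub>R B - dg d" using B corD[OF B(1)] by simp
  finally have "0 \<le> C *\<^sub>R (B - (1 / C) *\<^sub>R dg d)" using C by (simp add: scaleR_right_diff_distrib)
  then show ?thesis using scaleR_nonneg_cancel[OF C] by force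
qed

lemma eventually_ge:
  assumes T: "tends R L" and c: "\<And>n. cor d d (R n)" "cor d d L" and h: "\<And>n. adj (R n) = R n" "adj L = L"
    and L: "(2 * \<delta>) *\<^sub>R dg d \<le> L" and \<delta>: "0 < \<delta>"
  shows "\<exists>N. \<forall>n\<ge>N. \<delta> *\<^sub>R dg d \<le> R n"
proof -
  have "(\<lambda>n. nrm d (R n - L)) \<longlonglongrightarrow> 0" using tends_iff_nrm[of d R L, OF c] T by blast
  from order_tendstoD(2)[OF this \<delta>] obtain N where N: "\<And>n. N \<le> n \<Longrightarrow> nrm d (R n - L) < \<delta>"
    by (auto simp: eventually_sequentially)
  have "\<delta> *\<^sub>R dg d \<le> R n" if "N \<le> n" for n
  proof -
    have "nrm d (L - R n) = nrm d (R n - L)" using nrm_scaleR[of d "-1" "R n - L"] by simp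
    have "L - R n \<le> nrm d (L - R n) *\<^sub>R dg d"
    proof (rule herm_le_nrm)
      show "adj (L - R n) = L - R n" by (simp only: adj_simps h)
      show "cor d d (L - R n)" by (rule cor_intros(3)[OF c(2,1)])
    qed
    also have "\<dots> \<le> \<delta> *\<^sub>R dg d"
      using N[OF that] \<open>nrm d (L - R n) = nrm d (R n - L)\<close> by (intro scaleR_right_mono psd_dg) linarith
    finally have "L - R n \<le> \<delta> *\<^sub>R dg d" .
    then have "(L - R n) + R n \<le> \<delta> *\<^sub>R dg d + R n" by (rule add_right_mono)
    then have "L \<le> \<delta> *\<^sub>R dg d + R n" by simp
    with L have "(2 * \<delta>) *\<^sub>R dg d \<le> \<delta> *\<^sub>R dg d + R n" by (rule order.trans)
    then show ?thesis by (simp only: mult_2 scaleR_add_left add_le_cancel_left)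
  qed
  then show ?thesis by blast
qed

lemma cor_mono:
  assumes "cor d e A" "d \<le> d'" "e \<le> e'" shows "cor d' e' A"
proof (rule corI)
  fix i j assume "d' \<le> i \<or> e' \<le> j"
  then have "d \<le> i \<or> e \<le> j" using assms(2,3) by linarith
  then show "ent A i j = 0" by (rule cor_ent[OF assms(1)])
qed

lemma nrm_cor:
  assumes "cor e e A" "e \<le> d" shows "nrm d A = nrm e A"
proof -
  have "nrm d A = (\<Sum>i<e. \<Sum>j<d. cmod (ent A i j))"
    unfolding nrm_def by (rule sum.mono_neutral_right) (use assms cor_ent[OF assms(1)] in auto)
  also have "\<dots> = nrm e A"
    unfolding nrm_def by (intro sum.cong refl sum.mono_neutral_right) (use assms cor_ent[OF assms(1)] in auto)
  finally show ?thesis .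
qed

context ball_data
begin

definition "y = c * blk m 0 - blk m 1"
definition "t = blk m 0 + adj c * blk m 1"

lemma cor_y_t: "cor m (2 * m) y" "cor m (2 * m) t"
proof -
  show "cor m (2 * m) y"
    unfolding y_def by (rule cor_intros(3)[OF cor_mult[OF cor_c(1) cor_blk2(1)] cor_blk2(2)])
  show "cor m (2 * m) t"
    unfolding t_def by (rule cor_intros(2)[OF cor_blk2(1) cor_mult[OF cor_intros(6)[OF cor_c(1)] cor_blk2(2)]])
qed

lemma sX_R2: "sX * R2 = dg m"
proof -
  have "sX * R2 = adj (R2 * sX)" using adj_R2 psd_adj[OF pd_psd[OF pd_s]] by (simp add: sX_def)
  then show ?thesis by (simp add: R2_sX)
qed

lemma X12_c: "X12 = - (a * adj c)"
  unfolding c_def using ai corD[OF cor_X12(1)] by (simp flip: mult.assoc)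

lemma blk0_X: "blk m 0 * X = - (a * t)"
proof -
  have "blk m 0 * X = (blk m 0 * X) * (adj (blk m 0) * blk m 0 + adj (blk m 1) * blk m 1)"
    unfolding sum_blk2 using corD[OF cor_X] by (simp add: mult.assoc)
  also have "\<dots> = - a * blk m 0 + X12 * blk m 1"
    unfolding a_def X12_def by (simp add: distrib_left mult.assoc)
  finally show ?thesis unfolding t_def X12_c by (simp add: distrib_left mult.assoc)
qed

lemma y_X: "y * X = - (R2 * blk m 1)"
proof -
  have "y * X = - (c * (a * t)) - blk m 1 * X" unfolding y_def by (simp add: left_diff_distrib mult.assoc blk0_X)
  moreover have "blk m 1 * X = (blk m 1 * X) * (adj (blk m 0) * blk m 0 + adj (blk m 1) * blk m 1)"
    unfolding sum_blk2 using corD[OF cor_X] by (simp add: mult.assoc)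
  then have "blk m 1 * X = adj X12 * blk m 0 + X22 * blk m 1"
    unfolding X22_def X21[symmetric] by (simp add: distrib_left mult.assoc)
  moreover have "adj X12 = - (c * a)" unfolding X12_c using adj_a by simp
  moreover have "X22 = R2 - c * (a * adj c)"
  proof -
    have "adj X12 * (ai * X12) = c * (a * adj c)"
    proof -
      have "ai * X12 = - (adj c)" unfolding X12_c using ai corD[OF cor_intros(6)[OF cor_c(1)]] by (simp flip: mult.assoc)
      then show ?thesis using \<open>adj X12 = _\<close> by (simp add: mult.assoc)
    qed
    then show ?thesis by (simp add: R2_def)
  qed
  ultimately show ?thesis unfolding t_def by (simp add: distrib_left left_diff_distrib mult.assoc)
qed

text \<open>The triangular factorisation of \<open>X\<close> with pivots \<open>-a\<close>
  and \<open>R2\<close>.\<close>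
lemma X_eq: "X = adj (blk m 1) * (R2 * blk m 1) - adj t * (a * t)"
proof -
  have b: "blk m 1 * X = R2 * blk m 1 - c * (a * t)"
    using y_X unfolding y_def by (simp add: left_diff_distrib mult.assoc blk0_X) (simp add: algebra_simps)
  have "X = (adj (blk m 0) * blk m 0 + adj (blk m 1) * blk m 1) * X"
    unfolding sum_blk2 using corD[OF cor_X] by simp
  also have "\<dots> = adj (blk m 0) * (blk m 0 * X) + adj (blk m 1) * (blk m 1 * X)"
    by (simp only: distrib_right mult.assoc)
  also have "\<dots> = adj (blk m 1) * (R2 * blk m 1) - adj t * (a * t)"
    unfolding blk0_X b by (simp add: t_def distrib_left distrib_right right_diff_distrib mult.assoc)
  finally show ?thesis .
qed

lemma Xi_eq: "Xi = adj y * (sX * y) - adj (blk m 0) * (ai * blk m 0)"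
proof -
  have b1: "blk m 1 * Xi = - (sX * y)"
  proof -
    have "sX * ((y * X) * Xi) = - ((sX * R2) * (blk m 1 * Xi))" unfolding y_X by (simp add: mult.assoc)
    also have "(y * X) * Xi = y" using X_Xi corD(2)[OF cor_y_t(1)] by (simp add: mult.assoc)
    finally show ?thesis unfolding sX_R2 by (simp flip: mult.assoc)
  qed
  have t1: "t * Xi = - (ai * blk m 0)"
  proof -
    have "ai * ((blk m 0 * X) * Xi) = - ((ai * a) * (t * Xi))" unfolding blk0_X by (simp add: mult.assoc)
    also have "(blk m 0 * X) * Xi = blk m 0" using X_Xi corD(2)[OF cor_blk2(1)] by (simp add: mult.assoc)
    finally show ?thesis using ai(3) corD(3)[OF cor_y_t(2)] by simp
  qed
  have b0: "blk m 0 * Xi = adj c * (sX * y) - ai * blk m 0"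
    using t1 b1 unfolding t_def by (simp add: distrib_right mult.assoc) (simp add: algebra_simps)
  have "Xi = (adj (blk m 0) * blk m 0 + adj (blk m 1) * blk m 1) * Xi"
    unfolding sum_blk2 using corD[OF cor_Xi] by simp
  also have "\<dots> = adj (blk m 0) * (blk m 0 * Xi) + adj (blk m 1) * (blk m 1 * Xi)"
    by (simp only: distrib_right mult.assoc)
  also have "\<dots> = adj y * (sX * y) - adj (blk m 0) * (ai * blk m 0)"
    unfolding b0 b1 by (simp add: y_def left_diff_distrib right_diff_distrib mult.assoc)
  finally show ?thesis .
qed

lemma center_mem: "c \<in> ballX m X"
  unfolding mem_ballX using cor_c pd_psd[OF pd_R2] by simp

lemma psd_parts: "0 \<le> a" "0 \<le> ai" "0 \<le> R2" "0 \<le> sX"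
  using pd_psd[OF pd_a] pd_psd[OF ai(4)] pd_psd[OF pd_R2] pd_psd[OF pd_s] by (simp_all add: a_def sX_def)

end

lemma ballX_mono: "X' \<le> X \<Longrightarrow> ballX m X' \<subseteq> ballX m X"
proof
  fix u assume "X' \<le> X" and u: "u \<in> ballX m X'"
  then have "0 \<le> (u * blk m 0 - blk m 1) * X' * adj (u * blk m 0 - blk m 1)" by (simp add: ballX_def mult.assoc)
  also have "\<dots> \<le> (u * blk m 0 - blk m 1) * X * adj (u * blk m 0 - blk m 1)" by (rule le_cong) fact
  finally show "u \<in> ballX m X" using u by (simp add: ballX_def mult.assoc)
qed

text \<open>The matrix \<open>R2\<close> is the largest value of the form on the rows
  \<open>(w, -I)\<close>, so it is monotone in \<open>X\<close>.\<close>
lemma ball_R2_mono: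
  assumes "ball_data m X Xi" "ball_data m X' Xi'" and le: "X' \<le> X"
  shows "ball_data.R2 m X' \<le> ball_data.R2 m X"
proof -
  interpret P: ball_data m X Xi by fact
  interpret Q: ball_data m X' Xi' by fact
  have "Q.R2 = (Q.c * blk m 0 - blk m 1) * X' * adj (Q.c * blk m 0 - blk m 1)"
    using Q.ball_form[OF Q.cor_c(1)] by (simp add: mult.assoc)
  also have "\<dots> \<le> (Q.c * blk m 0 - blk m 1) * X * adj (Q.c * blk m 0 - blk m 1)" by (rule le_cong[OF le])
  also have "\<dots> = P.R2 - (Q.c - P.c) * (P.a * adj (Q.c - P.c))"
    using P.ball_form[OF Q.cor_c(1)] by (simp add: mult.assoc)
  also have "\<dots> \<le> P.R2" using psd_cong[OF P.psd_parts(1), of "Q.c - P.c"] by (simp add: mult.assoc)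
  finally show ?thesis .
qed

(*%FILE D3*)
definition fball :: "nat \<Rightarrow> fmat \<Rightarrow> fmat \<Rightarrow> fmat \<Rightarrow> fmat set" where
  "fball m c r \<rho> = {c + r * V * \<rho> | V. cor m m V \<and> adj V * V \<le> dg m}"

text \<open>If both semi-radii are at least \<open>\<delta>\<close>, the ball contains the
  center plus and minus \<open>\<delta>\<^sup>2\<close>.\<close>
lemma fball_contains_scalars:
  assumes r: "\<delta> *\<^sub>R dg m \<le> r" "cor m m r" and \<rho>: "\<delta> *\<^sub>R dg m \<le> \<rho>" "cor m m \<rho>" and \<delta>: "0 < \<delta>"
  shows "c + (\<delta> * \<delta>) *\<^sub>R dg m \<in> fball m c r \<rho>" "c - (\<delta> * \<delta>) *\<^sub>R dg m \<in> fball m c r \<rho>"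
proof -
  have inv: "\<exists>B. cor m m B \<and> A * B = dg m \<and> B * A = dg m \<and> adj B = B \<and> B * B \<le> (1 / (\<delta> * \<delta>)) *\<^sub>R dg m"
    if A: "\<delta> *\<^sub>R dg m \<le> A" "cor m m A" for A
  proof -
    have "pd m A" using A \<delta> by (auto simp: pd_def)
    then obtain B where B: "cor m m B" "A * B = dg m" "B * A = dg m" by (rule pd_inverse)
    note le = pd_inverse_le[OF \<delta> A B]
    have "0 \<le> (1 / \<delta>) *\<^sub>R B - B * B" by (rule psd_sub_square[OF le(3,2) B(1)]) (use \<delta> in simp)
    then have "B * B \<le> (1 / \<delta>) *\<^sub>R B" by simp
    also have "\<dots> \<le> (1 / \<delta>) *\<^sub>R ((1 / \<delta>) *\<^sub>R dg m)" by (rule scaleR_left_mono[OF le(2)]) (use \<delta> in simp)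
    finally show ?thesis using B le(1) by auto
  qed
  obtain ri where ri: "cor m m ri" "r * ri = dg m" "adj ri = ri" "ri * ri \<le> (1 / (\<delta> * \<delta>)) *\<^sub>R dg m" using inv[OF r] by blast
  obtain pi where pi: "cor m m pi" "pi * \<rho> = dg m" "adj pi = pi" "pi * pi \<le> (1 / (\<delta> * \<delta>)) *\<^sub>R dg m" using inv[OF \<rho>] by blast
  have mem: "c + s *\<^sub>R dg m \<in> fball m c r \<rho>" if s: "s * s = (\<delta> * \<delta>) * (\<delta> * \<delta>)" for s
  proof -
    define V where "V = s *\<^sub>R (ri * pi)"
    have cV: "cor m m V" unfolding V_def by (intro cor_scaleR cor_mult[OF ri(1) pi(1)])
    have "adj V * V = (s * s) *\<^sub>R (pi * (ri * ri) * adj pi)" unfolding V_def using ri pi by (simp add: mult.assoc)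
    also have "\<dots> \<le> (s * s) *\<^sub>R (pi * ((1 / (\<delta> * \<delta>)) *\<^sub>R dg m) * adj pi)"
      by (intro scaleR_left_mono le_cong ri) simp
    also have "\<dots> = (\<delta> * \<delta>) *\<^sub>R (pi * pi)" unfolding s using pi corD(2)[OF pi(1)] \<delta> by (simp add: mult.assoc corD)
    also have "\<dots> \<le> (\<delta> * \<delta>) *\<^sub>R ((1 / (\<delta> * \<delta>)) *\<^sub>R dg m)" by (intro scaleR_left_mono pi) simp
    also have "\<dots> = dg m" using \<delta> by simp
    finally have "adj V * V \<le> dg m" .
    moreover have "r * V * \<rho> = s *\<^sub>R dg m"
    proof -
      have "r * V * \<rho> = s *\<^sub>R ((r * ri) * (pi * \<rho>))" unfolding V_def by (simp add: mult.assoc)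
      then show ?thesis by (simp add: ri pi)
    qed
    then have "c + s *\<^sub>R dg m = c + r * V * \<rho>" by simp
    ultimately show ?thesis using cV unfolding fball_def by blast
  qed
  show "c + (\<delta> * \<delta>) *\<^sub>R dg m \<in> fball m c r \<rho>" by (rule mem) simp
  show "c - (\<delta> * \<delta>) *\<^sub>R dg m \<in> fball m c r \<rho>" using mem[of "- (\<delta> * \<delta>)"] by simp
qed

context ball_data
begin

text \<open>The parallelogram identity for the form of \<open>a\<close>. The point
  \<open>u\<close> need not be the center read off from \<open>X\<close>.\<close>
lemma diameter_bound:
  assumes u: "u + E \<in> ballX m X" "u - E \<in> ballX m X"
  shows "E * (a * adj E) \<le> R2"
proof -
  define D where "D = u - c"
  have 1: "(D + E) * (a * adj (D + E)) \<le> R2" using u(1) by (simp add: mem_ballX D_def algebra_simps)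
  have 2: "(D - E) * (a * adj (D - E)) \<le> R2" using u(2) by (simp add: mem_ballX D_def algebra_simps)
  have "2 *\<^sub>R (E * (a * adj E)) \<le> 2 *\<^sub>R (E * (a * adj E)) + 2 *\<^sub>R (D * a * adj D)"
    using psd_cong[OF psd_parts(1), of D] by (simp add: scaleR_nonneg_nonneg)
  also have "\<dots> = (D + E) * (a * adj (D + E)) + (D - E) * (a * adj (D - E))"
    by (simp add: algebra_simps scaleR_2)
  also have "\<dots> \<le> 2 *\<^sub>R R2" using add_mono[OF 1 2] by (simp add: scaleR_2)
  finally show ?thesis by (rule scaleR_le_cancel[rotated]) simp
qed

lemma radius_bound:
  assumes u: "u \<in> ballX m X" and \<delta>: "0 < \<delta>" "\<delta> *\<^sub>R dg m \<le> a"
  shows "nrm m (u - c) \<le> 1 + (real m)\<^sup>2 * (trc m R2 / \<delta>)"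
proof -
  have cu: "cor m m u" and le: "(u - c) * (a * adj (u - c)) \<le> R2" using u by (auto simp: mem_ballX)
  have cD: "cor m m (u - c)" by (rule cor_intros(3)[OF cu cor_c(1)])
  have "\<delta> *\<^sub>R ((u - c) * adj (u - c)) = (u - c) * (\<delta> *\<^sub>R dg m) * adj (u - c)"
    using corD(2)[OF cD] by simp
  also have "\<dots> \<le> (u - c) * a * adj (u - c)" by (rule le_cong[OF \<delta>(2)])
  also have "\<dots> \<le> R2" using le by (simp add: mult.assoc)
  finally have "\<delta> * trc m ((u - c) * adj (u - c)) \<le> trc m R2" using trc_mono by (metis trc_simps(3))
  then have "trc m ((u - c) * adj (u - c)) \<le> trc m R2 / \<delta>" using \<delta>(1) by (simp add: field_simps)
  then have "(nrm m (u - c))\<^sup>2 \<le> (real m)\<^sup>2 * (trc m R2 / \<delta>)"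
    using trc_square[OF cD] mult_left_mono[of _ "trc m R2 / \<delta>" "(real m)\<^sup>2"] by (meson order.trans zero_le_power2)
  moreover have "nrm m (u - c) \<le> 1 + (nrm m (u - c))\<^sup>2"
  proof -
    have "0 \<le> (nrm m (u - c) - 1)\<^sup>2" by simp
    then have "2 * nrm m (u - c) \<le> 1 + (nrm m (u - c))\<^sup>2" by (simp add: power2_diff)
    then show ?thesis using nrm_nonneg[of m "u - c"] by linarith
  qed
  ultimately show ?thesis by linarith
qed

text \<open>Bounds for center, pivots and their inverses bound \<open>X\<close> and its
  inverse through the triangular factorisation.\<close>
lemma nrm_bound:
  assumes K: "0 \<le> K" "nrm m c \<le> K" "a \<le> K *\<^sub>R dg m" "ai \<le> K *\<^sub>R dg m" "R2 \<le> K *\<^sub>R dg m" "sX \<le> K *\<^sub>R dg m"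
  defines "\<beta> \<equiv> nrm (2 * m) (blk m 0) + nrm (2 * m) (blk m 1)"
  defines "G \<equiv> 2 * ((\<beta> + K * \<beta>) * (real (2 * m) * (K * real m) * (\<beta> + K * \<beta>)))"
  shows "nrm (2 * m) X \<le> G" "nrm (2 * m) Xi \<le> G"
proof -
  let ?n = "nrm (2 * m)"
  have up: "cor (2 * m) (2 * m) A" if "cor m m A \<or> cor m (2 * m) A" for A
    using that cor_mono[of m m A "2 * m" "2 * m"] cor_mono[of m "2 * m" A "2 * m" "2 * m"] by auto
  have nb: "0 \<le> ?n A" for A by (rule nrm_nonneg)
  have \<beta>0: "?n (blk m 0) \<le> \<beta>" "?n (blk m 1) \<le> \<beta>" "0 \<le> \<beta>"
    using nb[of "blk m 0"] nb[of "blk m 1"] unfolding \<beta>_def by simp_all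
  have \<beta>1: "\<beta> \<le> \<beta> + K * \<beta>" using K(1) \<beta>0(3) by simp
  have ball: "?n A \<le> real (2 * m) * (K * real m)" if "0 \<le> A" "A \<le> K *\<^sub>R dg m" for A
    by (rule nrm_le_of_le_dg[OF that]) simp
  have nc: "?n c \<le> K" using nrm_cor[OF cor_c(1), of "2 * m"] K(2) by simp
  have ny: "?n y \<le> \<beta> + K * \<beta>"
  proof -
    have "?n y \<le> ?n (c * blk m 0) + ?n (blk m 1)" unfolding y_def by (rule nrm_diff)
    also have "?n (c * blk m 0) \<le> ?n c * ?n (blk m 0)" using up cor_c(1) by (intro nrm_mult) blast
    also have "?n c * ?n (blk m 0) \<le> K * \<beta>" by (intro mult_mono nc \<beta>0 K nb)
    finally show ?thesis using \<beta>0 by linarith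
  qed
  have nt: "?n t \<le> \<beta> + K * \<beta>"
  proof -
    have "?n t \<le> ?n (blk m 0) + ?n (adj c * blk m 1)" unfolding t_def by (rule nrm_add)
    also have "?n (adj c * blk m 1) \<le> ?n (adj c) * ?n (blk m 1)" using up cor_intros(6)[OF cor_c(1)] by (intro nrm_mult) blast
    also have "?n (adj c) * ?n (blk m 1) \<le> K * \<beta>" unfolding nrm_adj by (intro mult_mono nc \<beta>0 K nb)
    finally show ?thesis using \<beta>0 by linarith
  qed
  have sand: "?n (adj s * (A * s)) \<le> (\<beta> + K * \<beta>) * (real (2 * m) * (K * real m) * (\<beta> + K * \<beta>))"
    if s: "cor m (2 * m) s" "?n s \<le> \<beta> + K * \<beta>" and A: "cor m m A" "0 \<le> A" "A \<le> K *\<^sub>R dg m" for s A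
  proof -
    have "?n (adj s * (A * s)) \<le> ?n (adj s) * ?n (A * s)" using up[of s] s(1) cor_intros(6) by (intro nrm_mult) blast
    also have "\<dots> \<le> ?n (adj s) * (?n A * ?n s)"
      using up[of A] A(1) by (intro mult_left_mono nrm_mult nb) blast
    also have "\<dots> \<le> (\<beta> + K * \<beta>) * (real (2 * m) * (K * real m) * (\<beta> + K * \<beta>))"
      unfolding nrm_adj using K(1) \<beta>0(3)
      by (intro mult_mono s(2) ball A nb mult_nonneg_nonneg add_nonneg_nonneg) auto
    finally show ?thesis .
  qed
  have "?n X \<le> ?n (adj (blk m 1) * (R2 * blk m 1)) + ?n (adj t * (a * t))"
    by (subst X_eq) (rule nrm_diff)
  also have "\<dots> \<le> G"
    unfolding G_def using sand[OF cor_blk2(2) _ cor_c(2) psd_parts(3) K(5)] sand[OF cor_y_t(2) nt cor_a psd_parts(1) K(3)] \<beta>0 \<beta>1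
    by linarith
  finally show "?n X \<le> G" .
  have "?n Xi \<le> ?n (adj y * (sX * y)) + ?n (adj (blk m 0) * (ai * blk m 0))"
    by (subst Xi_eq) (rule nrm_diff)
  also have "\<dots> \<le> G"
    unfolding G_def using sand[OF cor_blk2(1) _ ai(1) psd_parts(2) K(4)] sand[OF cor_y_t(1) ny cor_sX psd_parts(4) K(6)] \<beta>0 \<beta>1
    by linarith
  finally show "?n Xi \<le> G" .
qed

end

lemma tends_block:
  assumes "tends Z L" "\<And>n. cor (2 * m) (2 * m) (Z n)" "i < 2"
  shows "tends (\<lambda>n. blk m i * (Z n * adj (blk m j))) (blk m i * (L * adj (blk m j)))"
  by (rule tends_mult[OF tends_const tends_mult[OF assms(1) tends_const assms(2)] cor_blk[OF assms(3)]])

(*%FILE D4*)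
context pick_point
begin

lemma X_decseq: "i \<le> j \<Longrightarrow> X j x \<le> X i x"
  by (induction rule: dec_induct) (auto intro: order.trans[OF X_dec])

lemma sqrt_sequence:
  assumes "\<And>n. 1 \<le> n \<Longrightarrow> pd m (A n)"
  obtains r where "\<And>n. 1 \<le> n \<Longrightarrow> pd m (r n)" "\<And>n. 1 \<le> n \<Longrightarrow> r n * r n = A n"
proof -
  have "\<forall>n. \<exists>r. 1 \<le> n \<longrightarrow> pd m r \<and> r * r = A n"
    using pd_sqrt_exists assms by metis
  then show ?thesis using that by metis
qed

text \<open>Bounded monotone sequences converge, so \<open>X\<close> and its inverse
  converge. The limits are again inverse to each other and still have definite corner
  blocks, by monotonicity; hence the limit is the data of a ball with definite semi-radii,
  and center and semi-radii converge because they are obtained by products, inverses and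
  roots of matrices with uniform two-sided bounds.\<close>
lemma limit_of_balls:
  assumes bd: "\<And>n. nr (X n x) \<le> C" "\<And>n. nr (Xi n) \<le> C"
  obtains c r \<rho> cs rs \<rho>s where
    "cor m m c" "pd m r" "pd m \<rho>" "(\<Inter>n\<in>{1..}. ballX m (X n x)) = fball m c r \<rho>"
    "\<And>n. 1 \<le> n \<Longrightarrow> cor m m (cs n) \<and> pd m (rs n) \<and> pd m (\<rho>s n) \<and> ballX m (X n x) = fball m (cs n) (rs n) (\<rho>s n)"
    "tends (\<lambda>n. cs (Suc n)) c" "tends (\<lambda>n. rs (Suc n)) r" "tends (\<lambda>n. \<rho>s (Suc n)) \<rho>"
proof -
  \<comment> \<open>without nodes there is no ball: the corner blocks are definite from index 1 on\<close>
  define Xn where "Xn n = X (Suc n) x" for n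
  define Yn where "Yn n = Xi (Suc n)" for n
  have cX: "cor (2 * m) (2 * m) (Xn n)" and cY: "cor (2 * m) (2 * m) (Yn n)" for n
    by (simp_all only: Xn_def Yn_def cor_X cor_Xi)
  have X_dec': "Xn (Suc n) \<le> Xn n" and Y_inc': "Yn n \<le> Yn (Suc n)" for n
    by (simp_all only: Xn_def Yn_def X_dec Xi_inc)
  have bX: "nr (Xn n) \<le> C" and bY: "nr (Yn n) \<le> C" for n by (simp_all only: Xn_def Yn_def bd)
  obtain L where L: "tends Xn L" "cor (2 * m) (2 * m) L" "\<And>n. L \<le> Xn n"
    using decseq_tends[of Xn "2 * m" C, OF X_dec' cX bX] by metis
  obtain M where M: "tends Yn M" "cor (2 * m) (2 * m) M" "\<And>n. Yn n \<le> M"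
    using incseq_tends[of Yn "2 * m" C, OF Y_inc' cY bY] by metis
  have LM: "L * M = e"
  proof (rule tends_unique)
    show "tends (\<lambda>n. Xn n * Yn n) (L * M)" by (rule tends_mult[OF L(1) M(1) cX])
    show "tends (\<lambda>n. Xn n * Yn n) e" by (simp only: Xn_def Yn_def X_Xi tends_const)
  qed
  have adjL: "adj L = L"
  proof (rule tends_unique)
    show "tends (\<lambda>n. adj (Xn n)) (adj L)" by (rule tends_adj[OF L(1)])
    have "(\<lambda>n. adj (Xn n)) = Xn" by (rule ext) (simp only: Xn_def adj_X)
    then show "tends (\<lambda>n. adj (Xn n)) L" using L(1) by simp
  qed
  have tXb: "tends (\<lambda>n. blk m i * (Xn n * adj (blk m j))) (blk m i * (L * adj (blk m j)))" if "i < 2" for i j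
    by (rule tends_block[OF L(1) cX that])
  have tYb: "tends (\<lambda>n. blk m i * (Yn n * adj (blk m j))) (blk m i * (M * adj (blk m j)))" if "i < 2" for i j
    by (rule tends_block[OF M(1) cY that])
  define aL where "aL = ball_data.a m L"
  have taX: "tends (\<lambda>n. aX (Suc n)) (- (blk m 0 * (L * adj (blk m 0))))"
    unfolding aX_def using tends_uminus[OF tXb[of 0 0]] by (simp add: Xn_def)
  have tsX: "tends (\<lambda>n. sX (Suc n)) (blk m 1 * (M * adj (blk m 1)))"
    unfolding sX_def using tYb[of 1 1] by (simp only: Yn_def one_less_numeral_iff semiring_norm simp_thms)
  have corb: "cor m m (blk m i * (A * adj (blk m j)))" if "cor (2 * m) (2 * m) A" "i < 2" "j < 2" for A i j
    by (rule cor_mult[OF cor_blk[OF that(2)] cor_mult[OF that(1) cor_intros(6)[OF cor_blk[OF that(3)]]]])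
  have Q: "ball_data m L M"
  proof
    show "cor (2 * m) (2 * m) L" "cor (2 * m) (2 * m) M" "L * M = dg (2 * m)" "adj L = L" by fact+
    have "aX 1 \<le> - (blk m 0 * (L * adj (blk m 0)))"
      by (rule tends_ge[OF taX cor_aX(1) cor_aX(1), of 0]) (use aX_inc(2) in simp)
    then show "pd m (- (blk m 0 * (L * adj (blk m 0))))"
      by (rule pd_mono[OF pd_aX_sX(1)[OF order.refl]]) (intro cor_intros(4) corb L; simp)
    have "sX 1 \<le> blk m 1 * (M * adj (blk m 1))"
      by (rule tends_ge[OF tsX cor_aX(2) cor_aX(2), of 0]) (use sX_inc(2) in simp)
    then show "pd m (blk m 1 * (M * adj (blk m 1)))"
      by (rule pd_mono[OF pd_aX_sX(2)[OF order.refl]]) (intro corb M; simp)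
  qed
  interpret Q: ball_data m L M by (rule Q)
  have B: "ball_data m (Xn n) (Yn n)" for n unfolding Xn_def Yn_def by (rule ball_data_X) simp
  let ?a = "\<lambda>n. ball_data.a m (Xn n)" and ?ai = "\<lambda>n. ball_data.ai m (Xn n)"
    and ?R2 = "\<lambda>n. ball_data.R2 m (Xn n)" and ?c = "\<lambda>n. ball_data.c m (Xn n)" and ?X12 = "\<lambda>n. ball_data.X12 m (Xn n)"
  have aX: "?a n = aX (Suc n)" for n unfolding ball_data.a_def[OF B] unfolding aX_def Xn_def by (rule refl)
  have ta: "tends ?a Q.a" unfolding aX Q.a_def by (rule taX)
  obtain \<delta> where \<delta>: "0 < \<delta>" "\<delta> *\<^sub>R dg m \<le> aX 1" using pd_aX_sX(1)[of 1] by (auto simp: pd_def)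
  have alo: "\<delta> *\<^sub>R dg m \<le> ?a n" for n
    unfolding aX by (rule order.trans[OF \<delta>(2) aX_inc(2)]) simp
  have aiup: "?ai n \<le> (1 / \<delta>) *\<^sub>R dg m" for n
    by (rule pd_inverse_le(2)[OF \<delta>(1) alo ball_data.cor_a[OF B] ball_data.ai(1)[OF B] ball_data.ai(2,3)[OF B]])
  have aib: "nrm m (?ai n) \<le> real m * (1 / \<delta> * real m)" for n
    by (rule nrm_le_of_le_dg[OF ball_data.psd_parts(2)[OF B] aiup]) simp
  have tai: "tends ?ai Q.ai"
    by (rule tends_inverse[OF ta ball_data.cor_a[OF B] ball_data.ai(1)[OF B] Q.ai(1) ball_data.ai(3)[OF B] Q.ai(2) aib])
  have tX12: "tends ?X12 Q.X12" unfolding ball_data.X12_def[OF B] Q.X12_def by (rule tXb) simp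
  have tX22: "tends (\<lambda>n. ball_data.X22 m (Xn n)) Q.X22" unfolding ball_data.X22_def[OF B] Q.X22_def by (rule tXb) simp
  have tc: "tends ?c Q.c"
    unfolding ball_data.c_def[OF B] Q.c_def
    by (rule tends_uminus[OF tends_mult[OF tends_adj[OF tX12] tai cor_intros(6)[OF ball_data.cor_X12(1)[OF B]]]])
  have tR2: "tends ?R2 Q.R2"
    unfolding ball_data.R2_def[OF B] Q.R2_def
    by (rule tends_add[OF tX22 tends_mult[OF tends_adj[OF tX12] tends_mult[OF tai tX12 ball_data.ai(1)[OF B]]
          cor_intros(6)[OF ball_data.cor_X12(1)[OF B]]]])
  have B1: "ball_data m (X n x) (Xi n)" if "1 \<le> n" for n using ball_data_X[OF that] .
  obtain rs where rs: "\<And>n. 1 \<le> n \<Longrightarrow> pd m (rs n)" "\<And>n. 1 \<le> n \<Longrightarrow> rs n * rs n = ball_data.R2 m (X n x)"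
    using sqrt_sequence[of "\<lambda>n. ball_data.R2 m (X n x)"] ball_data.pd_R2[OF B1] by metis
  obtain \<rho>s where \<rho>s: "\<And>n. 1 \<le> n \<Longrightarrow> pd m (\<rho>s n)" "\<And>n. 1 \<le> n \<Longrightarrow> \<rho>s n * \<rho>s n = ball_data.ai m (X n x)"
    using sqrt_sequence[of "\<lambda>n. ball_data.ai m (X n x)"] ball_data.ai(4)[OF B1] by metis
  obtain r where r: "pd m r" "r * r = Q.R2" using pd_sqrt_exists[OF Q.pd_R2] by blast
  obtain \<rho> where \<rho>: "pd m \<rho>" "\<rho> * \<rho> = Q.ai" using pd_sqrt_exists[OF Q.ai(4)] by blast
  have sq: "rs (Suc n) * rs (Suc n) = ?R2 n" "\<rho>s (Suc n) * \<rho>s (Suc n) = ?ai n" for n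
    using rs(2)[of "Suc n"] \<rho>s(2)[of "Suc n"] by (simp_all add: Xn_def)
  have cpd: "cor m m A" if "pd m A" for A using that by (simp add: pd_def)
  have trs: "tends (\<lambda>n. rs (Suc n)) r"
  proof -
    obtain \<eta> where \<eta>: "0 < \<eta>" "\<eta> *\<^sub>R dg m \<le> Q.R2" using Q.pd_R2 by (auto simp: pd_def)
    have lo: "\<eta> *\<^sub>R dg m \<le> rs (Suc n) * rs (Suc n)" for n
      unfolding sq by (rule order.trans[OF \<eta>(2) ball_R2_mono[OF B Q L(3)]])
    have up: "rs (Suc n) * rs (Suc n) \<le> nrm m (?R2 0) *\<^sub>R dg m" for n
    proof -
      have "Xn n \<le> Xn 0" unfolding Xn_def by (rule X_decseq) simp
      then have "?R2 n \<le> ?R2 0" by (rule ball_R2_mono[OF B B])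
      also have "\<dots> \<le> nrm m (?R2 0) *\<^sub>R dg m" by (rule herm_le_nrm[OF ball_data.adj_R2[OF B] ball_data.cor_c(2)[OF B]])
      finally show ?thesis unfolding sq .
    qed
    have T: "tends (\<lambda>n. rs (Suc n) * rs (Suc n)) (r * r)" unfolding sq r(2) by (rule tR2)
    have p: "0 \<le> rs (Suc n)" "cor m m (rs (Suc n))" for n using pd_psd cpd rs(1)[of "Suc n"] by simp_all
    show ?thesis by (rule tends_sqrt[OF T p pd_psd[OF r(1)] cpd[OF r(1)] \<eta>(1) lo up nrm_nonneg])
  qed
  have t\<rho>s: "tends (\<lambda>n. \<rho>s (Suc n)) \<rho>"
  proof -
    define K where "K = nrm m Q.a + 1"
    have K: "0 < K" unfolding K_def using nrm_nonneg[of m Q.a] by linarith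
    have aup: "?a n \<le> K *\<^sub>R dg m" for n
    proof -
      have "?a n \<le> Q.a"
        using le_cong[OF L(3)[of n], of "blk m 0"] by (simp add: ball_data.a_def[OF B] Q.a_def mult.assoc)
      also have "\<dots> \<le> nrm m Q.a *\<^sub>R dg m" by (rule herm_le_nrm[OF Q.adj_a Q.cor_a])
      also have "\<dots> \<le> K *\<^sub>R dg m" by (rule scaleR_right_mono[OF _ psd_dg]) (simp add: K_def)
      finally show ?thesis .
    qed
    have lo: "(1 / K) *\<^sub>R dg m \<le> \<rho>s (Suc n) * \<rho>s (Suc n)" for n
      unfolding sq by (rule inverse_ge[OF ball_data.psd_parts(1)[OF B] aup ball_data.cor_a[OF B] K
         ball_data.ai(1)[OF B] ball_data.ai(5)[OF B] ball_data.ai(2,3)[OF B]])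
    have T: "tends (\<lambda>n. \<rho>s (Suc n) * \<rho>s (Suc n)) (\<rho> * \<rho>)" unfolding sq \<rho>(2) by (rule tai)
    have up: "\<rho>s (Suc n) * \<rho>s (Suc n) \<le> (1 / \<delta>) *\<^sub>R dg m" for n unfolding sq by (rule aiup)
    have p: "0 \<le> \<rho>s (Suc n)" "cor m m (\<rho>s (Suc n))" for n using pd_psd cpd \<rho>s(1)[of "Suc n"] by simp_all
    show ?thesis
      by (rule tends_sqrt[OF T p pd_psd[OF \<rho>(1)] cpd[OF \<rho>(1)] _ lo up]) (use K \<delta> in simp_all)
  qed
  have ballL: "(\<Inter>n\<in>{1..}. ballX m (X n x)) = ballX m L"
  proof (intro equalityI subsetI)
    fix u assume u: "u \<in> (\<Inter>n\<in>{1..}. ballX m (X n x))"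
    then have un: "u \<in> ballX m (Xn n)" for n by (simp add: Xn_def)
    have cu: "cor m m u" using un[of 0] by (simp add: ballX_def)
    define v where "v = u * blk m 0 - blk m 1"
    have cv: "cor m (2 * m) v" unfolding v_def by (rule cor_intros(3)[OF cor_mult[OF cu cor_blk2(1)] cor_blk2(2)])
    have "0 \<le> v * (L * adj v)"
    proof (rule tends_psd)
      show "tends (\<lambda>n. v * (Xn n * adj v)) (v * (L * adj v))"
        by (rule tends_mult[OF tends_const tends_mult[OF L(1) tends_const cX] cv])
      show "cor m m (v * (Xn n * adj v))" for n by (rule cor_mult[OF cv cor_mult[OF cX cor_intros(6)[OF cv]]])
      show "0 \<le> v * (Xn n * adj v)" if "0 \<le> n" for n using un[of n] by (simp add: ballX_def v_def)
    qed
    then show "u \<in> ballX m L" using cu by (simp add: ballX_def v_def)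
  next
    fix u assume u: "u \<in> ballX m L"
    show "u \<in> (\<Inter>n\<in>{1..}. ballX m (X n x))"
    proof
      fix n :: nat assume "n \<in> {1..}"
      then have "X n x = Xn (n - 1)" by (simp add: Xn_def)
      then show "u \<in> ballX m (X n x)" using ballX_mono[OF L(3)[of "n - 1"]] u by auto
    qed
  qed
  show ?thesis
  proof (rule that)
    show "cor m m Q.c" by (rule Q.cor_c(1))
    show "pd m r" "pd m \<rho>" by fact+
    show "(\<Inter>n\<in>{1..}. ballX m (X n x)) = fball m Q.c r \<rho>"
      unfolding ballL fball_def by (rule Q.ballX_eq[OF r \<rho>])
    show "cor m m (ball_data.c m (X n x)) \<and> pd m (rs n) \<and> pd m (\<rho>s n)
        \<and> ballX m (X n x) = fball m (ball_data.c m (X n x)) (rs n) (\<rho>s n)" if "1 \<le> n" for n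
      unfolding fball_def
      using ball_data.cor_c(1)[OF B1[OF that]] rs(1)[OF that] \<rho>s(1)[OF that]
        ball_data.ballX_eq[OF B1[OF that] rs[OF that] \<rho>s[OF that]] by blast
    show "tends (\<lambda>n. ball_data.c m (X (Suc n) x)) Q.c" using tc by (simp only: Xn_def)
    show "tends (\<lambda>n. rs (Suc n)) r" "tends (\<lambda>n. \<rho>s (Suc n)) \<rho>" by fact+
  qed
qed

text \<open>Eventually the semi-radii are at least some \<open>\<delta>\<close>, so every
  ball contains two points whose difference is \<open>2 \<delta>\<^sup>2\<close>. For the
  ball described by \<open>X\<close> this gives \<open>\<epsilon>\<^sup>2 a \<le> R2\<close>
  with \<open>\<epsilon> = \<delta>\<^sup>2\<close>. As \<open>R2\<close> decreases and
  \<open>a\<close> increases, both are bounded above and below. The centers stay in the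
  first ball. The argument sees the given semi-radii only through these two points, and so
  it is independent of their normalisation.\<close>
lemma bounded_of_balls:
  assumes balls: "\<And>n. 1 \<le> n \<Longrightarrow> pd m (rs n) \<and> pd m (\<rho>s n) \<and> ballX m (X n x) = fball m (cs n) (rs n) (\<rho>s n)"
    and T: "tends (\<lambda>n. rs (Suc n)) r" "tends (\<lambda>n. \<rho>s (Suc n)) \<rho>" and r: "pd m r" and \<rho>: "pd m \<rho>"
  obtains C where "\<And>n. nr (X n x) \<le> C" "\<And>n. nr (Xi n) \<le> C"
proof -
  have cpd: "cor m m A" "adj A = A" if "pd m A" for A using that psd_adj pd_psd by (auto simp: pd_def)
  obtain \<delta>' where \<delta>': "0 < \<delta>'" "\<delta>' *\<^sub>R dg m \<le> r" "\<delta>' *\<^sub>R dg m \<le> \<rho>" using pd_common[OF r \<rho>] .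
  define \<delta> where "\<delta> = \<delta>' / 2"
  have \<delta>: "0 < \<delta>" "(2 * \<delta>) *\<^sub>R dg m \<le> r" "(2 * \<delta>) *\<^sub>R dg m \<le> \<rho>" using \<delta>' by (simp_all add: \<delta>_def)
  have seq: "\<exists>N. \<forall>n\<ge>N. \<delta> *\<^sub>R dg m \<le> R (Suc n)"
    if "tends (\<lambda>n. R (Suc n)) L" "pd m L" "(2 * \<delta>) *\<^sub>R dg m \<le> L" "\<And>n. 1 \<le> n \<Longrightarrow> pd m (R n)" for R L
    by (rule eventually_ge[OF that(1) _ cpd(1)[OF that(2)] _ cpd(2)[OF that(2)] that(3) \<delta>(1)]) (simp_all add: cpd that(4))
  obtain N1 where N1: "\<And>n. N1 \<le> n \<Longrightarrow> \<delta> *\<^sub>R dg m \<le> rs (Suc n)" using seq[OF T(1) r \<delta>(2)] balls by blast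
  obtain N2 where N2: "\<And>n. N2 \<le> n \<Longrightarrow> \<delta> *\<^sub>R dg m \<le> \<rho>s (Suc n)" using seq[OF T(2) \<rho> \<delta>(3)] balls by blast
  define \<epsilon> where "\<epsilon> = \<delta> * \<delta>"
  have \<epsilon>: "0 < \<epsilon>" using \<delta> by (simp add: \<epsilon>_def)
  have B: "ball_data m (X (Suc n) x) (Xi (Suc n))" for n by (rule ball_data_X) simp
  let ?a = "\<lambda>n. ball_data.a m (X (Suc n) x)" and ?ai = "\<lambda>n. ball_data.ai m (X (Suc n) x)"
    and ?R2 = "\<lambda>n. ball_data.R2 m (X (Suc n) x)" and ?c = "\<lambda>n. ball_data.c m (X (Suc n) x)"
    and ?sX = "\<lambda>n. ball_data.sX m (Xi (Suc n))"
  have aX: "?a n = aX (Suc n)" for n unfolding ball_data.a_def[OF B] aX_def by (rule refl)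
  obtain \<eta> where \<eta>: "0 < \<eta>" "\<eta> *\<^sub>R dg m \<le> aX 1" using pd_aX_sX(1)[of 1] by (auto simp: pd_def)
  have alo: "\<eta> *\<^sub>R dg m \<le> ?a n" for n
    unfolding aX by (rule order.trans[OF \<eta>(2) aX_inc(2)]) simp
  have aiup: "?ai n \<le> (1 / \<eta>) *\<^sub>R dg m" for n
    by (rule pd_inverse_le(2)[OF \<eta>(1) alo ball_data.cor_a[OF B] ball_data.ai(1)[OF B] ball_data.ai(2,3)[OF B]])
  have Xle: "X (Suc n) x \<le> X (Suc 0) x" for n by (rule X_decseq) simp
  define k where "k = nrm m (?R2 0)"
  have R2up: "?R2 n \<le> k *\<^sub>R dg m" for n
    unfolding k_def by (rule order.trans[OF ball_R2_mono[OF B B Xle] herm_le_nrm[OF ball_data.adj_R2[OF B] ball_data.cor_c(2)[OF B]]])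
  have key: "(\<epsilon> * \<epsilon>) *\<^sub>R ?a n \<le> ?R2 n" if n: "N1 \<le> n" "N2 \<le> n" for n
  proof -
    have b: "pd m (rs (Suc n))" "pd m (\<rho>s (Suc n))" "ballX m (X (Suc n) x) = fball m (cs (Suc n)) (rs (Suc n)) (\<rho>s (Suc n))"
      using balls[of "Suc n"] by auto
    note mem = fball_contains_scalars[OF N1[OF n(1)] cpd(1)[OF b(1)] N2[OF n(2)] cpd(1)[OF b(2)] \<delta>(1), of "cs (Suc n)",
      folded b(3) \<epsilon>_def]
    show ?thesis using ball_data.diameter_bound[OF B mem] corD[OF ball_data.cor_a[OF B]] by simp
  qed
  define q where "q = \<epsilon> * \<epsilon> * \<eta>"
  have q: "0 < q" using \<epsilon> \<eta> by (simp add: q_def)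
  have R2lo: "q *\<^sub>R dg m \<le> ?R2 n" if n: "N1 \<le> n" "N2 \<le> n" for n
  proof -
    have "q *\<^sub>R dg m = (\<epsilon> * \<epsilon>) *\<^sub>R (\<eta> *\<^sub>R dg m)" by (simp add: q_def)
    also have "\<dots> \<le> (\<epsilon> * \<epsilon>) *\<^sub>R ?a n" by (rule scaleR_left_mono[OF alo]) (use \<epsilon> in simp)
    also have "\<dots> \<le> ?R2 n" by (rule key[OF n])
    finally show ?thesis .
  qed
  have aup: "?a n \<le> (k / (\<epsilon> * \<epsilon>)) *\<^sub>R dg m" if n: "N1 \<le> n" "N2 \<le> n" for n
  proof (rule scaleR_le_cancel)
    show "0 < \<epsilon> * \<epsilon>" using \<epsilon> by simp
    show "(\<epsilon> * \<epsilon>) *\<^sub>R ?a n \<le> (\<epsilon> * \<epsilon>) *\<^sub>R (k / (\<epsilon> * \<epsilon>)) *\<^sub>R dg m"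
      using order.trans[OF key[OF n] R2up] \<epsilon> by simp
  qed
  have sup: "?sX n \<le> (1 / q) *\<^sub>R dg m" if n: "N1 \<le> n" "N2 \<le> n" for n
    by (rule pd_inverse_le(2)[OF q R2lo[OF n] ball_data.cor_c(2)[OF B] ball_data.cor_sX[OF B] ball_data.R2_sX[OF B]
      ball_data.sX_R2[OF B]])
  define b where "b = 1 + (real m)\<^sup>2 * (trc m (?R2 0) / \<eta>)"
  have cb: "nrm m (?c n) \<le> b + nrm m (?c 0)" for n
  proof -
    have "?c n \<in> ballX m (X (Suc 0) x)" using ballX_mono[OF Xle] ball_data.center_mem[OF B] by blast
    then have "nrm m (?c n - ?c 0) \<le> b" unfolding b_def by (rule ball_data.radius_bound[OF B _ \<eta>(1) alo])
    then show ?thesis using nrm_add[of m "?c n - ?c 0" "?c 0"] by simp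
  qed
  have b0: "0 \<le> b" using ball_data.psd_parts(3)[OF B, of 0] \<eta>(1) trc_nonneg unfolding b_def
    by (intro add_nonneg_nonneg mult_nonneg_nonneg divide_nonneg_pos) auto
  have k0: "0 \<le> k" unfolding k_def by (rule nrm_nonneg)
  \<comment> \<open>one constant for all five bounds\<close>
  define K where "K = k / (\<epsilon> * \<epsilon>) + 1 / \<eta> + k + 1 / q + (b + nrm m (?c 0))"
  have parts: "0 \<le> k / (\<epsilon> * \<epsilon>)" "0 \<le> 1 / \<eta>" "0 \<le> 1 / q" "0 \<le> b + nrm m (?c 0)"
    using \<epsilon> \<eta> q k0 b0 nrm_nonneg[of m "?c 0"] by simp_all
  have Kge: "0 \<le> K" "k / (\<epsilon> * \<epsilon>) \<le> K" "1 / \<eta> \<le> K" "k \<le> K" "1 / q \<le> K" "b + nrm m (?c 0) \<le> K"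
    using parts k0 unfolding K_def by linarith+
  have up: "A \<le> K *\<^sub>R dg m" if "A \<le> s *\<^sub>R dg m" "s \<le> K" for A s
    by (rule order.trans[OF that(1) scaleR_right_mono[OF that(2) psd_dg]])
  define G where "G = 2 * ((nr (blk m 0) + nr (blk m 1) + K * (nr (blk m 0) + nr (blk m 1)))
    * (real (2 * m) * (K * real m) * (nr (blk m 0) + nr (blk m 1) + K * (nr (blk m 0) + nr (blk m 1)))))"
  have bound: "nr (X (Suc n) x) \<le> G" "nr (Xi (Suc n)) \<le> G" if n: "N1 \<le> n" "N2 \<le> n" for n
    unfolding G_def
    by (rule ball_data.nrm_bound[OF B Kge(1) order.trans[OF cb Kge(6)] up[OF aup[OF n] Kge(2)] up[OF aiup Kge(3)]
        up[OF R2up Kge(4)] up[OF sup[OF n] Kge(5)]])+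
  \<comment> \<open>the sum covers the finitely many indices before the semi-radii are bounded below\<close>
  define C where "C = G + (\<Sum>k\<le>N1 + N2. nr (X k x) + nr (Xi k))"
  have G0: "0 \<le> G" using bound(1)[of "N1 + N2"] nrm_nonneg[of "2 * m" "X (Suc (N1 + N2)) x"] by simp
  have "nr (X n x) \<le> C \<and> nr (Xi n) \<le> C" for n
  proof (cases "n \<le> N1 + N2")
    case True
    have "nr (X n x) + nr (Xi n) \<le> (\<Sum>k\<le>N1 + N2. nr (X k x) + nr (Xi k))"
      by (rule member_le_sum[where f = "\<lambda>k. nr (X k x) + nr (Xi k)"]) (use True in \<open>simp_all add: nrm_nonneg\<close>)
    then show ?thesis using G0 nrm_nonneg[of "2 * m" "X n x"] nrm_nonneg[of "2 * m" "Xi n"] unfolding C_def by linarith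
  next
    case False
    then obtain j where j: "n = Suc j" "N1 \<le> j" "N2 \<le> j" by (cases n) auto
    have "0 \<le> (\<Sum>k\<le>N1 + N2. nr (X k x) + nr (Xi k))" by (intro sum_nonneg add_nonneg_nonneg nrm_nonneg)
    then show ?thesis using bound[OF j(2,3)] unfolding C_def j(1) by linarith
  qed
  then show ?thesis using that by blast
qed

text \<open>The terms are positive matrices, whose norm is controlled by the trace, that is
  by the diagonal entries.\<close>
lemma summable_entries_iff:
  "(\<forall>a<2 * m. \<forall>b<2 * m. summable (\<lambda>n. complex_of_real (coef n) * ent (N n) a b)) \<longleftrightarrow> summable (\<lambda>n. coef n * nr (N n))"
proof
  assume s: "\<forall>a<2 * m. \<forall>b<2 * m. summable (\<lambda>n. complex_of_real (coef n) * ent (N n) a b)"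
  have "summable (\<lambda>n. coef n * (real (2 * m) * trc (2 * m) (N n)))"
  proof -
    have "summable (\<lambda>n. Re (complex_of_real (coef n) * ent (N n) a a))" if "a < 2 * m" for a
      using s that summable_Re by blast
    then have "summable (\<lambda>n. \<Sum>a<2 * m. coef n * Re (ent (N n) a a))" by (intro summable_sum) simp
    then have "summable (\<lambda>n. real (2 * m) * (\<Sum>a<2 * m. coef n * Re (ent (N n) a a)))" by (rule summable_mult)
    then show ?thesis by (simp only: trc_def sum_distrib_left mult.left_commute)
  qed
  then show "summable (\<lambda>n. coef n * nr (N n))"
  proof (rule summable_comparison_test'[where N = 0])
    show "norm (coef n * nr (N n)) \<le> coef n * (real (2 * m) * trc (2 * m) (N n))" for n
      using nrm_le_trc[OF N_psd, of "2 * m" n] coef_nonneg[of n] nrm_nonneg[of "2 * m" "N n"] by (simp add: mult_left_mono)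
  qed
next
  assume s: "summable (\<lambda>n. coef n * nr (N n))"
  show "\<forall>a<2 * m. \<forall>b<2 * m. summable (\<lambda>n. complex_of_real (coef n) * ent (N n) a b)"
  proof (intro allI impI)
    fix a b assume ab: "a < 2 * m" "b < 2 * m"
    show "summable (\<lambda>n. complex_of_real (coef n) * ent (N n) a b)"
    proof (rule summable_comparison_test'[OF s, where N = 0])
      show "norm (complex_of_real (coef n) * ent (N n) a b) \<le> coef n * nr (N n)" for n
        using nrm_entry[OF ab, of "N n"] coef_nonneg[of n] by (simp add: norm_mult mult_left_mono)
    qed
  qed
qed

end

(*%FILE E1*)
section \<open>Block constructions on finite matrices\<close>

lemma cor_block_entries: "cor m m (blk m j * (Y * adj (blk m k)))"
proof -
  have "dg m * (blk m j * (Y * adj (blk m k))) = blk m j * (Y * adj (blk m k))" by (simp only: dg_blk)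
  moreover have "(blk m j * (Y * adj (blk m k))) * dg m = blk m j * (Y * adj (blk m k))" by (simp only: dg_blk mult.assoc)
  ultimately show ?thesis by (simp add: cor_def)
qed

lemma block_expansion:
  assumes "cor (n * m) (k * m) Y"
  shows "Y = (\<Sum>i<n. \<Sum>j<k. adj (blk m i) * ((blk m i * (Y * adj (blk m j))) * blk m j))"
proof -
  have "Y = dg (n * m) * (Y * dg (k * m))" using corD[OF assms] by simp
  then have "Y = (\<Sum>j<k. \<Sum>i<n. adj (blk m i) * (blk m i * (Y * (adj (blk m j) * blk m j))))"
    unfolding sum_adj_blk_blk[symmetric] by (simp only: sum_distrib_left sum_distrib_right mult.assoc)
  from trans[OF this sum.swap] show ?thesis unfolding mult.assoc .
qed

lemma emb_eqI:
  assumes "cor d e A" "M \<in> carrier_mat d e" "\<And>i j. i < d \<Longrightarrow> j < e \<Longrightarrow> M $$ (i, j) = ent A i j"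
  shows "emb M = A"
proof (rule fmat_eqI)
  fix i j
  show "ent (emb M) i j = ent A i j"
    using assms cor_ent[OF assms(1), of i j] by (cases "i < d \<and> j < e") (auto simp: ent_emb)
qed

lemma emb_block_mat:
  assumes F: "\<And>i j. i < n \<Longrightarrow> j < k \<Longrightarrow> F (Suc i) (Suc j) \<in> carrier_mat m m"
  shows "emb (block_mat m n k F) = (\<Sum>i<n. \<Sum>j<k. adj (blk m i) * (emb (F (Suc i) (Suc j)) * blk m j))"
    and "block_mat m n k F \<in> carrier_mat (n * m) (k * m)"
proof -
  let ?M = "block_mat m n k F"
  show c: "?M \<in> carrier_mat (n * m) (k * m)" by (simp add: block_mat_def)
  have b: "blk m i * (emb ?M * adj (blk m j)) = emb (F (Suc i) (Suc j))" if ij: "i < n" "j < k" for i j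
  proof (rule sym, rule emb_eqI[OF cor_block_entries F[OF ij]])
    fix a b assume ab: "a < m" "b < m"
    have "i * m + a < n * m" "j * m + b < k * m"
    proof -
      have "p * m + q < l * m" if "p < l" "q < m" for p q l
      proof -
        have "p * m + q < Suc p * m" using that(2) by simp
        also have "Suc p * m \<le> l * m" using that(1) by (intro mult_le_mono1) simp
        finally show ?thesis .
      qed
      then show "i * m + a < n * m" "j * m + b < k * m" using ij ab by blast+
    qed
    moreover have "(i * m + a) div m = i" "(j * m + b) div m = j" "(i * m + a) mod m = a" "(j * m + b) mod m = b"
      using ab by simp_all
    ultimately show "F (Suc i) (Suc j) $$ (a, b) = ent (blk m i * (emb ?M * adj (blk m j))) a b"
      unfolding ent_block[OF ab] by (simp add: ent_emb block_mat_def)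
  qed
  show "emb ?M = (\<Sum>i<n. \<Sum>j<k. adj (blk m i) * (emb (F (Suc i) (Suc j)) * blk m j))"
    by (subst block_expansion[OF cor_emb[OF c]]) (simp add: b)
qed

lemma blk_0: "blk m 0 = dg m"
  by (rule fmat_eqI) (auto simp: ent_blk ent_dg)

lemma emb_four_block:
  assumes "A \<in> carrier_mat m m" "B \<in> carrier_mat m m" "C \<in> carrier_mat m m" "D \<in> carrier_mat m m"
  shows "emb (four_block_mat A B C D) = adj (blk m 0) * (emb A * blk m 0) + adj (blk m 0) * (emb B * blk m 1)
    + adj (blk m 1) * (emb C * blk m 0) + adj (blk m 1) * (emb D * blk m 1)"
proof -
  let ?M = "four_block_mat A B C D"
  have c: "?M \<in> carrier_mat (2 * m) (2 * m)"
    using four_block_carrier_mat[OF assms(1) assms(4)] by (simp add: mult_2)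
  have b: "blk m 0 * (emb ?M * adj (blk m 0)) = emb A" "blk m 0 * (emb ?M * adj (blk m 1)) = emb B"
    "blk m 1 * (emb ?M * adj (blk m 0)) = emb C" "blk m 1 * (emb ?M * adj (blk m 1)) = emb D"
    by (rule sym, rule emb_eqI[OF cor_block_entries]; use assms in \<open>simp add: ent_block ent_emb\<close>)+
  have two: "{..<2::nat} = {0, 1}" by auto
  show ?thesis
    by (subst block_expansion[OF cor_emb[OF c]]) (simp only: two b sum.insert finite.intros sum.empty insert_iff
      empty_iff zero_neq_one simp_thms if_False add_0_right add.assoc not_False_eq_True)
qed

lemma emb_J: "emb (J_mat m) = Jm m" "J_mat m \<in> carrier_mat (2 * m) (2 * m)"
proof -
  show "emb (J_mat m) = Jm m"
    unfolding J_mat_def by (subst emb_four_block[of _ m]) (simp_all add: emb_zero emb_smult emb_one Jm_def)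
  show "J_mat m \<in> carrier_mat (2 * m) (2 * m)" unfolding J_mat_def
    using four_block_carrier_mat[of "0\<^sub>m m m :: complex mat" m m "0\<^sub>m m m" m m] by (simp add: mult_2)
qed

lemma emb_row_block:
  assumes A: "A \<in> carrier_mat m (n * m)"
  shows "emb (four_block_mat A (1\<^sub>m m) (0\<^sub>m 0 (n * m)) (0\<^sub>m 0 m)) = emb A + blk m n"
    "four_block_mat A (1\<^sub>m m) (0\<^sub>m 0 (n * m)) (0\<^sub>m 0 m) \<in> carrier_mat m (Suc n * m)"
proof -
  let ?M = "four_block_mat A (1\<^sub>m m) (0\<^sub>m 0 (n * m)) (0\<^sub>m 0 m)"
  show c: "?M \<in> carrier_mat m (Suc n * m)"
    using four_block_carrier_mat[OF A, of "0\<^sub>m 0 m" 0 m "1\<^sub>m m" "0\<^sub>m 0 (n * m)"] by (simp add: add.commute)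
  show "emb ?M = emb A + blk m n"
  proof (rule emb_eqI[OF _ c])
    show "cor m (Suc n * m) (emb A + blk m n)"
      by (intro cor_intros(2) cor_mono[OF cor_emb[OF A]] cor_blk) auto
    show "?M $$ (i, j) = ent (emb A + blk m n) i j" if "i < m" "j < Suc n * m" for i j
      using that A by (auto simp: ent_emb ent_blk)
  qed
qed

lemma emb_split_block:
  assumes M: "M \<in> carrier_mat (Suc n * m) (Suc n * m)"
    and s: "split_block M (n * m) (n * m) = (A, B, C, D)"
  shows "emb B = dg (n * m) * (emb M * adj (blk m n))" "emb D = blk m n * (emb M * adj (blk m n))"
    "B \<in> carrier_mat (n * m) m" "D \<in> carrier_mat m m"
proof -
  have dims: "dim_row M = n * m + m" "dim_col M = n * m + m" using M by auto
  have BD: "B = mat (n * m) m (\<lambda>(i, j). M $$ (i, j + n * m))" "D = mat m m (\<lambda>(i, j). M $$ (i + n * m, j + n * m))"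
    using s unfolding split_block_def Let_def dims by auto
  then show cB: "B \<in> carrier_mat (n * m) m" and cD: "D \<in> carrier_mat m m" by simp_all
  have col: "ent (Y * adj (blk m n)) i b = ent Y i (n * m + b)" if "b < m" for Y i b
    using that by (rule ent_mult_adj_blk)
  show "emb B = dg (n * m) * (emb M * adj (blk m n))"
  proof (rule emb_eqI[OF _ cB])
    have "dg (n * m) * (emb M * adj (blk m n)) * dg m = dg (n * m) * (emb M * adj (blk m n))" by (simp only: dg_blk mult.assoc)
    moreover have "dg (n * m) * (dg (n * m) * (emb M * adj (blk m n))) = dg (n * m) * (emb M * adj (blk m n))"
      by (simp only: dg_dg mult.assoc[symmetric])
    ultimately show "cor (n * m) m (dg (n * m) * (emb M * adj (blk m n)))" by (simp add: cor_def)
    show "B $$ (i, j) = ent (dg (n * m) * (emb M * adj (blk m n))) i j" if "i < n * m" "j < m" for i j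
      using that dims by (simp add: BD ent_dg_mult col ent_emb add.commute)
  qed
  show "emb D = blk m n * (emb M * adj (blk m n))"
  proof (rule emb_eqI[OF cor_block_entries cD])
    show "D $$ (i, j) = ent (blk m n * (emb M * adj (blk m n))) i j" if "i < m" "j < m" for i j
      using that dims by (simp add: BD ent_block ent_emb add.commute)
  qed
qed

text \<open>The positive powers of \<open>A\<close> are \<open>\<plusminus> A\<close>, so
  the exponential series is a scalar one.\<close>
lemma mat_exp_projection:
  assumes A: "A \<in> carrier_mat d d" and P: "emb A * emb A = - emb A"
  shows "emb (mat_exp (s \<cdot>\<^sub>m A)) = dg d + (1 - exp (- s)) *c emb A" "mat_exp (s \<cdot>\<^sub>m A) \<in> carrier_mat d d"
proof -
  let ?M = "s \<cdot>\<^sub>m A"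
  have cM: "?M \<in> carrier_mat d d" using A by simp
  show cE: "mat_exp ?M \<in> carrier_mat d d" using A by (simp add: mat_exp_def)
  have pow: "?M ^\<^sub>m k \<in> carrier_mat d d \<and> emb (?M ^\<^sub>m k) = (if k = 0 then dg d else - ((- s) ^ k *c emb A))" for k
  proof (induction k)
    case 0
    then show ?case using A by (simp add: emb_one)
  next
    case (Suc k)
    then have c: "?M ^\<^sub>m k \<in> carrier_mat d d" by blast
    have "emb (?M ^\<^sub>m Suc k) = emb (?M ^\<^sub>m k) * (s *c emb A)"
      by (simp add: emb_mult[OF c cM] emb_smult)
    also have "\<dots> = - ((- s) ^ Suc k *c emb A)"
      using Suc corD(1)[OF cor_emb[OF A]] P by (cases "k = 0") simp_all
    finally show ?case using mult_carrier_mat[OF c cM] by simp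
  qed
  show "emb (mat_exp ?M) = dg d + (1 - exp (- s)) *c emb A"
  proof (rule emb_eqI[OF _ cE])
    show "cor d d (dg d + (1 - exp (- s)) *c emb A)" by (intro cor_intros cor_emb A)
    fix i j assume ij: "i < d" "j < d"
    have e: "(?M ^\<^sub>m k) $$ (i, j) = ent (emb (?M ^\<^sub>m k)) i j" for k
      unfolding ent_emb carrier_matD[OF conjunct1[OF pow[of k]]] using ij by (simp only: simp_thms if_True)
    define q where "q = ent (emb A) i j"
    define h where "h = (if i = j then 1 else 0 :: complex)"
    have e': "ent (emb (?M ^\<^sub>m k)) i j = (if k = 0 then h else - ((- s) ^ k * q))" for k
      unfolding conjunct2[OF pow] using ij by (simp add: q_def h_def ent_dg)
    have coeff: "(?M ^\<^sub>m k) $$ (i, j) / fact k = - q * ((- s) ^ k /\<^sub>R fact k) + (if k = 0 then h + q else 0)" for k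
      unfolding e e' by (simp add: scaleR_conv_of_real field_simps)
    have "(\<lambda>k. - q * ((- s) ^ k /\<^sub>R fact k) + (if k = 0 then h + q else 0)) sums (- q * exp (- s) + (h + q))"
      by (intro sums_add sums_mult exp_converges sums_single[of 0 "\<lambda>_. h + q"])
    then have "(\<Sum>k. (?M ^\<^sub>m k) $$ (i, j) / fact k) = - q * exp (- s) + (h + q)"
      unfolding coeff by (rule sums_unique[symmetric])
    moreover have "mat_exp ?M $$ (i, j) = (\<Sum>k. (?M ^\<^sub>m k) $$ (i, j) / fact k)"
      using A ij by (simp add: mat_exp_def)
    ultimately show "mat_exp ?M $$ (i, j) = ent (dg d + (1 - exp (- s)) *c emb A) i j"
      using ij by (simp add: ent_dg q_def h_def algebra_simps)
  qed
qed

text \<open>A positive matrix of full rank is invertible, hence definite.\<close>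
lemma rank_full_iff_pd:
  assumes A: "A \<in> carrier_mat d d" and p: "psd A"
  shows "vec_space.rank d A = d \<longleftrightarrow> pd d (emb A)"
proof -
  have "vec_space.rank d A = d \<longleftrightarrow> det A \<noteq> 0" using vec_space.det_rank_iff[OF A] by blast
  also have "\<dots> \<longleftrightarrow> pd d (emb A)"
  proof
    assume "det A \<noteq> 0"
    then have "A *\<^sub>v x = 0\<^sub>v d \<Longrightarrow> x = 0\<^sub>v d" if "x \<in> carrier_vec d" for x
      using det_0_iff_vec_prod_zero[OF A] that by blast
    note inv = mat_inv_props[OF A this]
    have B: "cor d d (emb (mat_inv A))" "emb A * emb (mat_inv A) = dg d" "emb (mat_inv A) * emb A = dg d"
      using inv(3,2) by (simp_all add: cor_emb[OF inv(1)] emb_one flip: emb_mult[OF A inv(1)] emb_mult[OF inv(1) A])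
    have "0 \<le> emb A" using p psd_emb[OF A] by blast
    from psd_inverse_pd[OF this cor_emb[OF A] B] have "pd d (emb (mat_inv A))" .
    from psd_inverse_pd[OF pd_psd[OF this] B(1) cor_emb[OF A] B(3,2)] show "pd d (emb A)" .
  next
    assume "pd d (emb A)"
    then obtain B where B: "cor d d B" "emb A * B = dg d" by (rule pd_inverse)
    have "emb (A * unemb d d B) = emb (1\<^sub>m d)"
      using emb_mult[OF A unemb_carrier] emb_unemb[OF B(1)] B(2) by (simp add: emb_one)
    then have "A * unemb d d B = 1\<^sub>m d"
      by (rule emb_inj[OF mult_carrier_mat[OF A unemb_carrier] one_carrier_mat])
    then have "det A * det (unemb d d B) = 1" using det_mult[OF A unemb_carrier, of B] by simp
    then show "det A \<noteq> 0" by auto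
  qed
  finally show ?thesis .
qed

lemma emb_matrix_ball:
  assumes c: "c \<in> carrier_mat m m" and r: "r \<in> carrier_mat m m" and \<rho>: "\<rho> \<in> carrier_mat m m"
  shows "emb ` matrix_ball m c r \<rho> = fball m (emb c) (emb r) (emb \<rho>)" "matrix_ball m c r \<rho> \<subseteq> carrier_mat m m"
proof -
  have e: "emb (c + r * V * \<rho>) = emb c + emb r * emb V * emb \<rho>" if V: "V \<in> carrier_mat m m" for V
    using emb_add[OF c mult_carrier_mat[OF mult_carrier_mat[OF r V] \<rho>]] emb_mult[OF mult_carrier_mat[OF r V] \<rho>]
      emb_mult[OF r V] by simp
  have p: "psd (1\<^sub>m m - mat_adjoint V * V) \<longleftrightarrow> adj (emb V) * emb V \<le> dg m" if V: "V \<in> carrier_mat m m" for V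
  proof -
    have node_row: "mat_adjoint V * V \<in> carrier_mat m m" by (rule mult_carrier_mat[OF mat_adjoint_carrier[OF V] V])
    have "psd (1\<^sub>m m - mat_adjoint V * V) \<longleftrightarrow> 0 \<le> emb (1\<^sub>m m - mat_adjoint V * V)"
      by (rule psd_emb[OF minus_carrier_mat[OF node_row]])
    also have "emb (1\<^sub>m m - mat_adjoint V * V) = dg m - adj (emb V) * emb V"
      using emb_diff[OF one_carrier_mat node_row] emb_mult[OF mat_adjoint_carrier[OF V] V] by (simp add: emb_one emb_adj)
    finally show ?thesis by simp
  qed
  show "emb ` matrix_ball m c r \<rho> = fball m (emb c) (emb r) (emb \<rho>)"
  proof (intro equalityI subsetI)
    fix u assume "u \<in> emb ` matrix_ball m c r \<rho>"
    then obtain V where V: "V \<in> carrier_mat m m" "psd (1\<^sub>m m - mat_adjoint V * V)" "u = emb (c + r * V * \<rho>)"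
      by (auto simp: matrix_ball_def)
    then show "u \<in> fball m (emb c) (emb r) (emb \<rho>)"
      unfolding fball_def using e[OF V(1)] p[OF V(1)] cor_emb[OF V(1)] by blast
  next
    fix u assume "u \<in> fball m (emb c) (emb r) (emb \<rho>)"
    then obtain V where V: "cor m m V" "adj V * V \<le> dg m" "u = emb c + emb r * V * emb \<rho>" by (auto simp: fball_def)
    let ?V = "unemb m m V"
    have "?V \<in> carrier_mat m m" "emb ?V = V" by (simp_all add: unemb_carrier emb_unemb[OF V(1)])
    then have "u = emb (c + r * ?V * \<rho>)" "psd (1\<^sub>m m - mat_adjoint ?V * ?V)" using e p V by simp_all
    then show "u \<in> emb ` matrix_ball m c r \<rho>" unfolding matrix_ball_def using unemb_carrier by blast
  qed
  show "matrix_ball m c r \<rho> \<subseteq> carrier_mat m m" using c r \<rho> by (auto simp: matrix_ball_def)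
qed

lemma mat_tendsto_iff:
  assumes X: "\<And>n. 1 \<le> n \<Longrightarrow> X n \<in> carrier_mat m m" and L: "L \<in> carrier_mat m m"
  shows "mat_tendsto m X L \<longleftrightarrow> tends (\<lambda>n. emb (X (Suc n))) (emb L)"
proof -
  have e: "ent (emb (X (Suc n))) a b = X (Suc n) $$ (a, b)" "ent (emb L) a b = L $$ (a, b)" if "a < m" "b < m" for n a b
    using X[of "Suc n"] L that by (auto simp: ent_emb)
  have z: "ent (emb (X (Suc n))) a b = 0" "ent (emb L) a b = 0" if "\<not> (a < m \<and> b < m)" for n a b
    using X[of "Suc n"] L that by (auto simp: ent_emb)
  have "(\<lambda>n. X n $$ (a, b)) \<longlonglongrightarrow> L $$ (a, b) \<longleftrightarrow> (\<lambda>n. ent (emb (X (Suc n))) a b) \<longlonglongrightarrow> ent (emb L) a b"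
    if "a < m" "b < m" for a b
    unfolding e[OF that] by (rule filterlim_sequentially_Suc[symmetric])
  moreover have "(\<lambda>n. ent (emb (X (Suc n))) a b) \<longlonglongrightarrow> ent (emb L) a b" if "\<not> (a < m \<and> b < m)" for a b
    unfolding z[OF that] by (rule tendsto_const)
  ultimately show ?thesis unfolding mat_tendsto_def tends_def by blast
qed

(*%FILE E2*)
section \<open>The matrices of the interpolation problem\<close>

locale interpolation_data =
  fixes m :: nat and z :: "nat \<Rightarrow> complex" and W :: "nat \<Rightarrow> complex mat"
  assumes m: "1 \<le> m" and Im: "\<And>j. 1 \<le> j \<Longrightarrow> 0 < Im (z j)" and W: "\<And>j. 1 \<le> j \<Longrightarrow> W j \<in> carrier_mat m m"
    and pick_pos: "\<And>n. 1 \<le> n \<Longrightarrow> pos_def (pick_mat m z W n)"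
begin

sublocale P: pick_data m "\<lambda>k. z (Suc k)" "\<lambda>k. emb (W (Suc k))"
  by unfold_locales (simp_all add: Im W cor_emb)

lemma T_mat:
  "emb (T_mat m z n) = (\<Sum>k<n. (1 / z (Suc k)) *c (adj (blk m k) * blk m k))"
  "T_mat m z n \<in> carrier_mat (n * m) (n * m)"
proof -
  have e: "emb (if Suc i = Suc j then inverse (z (Suc i)) \<cdot>\<^sub>m 1\<^sub>m m else 0\<^sub>m m m)
      = (if i = j then (1 / z (Suc i)) *c dg m else 0)" for i j
    by (simp add: emb_smult emb_one emb_zero inverse_eq_divide)
  have "(\<Sum>j<n. adj (blk m i) * ((if i = j then (1 / z (Suc i)) *c dg m else 0) * blk m j))
      = (1 / z (Suc i)) *c (adj (blk m i) * blk m i)" if "i < n" for i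
  proof -
    have "adj (blk m i) * ((if i = j then (1 / z (Suc i)) *c dg m else 0) * blk m j)
      = (if j = i then (1 / z (Suc i)) *c (adj (blk m i) * blk m i) else 0)" for j by simp
    then show ?thesis using that by simp
  qed
  then show "emb (T_mat m z n) = (\<Sum>k<n. (1 / z (Suc k)) *c (adj (blk m k) * blk m k))"
    unfolding T_mat_def
    by (subst emb_block_mat(1)) (simp, simp only: e, intro sum.cong refl, simp)
  show "T_mat m z n \<in> carrier_mat (n * m) (n * m)"
    unfolding T_mat_def by (rule emb_block_mat(2)) simp
qed

lemma T_inv:
  "mat_inv (T_mat m z n) \<in> carrier_mat (n * m) (n * m)"
  "emb (mat_inv (T_mat m z n)) = (\<Sum>k<n. z (Suc k) *c (adj (blk m k) * blk m k))"
proof -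
  let ?D = "\<Sum>k<n. z (Suc k) *c (adj (blk m k) * blk m k)"
  have "?D * emb (T_mat m z n) = (\<Sum>k<n. adj (blk m k) * (z (Suc k) *c (blk m k * emb (T_mat m z n))))"
    by (simp add: sum_distrib_right mult.assoc)
  also have "\<dots> = (\<Sum>k<n. adj (blk m k) * blk m k)"
  proof (rule sum.cong[OF refl])
    fix k assume "k \<in> {..<n}"
    then have k: "k < n" by simp
    have "blk m k * emb (T_mat m z n) = (1 / z (Suc k)) *c blk m k"
      unfolding T_mat using blk_sum[OF k, of m "\<lambda>k. (1 / z (Suc k)) *c blk m k"] by simp
    then show "adj (blk m k) * (z (Suc k) *c (blk m k * emb (T_mat m z n))) = adj (blk m k) * blk m k"
      using P.z_nz(1)[of k] by simp
  qed
  finally have "?D * emb (T_mat m z n) = dg (n * m)" by (simp only: sum_adj_blk_blk)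
  moreover have "cor (n * m) (n * m) ?D"
    by (intro cor_sum cor_intros(5) cor_mult[OF cor_intros(6)[OF cor_blk] cor_blk]) auto
  ultimately show "mat_inv (T_mat m z n) \<in> carrier_mat (n * m) (n * m)" "emb (mat_inv (T_mat m z n)) = ?D"
    using emb_mat_inv[OF T_mat(2)] by blast+
qed

lemma pick_mat: "emb (pick_mat m z W n) = P.Pick n" "pick_mat m z W n \<in> carrier_mat (n * m) (n * m)"
proof -
  let ?F = "\<lambda>j k. (1 / (z j - cnj (z k))) \<cdot>\<^sub>m (W j - mat_adjoint (W k))"
  let ?G = "\<lambda>j k. (1 / (z (Suc j) - cnj (z (Suc k)))) *c (emb (W (Suc j)) - adj (emb (W (Suc k))))"
  let ?D = "\<Sum>k<n. z (Suc k) *c (adj (blk m k) * blk m k)"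
  have F: "?F (Suc i) (Suc j) \<in> carrier_mat m m" for i j
    using minus_carrier_mat[OF mat_adjoint_carrier[OF W[of "Suc j"]], of "W (Suc i)"] by (intro smult_carrier_mat) simp
  have eF: "emb (?F (Suc i) (Suc j)) = ?G i j" for i j
    using emb_diff[OF W[of "Suc i"] mat_adjoint_carrier[OF W[of "Suc j"]]] by (simp add: emb_smult emb_adj)
  note bm = emb_block_mat[of n n ?F m, OF F]
  note cT = T_inv(1)[of n]
  show c: "pick_mat m z W n \<in> carrier_mat (n * m) (n * m)"
    unfolding pick_mat_def by (rule mult_carrier_mat[OF mult_carrier_mat[OF cT bm(2)] mat_adjoint_carrier[OF cT]])
  have "emb (pick_mat m z W n) = ?D * (\<Sum>i<n. \<Sum>j<n. adj (blk m i) * (?G i j * blk m j)) * adj ?D"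
    unfolding pick_mat_def emb_mult[OF mult_carrier_mat[OF cT bm(2)] mat_adjoint_carrier[OF cT]]
      emb_mult[OF cT bm(2)] emb_adj T_inv(2) bm(1) eF by (rule refl)
  also have "?D * (\<Sum>i<n. \<Sum>j<n. adj (blk m i) * (?G i j * blk m j))
      = (\<Sum>i<n. adj (blk m i) * (z (Suc i) *c (\<Sum>j<n. ?G i j * blk m j)))"
  proof -
    have D: "?D * Y = (\<Sum>k<n. adj (blk m k) * (z (Suc k) *c (blk m k * Y)))" for Y
      by (simp add: sum_distrib_right mult.assoc)
    have "?D * (\<Sum>i<n. \<Sum>j<n. adj (blk m i) * (?G i j * blk m j))
      = (\<Sum>k<n. adj (blk m k) * (z (Suc k) *c (blk m k * (\<Sum>i<n. adj (blk m i) * (\<Sum>j<n. ?G i j * blk m j)))))"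
      unfolding D sum_distrib_left[symmetric] by (rule refl)
    also have "\<dots> = (\<Sum>i<n. adj (blk m i) * (z (Suc i) *c (\<Sum>j<n. ?G i j * blk m j)))"
    proof (rule sum.cong[OF refl])
      fix k assume "k \<in> {..<n}"
      then have "blk m k * (\<Sum>i<n. adj (blk m i) * (\<Sum>j<n. ?G i j * blk m j)) = dg m * (\<Sum>j<n. ?G k j * blk m j)"
        by (intro blk_sum) simp
      then show "adj (blk m k) * (z (Suc k) *c (blk m k * (\<Sum>i<n. adj (blk m i) * (\<Sum>j<n. ?G i j * blk m j))))
        = adj (blk m k) * (z (Suc k) *c (\<Sum>j<n. ?G k j * blk m j))" by (simp only: dg_blk cscale_mult)
    qed
    finally show ?thesis .
  qed
  also have "\<dots> * adj ?D = P.Pick n"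
  proof -
    have b: "blk m j * adj ?D = cnj (z (Suc j)) *c blk m j" if "j < n" for j
      using blk_sum[OF that, of m "\<lambda>k. cnj (z (Suc k)) *c blk m k"] by simp
    have "(\<Sum>j<n. ?G i j * blk m j) * adj ?D = (\<Sum>j<n. cnj (z (Suc j)) *c (?G i j * blk m j))" for i
    proof -
      have "(\<Sum>j<n. ?G i j * blk m j) * adj ?D = (\<Sum>j<n. ?G i j * (blk m j * adj ?D))"
        by (simp only: sum_distrib_right mult.assoc)
      also have "\<dots> = (\<Sum>j<n. cnj (z (Suc j)) *c (?G i j * blk m j))"
        by (rule sum.cong[OF refl]) (simp only: b lessThan_iff cscale_mult)
      finally show ?thesis .
    qed
    then have "(\<Sum>i<n. adj (blk m i) * (z (Suc i) *c (\<Sum>j<n. ?G i j * blk m j))) * adj ?D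
      = (\<Sum>i<n. adj (blk m i) * (z (Suc i) *c (\<Sum>j<n. cnj (z (Suc j)) *c (?G i j * blk m j))))"
      by (simp only: sum_distrib_right mult.assoc cscale_mult)
    also have "\<dots> = P.Pick n"
      unfolding P.Pick_def P.pick_block_def by (simp add: sum_distrib_left cscale_sum)
    finally show ?thesis .
  qed
  finally show "emb (pick_mat m z W n) = P.Pick n" .
qed

lemma Pick_pos: "1 \<le> n \<Longrightarrow> pd (n * m) (P.Pick n)"
  using pos_def_imp_pd[OF pick_mat(2) pick_pos] pick_mat(1) by metis

lemma nondegenerate: "P.nondegenerate n"
  by (rule P.nondegenerate_if_Pick_pd) (simp add: Pick_pos del: mult_Suc)

lemma Schur_pos: "pd m (P.Schur n)"
  using nondegenerate[of "Suc n"] by (simp add: P.nondegenerate_Suc)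

lemma pick_inv:
  "mat_inv (pick_mat m z W n) \<in> carrier_mat (n * m) (n * m)" "emb (mat_inv (pick_mat m z W n)) = P.Pick_inv n"
proof -
  have "P.Pick_inv n * emb (pick_mat m z W n) = dg (n * m)"
    unfolding pick_mat(1) by (rule P.Pick_inv_props(3)[OF nondegenerate])
  then show "mat_inv (pick_mat m z W n) \<in> carrier_mat (n * m) (n * m)" "emb (mat_inv (pick_mat m z W n)) = P.Pick_inv n"
    using emb_mat_inv[OF pick_mat(2) P.Pick_inv_props(1)[OF nondegenerate]] by blast+
qed

lemma B_C_block:
  "emb (B_block m z W (Suc n)) = P.last_col n" "emb (C_block m z W (Suc n)) = P.pick_block n n"
  "B_block m z W (Suc n) \<in> carrier_mat (n * m) m" "C_block m z W (Suc n) \<in> carrier_mat m m"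
proof -
  obtain A B C D where s: "split_block (pick_mat m z W (Suc n)) (n * m) (n * m) = (A, B, C, D)"
    by (metis prod_cases4)
  have BC: "B_block m z W (Suc n) = B" "C_block m z W (Suc n) = D"
    by (simp_all add: B_block_def C_block_def s)
  note sp = emb_split_block[OF pick_mat(2) s]
  have col: "P.Pick (Suc n) * adj (blk m n) = P.last_col n + adj (blk m n) * P.pick_block n n"
    unfolding P.Pick_Suc
    using P.blk_orth'(2)[OF P.cor_nm(1)] P.blk_orth'(2)[OF cor_intros(6)[OF P.cor_nm(3)]] corD(2)[OF P.cor_nm(3)]
    by (simp add: distrib_right mult.assoc blk_adj_blk)
  show "emb (B_block m z W (Suc n)) = P.last_col n"
    unfolding BC sp(1) pick_mat(1) col using corD[OF P.cor_nm(3)] P.blk_orth(2)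
    by (simp add: distrib_left flip: mult.assoc)
  show "emb (C_block m z W (Suc n)) = P.pick_block n n"
    unfolding BC sp(2) pick_mat(1) col using P.blk_orth'(1)[OF P.cor_nm(3)]
    by (simp add: distrib_left blk_adj_blk_mult)
  show "B_block m z W (Suc n) \<in> carrier_mat (n * m) m" "C_block m z W (Suc n) \<in> carrier_mat m m"
    unfolding BC using sp(3,4) .
qed

lemma last_col_Pick_inv_mat:
  "emb (mat_adjoint (B_block m z W (Suc n)) * mat_inv (pick_mat m z W n)) = adj (P.last_col n) * P.Pick_inv n"
  "mat_adjoint (B_block m z W (Suc n)) * mat_inv (pick_mat m z W n) \<in> carrier_mat m (n * m)"
  using emb_mult[OF mat_adjoint_carrier[OF B_C_block(3)] pick_inv(1)] mult_carrier_mat[OF mat_adjoint_carrier[OF B_C_block(3)] pick_inv(1)]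
  by (simp_all add: emb_adj B_C_block(1) pick_inv(2))

lemma K_hat: "emb (K_hat m z W (Suc n)) = P.Schur n" "K_hat m z W (Suc n) \<in> carrier_mat m m"
proof -
  have "emb (K_hat m z W (Suc n)) = P.Schur n \<and> K_hat m z W (Suc n) \<in> carrier_mat m m"
  proof (cases n)
    case 0
    have "P.Schur 0 = P.Pick 1" by (simp add: P.Schur_def P.Pick_def blk_0)
    then show ?thesis using pick_mat[of 1] unfolding 0 by (simp add: K_hat_def)
  next
    case (Suc k)
    have c: "mat_adjoint (B_block m z W (Suc n)) * mat_inv (pick_mat m z W n) * B_block m z W (Suc n) \<in> carrier_mat m m"
      by (rule mult_carrier_mat[OF last_col_Pick_inv_mat(2) B_C_block(3)])
    have K: "K_hat m z W (Suc n) = C_block m z W (Suc n)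
        - mat_adjoint (B_block m z W (Suc n)) * mat_inv (pick_mat m z W n) * B_block m z W (Suc n)"
      using Suc by (simp add: K_hat_def)
    have "emb (K_hat m z W (Suc n)) = P.Schur n"
      unfolding K emb_diff[OF B_C_block(4) c] emb_mult[OF last_col_Pick_inv_mat(2) B_C_block(3)] last_col_Pick_inv_mat(1) B_C_block P.Schur_def by (simp add: mult.assoc)
    then show ?thesis unfolding K using minus_carrier_mat[OF c] by simp
  qed
  then show "emb (K_hat m z W (Suc n)) = P.Schur n" "K_hat m z W (Suc n) \<in> carrier_mat m m" by blast+
qed

lemma L_row: "emb (L_row m z W (Suc n)) = P.Schur_row n" "L_row m z W (Suc n) \<in> carrier_mat m (Suc n * m)"
proof -
  have "emb (L_row m z W (Suc n)) = P.Schur_row n \<and> L_row m z W (Suc n) \<in> carrier_mat m (Suc n * m)"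
  proof (cases n)
    case 0
    then show ?thesis by (simp add: L_row_def emb_one P.Schur_row_def blk_0)
  next
    case (Suc k)
    have c: "- (mat_adjoint (B_block m z W (Suc n)) * mat_inv (pick_mat m z W n)) \<in> carrier_mat m (n * m)"
      using last_col_Pick_inv_mat(2) by (rule uminus_carrier_mat)
    have L: "L_row m z W (Suc n) = four_block_mat (- (mat_adjoint (B_block m z W (Suc n)) * mat_inv (pick_mat m z W n)))
        (1\<^sub>m m) (0\<^sub>m 0 (n * m)) (0\<^sub>m 0 m)"
      using Suc by (simp add: L_row_def)
    show ?thesis unfolding L using emb_row_block[OF c] by (simp add: emb_uminus last_col_Pick_inv_mat(1) P.Schur_row_def)
  qed
  then show "emb (L_row m z W (Suc n)) = P.Schur_row n" "L_row m z W (Suc n) \<in> carrier_mat m (Suc n * m)" by blast+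
qed

lemma R_mat_0: "R_mat m z n 0 = 1\<^sub>m (n * m)"
proof -
  have "1\<^sub>m (n * m) - 0 \<cdot>\<^sub>m T_mat m z n = 1\<^sub>m (n * m)" using T_mat(2)[of n] by (intro eq_matI) auto
  then show ?thesis by (simp add: R_mat_def mat_inv_one)
qed

lemma v_u_mat:
  "v_mat m n \<in> carrier_mat (n * m) m" "u_mat m W n \<in> carrier_mat (n * m) m"
  "emb (v_mat m n) * blk m 0 + emb (u_mat m W n) * blk m 1 = P.V n"
proof -
  show "v_mat m n \<in> carrier_mat (n * m) m" "u_mat m W n \<in> carrier_mat (n * m) m"
    using emb_block_mat(2)[of n 1 "\<lambda>j k. 1\<^sub>m m" m] emb_block_mat(2)[of n 1 "\<lambda>j k. W j" m] W
    by (simp_all add: v_mat_def u_mat_def)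
  have "emb (v_mat m n) = (\<Sum>i<n. adj (blk m i) * dg m)"
    unfolding v_mat_def by (subst emb_block_mat(1)) (simp_all add: emb_one blk_0)
  moreover have "emb (u_mat m W n) = (\<Sum>i<n. adj (blk m i) * emb (W (Suc i)))"
    unfolding u_mat_def by (subst emb_block_mat(1)) (simp_all add: blk_0 W)
  ultimately show "emb (v_mat m n) * blk m 0 + emb (u_mat m W n) * blk m 1 = P.V n"
    by (simp add: P.V_def P.node_row_def sum_distrib_right distrib_left sum.distrib mult.assoc)
qed

text \<open>The square root of the Schur complement enters only through the square of its
  inverse.\<close>
lemma P_cal: "emb (P_cal m z W (Suc n)) = P.elem n" "P_cal m z W (Suc n) \<in> carrier_mat (2 * m) (2 * m)"
proof -
  show cP: "P_cal m z W (Suc n) \<in> carrier_mat (2 * m) (2 * m)" by (rule P_cal_carrier)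
  obtain r where r: "pd m r" "r * r = P.Schur n" using pd_sqrt_exists[OF Schur_pos] .
  define ri where "ri = cinv m r"
  note ri = cinv[OF r(1), folded ri_def]
  have riri: "ri * ri = P.Schur_inv n"
  proof -
    have K: "cor m m (P.Schur_inv n)" "P.Schur n * P.Schur_inv n = dg m" using cinv(1,2)[OF Schur_pos] by (simp_all add: P.Schur_inv_def)
    have "(ri * ri) * (r * r) = ri * ((ri * r) * r)" by (simp only: mult.assoc)
    also have "\<dots> = dg m" using corD(1)[of m m r] r(1) by (simp only: ri(3) pd_def simp_thms)
    finally have "(ri * ri) * P.Schur n = dg m" unfolding r(2) .
    then have "dg m * P.Schur_inv n = (ri * ri) * dg m" unfolding K(2)[symmetric] by (simp only: mult.assoc[symmetric])
    then show ?thesis using corD[OF K(1)] corD[OF ri(1)] by (simp add: mult.assoc)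
  qed
  note sq = emb_mat_sqrt[OF K_hat(2) r(1) trans[OF r(2) K_hat(1)[symmetric]]]
  define S where "S = mat_inv (mat_sqrt (K_hat m z W (Suc n)))"
  have S: "S \<in> carrier_mat m m" "emb S = ri"
    using emb_mat_inv[OF sq(1) ri(1)] ri(3) unfolding sq(2) S_def by blast+
  define A where "A = S * L_row m z W (Suc n)"
  have A: "A \<in> carrier_mat m (Suc n * m)" "emb A = ri * P.Schur_row n"
    unfolding A_def emb_mult[OF S(1) L_row(2)] S(2) L_row(1) using mult_carrier_mat[OF S(1) L_row(2)] by simp_all
  have AR: "A * R_mat m z (Suc n) 0 = A" unfolding R_mat_0 by (rule right_mult_one_mat[OF A(1)])
  define p q where "p = P_fun m z W (Suc n) 0" and "q = Q_fun m z W (Suc n) 0"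
  have p: "p = A * v_mat m (Suc n)" and q: "q = - (A * u_mat m W (Suc n))"
    unfolding p_def q_def P_fun_def Q_fun_def S_def[symmetric] A_def[symmetric] AR by (rule refl)+
  have cp: "p \<in> carrier_mat m m" and cq: "q \<in> carrier_mat m m"
    unfolding p q using mult_carrier_mat[OF A(1) v_u_mat(1)] mult_carrier_mat[OF A(1) v_u_mat(2)] by (simp_all add: uminus_carrier_mat)
  have ep: "emb p = ri * (P.Schur_row n * emb (v_mat m (Suc n)))" and eq: "emb q = - (ri * (P.Schur_row n * emb (u_mat m W (Suc n))))"
    unfolding p q emb_uminus emb_mult[OF A(1) v_u_mat(1)] emb_mult[OF A(1) v_u_mat(2)] A(2) mult.assoc by (rule refl)+
  have row: "emb p * blk m 0 - emb q * blk m 1 = ri * P.g n"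
  proof -
    have "emb p * blk m 0 - emb q * blk m 1
      = ri * (P.Schur_row n * (emb (v_mat m (Suc n)) * blk m 0 + emb (u_mat m W (Suc n)) * blk m 1))"
      unfolding ep eq by (simp add: mult.assoc distrib_left)
    then show ?thesis unfolding v_u_mat(3) P.g_def .
  qed
  let ?M = "four_block_mat (mat_adjoint p * p) (- (mat_adjoint p * q)) (- (mat_adjoint q * p)) (mat_adjoint q * q)"
  note cpa = mat_adjoint_carrier[OF cp] and cqa = mat_adjoint_carrier[OF cq]
  note cs = mult_carrier_mat[OF cpa cp] uminus_carrier_mat[OF mult_carrier_mat[OF cpa cq]]
    uminus_carrier_mat[OF mult_carrier_mat[OF cqa cp]] mult_carrier_mat[OF cqa cq]
  have cM: "?M \<in> carrier_mat (2 * m) (2 * m)" using four_block_carrier_mat[OF cs(1,4)] by (simp add: mult_2)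
  have "emb ?M = adj (ri * P.g n) * (ri * P.g n)"
    unfolding row[symmetric] emb_four_block[OF cs] emb_uminus emb_mult[OF cpa cp] emb_mult[OF cpa cq] emb_mult[OF cqa cp]
      emb_mult[OF cqa cq] emb_adj
    by (simp add: algebra_simps)
  also have "\<dots> = adj (P.g n) * (P.Schur_inv n * P.g n)" unfolding riri[symmetric] by (simp add: mult.assoc ri)
  finally have eM: "emb ?M = adj (P.g n) * (P.Schur_inv n * P.g n)" .
  have "emb (P_cal m z W (Suc n)) = complex_of_real (P.node_weight n) *c (emb ?M * Jm m)"
    unfolding P_cal_def Let_def p_def[symmetric] q_def[symmetric] emb_smult emb_mult[OF cM emb_J(2)] emb_J(1) P.node_weight_def by (rule refl)
  then show "emb (P_cal m z W (Suc n)) = P.elem n" unfolding eM P.elem_def by (simp only: mult.assoc)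
qed

end

(*%FILE E3*)
section \<open>The modified matrices and the limit ball\<close>

locale interpolation_point = interpolation_data +
  fixes z0 :: complex
  assumes Im_z0: "0 < Im z0" and z0_new: "z0 \<notin> z ` {1..}"
begin

sublocale Q: pick_point m "\<lambda>k. z (Suc k)" "\<lambda>k. emb (W (Suc k))" z0
proof
  show "0 < m" using m by simp
  show "0 < Im z0" by (rule Im_z0)
  show "z0 \<noteq> z (Suc k)" for k using z0_new by (metis atLeast_iff imageI le_add1 plus_1_eq_Suc)
  show "pd m (P.Schur k)" for k by (rule Schur_pos)
qed

lemma tilde_projection:
  "(Q.U n * (P.elem n * Q.Ui n)) * (Q.U n * (P.elem n * Q.Ui n)) = - (Q.U n * (P.elem n * Q.Ui n))"
proof -
  have "(Q.U n * (P.elem n * Q.Ui n)) * (Q.U n * (P.elem n * Q.Ui n)) = Q.U n * ((P.elem n * P.elem n) * Q.Ui n)"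
    by (simp only: mult.assoc Q.inverse_cancel)
  then show ?thesis by (simp only: Q.elem_elem mult_minus_left mult_minus_right)
qed

text \<open>One induction for both: the exponential of the modified matrix, multiplied by
  its predecessors, equals the predecessors multiplied by the exponential of the elementary
  matrix.\<close>
lemma U_mat: "U_mat m z W z0 n \<in> carrier_mat (2 * m) (2 * m) \<and> emb (U_mat m z W z0 n) = dg (2 * m) * Q.U n"
  and P_tilde: "P_tilde m z W z0 (Suc n) \<in> carrier_mat (2 * m) (2 * m) \<and> emb (P_tilde m z W z0 (Suc n)) = Q.U n * (P.elem n * Q.Ui n)"
proof -
  have tilde: "P_tilde m z W z0 (Suc n) \<in> carrier_mat (2 * m) (2 * m) \<and> emb (P_tilde m z W z0 (Suc n)) = Q.U n * (P.elem n * Q.Ui n)"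
    if c: "U_mat m z W z0 n \<in> carrier_mat (2 * m) (2 * m)" and U: "emb (U_mat m z W z0 n) = dg (2 * m) * Q.U n" for n
  proof -
    have cUi: "cor (2 * m) (2 * m) (dg (2 * m) * Q.Ui n)"
      using Q.cor_commuting(2)[OF cor_intros(7) Q.corner_commute(2)] .
    have "(dg (2 * m) * Q.Ui n) * (dg (2 * m) * Q.U n) = dg (2 * m) * ((Q.Ui n * dg (2 * m)) * Q.U n)"
      by (simp only: mult.assoc)
    also have "\<dots> = dg (2 * m) * (dg (2 * m) * (Q.Ui n * Q.U n))"
      unfolding Q.corner_commute(2)[symmetric] by (simp only: mult.assoc)
    finally have "(dg (2 * m) * Q.Ui n) * emb (U_mat m z W z0 n) = dg (2 * m)"
      unfolding U Q.U_Ui(2) by simp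
    then have inv: "mat_inv (U_mat m z W z0 n) \<in> carrier_mat (2 * m) (2 * m)"
      "emb (mat_inv (U_mat m z W z0 n)) = dg (2 * m) * Q.Ui n"
      using emb_mat_inv[OF c cUi] by blast+
    have UP: "U_mat m z W z0 n * P_cal m z W (Suc n) \<in> carrier_mat (2 * m) (2 * m)"
      by (rule mult_carrier_mat[OF c P_cal(2)])
    have "emb (P_tilde m z W z0 (Suc n)) = ((dg (2 * m) * Q.U n) * P.elem n) * (dg (2 * m) * Q.Ui n)"
      unfolding P_tilde_def diff_Suc_1 emb_mult[OF UP inv(1)] emb_mult[OF c P_cal(2)] U inv(2) P_cal(1) by (rule refl)
    also have "\<dots> = Q.U n * ((dg (2 * m) * P.elem n * dg (2 * m)) * Q.Ui n)"
      unfolding Q.corner_commute(1) by (simp only: mult.assoc)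
    also have "dg (2 * m) * P.elem n * dg (2 * m) = P.elem n" using corD[OF Q.cor_elem[of n]] by (simp only:)
    finally show ?thesis
      unfolding P_tilde_def diff_Suc_1 using mult_carrier_mat[OF UP inv(1)] by simp
  qed
  have U: "U_mat m z W z0 n \<in> carrier_mat (2 * m) (2 * m) \<and> emb (U_mat m z W z0 n) = dg (2 * m) * Q.U n" for n
  proof (induction n)
    case 0
    then show ?case by (simp add: emb_one)
  next
    case (Suc n)
    then have c: "U_mat m z W z0 n \<in> carrier_mat (2 * m) (2 * m)" and U: "emb (U_mat m z W z0 n) = dg (2 * m) * Q.U n"
      by blast+
    let ?A = "P_tilde m z W z0 (Suc n)" and ?s = "- \<i> * complex_of_real (phase z z0 (Suc n))"
    have A: "?A \<in> carrier_mat (2 * m) (2 * m)" "emb ?A = Q.U n * (P.elem n * Q.Ui n)" using tilde[OF c U] by blast+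
    have "emb ?A * emb ?A = - emb ?A" unfolding A(2) by (rule tilde_projection)
    note ex = mat_exp_projection[OF A(1) this, of ?s]
    have ph: "exp (- ?s) = Q.ph n" by (simp add: Q.ph_def Q.ze_def P.zeta_def phase_def)
    have "emb (U_mat m z W z0 (Suc n)) = (dg (2 * m) + (1 - Q.ph n) *c emb ?A) * (dg (2 * m) * Q.U n)"
      unfolding U_mat_Suc emb_mult[OF ex(2) c] ex(1) ph U by (rule refl)
    also have "\<dots> = (dg (2 * m) + (1 - Q.ph n) *c emb ?A) * dg (2 * m) * Q.U n" by (simp only: mult.assoc)
    also have "(dg (2 * m) + (1 - Q.ph n) *c emb ?A) * dg (2 * m) = dg (2 * m) + (1 - Q.ph n) *c emb ?A"
      using corD(2)[OF cor_emb[OF A(1)]] by (simp add: distrib_right)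
    also have "(dg (2 * m) + (1 - Q.ph n) *c emb ?A) * Q.U n = dg (2 * m) * Q.U n + (1 - Q.ph n) *c (emb ?A * Q.U n)"
      by (simp only: distrib_right cscale_mult)
    also have "emb ?A * Q.U n = dg (2 * m) * (Q.U n * P.elem n)"
    proof -
      have 1: "emb ?A * Q.U n = dg (2 * m) * (emb ?A * Q.U n)" using corD(3)[OF cor_emb[OF A(1)]] by simp
      have 2: "emb ?A * Q.U n = Q.U n * (P.elem n * (Q.Ui n * Q.U n))" unfolding A(2) by (simp only: mult.assoc)
      show ?thesis by (rule trans[OF 1]) (simp only: 2 Q.U_Ui mult_1_right)
    qed
    finally have "emb (U_mat m z W z0 (Suc n)) = dg (2 * m) * Q.U (Suc n)"
      by (simp add: distrib_left)
    then show ?case unfolding U_mat_Suc using mult_carrier_mat[OF ex(2) c] by simp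
  qed
  show "U_mat m z W z0 n \<in> carrier_mat (2 * m) (2 * m) \<and> emb (U_mat m z W z0 n) = dg (2 * m) * Q.U n" by (rule U)
  show "P_tilde m z W z0 (Suc n) \<in> carrier_mat (2 * m) (2 * m) \<and> emb (P_tilde m z W z0 (Suc n)) = Q.U n * (P.elem n * Q.Ui n)"
    by (rule tilde) (use U in blast)+
qed

lemma tilde_J:
  "P_tilde m z W z0 (Suc n) * J_mat m \<in> carrier_mat (2 * m) (2 * m)"
  "emb (P_tilde m z W z0 (Suc n) * J_mat m) = Q.N n"
proof -
  have c: "P_tilde m z W z0 (Suc n) \<in> carrier_mat (2 * m) (2 * m)" and e: "emb (P_tilde m z W z0 (Suc n)) = Q.N n * Jm m"
    using P_tilde[of n] by (simp_all add: Q.N_J)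
  show "P_tilde m z W z0 (Suc n) * J_mat m \<in> carrier_mat (2 * m) (2 * m)" by (rule mult_carrier_mat[OF c emb_J(2)])
  show "emb (P_tilde m z W z0 (Suc n) * J_mat m) = Q.N n"
    unfolding emb_mult[OF c emb_J(2)] e emb_J(1) mult.assoc Jm_Jm using corD(2)[OF Q.cor_N[of n]] .
qed

lemma series_summable_iff:
  "mat_summable (2 * m) (\<lambda>j. complex_of_real (Im (z (Suc j)) / (cmod (z0 - z (Suc j)))\<^sup>2) \<cdot>\<^sub>m
      (P_tilde m z W z0 (Suc j) * J_mat m)) \<longleftrightarrow> summable (\<lambda>n. Q.coef n * nrm (2 * m) (Q.N n))"
proof -
  have "(complex_of_real (Im (z (Suc j)) / (cmod (z0 - z (Suc j)))\<^sup>2) \<cdot>\<^sub>m (P_tilde m z W z0 (Suc j) * J_mat m)) $$ (a, b)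
      = complex_of_real (Q.coef j) * ent (Q.N j) a b" if ab: "a < 2 * m" "b < 2 * m" for a b j
    unfolding tilde_J(2)[symmetric] Q.coef_def using carrier_matD[OF tilde_J(1)[of j]] ab by (simp add: ent_emb)
  then show ?thesis unfolding mat_summable_def Q.summable_entries_iff[symmetric] by simp
qed

lemma solutions_iff:
  assumes "N \<subseteq> {1..}"
  shows "f \<in> solutions m z W N \<longleftrightarrow> f \<in> nevanlinna_class m \<and> (\<forall>k. Suc k \<in> N \<longrightarrow> emb (f (z (Suc k))) = emb (W (Suc k)))"
proof -
  have "f (z (Suc k)) = W (Suc k) \<longleftrightarrow> emb (f (z (Suc k))) = emb (W (Suc k))" if "f \<in> nevanlinna_class m" for k
  proof -
    have "f (z (Suc k)) \<in> carrier_mat m m" using that Im[of "Suc k"] by (auto simp: nevanlinna_class_def)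
    then show ?thesis using emb_inj[OF _ W[of "Suc k"]] by auto
  qed
  moreover have "(\<forall>j\<in>N. R j) \<longleftrightarrow> (\<forall>k. Suc k \<in> N \<longrightarrow> R (Suc k))" for R
  proof -
    have "\<exists>k. j = Suc k" if "j \<in> N" for j
    proof -
      have "j \<in> {1..}" using assms that by blast
      then show ?thesis by (cases j) auto
    qed
    then show ?thesis by blast
  qed
  ultimately show ?thesis unfolding solutions_def by auto
qed

lemma solution_values:
  "1 \<le> n \<Longrightarrow> emb ` (\<lambda>w. w z0) ` solutions m z W {1..n} = ballX m (P.X n z0)"
  "emb ` (\<lambda>w. w z0) ` solutions m z W {1..} = (\<Inter>n\<in>{1..}. ballX m (P.X n z0))"
  "N \<subseteq> {1..} \<Longrightarrow> (\<lambda>w. w z0) ` solutions m z W N \<subseteq> carrier_mat m m"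
proof -
  show "emb ` (\<lambda>w. w z0) ` solutions m z W {1..n} = ballX m (P.X n z0)" if "1 \<le> n"
  proof -
    have "f \<in> solutions m z W {1..n} \<longleftrightarrow> f \<in> P.interpolants n" for f
      using solutions_iff[of "{1..n}" f] by (auto simp: P.interpolants_def)
    then have "solutions m z W {1..n} = P.interpolants n" by blast
    then show ?thesis unfolding Q.interpolant_values[OF that, symmetric] image_image by simp
  qed
  have "f \<in> solutions m z W {1..} \<longleftrightarrow> f \<in> nevanlinna_class m \<and> (\<forall>k. emb (f (z (Suc k))) = emb (W (Suc k)))" for f
    using solutions_iff[of "{1..}" f] by auto
  then have "solutions m z W {1..} = {f \<in> nevanlinna_class m. \<forall>k. emb (f (z (Suc k))) = emb (W (Suc k))}" by blast
  then show "emb ` (\<lambda>w. w z0) ` solutions m z W {1..} = (\<Inter>n\<in>{1..}. ballX m (P.X n z0))"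
    unfolding Q.full_interpolant_values[symmetric] image_image by simp
  show "(\<lambda>w. w z0) ` solutions m z W N \<subseteq> carrier_mat m m" if "N \<subseteq> {1..}"
    using Im_z0 by (auto simp: solutions_iff[OF that] nevanlinna_class_def)
qed

text \<open>The embedding into the ring is injective on matrices of a fixed size.\<close>
lemma values_eq_matrix_ball_iff:
  assumes S: "S \<subseteq> carrier_mat m m" and c: "c \<in> carrier_mat m m" "r \<in> carrier_mat m m" "\<rho> \<in> carrier_mat m m"
  shows "S = matrix_ball m c r \<rho> \<longleftrightarrow> emb ` S = fball m (emb c) (emb r) (emb \<rho>)"
proof -
  have "inj_on emb (carrier_mat m m)" by (rule inj_onI) (rule emb_inj)
  from inj_on_image_eq_iff[OF this S emb_matrix_ball(2)[OF c]] show ?thesis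
    unfolding emb_matrix_ball(1)[OF c] by blast
qed

lemma indeterminate_of_summable:
  assumes "summable (\<lambda>n. Q.coef n * nrm (2 * m) (Q.N n))"
  shows "completely_indeterminate m z W z0"
proof -
  obtain C where C: "\<And>n. nrm (2 * m) (P.X n z0) \<le> C" "\<And>n. nrm (2 * m) (Q.Xi n) \<le> C"
    using Q.bounded_X_Xi[OF assms] by metis
  obtain c r \<rho> cs rs \<rho>s where lim: "cor m m c" "pd m r" "pd m \<rho>"
    and full: "(\<Inter>n\<in>{1..}. ballX m (P.X n z0)) = fball m c r \<rho>"
    and fin: "\<And>n. 1 \<le> n \<Longrightarrow> cor m m (cs n) \<and> pd m (rs n) \<and> pd m (\<rho>s n) \<and> ballX m (P.X n z0) = fball m (cs n) (rs n) (\<rho>s n)"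
    and T: "tends (\<lambda>n. cs (Suc n)) c" "tends (\<lambda>n. rs (Suc n)) r" "tends (\<lambda>n. \<rho>s (Suc n)) \<rho>"
  proof (rule Q.limit_of_balls[OF C], goal_cases)
    case (1 c r \<rho> cs rs \<rho>s)
    from 1(2-) show ?case by (rule 1(1))
  qed
  let ?u = "unemb m m"
  note u = unemb_carrier[of m m]
  have cor: "cor m m A" if "pd m A" for A using that by (simp add: pd_def)
  note eu = emb_unemb[of m m]
  have psd_u: "psd (?u A)" if "pd m A" for A
    using psd_emb[OF u, of A] eu[OF cor[OF that]] pd_psd[OF that] by simp
  have pos_u: "pos_def (?u A)" if "pd m A" for A
    using pd_imp_pos_def[OF u, of A] eu[OF cor[OF that]] that by simp
  have fullm: "(\<lambda>w. w z0) ` solutions m z W {1..} = matrix_ball m (?u c) (?u r) (?u \<rho>)"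
    unfolding values_eq_matrix_ball_iff[OF solution_values(3)[OF order.refl] u u u]
    unfolding solution_values(2) full eu[OF lim(1)] eu[OF cor[OF lim(2)]] eu[OF cor[OF lim(3)]] by (rule refl)
  have finm: "?u (cs n) \<in> carrier_mat m m \<and> ?u (rs n) \<in> carrier_mat m m \<and> ?u (\<rho>s n) \<in> carrier_mat m m \<and>
      pos_def (?u (rs n)) \<and> pos_def (?u (\<rho>s n)) \<and>
      (\<lambda>w. w z0) ` solutions m z W {1..n} = matrix_ball m (?u (cs n)) (?u (rs n)) (?u (\<rho>s n))" if n: "1 \<le> n" for n
  proof -
    have f: "cor m m (cs n)" "pd m (rs n)" "pd m (\<rho>s n)" "ballX m (P.X n z0) = fball m (cs n) (rs n) (\<rho>s n)"
      using fin[OF n] by blast+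
    have sub: "{1..n} \<subseteq> {1..}" by auto
    have "(\<lambda>w. w z0) ` solutions m z W {1..n} = matrix_ball m (?u (cs n)) (?u (rs n)) (?u (\<rho>s n))"
      unfolding values_eq_matrix_ball_iff[OF solution_values(3)[OF sub] u u u]
      unfolding solution_values(1)[OF n] f(4) eu[OF f(1)] eu[OF cor[OF f(2)]] eu[OF cor[OF f(3)]] by (rule refl)
    then show ?thesis using u pos_u f by blast
  qed
  have Tm: "mat_tendsto m (\<lambda>n. ?u (As n)) (?u A)"
    if "tends (\<lambda>n. As (Suc n)) A" "cor m m A" "\<And>n. 1 \<le> n \<Longrightarrow> cor m m (As n)" for As A
    unfolding mat_tendsto_iff[of "\<lambda>n. ?u (As n)", OF u u] using that by (simp add: eu)
  have "limit_ball m z W z0 (?u c) (?u r) (?u \<rho>)"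
    unfolding limit_ball_def
  proof (intro conjI exI allI impI u psd_u lim fullm)
    show "mat_tendsto m (\<lambda>n. ?u (cs n)) (?u c)" by (rule Tm[OF T(1) lim(1)]) (use fin in blast)
    show "mat_tendsto m (\<lambda>n. ?u (rs n)) (?u r)" by (rule Tm[OF T(2) cor[OF lim(2)]]) (use fin cor in blast)
    show "mat_tendsto m (\<lambda>n. ?u (\<rho>s n)) (?u \<rho>)" by (rule Tm[OF T(3) cor[OF lim(3)]]) (use fin cor in blast)
  qed (use finm in blast)+
  moreover have "vec_space.rank m (?u r) = m" "vec_space.rank m (?u \<rho>) = m"
    using rank_full_iff_pd[OF u psd_u[OF lim(2)]] rank_full_iff_pd[OF u psd_u[OF lim(3)]] lim
    by (simp_all add: eu cor)
  ultimately show ?thesis unfolding completely_indeterminate_def by blast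
qed

lemma summable_of_indeterminate:
  assumes "completely_indeterminate m z W z0"
  shows "summable (\<lambda>n. Q.coef n * nrm (2 * m) (Q.N n))"
proof -
  obtain c r \<rho> where L: "limit_ball m z W z0 c r \<rho>" and rank: "vec_space.rank m r = m" "vec_space.rank m \<rho> = m"
    using assms unfolding completely_indeterminate_def by blast
  have cr: "r \<in> carrier_mat m m" "\<rho> \<in> carrier_mat m m" "psd r" "psd \<rho>"
    using L unfolding limit_ball_def by blast+
  have "\<exists>cs rs \<rho>s. (\<forall>n\<ge>1. cs n \<in> carrier_mat m m \<and> rs n \<in> carrier_mat m m \<and> \<rho>s n \<in> carrier_mat m m \<and>
           pos_def (rs n) \<and> pos_def (\<rho>s n) \<and>
           (\<lambda>w. w z0) ` solutions m z W {1..n} = matrix_ball m (cs n) (rs n) (\<rho>s n)) \<and>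
        mat_tendsto m cs c \<and> mat_tendsto m rs r \<and> mat_tendsto m \<rho>s \<rho>"
    using L unfolding limit_ball_def by (elim conjE)
  then obtain cs rs \<rho>s where fin: "\<forall>n\<ge>1. cs n \<in> carrier_mat m m \<and> rs n \<in> carrier_mat m m \<and> \<rho>s n \<in> carrier_mat m m \<and>
           pos_def (rs n) \<and> pos_def (\<rho>s n) \<and>
           (\<lambda>w. w z0) ` solutions m z W {1..n} = matrix_ball m (cs n) (rs n) (\<rho>s n)"
    and T: "mat_tendsto m rs r" "mat_tendsto m \<rho>s \<rho>" by blast
  have car: "cs n \<in> carrier_mat m m" "rs n \<in> carrier_mat m m" "\<rho>s n \<in> carrier_mat m m" if "1 \<le> n" for n
    using fin that by blast+
  have pd: "pd m (emb (rs n)) \<and> pd m (emb (\<rho>s n)) \<and> ballX m (P.X n z0) = fball m (emb (cs n)) (emb (rs n)) (emb (\<rho>s n))"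
    if n: "1 \<le> n" for n
  proof -
    have f: "pos_def (rs n)" "pos_def (\<rho>s n)" "(\<lambda>w. w z0) ` solutions m z W {1..n} = matrix_ball m (cs n) (rs n) (\<rho>s n)"
      using fin n by blast+
    have sub: "{1..n} \<subseteq> {1..}" by auto
    show ?thesis
      using pos_def_imp_pd[OF car(2)[OF n] f(1)] pos_def_imp_pd[OF car(3)[OF n] f(2)]
        f(3)[unfolded values_eq_matrix_ball_iff[OF solution_values(3)[OF sub] car[OF n]] solution_values(1)[OF n]] by blast
  qed
  have lim: "pd m (emb r)" "pd m (emb \<rho>)"
    using rank rank_full_iff_pd[OF cr(1,3)] rank_full_iff_pd[OF cr(2,4)] by blast+
  have tr: "tends (\<lambda>n. emb (rs (Suc n))) (emb r)" "tends (\<lambda>n. emb (\<rho>s (Suc n))) (emb \<rho>)"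
    using T mat_tendsto_iff[of rs m, OF car(2) cr(1)] mat_tendsto_iff[of \<rho>s m, OF car(3) cr(2)] by blast+
  obtain C where "\<And>n. nrm (2 * m) (P.X n z0) \<le> C" "\<And>n. nrm (2 * m) (Q.Xi n) \<le> C"
    using Q.bounded_of_balls[of "\<lambda>n. emb (rs n)" "\<lambda>n. emb (\<rho>s n)" "\<lambda>n. emb (cs n)", OF pd tr lim] by metis
  then show ?thesis by (rule Q.summable_coef_N)
qed

end

theorem theorem6p10:
  fixes m :: nat and z :: "nat \<Rightarrow> complex" and W :: "nat \<Rightarrow> complex mat" and z0 :: complex
  assumes "1 \<le> m"
    and "\<And>j. 1 \<le> j \<Longrightarrow> 0 < Im (z j)"
    and "inj_on z {1..}"
    and "\<And>j. 1 \<le> j \<Longrightarrow> W j \<in> carrier_mat m m"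
    and "\<And>n. 1 \<le> n \<Longrightarrow> pos_def (pick_mat m z W n)"
    and "0 < Im z0"
    and "z0 \<notin> z ` {1..}"
  shows "completely_indeterminate m z W z0 \<longleftrightarrow>
    mat_summable (2 * m) (\<lambda>j.
      complex_of_real (Im (z (Suc j)) / (cmod (z0 - z (Suc j)))\<^sup>2) \<cdot>\<^sub>m
        (P_tilde m z W z0 (Suc j) * J_mat m))"
proof -
  interpret interpolation_point m z W z0
    by unfold_locales (fact assms)+
  show ?thesis
    unfolding series_summable_iff using indeterminate_of_summable summable_of_indeterminate by blast
qed

end
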